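(* Let $H$ be a graph. There are only finitely many (up to isomorphism) $H$-free minimal list-obstructions if and only if $H$ is an induced subgraph of $P_6$, or of $P_4 + kP_1$ for some $k \in \mathbb{N}$.
   Context: All graphs are finite and simple. A graph $G$ is $H$-free if no induced subgraph of $G$ is isomorphic to $H$. A list system $L$ of $G$ assigns to each vertex $v$ a set $L(v)\subseteq\{1,2,3\}$. $(G,L)$ is colorable if there is a proper coloring $c$ of $G$ with $c(v)\in L(v)$ for all $v$. $(G,L)$ is a minimal list-obstruction if $(G,L)$ is not colorable but for every proper induced subgraph $A$ of $G$, $(A,L|_{V(A)})$ is colorable. $P_t$ is the path on $t$ vertices, $+$ denotes disjoint union, and $P_4+kP_1$ is $P_4$ together with $k$ isolated vertices. $H$-freeness of a minimal list-obstruction $(G,L)$ refers to the graph $G$. *)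

theory Defs
  imports "Graph_Theory.Graph_Theory"
begin

text \<open>
  A finite simple graph is a \<^locale>\<open>pair_graph\<close>: finite, loop-free, and with each edge
  \<open>uv\<close> stored as the two arcs \<open>(u,v)\<close> and \<open>(v,u)\<close>. The graph without vertices is allowed.
\<close>

definition is_induced_subgraph_of ::
    "'a pair_pre_digraph \<Rightarrow> 'b pair_pre_digraph \<Rightarrow> bool" where
  "is_induced_subgraph_of H G \<longleftrightarrow>
     (\<exists>A. induced_subgraph (with_proj A) (with_proj G) \<and> digraph_iso (with_proj A) (with_proj H))"

definition free_of :: "'a pair_pre_digraph \<Rightarrow> 'b pair_pre_digraph \<Rightarrow> bool" where
  "free_of H G \<longleftrightarrow> \<not> is_induced_subgraph_of H G"

definition path_graph :: "nat \<Rightarrow> nat pair_pre_digraph" where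
  "path_graph t = \<lparr> pverts = {..<t},
     parcs = {(i, j). i < t \<and> j < t \<and> (j = Suc i \<or> i = Suc j)} \<rparr>"

definition disjoint_union ::
    "'a pair_pre_digraph \<Rightarrow> 'b pair_pre_digraph \<Rightarrow> ('a + 'b) pair_pre_digraph" where
  "disjoint_union G H = \<lparr> pverts = Inl ` pverts G \<union> Inr ` pverts H,
     parcs = map_prod Inl Inl ` parcs G \<union> map_prod Inr Inr ` parcs H \<rparr>"

definition copies :: "nat \<Rightarrow> 'a pair_pre_digraph \<Rightarrow> (nat \<times> 'a) pair_pre_digraph" where
  "copies k G = \<lparr> pverts = {..<k} \<times> pverts G,
     parcs = {((i, u), (j, v)). i < k \<and> j = i \<and> (u, v) \<in> parcs G} \<rparr>"

definition list_system :: "'a pair_pre_digraph \<Rightarrow> ('a \<Rightarrow> nat set) \<Rightarrow> bool" where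
  "list_system G L \<longleftrightarrow> (\<forall>v \<in> pverts G. L v \<subseteq> {1, 2, 3})"

definition colorable :: "'a pair_pre_digraph \<Rightarrow> ('a \<Rightarrow> nat set) \<Rightarrow> bool" where
  "colorable G L \<longleftrightarrow>
     (\<exists>c. (\<forall>v \<in> pverts G. c v \<in> L v) \<and> (\<forall>(u, v) \<in> parcs G. c u \<noteq> c v))"

text \<open>
  Only the values of \<open>L\<close> on the vertices of a graph matter, so the restriction of \<open>L\<close> to an
  induced subgraph \<open>A\<close> is \<open>L\<close> itself.
\<close>

definition minimal_list_obstruction :: "'a pair_pre_digraph \<Rightarrow> ('a \<Rightarrow> nat set) \<Rightarrow> bool" where
  "minimal_list_obstruction G L \<longleftrightarrow> pair_graph G \<and> list_system G L \<and> \<not> colorable G L \<and>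
     (\<forall>A. induced_subgraph (with_proj A) (with_proj G) \<and> A \<noteq> G \<longrightarrow> colorable A L)"

text \<open>
  Isomorphism of graphs with lists: a graph isomorphism that carries each list to the same list.
  Colors are not permuted.
\<close>

definition list_graph_iso ::
    "(('a pair_pre_digraph \<times> ('a \<Rightarrow> nat set)) \<times> ('a pair_pre_digraph \<times> ('a \<Rightarrow> nat set))) set" where
  "list_graph_iso = {((G, L), (G', L')). \<exists>f.
     pre_digraph.digraph_isomorphism (with_proj G) f \<and> with_proj G' = app_iso f (with_proj G) \<and>
     (\<forall>v \<in> pverts G. L' (iso_verts f v) = L v)}"

text \<open>
  Every finite graph is isomorphic to one whose vertices are natural numbers, so the vertex
  type \<^typ>\<open>nat\<close> covers all isomorphism classes.
\<close>

definition free_minimal_list_obstructions ::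
    "'a pair_pre_digraph \<Rightarrow> (nat pair_pre_digraph \<times> (nat \<Rightarrow> nat set)) set" where
  "free_minimal_list_obstructions H = {(G, L). minimal_list_obstruction G L \<and> free_of H G}"

lemma pair_graph_path_graph: "pair_graph (path_graph t)"
proof -
  have "finite (parcs (path_graph t))"
    by (rule finite_subset[of _ "{..<t} \<times> {..<t}"]) (auto simp: path_graph_def)
  then show ?thesis
    by unfold_locales (auto simp: path_graph_def symmetric_def sym_def)
qed

lemma pair_graph_disjoint_union:
  assumes "pair_graph G" "pair_graph H"
  shows "pair_graph (disjoint_union G H)"
proof -
  interpret G: pair_graph G by fact
  interpret H: pair_graph H by fact
  show ?thesis
    by unfold_locales
      (auto simp: disjoint_union_def symmetric_def sym_def
        dest: G.wellformed' H.wellformed' G.no_loops' H.no_loops' G.arcs_symmetric H.arcs_symmetric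
        intro: rev_image_eqI[OF G.arcs_symmetric] rev_image_eqI[OF H.arcs_symmetric])
qed

lemma pair_graph_copies:
  assumes "pair_graph G"
  shows "pair_graph (copies k G)"
proof -
  interpret G: pair_graph G by fact
  have "finite (parcs (copies k G))"
    by (rule finite_subset[of _ "({..<k} \<times> pverts G) \<times> ({..<k} \<times> pverts G)"])
      (auto simp: copies_def dest: G.wellformed')
  then show ?thesis
    by unfold_locales
      (auto simp: copies_def symmetric_def sym_def
        dest: G.wellformed' G.no_loops' G.arcs_symmetric)
qed

lemma list_graph_iso_iff:
  assumes "pair_graph G" "pair_graph G'"
  shows "((G, L), (G', L')) \<in> list_graph_iso \<longleftrightarrow>
    (\<exists>h. bij_betw h (pverts G) (pverts G') \<and>
      (\<forall>u \<in> pverts G. \<forall>v \<in> pverts G. (h u, h v) \<in> parcs G' \<longleftrightarrow> (u, v) \<in> parcs G) \<and>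
      (\<forall>v \<in> pverts G. L' (h v) = L v))" (is "?l \<longleftrightarrow> ?r")
proof
  interpret G: pair_graph G by fact
  assume ?l
  then obtain f where f: "G.digraph_isomorphism f" "with_proj G' = app_iso f (with_proj G)"
    and L: "\<forall>v \<in> pverts G. L' (iso_verts f v) = L v"
    unfolding list_graph_iso_def by auto
  have V: "pverts G' = iso_verts f ` pverts G"
    using arg_cong[OF f(2), of verts] by simp
  have E: "parcs G' = (\<lambda>(u, v). (iso_verts f u, iso_verts f v)) ` parcs G"
    using arg_cong[OF f(2), of arcs_ends] G.arcs_ends_app_iso_eq[OF f(1)] by simp
  have inj: "inj_on (iso_verts f) (pverts G)"
    using G.digraph_isomorphism_inj_on_verts[OF f(1)] by simp
  have "(iso_verts f u, iso_verts f v) \<in> parcs G' \<longleftrightarrow> (u, v) \<in> parcs G"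
    if "u \<in> pverts G" "v \<in> pverts G" for u v
    using that unfolding E
    by (auto intro: rev_image_eqI) (metis G.wellformed' inj inj_onD)
  then show ?r
    using V inj L by (intro exI[of _ "iso_verts f"]) (auto simp: bij_betw_def)
next
  interpret G: pair_graph G by fact
  interpret G': pair_graph G' by fact
  assume ?r
  then obtain h where h: "bij_betw h (pverts G) (pverts G')"
    and E: "\<And>u v. u \<in> pverts G \<Longrightarrow> v \<in> pverts G \<Longrightarrow> (h u, h v) \<in> parcs G' \<longleftrightarrow> (u, v) \<in> parcs G"
    and L: "\<forall>v \<in> pverts G. L' (h v) = L v"
    by blast
  have inj: "inj_on h (pverts G)" and V: "pverts G' = h ` pverts G"
    using h by (auto simp: bij_betw_def)
  let ?f = "\<lparr> iso_verts = h, iso_arcs = map_prod h h, iso_head = snd, iso_tail = fst \<rparr>"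
  have "inj_on (map_prod h h) (parcs G)"
    by (rule inj_on_subset[OF map_prod_inj_on[OF inj inj]]) (auto dest: G.wellformed')
  moreover have "parcs G' = map_prod h h ` parcs G"
  proof (intro equalityI subrelI)
    fix x y assume xy: "(x, y) \<in> parcs G'"
    then obtain u v where "u \<in> pverts G" "v \<in> pverts G" "x = h u" "y = h v"
      using V G'.in_arcsD1[OF xy] G'.in_arcsD2[OF xy] by auto
    with xy show "(x, y) \<in> map_prod h h ` parcs G"
      by (auto simp: E intro: rev_image_eqI)
  qed (auto simp: E G.in_arcsD1 G.in_arcsD2)
  ultimately have "G.digraph_isomorphism ?f" "with_proj G' = app_iso ?f (with_proj G)"
    using inj V G.wf_digraph
    by (auto simp: pre_digraph.digraph_isomorphism_def app_iso_def with_proj_def)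
  with L show ?l
    unfolding list_graph_iso_def by (auto intro!: exI[of _ ?f])
qed

end

theory Submission
  imports Defs "HOL-Library.Ramsey"
begin

text \<open>
  Call an obstruction bounded if it contains a non-colourable set of at most \<open>n\<close> vertices, where \<open>n\<close>
  depends on \<open>H\<close> only; finiteness amounts to all obstructions being bounded. Guessing the colours of
  boundedly many vertices and propagating colours preserve boundedness.

  If all lists have at most two colours, a contradiction is a pair of forcing sequences, and a
  shortest one has so few chords that a long one contains an induced \<open>P\<^sub>6\<close>, respectively
  \<open>P\<^sub>4 + kP\<^sub>1\<close>; the former is a finite case check carried out by certificates.

  A \<open>P\<^sub>6\<close>-free connected graph contains a \<open>C\<^sub>5\<close> or has a clique such that every vertex is within distance
  two of it. Colour this \<open>C\<^sub>5\<close> or clique. The vertices at distance two keep three colours, but after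
  boundedly many further guesses the components they induce are modules with respect to
  neighbours that jointly miss a colour, so that each component can be treated as a single vertex
  with a list of size two. In a \<open>(P\<^sub>4 + kP\<^sub>1)\<close>-free graph that is not \<open>P\<^sub>4\<close>-free, a \<open>P\<^sub>4\<close> and its non-neighbours form a
  dominating set, which is bounded by Ramsey's theorem.

  Conversely, three infinite families of minimal obstructions, built along a single forcing
  sequence, consist of paths, of \<open>(2P\<^sub>2 + P\<^sub>1)\<close>-free graphs and of \<open>2P\<^sub>3\<close>-free graphs. A graph that embeds
  into a member of each family is an induced subgraph of \<open>P\<^sub>6\<close> or of some \<open>P\<^sub>4 + kP\<^sub>1\<close>.
\<close>

section \<open>Bounded obstructions\<close>

text \<open>What is carried through the proof is a bound on some non-colourable vertex set, not on
  the whole graph: such a bound passes to larger vertex sets, adds up over case distinctions and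
  pulls back along list reductions, whereas minimality survives none of these. Minimality enters
  only at the end. The numbers mean nothing beyond being independent of the graph and its lists.

  The obstacle is that structural case distinctions range over sets of unbounded size, such as
  whether some vertex of \<open>W\<close> receives the colour \<open>c\<close>. A refutation
  \<open>X\<close> of the case in which none does has bounded size, and then only the members of
  \<open>X\<close> have to be tried with colour \<open>c\<close>. Hence such a distinction also
  costs boundedly many vertices, and vertices that nothing in the lists singles out can be selected:
  for instance two nonadjacent ones that share a colour.

  For lists of size two the obstacle is a long shortest derivation. Its chords are so restricted by
  colours that only one equality pattern per chord is left, which makes the search for induced
  subgraphs in it a problem about words of truth values.\<close>

definition lcol :: "('a \<Rightarrow> 'a \<Rightarrow> bool) \<Rightarrow> 'a set \<Rightarrow> ('a \<Rightarrow> nat set) \<Rightarrow> bool" where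
  "lcol E V L \<longleftrightarrow> (\<exists>c. (\<forall>v\<in>V. c v \<in> L v) \<and> (\<forall>u\<in>V. \<forall>v\<in>V. E u v \<longrightarrow> c u \<noteq> c v))"

definition small_obs :: "('a \<Rightarrow> 'a \<Rightarrow> bool) \<Rightarrow> nat \<Rightarrow> 'a set \<Rightarrow> ('a \<Rightarrow> nat set) \<Rightarrow> bool" where
  "small_obs E n V L \<longleftrightarrow> (\<exists>X\<subseteq>V. finite X \<and> card X \<le> n \<and> \<not> lcol E X L)"

definition prop_lists :: "('a \<Rightarrow> 'a \<Rightarrow> bool) \<Rightarrow> 'a set \<Rightarrow> ('a \<Rightarrow> nat set) \<Rightarrow> 'a \<Rightarrow> nat set" where
  "prop_lists E V L u = {c \<in> L u. \<not> (\<exists>v\<in>V. E u v \<and> L v \<subseteq> {c})}"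

lemma lcolI: "(\<And>v. v \<in> V \<Longrightarrow> c v \<in> L v) \<Longrightarrow> (\<And>u v. u \<in> V \<Longrightarrow> v \<in> V \<Longrightarrow> E u v \<Longrightarrow> c u \<noteq> c v) \<Longrightarrow> lcol E V L"
  unfolding lcol_def by blast

lemma lcolE:
  assumes "lcol E V L"
  obtains c where "\<And>v. v \<in> V \<Longrightarrow> c v \<in> L v" "\<And>u v. u \<in> V \<Longrightarrow> v \<in> V \<Longrightarrow> E u v \<Longrightarrow> c u \<noteq> c v"
  using assms unfolding lcol_def by blast

lemma lcol_mono: "lcol E V L \<Longrightarrow> X \<subseteq> V \<Longrightarrow> (\<And>v. v \<in> X \<Longrightarrow> L v \<subseteq> M v) \<Longrightarrow> lcol E X M"
proof -
  assume a: "lcol E V L" "X \<subseteq> V" "\<And>v. v \<in> X \<Longrightarrow> L v \<subseteq> M v"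
  then obtain c where "\<forall>v\<in>V. c v \<in> L v" "\<forall>u\<in>V. \<forall>v\<in>V. E u v \<longrightarrow> c u \<noteq> c v"
    unfolding lcol_def by blast
  then show ?thesis
    unfolding lcol_def using a(2,3) by (intro exI[of _ c]) blast
qed

lemma small_obs_mono: "small_obs E n V L \<Longrightarrow> n \<le> m \<Longrightarrow> V \<subseteq> W \<Longrightarrow> small_obs E m W L"
  unfolding small_obs_def by (meson order_trans)

lemma small_obsI: "X \<subseteq> V \<Longrightarrow> finite X \<Longrightarrow> card X \<le> n \<Longrightarrow> \<not> lcol E X L \<Longrightarrow> small_obs E n V L"
  unfolding small_obs_def by blast

lemma small_obs_empty_list: "v \<in> V \<Longrightarrow> L v = {} \<Longrightarrow> 1 \<le> n \<Longrightarrow> small_obs E n V L"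
  by (rule small_obsI[of "{v}"]) (auto simp: lcol_def)

lemma small_obs_edge: "u \<in> V \<Longrightarrow> v \<in> V \<Longrightarrow> E u v \<Longrightarrow> L u \<subseteq> {c} \<Longrightarrow> L v \<subseteq> {c} \<Longrightarrow> 2 \<le> n
  \<Longrightarrow> small_obs E n V L"
  by (rule small_obsI[of "{u,v}"]) (auto simp: lcol_def card_insert_if)

text \<open>The condition on colourings is asked for every subset because it is applied to the union
  of the two refutations, not to \<open>V\<close>.\<close>

lemma small_obs_or:
  assumes "small_obs E n V L1" "small_obs E m V L2"
    and "\<And>X. X \<subseteq> V \<Longrightarrow> lcol E X L \<Longrightarrow> lcol E X L1 \<or> lcol E X L2"
  shows "small_obs E (n + m) V L"
proof -
  obtain X Y where X: "X \<subseteq> V" "finite X" "card X \<le> n" "\<not> lcol E X L1"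
    and Y: "Y \<subseteq> V" "finite Y" "card Y \<le> m" "\<not> lcol E Y L2"
    using assms(1,2) unfolding small_obs_def by blast
  have "\<not> lcol E (X \<union> Y) L"
    using assms(3)[of "X \<union> Y"] X Y lcol_mono[of E "X \<union> Y" L1 X L1] lcol_mono[of E "X \<union> Y" L2 Y L2]
    by auto
  then show ?thesis
    using X Y card_Un_le[of X Y] by (intro small_obsI[of "X \<union> Y"]) auto
qed

text \<open>An existential guess over a set \<open>W\<close> of arbitrary size. A refutation
  \<open>X\<close> of the case in which no vertex of \<open>W\<close> takes \<open>c\<close>
  contains all candidates that matter: adding, for each candidate in \<open>X\<close>, a refutation
  of its taking \<open>c\<close> refutes both cases. The size of \<open>W\<close> does not enter the
  bound.\<close>

lemma small_obs_avoid:
  assumes "small_obs E n V (\<lambda>v. if v \<in> W then L v - {c} else L v)"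
    and "\<And>w. w \<in> W \<Longrightarrow> w \<in> V \<Longrightarrow> c \<in> L w \<Longrightarrow> small_obs E m V (L(w := {c}))"
  shows "small_obs E (n + n * m) V L"
proof -
  obtain X where X: "X \<subseteq> V" "finite X" "card X \<le> n"
    and nX: "\<not> lcol E X (\<lambda>v. if v \<in> W then L v - {c} else L v)"
    using assms(1) unfolding small_obs_def by blast
  let ?C = "{w \<in> X. w \<in> W \<and> c \<in> L w}"
  have "\<forall>w\<in>?C. \<exists>Y. Y \<subseteq> V \<and> finite Y \<and> card Y \<le> m \<and> \<not> lcol E Y (L(w := {c}))"
    using assms(2) X(1) unfolding small_obs_def by blast
  from bchoice[OF this] obtain Y where "\<forall>w\<in>?C. Y w \<subseteq> V \<and> finite (Y w) \<and> card (Y w) \<le> m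
      \<and> \<not> lcol E (Y w) (L(w := {c}))" ..
  note Y = this[rule_format]
  let ?Z = "X \<union> (\<Union>w\<in>?C. Y w)"
  have "\<not> lcol E ?Z L"
  proof
    assume "lcol E ?Z L"
    then obtain f where f: "\<forall>v\<in>?Z. f v \<in> L v" "\<forall>u\<in>?Z. \<forall>v\<in>?Z. E u v \<longrightarrow> f u \<noteq> f v"
      unfolding lcol_def by blast
    show False
    proof (cases "\<exists>w\<in>?C. f w = c")
      case True
      then obtain w where w: "w \<in> ?C" "f w = c" by blast
      have "lcol E (Y w) (L(w := {c}))"
        unfolding lcol_def using f w by (intro exI[of _ f]) auto
      then show False using Y w by blast
    next
      case False
      then have "lcol E X (\<lambda>v. if v \<in> W then L v - {c} else L v)"
        unfolding lcol_def using f by (intro exI[of _ f]) auto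
      then show False using nX by blast
    qed
  qed
  moreover have "card ?Z \<le> n + n * m"
  proof -
    have "card (\<Union>w\<in>?C. Y w) \<le> (\<Sum>w\<in>?C. card (Y w))"
      using X by (intro card_UN_le) auto
    also have "\<dots> \<le> card ?C * m" using Y by (intro sum_bounded_above[where K=m, simplified]) auto
    also have "\<dots> \<le> n * m"
      using X card_mono[of X ?C] by (intro mult_right_mono) auto
    finally show ?thesis using card_Un_le[of X "\<Union>w\<in>?C. Y w"] X(3) by linarith
  qed
  moreover have "?Z \<subseteq> V" using X(1) Y by blast
  moreover have "finite ?Z"
  proof (intro finite_UnI finite_UN_I)
    show "finite X" "finite ?C" using X(2) by simp_all
    show "finite (Y w)" if "w \<in> ?C" for w using Y[OF that] by blast
  qed
  ultimately show ?thesis unfolding small_obs_def by blast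
qed

text \<open>The vertex \<open>v\<close> joins the union of the branch refutations, so that a
  colouring of the union decides which branch it contradicts; this is the summand 1.\<close>

lemma small_obs_guess:
  assumes "v \<in> V" "L v \<subseteq> {1,2,3}"
    and "\<And>a. a \<in> L v \<Longrightarrow> small_obs E n V (L(v := {a}))"
  shows "small_obs E (3 * n + 1) V L"
proof -
  have "\<forall>a\<in>L v. \<exists>Y. Y \<subseteq> V \<and> finite Y \<and> card Y \<le> n \<and> \<not> lcol E Y (L(v := {a}))"
    using assms(3) unfolding small_obs_def by blast
  from bchoice[OF this] obtain Y where "\<forall>a\<in>L v. Y a \<subseteq> V \<and> finite (Y a) \<and> card (Y a) \<le> n
      \<and> \<not> lcol E (Y a) (L(v := {a}))" ..
  note Y = this[rule_format]
  let ?Z = "{v} \<union> (\<Union>a\<in>L v. Y a)"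
  have fin: "finite (L v)" using assms(2) finite_subset by blast
  have "\<not> lcol E ?Z L"
  proof
    assume "lcol E ?Z L"
    then obtain f where f: "\<forall>v\<in>?Z. f v \<in> L v" "\<forall>u\<in>?Z. \<forall>v\<in>?Z. E u v \<longrightarrow> f u \<noteq> f v"
      unfolding lcol_def by blast
    then have "f v \<in> L v" by blast
    moreover have "lcol E (Y (f v)) (L(v := {f v}))"
      unfolding lcol_def using f by (intro exI[of _ f]) auto
    ultimately show False using Y by blast
  qed
  moreover have "card ?Z \<le> 3 * n + 1"
  proof -
    have "card (\<Union>a\<in>L v. Y a) \<le> (\<Sum>a\<in>L v. card (Y a))"
      using fin by (intro card_UN_le) auto
    also have "\<dots> \<le> card (L v) * n" using Y by (intro sum_bounded_above[where K=n, simplified]) auto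
    also have "\<dots> \<le> 3 * n"
      using card_mono[of "{1,2,3::nat}" "L v"] assms(2) by (intro mult_right_mono) auto
    finally show ?thesis using card_Un_le[of "{v}" "\<Union>a\<in>L v. Y a"] by auto
  qed
  moreover have "?Z \<subseteq> V" using assms(1) Y by blast
  moreover have "finite ?Z"
  proof (intro finite_UnI finite_UN_I)
    show "finite {v}" "finite (L v)" using fin by simp_all
    show "finite (Y a)" if "a \<in> L v" for a using Y[OF that] by blast
  qed
  ultimately show ?thesis unfolding small_obs_def by blast
qed

text \<open>Pull-back along a local list reduction. Each colour missing from \<open>M v\<close> is
  refuted by at most \<open>r\<close> further vertices; adding at most three of these sets for every
  vertex of a refutation of \<open>M\<close> forces a colouring from \<open>L\<close> back into
  \<open>M\<close>.\<close>

lemma small_obs_reduce: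
  assumes "\<And>v. v \<in> V \<Longrightarrow> L v \<subseteq> {1,2,3}"
    and "\<And>v c. v \<in> V \<Longrightarrow> c \<in> L v \<Longrightarrow> c \<notin> M v
      \<Longrightarrow> \<exists>X\<subseteq>V. finite X \<and> card X \<le> r \<and> \<not> lcol E (insert v X) (L(v := {c}))"
    and "small_obs E n V M"
  shows "small_obs E (n * (3 * r + 1)) V L"
proof -
  obtain X where X: "X \<subseteq> V" "finite X" "card X \<le> n" "\<not> lcol E X M"
    using assms(3) unfolding small_obs_def by blast
  define Y where "Y v c = (SOME Y. Y \<subseteq> V \<and> finite Y \<and> card Y \<le> r \<and> \<not> lcol E (insert v Y) (L(v := {c})))"
    for v c
  have Y: "Y v c \<subseteq> V \<and> finite (Y v c) \<and> card (Y v c) \<le> r \<and> \<not> lcol E (insert v (Y v c)) (L(v := {c}))"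
    if "v \<in> X" "c \<in> L v - M v" for v c
    unfolding Y_def by (rule someI_ex) (use assms(2)[of v c] X(1) that in blast)
  let ?Z = "X \<union> (\<Union>v\<in>X. \<Union>c\<in>L v - M v. Y v c)"
  have fin: "finite (L v)" "card (L v - M v) \<le> 3" if "v \<in> X" for v
  proof -
    have s: "L v \<subseteq> {1,2,3}" using assms(1)[of v] X(1) that by auto
    then show "finite (L v)" using finite_subset by blast
    have "card (L v - M v) \<le> card {1,2,3::nat}" using s by (intro card_mono) auto
    then show "card (L v - M v) \<le> 3" by simp
  qed
  have "\<not> lcol E ?Z L"
  proof
    assume "lcol E ?Z L"
    then obtain f where f: "\<And>v. v \<in> ?Z \<Longrightarrow> f v \<in> L v"
      "\<And>u v. u \<in> ?Z \<Longrightarrow> v \<in> ?Z \<Longrightarrow> E u v \<Longrightarrow> f u \<noteq> f v"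
      by (erule lcolE)
    have XZ: "X \<subseteq> ?Z" by (rule Un_upper1)
    have "f v \<in> M v" if v: "v \<in> X" for v
    proof (rule ccontr)
      assume "f v \<notin> M v"
      then have c: "f v \<in> L v - M v" using f(1)[OF subsetD[OF XZ v]] by simp
      have sub: "insert v (Y v (f v)) \<subseteq> ?Z" using v c by blast
      have "lcol E (insert v (Y v (f v))) (L(v := {f v}))"
      proof (rule lcolI[of _ f])
        fix u assume "u \<in> insert v (Y v (f v))"
        then have "u \<in> ?Z" by (rule subsetD[OF sub])
        then have "f u \<in> L u" by (rule f(1))
        then show "f u \<in> (L(v := {f v})) u" by simp
      next
        fix u w assume "u \<in> insert v (Y v (f v))" "w \<in> insert v (Y v (f v))" "E u w"
        from f(2)[OF subsetD[OF sub this(1)] subsetD[OF sub this(2)] this(3)] show "f u \<noteq> f w" .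
      qed
      then show False using Y[OF v c] by simp
    qed
    then have "lcol E X M"
      by (intro lcolI[of X f] f(2)[OF subsetD[OF XZ] subsetD[OF XZ]])
    then show False using X by blast
  qed
  moreover have "card ?Z \<le> n * (3 * r + 1)"
  proof -
    have "card (\<Union>c\<in>L v - M v. Y v c) \<le> 3 * r" if v: "v \<in> X" for v
    proof -
      have "card (\<Union>c\<in>L v - M v. Y v c) \<le> (\<Sum>c\<in>L v - M v. card (Y v c))"
        using fin v by (intro card_UN_le) auto
      also have "\<dots> \<le> card (L v - M v) * r"
        by (rule sum_bounded_above[where K=r, simplified]) (use Y[OF v] in blast)
      also have "\<dots> \<le> 3 * r" using fin v by (intro mult_right_mono) auto
      finally show ?thesis .
    qed
    then have "(\<Sum>v\<in>X. card (\<Union>c\<in>L v - M v. Y v c)) \<le> card X * (3 * r)"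
      by (intro sum_bounded_above[where K="3*r", simplified]) auto
    moreover have "card (\<Union>v\<in>X. \<Union>c\<in>L v - M v. Y v c) \<le> (\<Sum>v\<in>X. card (\<Union>c\<in>L v - M v. Y v c))"
      using X by (intro card_UN_le) auto
    moreover have "card X * (3 * r) \<le> n * (3 * r)" using X(3) by (intro mult_right_mono) auto
    moreover have "n * (3 * r + 1) = n * (3 * r) + n" by simp
    ultimately show ?thesis
      using card_Un_le[of X "\<Union>v\<in>X. \<Union>c\<in>L v - M v. Y v c"] X(3) by linarith
  qed
  moreover have "?Z \<subseteq> V" using X(1) Y by blast
  moreover have "finite ?Z"
  proof (intro finite_UnI finite_UN_I)
    show "finite X" "finite X" by fact+
    show "finite (L v - M v)" if "v \<in> X" for v using fin(1)[OF that] by simp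
    show "finite (Y v c)" if "v \<in> X" "c \<in> L v - M v" for v c using Y[OF that] by blast
  qed
  ultimately show ?thesis unfolding small_obs_def by blast
qed

lemma prop_lists_sub: "prop_lists E V L u \<subseteq> L u"
  unfolding prop_lists_def by auto

lemma prop_lists_sub2: "prop_lists E V (prop_lists E V L) u \<subseteq> L u"
  unfolding prop_lists_def by auto

lemma prop_listsD: "c \<in> prop_lists E V L u \<Longrightarrow> v \<in> V \<Longrightarrow> E u v \<Longrightarrow> \<not> L v \<subseteq> {c}"
  unfolding prop_lists_def by auto

lemma small_obs_prop:
  assumes "\<And>v. v \<in> V \<Longrightarrow> L v \<subseteq> {1,2,3}" "small_obs E n V (prop_lists E V L)"
  shows "small_obs E (n * 4) V L"
proof -
  have "\<exists>X\<subseteq>V. finite X \<and> card X \<le> 1 \<and> \<not> lcol E (insert v X) (L(v := {c}))"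
    if vc: "v \<in> V" "c \<in> L v" "c \<notin> prop_lists E V L v" for v c
  proof -
    obtain u where u: "u \<in> V" "E v u" "L u \<subseteq> {c}"
      using vc unfolding prop_lists_def by auto
    have "\<not> lcol E (insert v {u}) (L(v := {c}))"
    proof
      assume "lcol E (insert v {u}) (L(v := {c}))"
      then obtain f where f: "f v \<in> (L(v := {c})) v" "f u \<in> (L(v := {c})) u" "f v \<noteq> f u"
        using u(2) unfolding lcol_def by blast
      then show False using u(3) by (cases "u = v") auto
    qed
    then show ?thesis using u by (intro exI[of _ "{u}"]) auto
  qed
  from small_obs_reduce[of V L "prop_lists E V L" 1, OF assms(1) this assms(2)] show ?thesis by simp
qed

text \<open>After propagation a vertex with at most one colour imposes nothing on the others: its
  neighbours have already lost that colour, so every colouring of the rest extends. Deletion matters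
  because such vertices need not share the structure that is found among the remaining ones.\<close>

lemma small_obs_prop_delete:
  assumes "\<And>u v. E u v \<Longrightarrow> E v u" "\<And>v. \<not> E v v"
    and L: "\<And>v. v \<in> V \<Longrightarrow> L v \<subseteq> {1,2,3}" and R: "\<And>r. r \<in> R \<Longrightarrow> r \<in> V \<Longrightarrow> \<exists>e. L r \<subseteq> {e}"
    and rest: "\<not> lcol E (V - R) (prop_lists E V L) \<Longrightarrow> small_obs E n (V - R) (prop_lists E V L)"
    and "\<not> lcol E V L"
  shows "small_obs E ((n + 1) * 4) V L"
proof (rule small_obs_prop[OF L])
  let ?M = "prop_lists E V L"
  show "small_obs E (n + 1) V ?M"
  proof (cases "\<exists>r\<in>R \<inter> V. ?M r = {}")
    case True
    then obtain r where "r \<in> V" "?M r = {}" by blast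
    then show ?thesis by (rule small_obs_empty_list) simp
  next
    case False
    have "\<not> lcol E (V - R) ?M"
    proof
      assume "lcol E (V - R) ?M"
      then obtain f where f: "\<forall>v\<in>V - R. f v \<in> ?M v" "\<forall>u\<in>V - R. \<forall>v\<in>V - R. E u v \<longrightarrow> f u \<noteq> f v"
        unfolding lcol_def by blast
      \<comment> \<open>On \<open>R\<close> the propagated list is nonempty and has at most one
        element, so the choice returns its only colour.\<close>
      let ?g = "\<lambda>v. if v \<in> R then (SOME e. e \<in> ?M v) else f v"
      have g: "?g v \<in> ?M v" if "v \<in> V" for v
      proof (cases "v \<in> R")
        case True
        then have "?M v \<noteq> {}" using False that by blast
        then show ?thesis using True some_in_eq[of "?M v"] by simp
      qed (use f(1) that in simp)
      have R1: "?g r \<noteq> ?g u" if ru: "r \<in> R" "r \<in> V" "u \<in> V" "E u r" for r u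
      proof
        define d where "d = ?g u"
        assume "?g r = ?g u"
        then have eq: "?g r = d" unfolding d_def .
        have du: "d \<in> ?M u" unfolding d_def by (rule g[OF ru(3)])
        obtain e where e: "L r \<subseteq> {e}" using R ru by blast
        have "d \<in> ?M r" using g[OF ru(2)] unfolding eq .
        then have "d \<in> L r" using prop_lists_sub[of E V L r] by blast
        then have "L r \<subseteq> {d}" using e by blast
        then show False using prop_listsD[OF du ru(2) ru(4)] by blast
      qed
      have "lcol E V L"
        unfolding lcol_def
      proof (intro exI[of _ ?g] conjI ballI impI)
        fix v assume "v \<in> V"
        from g[OF this] show "?g v \<in> L v" using prop_lists_sub[of E V L v] by (rule rev_subsetD)
      next
        fix u v assume uv: "u \<in> V" "v \<in> V" "E u v"
        consider "v \<in> R" | "u \<in> R" | "u \<in> V - R" "v \<in> V - R" using uv by blast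
        then show "?g u \<noteq> ?g v"
        proof cases
          case 1 from R1[OF 1 uv(2,1,3)] show ?thesis by (rule not_sym)
        next
          case 2 from R1[OF 2 uv(1,2) assms(1)[OF uv(3)]] show ?thesis .
        next
          case 3 then show ?thesis using f(2) uv(3) by simp
        qed
      qed
      then show False using assms(6) by blast
    qed
    then show ?thesis using small_obs_mono[OF rest, of "n + 1" V] by simp
  qed
qed

lemma K4_small_obs:
  assumes "T \<subseteq> V" "card T = 4" "\<And>x y. x \<in> T \<Longrightarrow> y \<in> T \<Longrightarrow> x \<noteq> y \<Longrightarrow> E x y" "\<And>v. v \<in> V \<Longrightarrow> L v \<subseteq> {1,2,3}"
  shows "small_obs E 4 V L"
proof -
  have finT: "finite T" using assms(2) card.infinite by fastforce
  have "\<not> lcol E T L"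
  proof
    assume "lcol E T L"
    then obtain f where f: "\<And>v. v \<in> T \<Longrightarrow> f v \<in> L v" "\<And>u v. u \<in> T \<Longrightarrow> v \<in> T \<Longrightarrow> E u v \<Longrightarrow> f u \<noteq> f v" by (erule lcolE)
    have "inj_on f T" using f(2) assms(3) by (intro inj_onI) metis
    moreover have "f ` T \<subseteq> {1,2,3}" using f(1) assms(1,4) by blast
    ultimately have "card T \<le> card {1,2,3::nat}" by (intro card_inj_on_le) auto
    then show False using assms(2) by simp
  qed
  then show ?thesis using assms(1,2) finT by (intro small_obsI[of T]) auto
qed

section \<open>Lists of size two\<close>

text \<open>
  A forcing sequence: \<open>v i\<close> has the list \<open>{c i, c (Suc i)}\<close>, and it must take the colour \<open>c (Suc i)\<close> once
  its predecessor has the colour \<open>c i\<close>. The last condition is what is left for the chords when no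
  shorter sequence and no bounded subgraph forces the same colour.
\<close>

definition chain :: "('a \<Rightarrow> 'a \<Rightarrow> bool) \<Rightarrow> 'a set \<Rightarrow> nat \<Rightarrow> (nat \<Rightarrow> 'a) \<Rightarrow> (nat \<Rightarrow> nat) \<Rightarrow> bool" where
  "chain E V N v c \<longleftrightarrow> (\<forall>i<N. v i \<in> V) \<and> inj_on v {..<N} \<and> (\<forall>i. Suc i < N \<longrightarrow> E (v i) (v (Suc i)))
    \<and> (\<forall>i\<le>N. c i \<in> {1,2,3}) \<and> (\<forall>i<N. c i \<noteq> c (Suc i))
    \<and> (\<forall>i j. i < j \<and> j < N \<and> j \<noteq> Suc i \<and> E (v i) (v j)
          \<longrightarrow> c i = c (Suc j) \<and> c (Suc i) \<noteq> c j \<and> c (Suc i) \<noteq> c (Suc j))"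

text \<open>The implication digraph of 2-satisfiability: a pair \<open>(v, c)\<close> is the literal
  that \<open>v\<close> has colour \<open>c\<close>, and a step derives the literal that it forces
  at a neighbour. Starting literals from which propagation meets no contradiction are those of
  \<open>good_start\<close>.\<close>

definition istep :: "('a \<Rightarrow> 'a \<Rightarrow> bool) \<Rightarrow> 'a set \<Rightarrow> ('a \<Rightarrow> nat set) \<Rightarrow> (('a \<times> nat) \<times> ('a \<times> nat)) set" where
  "istep E V M = {((v, c), (w, d)). v \<in> V \<and> w \<in> V \<and> E v w \<and> M w = {c, d} \<and> c \<noteq> d}"

definition good_start :: "('a \<Rightarrow> 'a \<Rightarrow> bool) \<Rightarrow> 'a set \<Rightarrow> ('a \<Rightarrow> nat set) \<Rightarrow> 'a \<times> nat \<Rightarrow> bool" where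
  "good_start E V M s \<longleftrightarrow>
    (\<forall>w d d'. (s, (w, d)) \<in> (istep E V M)\<^sup>* \<longrightarrow> (s, (w, d')) \<in> (istep E V M)\<^sup>* \<longrightarrow> d = d') \<and>
    (\<forall>w d u. (s, (w, d)) \<in> (istep E V M)\<^sup>* \<longrightarrow> u \<in> V \<longrightarrow> E w u \<longrightarrow> M u \<noteq> {d})"

lemma istep_reach:
  assumes "(s, (w, d)) \<in> (istep E V M)\<^sup>*" "fst s \<in> V" "snd s \<in> M (fst s)"
  shows "w \<in> V \<and> d \<in> M w"
  using assms(1) assms(2,3) by (induction "(w, d)" arbitrary: w d rule: rtrancl_induct) (auto simp: istep_def)

lemma card_le_2_cases:
  assumes "finite S" "card S \<le> 2" "x \<in> S"
  shows "S = {x} \<or> (\<exists>y. y \<noteq> x \<and> S = {x, y})"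
proof (cases "S = {x}")
  case False
  then obtain y where y: "y \<in> S" "y \<noteq> x" using assms(3) by blast
  have "{x, y} = S" using assms y by (intro card_seteq) auto
  then show ?thesis using y by blast
qed simp

text \<open>The propagation algorithm for 2-satisfiability: all literals forced by a good start are
  added to a partial colouring, and no vertex outside is affected by them. Contrapositively,
  non-colourable lists have a vertex all of whose starts are bad.\<close>

lemma lcol_of_good_starts:
  assumes sym: "\<And>u v. E u v \<Longrightarrow> E v u" and "finite V"
    and M: "\<And>v. v \<in> V \<Longrightarrow> finite (M v) \<and> card (M v) \<le> 2"
    and good: "\<And>v. v \<in> V \<Longrightarrow> \<exists>c\<in>M v. good_start E V M (v, c)"
  shows "lcol E V M"
proof -
  \<comment> \<open>The last conjunct says that the coloured part has been propagated to the end: no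
    outside vertex loses a colour to it, so good starts outside stay good with their full
    lists.\<close>
  define P where "P W f \<longleftrightarrow> W \<subseteq> V \<and> (\<forall>v\<in>W. f v \<in> M v) \<and> (\<forall>u\<in>W. \<forall>v\<in>W. E u v \<longrightarrow> f u \<noteq> f v)
     \<and> (\<forall>w\<in>W. \<forall>u\<in>V - W. E w u \<longrightarrow> f w \<notin> M u)" for W and f :: "'a \<Rightarrow> nat"
  have ext: "\<exists>W' f'. P W' f' \<and> card W < card W'" if P: "P W f" and "W \<noteq> V" for W f
  proof -
    have WV: "W \<subseteq> V" using P unfolding P_def by blast
    then obtain v where v: "v \<in> V" "v \<notin> W" using \<open>W \<noteq> V\<close> by blast
    obtain c where c: "c \<in> M v" "good_start E V M (v, c)" using good v by blast
    define R where "R = {(w, d). ((v, c), (w, d)) \<in> (istep E V M)\<^sup>*}"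
    have R1: "w \<in> V" "d \<in> M w" if "(w, d) \<in> R" for w d
      using istep_reach[of "(v,c)" w d E V M] that v c unfolding R_def by auto
    have R2: "d = d'" if "(w, d) \<in> R" "(w, d') \<in> R" for w d d'
      using that c(2) unfolding R_def good_start_def by blast
    have R3: "M u \<noteq> {d}" if "(w, d) \<in> R" "u \<in> V" "E w u" for w d u
      using that c(2) unfolding R_def good_start_def by blast
    have R4: "\<exists>d'. (u, d') \<in> R \<and> d' \<noteq> d" if wd: "(w, d) \<in> R" "u \<in> V" "E w u" "d \<in> M u" for w d u
    proof -
      obtain d' where d': "d' \<noteq> d" "M u = {d, d'}"
        using card_le_2_cases[of "M u" d] M[OF wd(2)] wd(4) R3[OF wd(1-3)] by blast
      then have "((w, d), (u, d')) \<in> istep E V M"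
        using wd R1(1)[OF wd(1)] unfolding istep_def by auto
      then have "(u, d') \<in> R" using wd(1) unfolding R_def by (auto intro: rtrancl_into_rtrancl)
      then show ?thesis using d' by blast
    qed
    define W' where "W' = W \<union> fst ` R"
    \<comment> \<open>Propagation may run back into \<open>W\<close>. The old colours are kept
      there, and the last conjunct of \<open>P\<close> makes them compatible with the new
      ones.\<close>
    define f' where "f' x = (if x \<in> W then f x else (SOME d. (x, d) \<in> R))" for x
    have f'R: "(x, f' x) \<in> R" if x: "x \<in> W'" "x \<notin> W" for x
    proof -
      have "\<exists>d. (x, d) \<in> R" using x unfolding W'_def by force
      from someI_ex[OF this] show ?thesis using x unfolding f'_def by simp
    qed
    have f'W: "f' x = f x" if "x \<in> W" for x using that unfolding f'_def by simp
    have "P W' f'" unfolding P_def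
    proof (intro conjI ballI impI)
      show "W' \<subseteq> V" using WV R1(1) unfolding W'_def by force
    next
      fix x assume "x \<in> W'"
      then show "f' x \<in> M x" using f'R[of x] R1(2) f'W[of x] P unfolding P_def by (cases "x \<in> W") auto
    next
      fix x y assume xy: "x \<in> W'" "y \<in> W'" "E x y"
      have W'V: "W' \<subseteq> V" using WV R1(1) unfolding W'_def by force
      have new: "f' x \<noteq> f' y" if "x \<in> W" "y \<in> W'" "y \<notin> W" "E x y" for x y
      proof -
        have "f x \<notin> M y" using P that W'V unfolding P_def by blast
        then show ?thesis using f'W[OF that(1)] R1(2)[OF f'R[OF that(2,3)]] by auto
      qed
      show "f' x \<noteq> f' y"
      proof (cases "x \<in> W"; cases "y \<in> W")
        assume "x \<in> W" "y \<in> W"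
        then show ?thesis using P xy f'W unfolding P_def by simp
      next
        assume "x \<in> W" "y \<notin> W" then show ?thesis using new xy by blast
      next
        assume "x \<notin> W" "y \<in> W" then show ?thesis using new[of y x] xy sym by metis
      next
        assume n: "x \<notin> W" "y \<notin> W"
        show ?thesis
        proof
          assume eq: "f' x = f' y"
          have "f' x \<in> M y" using R1(2)[OF f'R[OF xy(2) n(2)]] eq by simp
          then obtain d' where "(y, d') \<in> R" "d' \<noteq> f' x"
            using R4[OF f'R[OF xy(1) n(1)] _ xy(3)] W'V xy(2) by blast
          then show False using R2[OF f'R[OF xy(2) n(2)]] eq by simp
        qed
      qed
    next
      fix w u assume wu: "w \<in> W'" "u \<in> V - W'" "E w u"
      show "f' w \<notin> M u"
      proof (cases "w \<in> W")
        case True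
        then show ?thesis using P wu f'W[of w] unfolding P_def W'_def by auto
      next
        case False
        show ?thesis
        proof
          assume "f' w \<in> M u"
          then obtain d' where "(u, d') \<in> R" using R4[OF f'R[OF wu(1) False] _ wu(3)] wu(2) by blast
          then have "u \<in> W'" unfolding W'_def by force
          then show False using wu(2) by blast
        qed
      qed
    qed
    moreover have "v \<in> W'" unfolding W'_def R_def by force
    then have "W \<subset> W'" using v unfolding W'_def by blast
    then have "card W < card W'"
      using \<open>P W' f'\<close> \<open>finite V\<close> finite_subset unfolding P_def by (blast intro: psubset_card_mono)
    ultimately show ?thesis by blast
  qed
  have "\<exists>f. P V f"
  proof (rule ccontr)
    assume no: "\<nexists>f. P V f"
    have "\<exists>W f. P W f \<and> n \<le> card W" for n
    proof (induction n)
      case 0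
      have "P {} f" for f unfolding P_def by simp
      then show ?case by blast
    next
      case (Suc n)
      then obtain W f where "P W f" "n \<le> card W" by blast
      moreover then have "W \<noteq> V" using no by blast
      ultimately obtain W' f' where "P W' f'" "card W < card W'" using ext by blast
      with \<open>n \<le> card W\<close> have "P W' f' \<and> Suc n \<le> card W'" by simp
      then show ?case by blast
    qed
    then obtain W f where "P W f" "Suc (card V) \<le> card W" by blast
    moreover then have "card W \<le> card V" using \<open>finite V\<close> unfolding P_def by (blast intro: card_mono)
    ultimately show False by simp
  qed
  then show ?thesis unfolding P_def lcol_def by blast
qed

lemma istep_forced:
  assumes p: "\<And>i. i < k \<Longrightarrow> (p i, p (Suc i)) \<in> istep E V M"
    and f: "\<And>v. v \<in> X \<Longrightarrow> f v \<in> M v" "\<And>u v. u \<in> X \<Longrightarrow> v \<in> X \<Longrightarrow> E u v \<Longrightarrow> f u \<noteq> f v"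
    and X: "\<And>i. i \<le> k \<Longrightarrow> fst (p i) \<in> X"
    and start: "f (fst (p 0)) = snd (p 0)" and ik: "i \<le> k"
  shows "f (fst (p i)) = snd (p i)"
  using ik
proof (induction i)
  case 0 then show ?case using start by simp
next
  case (Suc i)
  have st: "E (fst (p i)) (fst (p (Suc i)))" "M (fst (p (Suc i))) = {snd (p i), snd (p (Suc i))}"
    using p[of i] Suc.prems unfolding istep_def by (auto simp: case_prod_unfold)
  then show ?case using Suc f(1)[OF X[of "Suc i"]] f(2)[OF X[of i] X[of "Suc i"]] by auto
qed

text \<open>If every derivable literal has a derivation of at most \<open>N\<close> steps, the
  contradiction consists of at most two such derivations and one more vertex. If some literal needs
  more steps, the beginning of a shortest derivation is either contradictory itself or a chain of
  \<open>N\<close> vertices, which is excluded. Shortness excludes one kind of chord, and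
  \<open>closed\<close>, saying that no colour in \<open>M\<close> is refuted by \<open>N\<close>
  further vertices, excludes another.\<close>

lemma bad_start_refuted:
  assumes sym: "\<And>u v. E u v \<Longrightarrow> E v u" and irr: "\<And>v. \<not> E v v"
    and L: "\<And>v. v \<in> V \<Longrightarrow> L v \<subseteq> {1,2,3} \<and> card (L v) \<le> 2"
    and subL: "\<And>v. v \<in> V \<Longrightarrow> M v \<subseteq> L v"
    and closed: "\<And>v c X. v \<in> V \<Longrightarrow> c \<in> M v \<Longrightarrow> X \<subseteq> V \<Longrightarrow> finite X \<Longrightarrow> card X \<le> N
        \<Longrightarrow> lcol E (insert v X) (L(v := {c}))"
    and nochain: "\<And>v c. \<not> chain E V N v c"
    and s: "v0 \<in> V" "c0 \<in> M v0" and bad: "\<not> good_start E V M (v0, c0)"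
  shows "\<exists>X\<subseteq>V. finite X \<and> card X \<le> 2 * N + 3 \<and> v0 \<in> X \<and>
     \<not> (\<exists>f. (\<forall>v\<in>X. f v \<in> M v) \<and> (\<forall>u\<in>X. \<forall>v\<in>X. E u v \<longrightarrow> f u \<noteq> f v) \<and> f v0 = c0)"
proof (cases "\<exists>y. (((v0, c0), y) \<in> (istep E V M)\<^sup>* \<and> (\<forall>k\<le>N. ((v0, c0), y) \<notin> istep E V M ^^ k))")
  case True
  then obtain y where "((v0, c0), y) \<in> (istep E V M)\<^sup>*" and far: "\<forall>k\<le>N. ((v0, c0), y) \<notin> istep E V M ^^ k"
    by blast
  then have ex: "\<exists>k. ((v0, c0), y) \<in> istep E V M ^^ k" by (simp add: rtrancl_power)
  define k where "k = (LEAST k. ((v0, c0), y) \<in> istep E V M ^^ k)"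
  have k: "((v0, c0), y) \<in> istep E V M ^^ k" unfolding k_def using LeastI_ex[OF ex] .
  have kmin: "((v0, c0), y) \<notin> istep E V M ^^ j" if "j < k" for j
    using that not_less_Least unfolding k_def by blast
  have kN: "N < k" using k far by (meson not_le)
  obtain p where p: "p 0 = (v0, c0)" "p k = y" "\<And>i. i < k \<Longrightarrow> (p i, p (Suc i)) \<in> istep E V M"
    using k unfolding relpow_fun_conv by blast
  define w where "w i = fst (p i)" for i
  define d where "d i = snd (p i)" for i
  have pd: "p i = (w i, d i)" for i unfolding w_def d_def by simp
  have seg: "(p i, p j) \<in> istep E V M ^^ (j - i)" if "i \<le> j" "j \<le> k" for i j
    unfolding relpow_fun_conv using that p(3)
    by (intro exI[of _ "\<lambda>t. p (i + t)"]) auto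
  have short: "((p i, p j) \<notin> istep E V M)" if "Suc i < j" "j \<le> k" for i j
  proof
    assume a: "(p i, p j) \<in> istep E V M"
    have "(p 0, p j) \<in> istep E V M ^^ Suc i" using seg[of 0 i] that a by auto
    then have "(p 0, p k) \<in> istep E V M ^^ (Suc i + (k - j))"
      using seg[of j k] that unfolding relpow_add by (metis order_refl relcomp.relcompI)
    moreover have "Suc i + (k - j) < k" using that by linarith
    ultimately show False using kmin p(1,2) by metis
  qed
  have neq: "p i \<noteq> p j" if "i < j" "j \<le> k" for i j
  proof
    assume a: "p i = p j"
    have "(p 0, p j) \<in> istep E V M ^^ i" using seg[of 0 i] that a by auto
    then have "(p 0, p k) \<in> istep E V M ^^ (i + (k - j))"
      using seg[of j k] that unfolding relpow_add by (metis order_refl relcomp.relcompI)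
    moreover have "i + (k - j) < k" using that by linarith
    ultimately show False using kmin p(1,2) by metis
  qed
  have st: "w i \<in> V" "w (Suc i) \<in> V" "E (w i) (w (Suc i))" "M (w (Suc i)) = {d i, d (Suc i)}" "d i \<noteq> d (Suc i)"
    if "i < k" for i
    using p(3)[OF that] unfolding istep_def pd by auto
  \<comment> \<open>The start \<open>w 0\<close> belongs to the refutation but not to the chain,
    because its list need not consist of two consecutive colours of the derivation.\<close>
  let ?X = "w ` {..N}"
  have XV: "?X \<subseteq> V" using st(1) kN by auto
  have "card ?X \<le> 2 * N + 3" using card_image_le[of "{..N}" w] by simp
  moreover have "v0 \<in> ?X" using p(1) pd[of 0] by force
  moreover have "\<not> (\<exists>f. (\<forall>v\<in>?X. f v \<in> M v) \<and> (\<forall>u\<in>?X. \<forall>v\<in>?X. E u v \<longrightarrow> f u \<noteq> f v) \<and> f v0 = c0)"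
  proof
    assume "\<exists>f. (\<forall>v\<in>?X. f v \<in> M v) \<and> (\<forall>u\<in>?X. \<forall>v\<in>?X. E u v \<longrightarrow> f u \<noteq> f v) \<and> f v0 = c0"
    then obtain f where f: "\<And>v. v \<in> ?X \<Longrightarrow> f v \<in> M v" "\<And>u v. u \<in> ?X \<Longrightarrow> v \<in> ?X \<Longrightarrow> E u v \<Longrightarrow> f u \<noteq> f v" "f v0 = c0"
      by blast
    have fd: "f (w i) = d i" if "i \<le> N" for i
      using istep_forced[of N p E V M ?X f i] p(1,3) kN f that unfolding w_def d_def by auto
    have inj: "w i \<noteq> w j" if "i < j" "j \<le> N" for i j
      using neq[of i j] fd[of i] fd[of j] that kN unfolding pd by auto
    have cons: "d i \<noteq> d j" if "i \<le> N" "j \<le> N" "E (w i) (w j)" for i j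
      using f(2)[of "w i" "w j"] fd that by auto
    have LM: "L (w (Suc i)) = {d i, d (Suc i)}" if "i < N" for i
    proof -
      have "w (Suc i) \<in> V" using st(2)[of i] that kN by auto
      then have "{d i, d (Suc i)} \<subseteq> L (w (Suc i))" "card (L (w (Suc i))) \<le> 2" "finite (L (w (Suc i)))"
        using subL[of "w (Suc i)"] st(4)[of i] that kN L[of "w (Suc i)"] finite_subset[of "L (w (Suc i))" "{1,2,3}"] by auto
      then show ?thesis using st(5)[of i] that kN by (intro card_seteq[symmetric]) auto
    qed
    have "chain E V N (\<lambda>i. w (Suc i)) d"
      unfolding chain_def
    proof (intro conjI allI impI)
      show "inj_on (\<lambda>i. w (Suc i)) {..<N}"
        by (rule linorder_inj_onI) (use inj in auto)
    next
      fix i assume "i \<le> N"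
      have "d i \<in> M (w i)" using f(1)[of "w i"] fd[OF \<open>i \<le> N\<close>] \<open>i \<le> N\<close> by auto
      then show "d i \<in> {1,2,3}" using subL[of "w i"] L[of "w i"] XV \<open>i \<le> N\<close> by auto
    next
      fix i j assume ij: "i < j \<and> j < N \<and> j \<noteq> Suc i \<and> E (w (Suc i)) (w (Suc j))"
      then have lt: "i < N" "j < N" by auto
      have a1: "d (Suc i) \<noteq> d (Suc j)" using cons[of "Suc i" "Suc j"] ij by auto
      \<comment> \<open>Otherwise the chord is itself a step and shortens the derivation.\<close>
      have a2: "d (Suc i) \<noteq> d j"
      proof
        assume "d (Suc i) = d j"
        then have "(p (Suc i), p (Suc j)) \<in> istep E V M"
          using st(2)[of i] st(2)[of j] st(4)[of j] st(5)[of j] ij kN unfolding istep_def pd by auto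
        then show False using short[of "Suc i" "Suc j"] ij kN by auto
      qed
      \<comment> \<open>Otherwise colour \<open>d j\<close> at \<open>w (Suc j)\<close> forces
        \<open>w (Suc i)\<close> through the chord, and then all vertices up to \<open>w j\<close>,
        to take their second colours. This puts \<open>d j\<close> on both ends of the edge from
        \<open>w j\<close> to \<open>w (Suc j)\<close>, a refutation with at most \<open>N\<close>
        vertices, against \<open>closed\<close>.\<close>
      have a3: "d i \<noteq> d j"
      proof
        assume eq: "d i = d j"
        let ?Y = "w ` {Suc i..j}"
        have "card ?Y \<le> N" using card_image_le[of "{Suc i..j}" w] ij by auto
        moreover have "d j \<in> M (w (Suc j))" "w (Suc j) \<in> V" using st(4)[of j] st(2)[of j] ij kN by auto
        moreover have "?Y \<subseteq> V" using XV ij by auto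
        ultimately have "lcol E (insert (w (Suc j)) ?Y) (L(w (Suc j) := {d j}))"
          by (intro closed) auto
        then obtain g where g: "\<And>v. v \<in> insert (w (Suc j)) ?Y \<Longrightarrow> g v \<in> (L(w (Suc j) := {d j})) v"
          "\<And>u v. u \<in> insert (w (Suc j)) ?Y \<Longrightarrow> v \<in> insert (w (Suc j)) ?Y \<Longrightarrow> E u v \<Longrightarrow> g u \<noteq> g v"
          by (erule lcolE)
        have gj: "g (w (Suc j)) = d j" using g(1)[of "w (Suc j)"] by simp
        have gl: "g (w (Suc t)) \<in> {d t, d (Suc t)}" if "i \<le> t" "t < j" for t
        proof -
          have "w (Suc t) \<in> ?Y" using that by auto
          moreover have "w (Suc t) \<noteq> w (Suc j)" using inj[of "Suc t" "Suc j"] that ij by auto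
          ultimately show ?thesis using g(1)[of "w (Suc t)"] LM[of t] that ij by auto
        qed
        have "g (w (Suc t)) = d (Suc t)" if "i \<le> t" "t < j" for t
          using that
        proof (induction t rule: dec_induct)
          case base
          have "w (Suc i) \<in> ?Y" using ij by auto
          then have "g (w (Suc i)) \<noteq> g (w (Suc j))" using g(2) ij by blast
          then show ?case using gl[of i] base gj eq by auto
        next
          case (step t)
          have "w (Suc t) \<in> ?Y" "w (Suc (Suc t)) \<in> ?Y" using step by auto
          then have "g (w (Suc t)) \<noteq> g (w (Suc (Suc t)))" using g(2) st(3)[of "Suc t"] step ij kN by auto
          then show ?case using gl[of "Suc t"] step by auto
        qed
        from this[of "j - 1"] have "g (w j) = d j" using ij by auto
        moreover have "w j \<in> ?Y" using ij by auto
        then have "g (w j) \<noteq> g (w (Suc j))" using g(2) st(3)[of j] ij kN by auto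
        ultimately show False using gj by simp
      qed
      have d3: "d t \<in> {1,2,3}" if "t \<le> N" for t
      proof -
        have "d t \<in> M (w t)" using f(1)[of "w t"] fd[OF that] that by auto
        then show ?thesis using subL[of "w t"] L[of "w t"] XV that by auto
      qed
      have "d i \<noteq> d (Suc i)" "d j \<noteq> d (Suc j)" using st(5) ij kN by auto
      then show "d i = d (Suc j)"
        using a1 a2 a3 d3[of i] d3[of j] d3[of "Suc i"] d3[of "Suc j"] ij by auto
      show "d (Suc i) \<noteq> d j" "d (Suc i) \<noteq> d (Suc j)" by fact+
    qed (use st kN in auto)
    then show False using nochain by blast
  qed
  ultimately show ?thesis using XV by (intro exI[of _ ?X]) auto
next
  case False
  have path: "\<exists>Y\<subseteq>V. finite Y \<and> card Y \<le> N + 1 \<and> v0 \<in> Y \<and> w \<in> Y \<and>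
      (\<forall>X f. Y \<subseteq> X \<longrightarrow> (\<forall>v\<in>X. f v \<in> M v) \<longrightarrow> (\<forall>u\<in>X. \<forall>v\<in>X. E u v \<longrightarrow> f u \<noteq> f v) \<longrightarrow> f v0 = c0 \<longrightarrow> f w = d)"
    if "((v0, c0), (w, d)) \<in> (istep E V M)\<^sup>*" for w d
  proof -
    obtain k where k: "k \<le> N" "((v0, c0), (w, d)) \<in> istep E V M ^^ k" using False \<open>((v0, c0), (w, d)) \<in> _\<close> by blast
    obtain p where p: "p 0 = (v0, c0)" "p k = (w, d)" "\<And>i. i < k \<Longrightarrow> (p i, p (Suc i)) \<in> istep E V M"
      using k unfolding relpow_fun_conv by blast
    let ?Y = "(\<lambda>i. fst (p i)) ` {..k}"
    have "fst (p i) \<in> V" if "i \<le> k" for i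
    proof (cases i)
      case 0 then show ?thesis using p(1) s by simp
    next
      case (Suc j) then show ?thesis using p(3)[of j] \<open>i \<le> k\<close> unfolding istep_def by (auto simp: case_prod_unfold)
    qed
    then have "?Y \<subseteq> V" by auto
    moreover have "card ?Y \<le> N + 1" using card_image_le[of "{..k}" "\<lambda>i. fst (p i)"] k by simp
    moreover have "v0 \<in> ?Y" "w \<in> ?Y" using p(1,2) by force+
    moreover have "f w = d" if X: "?Y \<subseteq> X" and f: "\<forall>v\<in>X. f v \<in> M v" "\<forall>u\<in>X. \<forall>v\<in>X. E u v \<longrightarrow> f u \<noteq> f v" "f v0 = c0" for X f
    proof -
      have "f (fst (p k)) = snd (p k)"
        by (rule istep_forced[of k p E V M X f k]) (use p X f in auto)
      then show ?thesis using p(2) by simp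
    qed
    ultimately show ?thesis by (intro exI[of _ ?Y]) auto
  qed
  from bad consider w d d' where "((v0, c0), (w, d)) \<in> (istep E V M)\<^sup>*" "((v0, c0), (w, d')) \<in> (istep E V M)\<^sup>*" "d \<noteq> d'"
    | w d u where "((v0, c0), (w, d)) \<in> (istep E V M)\<^sup>*" "u \<in> V" "E w u" "M u = {d}"
    unfolding good_start_def by blast
  then show ?thesis
  proof cases
    case 1
    obtain Y where Y: "Y \<subseteq> V" "finite Y" "card Y \<le> N + 1" "v0 \<in> Y"
      "\<And>X f. Y \<subseteq> X \<Longrightarrow> \<forall>v\<in>X. f v \<in> M v \<Longrightarrow> \<forall>u\<in>X. \<forall>v\<in>X. E u v \<longrightarrow> f u \<noteq> f v \<Longrightarrow> f v0 = c0 \<Longrightarrow> f w = d"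
      using path[OF 1(1)] by blast
    obtain Y' where Y': "Y' \<subseteq> V" "finite Y'" "card Y' \<le> N + 1" "v0 \<in> Y'"
      "\<And>X f. Y' \<subseteq> X \<Longrightarrow> \<forall>v\<in>X. f v \<in> M v \<Longrightarrow> \<forall>u\<in>X. \<forall>v\<in>X. E u v \<longrightarrow> f u \<noteq> f v \<Longrightarrow> f v0 = c0 \<Longrightarrow> f w = d'"
      using path[OF 1(2)] by blast
    have "card (Y \<union> Y') \<le> 2 * N + 3" using card_Un_le[of Y Y'] Y(3) Y'(3) by linarith
    then show ?thesis
      using Y Y'(1,2) Y(5)[of "Y \<union> Y'"] Y'(5)[of "Y \<union> Y'"] 1(3) by (intro exI[of _ "Y \<union> Y'"]) blast
  next
    case 2
    obtain Y where Y: "Y \<subseteq> V" "finite Y" "card Y \<le> N + 1" "v0 \<in> Y" "w \<in> Y"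
      "\<And>X f. Y \<subseteq> X \<Longrightarrow> \<forall>v\<in>X. f v \<in> M v \<Longrightarrow> \<forall>u\<in>X. \<forall>v\<in>X. E u v \<longrightarrow> f u \<noteq> f v \<Longrightarrow> f v0 = c0 \<Longrightarrow> f w = d"
      using path[OF 2(1)] by blast
    have "card (insert u Y) \<le> 2 * N + 3" using card_insert_le_m1[of "N + 2" Y u] Y(3) by simp
    moreover have "\<not> (\<exists>f. (\<forall>v\<in>insert u Y. f v \<in> M v) \<and> (\<forall>x\<in>insert u Y. \<forall>v\<in>insert u Y. E x v \<longrightarrow> f x \<noteq> f v) \<and> f v0 = c0)"
    proof
      assume "\<exists>f. (\<forall>v\<in>insert u Y. f v \<in> M v) \<and> (\<forall>x\<in>insert u Y. \<forall>v\<in>insert u Y. E x v \<longrightarrow> f x \<noteq> f v) \<and> f v0 = c0"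
      then obtain f where f: "\<forall>v\<in>insert u Y. f v \<in> M v" "\<forall>x\<in>insert u Y. \<forall>v\<in>insert u Y. E x v \<longrightarrow> f x \<noteq> f v" "f v0 = c0"
        by blast
      have "f w = d" using Y(6)[OF _ f] by blast
      moreover have "f u = d" using f(1) 2(4) by auto
      ultimately show False using f(2) 2(3) Y(5) by (metis insertI1 insertI2)
    qed
    ultimately show ?thesis using Y(1,2,4) 2(2) by (intro exI[of _ "insert u Y"]) auto
  qed
qed

text \<open>Colours refuted by at most \<open>N\<close> further vertices are discarded first, which
  gives \<open>bad_start_refuted\<close> its hypothesis \<open>closed\<close>. A vertex with only
  bad starts then yields at most two refutations of \<open>2 * N + 3\<close> vertices; with the
  vertex itself this makes \<open>4 * N + 7\<close>, and the factor \<open>3 * N + 1\<close>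
  restores the discarded colours.\<close>

theorem two_lists:
  assumes sym: "\<And>u v. E u v \<Longrightarrow> E v u" and irr: "\<And>v. \<not> E v v" and "finite V"
    and L: "\<And>v. v \<in> V \<Longrightarrow> L v \<subseteq> {1,2,3} \<and> card (L v) \<le> 2"
    and nochain: "\<And>v c. \<not> chain E V N v c"
    and nc: "\<not> lcol E V L"
  shows "small_obs E ((4 * N + 7) * (3 * N + 1)) V L"
proof -
  define M where "M v = {c \<in> L v. \<not> (\<exists>X\<subseteq>V. finite X \<and> card X \<le> N \<and> \<not> lcol E (insert v X) (L(v := {c})))}" for v
  have subL: "M v \<subseteq> L v" for v unfolding M_def by blast
  have closed: "lcol E (insert v X) (L(v := {c}))"
    if "v \<in> V" "c \<in> M v" "X \<subseteq> V" "finite X" "card X \<le> N" for v c X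
    using that unfolding M_def by blast
  have M2: "finite (M v) \<and> card (M v) \<le> 2" if "v \<in> V" for v
  proof -
    have "finite (L v)" using L[OF that] finite_subset[of "L v" "{1,2,3}"] by simp
    then show ?thesis using subL[of v] L[OF that] card_mono[of "L v" "M v"] finite_subset[of "M v" "L v"] by linarith
  qed
  have "\<not> lcol E V M" using nc lcol_mono[of E V M V L] subL by blast
  then obtain v where v: "v \<in> V" "\<And>c. c \<in> M v \<Longrightarrow> \<not> good_start E V M (v, c)"
    using lcol_of_good_starts[of E V M] sym \<open>finite V\<close> M2 by blast
  let ?P = "\<lambda>c X. X \<subseteq> V \<and> finite X \<and> card X \<le> 2 * N + 3 \<and> v \<in> X \<and>
     \<not> (\<exists>f. (\<forall>v\<in>X. f v \<in> M v) \<and> (\<forall>u\<in>X. \<forall>v\<in>X. E u v \<longrightarrow> f u \<noteq> f v) \<and> f v = c)"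
  have "\<forall>c\<in>M v. \<exists>X. ?P c X"
  proof
    fix c assume c: "c \<in> M v"
    from bad_start_refuted[OF sym irr L subL closed nochain v(1) c v(2)[OF c]] show "\<exists>X. ?P c X" by simp
  qed
  from bchoice[OF this] obtain X where X: "\<forall>c\<in>M v. ?P c (X c)" ..
  let ?Z = "insert v (\<Union>c\<in>M v. X c)"
  have "\<not> lcol E ?Z M"
  proof
    assume "lcol E ?Z M"
    then obtain f where f: "\<And>u. u \<in> ?Z \<Longrightarrow> f u \<in> M u" "\<And>u w. u \<in> ?Z \<Longrightarrow> w \<in> ?Z \<Longrightarrow> E u w \<Longrightarrow> f u \<noteq> f w"
      by (erule lcolE)
    have fv: "f v \<in> M v" using f(1)[of v] by simp
    have sub: "X (f v) \<subseteq> ?Z" using fv by blast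
    have "\<forall>u\<in>X (f v). f u \<in> M u" using f(1) subsetD[OF sub] by simp
    moreover have "\<forall>u\<in>X (f v). \<forall>w\<in>X (f v). E u w \<longrightarrow> f u \<noteq> f w" using f(2) subsetD[OF sub] by simp
    ultimately show False using X fv by blast
  qed
  moreover have "?Z \<subseteq> V" using X v(1) by blast
  moreover have "finite ?Z" using X M2[OF v(1)] by simp
  moreover have "card ?Z \<le> 4 * N + 7"
  proof -
    have "card (\<Union>c\<in>M v. X c) \<le> (\<Sum>c\<in>M v. card (X c))"
      using M2[OF v(1)] by (intro card_UN_le) simp
    also have "\<dots> \<le> card (M v) * (2 * N + 3)"
      using X by (intro sum_bounded_above[where K="2*N+3", simplified]) simp
    also have "\<dots> \<le> 2 * (2 * N + 3)" using M2[OF v(1)] by (intro mult_right_mono) auto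
    finally show ?thesis using card_insert_le_m1[of "4 * N + 7" "\<Union>c\<in>M v. X c" v] by simp
  qed
  ultimately have "small_obs E (4 * N + 7) V M" unfolding small_obs_def by blast
  then show ?thesis
    using small_obs_reduce[of V L M N E "4 * N + 7"] L unfolding M_def by blast
qed

section \<open>Chains in graphs without an induced six-vertex path\<close>

lemma chain_subset: "chain E W N v c \<Longrightarrow> W \<subseteq> V \<Longrightarrow> chain E V N v c"
  unfolding chain_def by blast

lemma chain_window:
  assumes "chain E V N v c" "k + n \<le> N"
  shows "chain E V n (\<lambda>i. v (k + i)) (\<lambda>i. c (k + i))"
proof -
  have inj: "inj_on v {..<N}" using assms(1) unfolding chain_def by blast
  have "inj_on (\<lambda>i. v (k + i)) {..<n}"
  proof (rule inj_onI)
    fix x y assume "x \<in> {..<n}" "y \<in> {..<n}" "v (k + x) = v (k + y)"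
    then show "x = y" using inj_onD[OF inj, of "k + x" "k + y"] assms(2) by simp
  qed
  then show ?thesis using assms unfolding chain_def by auto
qed

text \<open>The chord condition is invariant under reading a chain backwards, with vertices and
  colours reversed about different centres. Hence a pattern and its reverse share one
  certificate.\<close>

lemma chain_rev:
  assumes "chain E V N v c" and sym: "\<And>u v. E u v \<Longrightarrow> E v u"
  shows "chain E V N (\<lambda>i. v (N - 1 - i)) (\<lambda>i. c (N - i))"
proof -
  have inj: "inj_on v {..<N}" and c3: "\<And>i. i \<le> N \<Longrightarrow> c i \<in> {1,2,3}" and cs: "\<And>i. i < N \<Longrightarrow> c i \<noteq> c (Suc i)"
    and e: "\<And>i. Suc i < N \<Longrightarrow> E (v i) (v (Suc i))" and V: "\<And>i. i < N \<Longrightarrow> v i \<in> V"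
    and ch: "\<And>i j. i < j \<Longrightarrow> j < N \<Longrightarrow> j \<noteq> Suc i \<Longrightarrow> E (v i) (v j) \<Longrightarrow> c i = c (Suc j) \<and> c (Suc i) \<noteq> c j \<and> c (Suc i) \<noteq> c (Suc j)"
    using assms(1) unfolding chain_def by blast+
  show ?thesis
    unfolding chain_def
  proof (intro conjI allI impI)
    show "v (N - 1 - i) \<in> V" if "i < N" for i using V that by simp
    show "inj_on (\<lambda>i. v (N - 1 - i)) {..<N}"
    proof (rule inj_onI)
      fix x y assume "x \<in> {..<N}" "y \<in> {..<N}" "v (N - 1 - x) = v (N - 1 - y)"
      then show "x = y" using inj_onD[OF inj, of "N - 1 - x" "N - 1 - y"] by simp
    qed
    show "E (v (N - 1 - i)) (v (N - 1 - Suc i))" if "Suc i < N" for i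
      using sym[OF e[of "N - 1 - Suc i"]] that by (simp add: Suc_diff_Suc)
    show "c (N - i) \<in> {1,2,3}" for i using c3[of "N - i"] by simp
    show "c (N - i) \<noteq> c (N - Suc i)" if "i < N" for i
      using cs[of "N - Suc i"] that by (simp add: Suc_diff_Suc)
    fix i j assume a: "i < j \<and> j < N \<and> j \<noteq> Suc i \<and> E (v (N - 1 - i)) (v (N - 1 - j))"
    then have "i < N" "j < N" by simp_all
    then have 1: "Suc (N - 1 - i) = N - i" "Suc (N - 1 - j) = N - j" "N - 1 - i = N - Suc i" "N - 1 - j = N - Suc j" by (simp_all add: Suc_diff_Suc)
    have "c (N - 1 - j) = c (Suc (N - 1 - i)) \<and> c (Suc (N - 1 - j)) \<noteq> c (N - 1 - i) \<and> c (Suc (N - 1 - j)) \<noteq> c (Suc (N - 1 - i))"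
      by (rule ch) (use a sym in auto)
    moreover have "c (N - 1 - i) \<noteq> c (Suc (N - 1 - i))" "c (N - 1 - j) \<noteq> c (Suc (N - 1 - j))" by (rule cs, use a in simp)+
    ultimately show "c (N - i) = c (N - Suc j)" "c (N - Suc i) \<noteq> c (N - j)" "c (N - Suc i) \<noteq> c (N - Suc j)"
      using 1 by auto
  qed
qed

text \<open>A chain depends only on which colours are equal, so the first two may be taken to be 1
  and 2.\<close>

lemma chain_relabel:
  assumes "chain E V N v c" and \<pi>: "inj_on \<pi> {1,2,3::nat}" "\<pi> ` {1,2,3} \<subseteq> {1,2,3}"
  shows "chain E V N v (\<lambda>i. \<pi> (c i))"
proof -
  have c3: "c i \<in> {1,2,3}" if "i \<le> N" for i using assms(1) that unfolding chain_def by blast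
  have eq: "\<pi> (c i) = \<pi> (c j) \<longleftrightarrow> c i = c j" if "i \<le> N" "j \<le> N" for i j
    using inj_on_eq_iff[OF \<pi>(1) c3[OF that(1)] c3[OF that(2)]] .
  have "\<pi> (c i) \<in> {1,2,3}" if "i \<le> N" for i using subsetD[OF \<pi>(2) imageI[OF c3[OF that]]] .
  moreover have "\<pi> (c i) = \<pi> (c (Suc j)) \<and> \<pi> (c (Suc i)) \<noteq> \<pi> (c j) \<and> \<pi> (c (Suc i)) \<noteq> \<pi> (c (Suc j))"
    if "i < j \<and> j < N \<and> j \<noteq> Suc i \<and> E (v i) (v j)" for i j
    using assms(1) that unfolding chain_def by (simp add: eq)
  moreover have "\<pi> (c i) \<noteq> \<pi> (c (Suc i))" if "i < N" for i
    using assms(1) that unfolding chain_def by (simp add: eq)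
  ultimately show ?thesis using assms(1) unfolding chain_def by simp
qed

text \<open>
  A chain of \<open>n + 1\<close> vertices is described, up to a permutation of the colours, by the list of the
  \<open>n\<close> truth values \<open>c (i + 2) = c i\<close>. Entry \<open>i\<close> of \<open>pattern_cols 0 1 2 w\<close> is \<open>(i, c i, c (i + 1))\<close> for
  the chain with \<open>c 0 = 1\<close> and \<open>c 1 = 2\<close>. Integers and nested conditionals keep the
  evaluation of the certificates below cheap.
\<close>

fun pattern_cols :: "int \<Rightarrow> int \<Rightarrow> int \<Rightarrow> bool list \<Rightarrow> (int \<times> int \<times> int) list" where
  "pattern_cols k a b [] = [(k, a, b)]"
| "pattern_cols k a b (t # ts) = (k, a, b) # pattern_cols (k + 1) b (if t then a else 6 - a - b) ts"

fun lookup :: "(int \<times> int \<times> int) list \<Rightarrow> int \<Rightarrow> int \<times> int" where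
  "lookup [] i = (0, 0)"
| "lookup ((k, p) # cs) i = (if k = i then p else lookup cs i)"

lemma lookup_pattern_cols:
  assumes "\<And>i. i \<le> Suc (length w) \<Longrightarrow> c i \<in> {1,2,3::nat}"
    and "\<And>i. i \<le> length w \<Longrightarrow> c i \<noteq> c (Suc i)" "\<And>i. i < length w \<Longrightarrow> (c (Suc (Suc i)) = c i) = w ! i"
  shows "i \<le> length w \<Longrightarrow> lookup (pattern_cols k (int (c 0)) (int (c 1)) w) (k + int i) = (int (c i), int (c (Suc i)))"
  using assms
proof (induction w arbitrary: c i k)
  case Nil then show ?case by simp
next
  case (Cons t w)
  \<comment> \<open>The three colours sum to 6, so the colour different from two distinct ones is 6
    minus their sum.\<close>
  have c2: "int (c (Suc 1)) = (if t then int (c 0) else 6 - int (c 0) - int (c 1))"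
    using Cons.prems(2)[of 0] Cons.prems(2)[of 1] Cons.prems(2)[of 2] Cons.prems(3)[of 0] Cons.prems(3)[of 1] Cons.prems(4)[of 0]
    by (auto simp: numeral_2_eq_2)
  show ?case
  proof (cases i)
    case 0 then show ?thesis by simp
  next
    case (Suc j)
    have "lookup (pattern_cols (k + 1) (int (c (Suc 0))) (int (c (Suc 1))) w) (k + 1 + int j) = (int (c (Suc j)), int (c (Suc (Suc j))))"
    proof (rule Cons.IH[where c="\<lambda>i. c (Suc i)"])
      show "j \<le> length w" using Suc Cons.prems(1) by simp
      show "c (Suc i) \<in> {1,2,3}" if "i \<le> Suc (length w)" for i using Cons.prems(2)[of "Suc i"] that by simp
      show "c (Suc i) \<noteq> c (Suc (Suc i))" if "i \<le> length w" for i using Cons.prems(3)[of "Suc i"] that by simp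
      show "(c (Suc (Suc (Suc i))) = c (Suc i)) = w ! i" if "i < length w" for i using Cons.prems(4)[of "Suc i"] that by simp
    qed
    then show ?thesis unfolding c2 using Suc by (cases t) (simp_all add: add.assoc)
  qed
qed

text \<open>
  \<open>PA a b c d e f\<close> claims an induced path on the chain vertices with these indices;
  \<open>BR i j p q\<close> branches on whether \<open>i\<close> and \<open>j\<close> are adjacent.
\<close>

datatype cert = PA int int int int int int | BR int int cert cert

fun pair_member :: "(int \<times> int) list \<Rightarrow> int \<Rightarrow> int \<Rightarrow> bool" where
  "pair_member [] a b \<longleftrightarrow> False"
| "pair_member ((x, y) # ps) a b \<longleftrightarrow>
    (if x = a then if y = b then True else pair_member ps a b else pair_member ps a b)"

definition known_edge :: "(int \<times> int) list \<Rightarrow> int \<Rightarrow> int \<Rightarrow> bool" where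
  "known_edge ps a b \<longleftrightarrow> (if b = a + 1 then True else if a = b + 1 then True
    else if a < b then pair_member ps a b else pair_member ps b a)"

text \<open>The two pairs are the colours of the chain vertices \<open>a\<close> and
  \<open>b\<close>. A chord is excluded either because the chord condition of a chain fails for
  these colours or because the current branch assumes a nonedge, recorded in
  \<open>ns\<close>.\<close>

fun no_chord :: "(int \<times> int) list \<Rightarrow> int \<Rightarrow> int \<Rightarrow> int \<times> int \<Rightarrow> int \<times> int \<Rightarrow> bool" where
  "no_chord ns a b (p, q) (r, s) \<longleftrightarrow> (if b = a + 1 then False else
    if p = s then if q = r then True else if q = s then True else pair_member ns a b else True)"

definition known_nonedge :: "(int \<times> int) list \<Rightarrow> int \<Rightarrow> int \<times> int \<Rightarrow> int \<Rightarrow> int \<times> int \<Rightarrow> bool" where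
  "known_nonedge ns a x b y \<longleftrightarrow> (if a < b then no_chord ns a b x y else if b < a then no_chord ns b a y x else False)"

definition known_P6 :: "(int \<times> int) list \<Rightarrow> (int \<times> int) list \<Rightarrow> int \<Rightarrow> int \<times> int \<Rightarrow> int \<Rightarrow> int \<times> int
    \<Rightarrow> int \<Rightarrow> int \<times> int \<Rightarrow> int \<Rightarrow> int \<times> int \<Rightarrow> int \<Rightarrow> int \<times> int \<Rightarrow> int \<Rightarrow> int \<times> int \<Rightarrow> bool" where
  "known_P6 ps ns a a' b b' c c' d d' e e' f f' \<longleftrightarrow>
    (if known_edge ps a b then if known_edge ps b c then if known_edge ps c d then
     if known_edge ps d e then if known_edge ps e f then
     if known_nonedge ns a a' c c' then if known_nonedge ns a a' d d' then
     if known_nonedge ns a a' e e' then if known_nonedge ns a a' f f' then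
     if known_nonedge ns b b' d d' then if known_nonedge ns b b' e e' then
     if known_nonedge ns b b' f f' then if known_nonedge ns c c' e e' then
     if known_nonedge ns c c' f f' then known_nonedge ns d d' f f'
     else False else False else False else False else False else False else False
     else False else False else False else False else False else False else False)"

definition in_range :: "int \<Rightarrow> int \<Rightarrow> bool" where
  "in_range n a \<longleftrightarrow> (if 0 \<le> a then a < n else False)"

primrec refutes :: "int \<Rightarrow> (int \<times> int \<times> int) list \<Rightarrow> (int \<times> int) list \<Rightarrow> (int \<times> int) list \<Rightarrow> cert \<Rightarrow> bool" where
  "refutes n cs ps ns (PA a b c d e f) \<longleftrightarrow>
    (if in_range n a then if in_range n b then if in_range n c then if in_range n d then
     if in_range n e then if in_range n f then
     known_P6 ps ns a (lookup cs a) b (lookup cs b) c (lookup cs c) d (lookup cs d) e (lookup cs e) f (lookup cs f)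
     else False else False else False else False else False else False)"
| "refutes n cs ps ns (BR i j p q) \<longleftrightarrow>
    (if refutes n cs ((i, j) # ps) ns p then refutes n cs ps ((i, j) # ns) q else False)"

definition refuted_pattern :: "bool list \<Rightarrow> cert \<Rightarrow> bool" where
  "refuted_pattern w t \<longleftrightarrow> refutes (1 + int (length w)) (pattern_cols 0 1 2 w) [] [] t"

lemma if_else_False: "(if P then Q else False) \<longleftrightarrow> P \<and> Q"
  by simp

lemma pair_member_iff: "pair_member ps a b \<longleftrightarrow> (a, b) \<in> set ps"
  by (induction ps a b rule: pair_member.induct) auto

text \<open>Distinctness of the six vertices is left implicit: for a symmetric irreflexive relation
  it follows from the adjacencies and nonadjacencies.\<close>

definition P6_free_on :: "('a \<Rightarrow> 'a \<Rightarrow> bool) \<Rightarrow> 'a set \<Rightarrow> bool" where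
  "P6_free_on E V \<longleftrightarrow> \<not> (\<exists>a\<in>V. \<exists>b\<in>V. \<exists>c\<in>V. \<exists>d\<in>V. \<exists>e\<in>V. \<exists>f\<in>V.
    E a b \<and> E b c \<and> E c d \<and> E d e \<and> E e f \<and> \<not> E a c \<and> \<not> E a d \<and> \<not> E a e \<and> \<not> E a f \<and>
    \<not> E b d \<and> \<not> E b e \<and> \<not> E b f \<and> \<not> E c e \<and> \<not> E c f \<and> \<not> E d f)"

text \<open>At a branching the true adjacency of the two chain vertices selects a subtree whose
  assumptions hold, so the leaf that is reached names a real induced path.\<close>

lemma refutes_sound:
  assumes sym: "\<And>u v. E u v \<Longrightarrow> E v u" and ch: "chain E V n v c" and P6: "P6_free_on E V"
    and cs: "\<And>i. i < n \<Longrightarrow> lookup cs (int i) = (int (c i), int (c (Suc i)))"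
  shows "refutes (int n) cs ps ns t \<Longrightarrow> (\<And>i j. (i, j) \<in> set ps \<Longrightarrow> E (v (nat i)) (v (nat j))) \<Longrightarrow>
    (\<And>i j. (i, j) \<in> set ns \<Longrightarrow> \<not> E (v (nat i)) (v (nat j))) \<Longrightarrow> False"
proof (induction t arbitrary: ps ns)
  case (PA a b c' d e f)
  have V: "v (nat i) \<in> V" if "in_range (int n) i" for i
    using ch that unfolding in_range_def chain_def by (auto split: if_splits)
  have step: "E (v (nat i)) (v (nat (i + 1)))" if "in_range (int n) i" "in_range (int n) (i + 1)" for i
    using ch that unfolding in_range_def chain_def by (auto simp: nat_add_distrib split: if_splits)
  have 1: "E (v (nat i)) (v (nat j))" if k: "known_edge ps i j" and ij: "in_range (int n) i" "in_range (int n) j" for i j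
  proof -
    consider "j = i + 1" | "i = j + 1" | "(i, j) \<in> set ps" | "(j, i) \<in> set ps"
      using k unfolding known_edge_def pair_member_iff by (auto split: if_splits)
    then show ?thesis using step[OF ij(1)] step[OF ij(2)] ij PA.prems(2) sym by cases blast+
  qed
  have chord: "\<not> E (v (nat i)) (v (nat j))"
    if nc: "no_chord ns i j (lookup cs i) (lookup cs j)" and ij: "in_range (int n) i" "in_range (int n) j" "i < j" for i j
  proof
    assume e: "E (v (nat i)) (v (nat j))"
    have lk: "lookup cs i = (int (c (nat i)), int (c (Suc (nat i))))" "lookup cs j = (int (c (nat j)), int (c (Suc (nat j))))"
      using cs[of "nat i"] cs[of "nat j"] ij unfolding in_range_def by (auto split: if_splits)
    have o: "nat i < nat j" "nat j < n" "j \<noteq> i + 1" "nat j \<noteq> Suc (nat i)"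
      using nc ij unfolding in_range_def lk by (auto split: if_splits)
    have "c (nat i) = c (Suc (nat j)) \<and> c (Suc (nat i)) \<noteq> c (nat j) \<and> c (Suc (nat i)) \<noteq> c (Suc (nat j))"
      using ch o e unfolding chain_def by blast
    then have "(i, j) \<in> set ns" using nc o(3) unfolding lk by (auto simp: pair_member_iff)
    then show False using PA.prems(3) e by blast
  qed
  have 2: "\<not> E (v (nat i)) (v (nat j))" if k: "known_nonedge ns i (lookup cs i) j (lookup cs j)"
    and ij: "in_range (int n) i" "in_range (int n) j" for i j
    using k chord[OF _ ij] chord[OF _ ij(2,1)] sym unfolding known_nonedge_def by (metis)
  from PA.prems(1) have n: "in_range (int n) a" "in_range (int n) b" "in_range (int n) c'" "in_range (int n) d"
    "in_range (int n) e" "in_range (int n) f" unfolding refutes.simps if_else_False by blast+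
  from PA.prems(1) have *: "E (v (nat a)) (v (nat b))" "E (v (nat b)) (v (nat c'))" "E (v (nat c')) (v (nat d))"
    "E (v (nat d)) (v (nat e))" "E (v (nat e)) (v (nat f))"
    "\<not> E (v (nat a)) (v (nat c'))" "\<not> E (v (nat a)) (v (nat d))" "\<not> E (v (nat a)) (v (nat e))" "\<not> E (v (nat a)) (v (nat f))"
    "\<not> E (v (nat b)) (v (nat d))" "\<not> E (v (nat b)) (v (nat e))" "\<not> E (v (nat b)) (v (nat f))"
    "\<not> E (v (nat c')) (v (nat e))" "\<not> E (v (nat c')) (v (nat f))" "\<not> E (v (nat d)) (v (nat f))"
    unfolding refutes.simps known_P6_def if_else_False by (blast intro: 1 dest: 2)+
  show False using P6 V[OF n(1)] V[OF n(2)] V[OF n(3)] V[OF n(4)] V[OF n(5)] V[OF n(6)] *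
    unfolding P6_free_on_def by blast
next
  case (BR i j p q)
  from BR.prems(1) have pq: "refutes (int n) cs ((i, j) # ps) ns p" "refutes (int n) cs ps ((i, j) # ns) q"
    unfolding refutes.simps if_else_False by blast+
  show False
  proof (cases "E (v (nat i)) (v (nat j))")
    case True
    show False by (rule BR.IH(1)[OF pq(1)]) (use BR.prems(2,3) True in auto)
  next
    case False
    show False by (rule BR.IH(2)[OF pq(2)]) (use BR.prems(2,3) False in auto)
  qed
qed

lemma pattern_refuted:
  assumes sym: "\<And>u v. E u v \<Longrightarrow> E v u" and P6: "P6_free_on E V"
    and ch: "chain E V (Suc (length w)) v c" and w: "\<And>i. i < length w \<Longrightarrow> (c (Suc (Suc i)) = c i) = w ! i"
  shows "\<not> refuted_pattern w t"
proof
  assume r: "refuted_pattern w t"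
  define \<pi> where "\<pi> = (\<lambda>x. if x = c 0 then 1 else if x = c 1 then 2 else 3::nat)"
  have c01: "c 0 \<in> {1,2,3}" "c 1 \<in> {1,2,3}" "c 0 \<noteq> c 1" using ch unfolding chain_def by auto
  have inj: "inj_on \<pi> {1,2,3}"
    using c01 by (elim insertE emptyE) (simp_all add: inj_on_def \<pi>_def)
  define d where "d = (\<lambda>i. \<pi> (c i))"
  have chd: "chain E V (Suc (length w)) v d"
    unfolding d_def by (rule chain_relabel[OF ch inj]) (auto simp: \<pi>_def)
  have c3: "c i \<in> {1,2,3}" if "i \<le> Suc (length w)" for i using ch that unfolding chain_def by blast
  have "lookup (pattern_cols 0 (int (d 0)) (int (d 1)) w) (0 + int i) = (int (d i), int (d (Suc i)))" if "i < Suc (length w)" for i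
  proof (rule lookup_pattern_cols)
    show "i \<le> length w" using that by simp
    show "d i \<in> {1,2,3}" if "i \<le> Suc (length w)" for i using chd that unfolding chain_def by blast
    show "d i \<noteq> d (Suc i)" if "i \<le> length w" for i using chd that unfolding chain_def by auto
    show "(d (Suc (Suc i)) = d i) = w ! i" if "i < length w" for i
      using w[OF that] inj_on_eq_iff[OF inj c3[of "Suc (Suc i)"] c3[of i]] that by (simp add: d_def)
  qed
  moreover have "int (d 0) = 1" "int (d 1) = 2" using c01 by (auto simp: d_def \<pi>_def)
  ultimately have lk: "lookup (pattern_cols 0 1 2 w) (int i) = (int (d i), int (d (Suc i)))" if "i < Suc (length w)" for i
    using that by simp
  show False
    by (rule refutes_sound[OF sym chd P6 lk, of "[]" "[]" t]) (use r in \<open>simp_all add: refuted_pattern_def\<close>)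
qed

section \<open>Unavoidable patterns in words of truth values\<close>

datatype trie = Tip | End | Node trie trie

fun trie_insert :: "bool list \<Rightarrow> trie \<Rightarrow> trie" where
  "trie_insert [] t = End"
| "trie_insert (b # bs) End = End"
| "trie_insert (b # bs) Tip = (if b then Node (trie_insert bs Tip) Tip else Node Tip (trie_insert bs Tip))"
| "trie_insert (b # bs) (Node l r) = (if b then Node (trie_insert bs l) r else Node l (trie_insert bs r))"

fun trie_hit :: "trie \<Rightarrow> bool list \<Rightarrow> bool" where
  "trie_hit Tip bs \<longleftrightarrow> False"
| "trie_hit End bs \<longleftrightarrow> True"
| "trie_hit (Node l r) [] \<longleftrightarrow> False"
| "trie_hit (Node l r) (b # bs) \<longleftrightarrow> trie_hit (if b then l else r) bs"

lemma trie_hit_insert: "trie_hit (trie_insert w t) p \<Longrightarrow> trie_hit t p \<or> take (length w) p = w"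
proof (induction w t arbitrary: p rule: trie_insert.induct)
  case (3 b bs) then show ?case by (cases p) (auto split: if_splits)
next
  case (4 b bs l r) then show ?case by (cases p) (auto split: if_splits)
qed auto

lemma trie_hit_foldr: "trie_hit (foldr trie_insert ws Tip) p \<Longrightarrow> \<exists>w\<in>set ws. take (length w) p = w"
  by (induction ws) (auto dest: trie_hit_insert)

text \<open>Words grow at the front while \<open>trie_hit\<close> tests prefixes. A factor of a word
  is a prefix of one of its suffixes, so every position is tested, and a hit settles all further
  extensions at once.\<close>

primrec covered :: "trie \<Rightarrow> nat \<Rightarrow> bool list \<Rightarrow> bool" where
  "covered t 0 p \<longleftrightarrow> trie_hit t p"
| "covered t (Suc n) p \<longleftrightarrow> trie_hit t p \<or> covered t n (True # p) \<and> covered t n (False # p)"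

lemma covered_sound: "covered t n p \<Longrightarrow> length q = n \<Longrightarrow> \<exists>k. trie_hit t (drop k (rev q @ p))"
proof (induction n arbitrary: p q)
  case 0 then show ?case by (auto intro: exI[of _ 0])
next
  case (Suc n)
  then obtain b q' where q: "q = b # q'" "length q' = n" by (cases q) auto
  show ?case
  proof (cases "trie_hit t p")
    case True
    then show ?thesis by (intro exI[of _ "length q"]) simp
  next
    case False
    then have "covered t n (b # p)" using Suc.prems(1) by (cases b) auto
    from Suc.IH[OF this q(2)] show ?thesis using q by simp
  qed
qed

text \<open>
  Found by computer search: every list of 24 truth values contains one of these patterns or the
  reverse of one.
\<close>

definition P6_certs :: "(bool list \<times> cert) list" where
  "P6_certs = (let t = True; f = False in [
  ([f,t,t,t,f], PA 0 1 2 3 4 5), ([f,t,t,t,t], PA 0 1 2 3 4 5), ([t,t,t,t,t], PA 0 1 2 3 4 5), ([f,t,f,f,f,t], BR 3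
  5(PA 0 1 2 3 5 6)(BR 2 4(PA 0 1 2 4 5 6)(PA 0 1 2 3 4 5))), ([f,f,f,t,f,f,f], BR 1 3(BR 4 6(PA 0 1 3 4 6 7)(PA 0 1 3
  4 5 6))(BR 4 6(PA 1 2 3 4 6 7)(PA 1 2 3 4 5 6))), ([f,t,f,f,f,f,t], BR 3 5(PA 0 1 2 3 5 6)(BR 2 4(BR 1 7(PA 3 2 1 7
  6 5)(BR 4 6(PA 0 1 2 4 6 7)(PA 0 1 2 4 5 6)))(PA 0 1 2 3 4 5))), ([f,t,f,t,f,t,f], BR 1 4(PA 0 1 4 5 6 7)(PA 0 1 2 3
  4 5)), ([f,t,f,t,f,t,t], BR 1 4(PA 0 1 4 5 6 7)(PA 0 1 2 3 4 5)), ([f,t,t,f,t,f,t], BR 2 5(PA 0 1 2 5 6 7)(PA 1 2 3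
  4 5 6)), ([t,f,f,t,f,f,t], BR 0 5(BR 1 3(PA 3 1 0 5 6 7)(PA 3 2 1 0 5 6))(BR 1 3(BR 4 6(PA 0 1 3 4 6 7)(PA 0 1 3 4 5
  6))(PA 0 1 2 3 4 5))), ([t,f,t,f,t,f,t], BR 0 3(PA 1 0 3 4 5 6)(BR 2 5(BR 0 7(PA 3 2 1 0 7 6)(PA 0 1 2 5 6 7))(PA 0
  1 2 3 4 5))), ([t,t,f,f,f,t,t], BR 3 5(PA 0 1 2 3 5 6)(BR 2 4(PA 1 2 4 5 6 7)(PA 1 2 3 4 5 6))), ([t,t,f,t,f,t,t],
  BR 1 4(PA 0 1 4 5 6 7)(PA 0 1 2 3 4 5)), ([f,f,f,f,t,f,f,t], BR 1 3(PA 0 1 3 4 5 6)(BR 3 8(PA 1 2 3 8 7 6)(BR 2 4(BR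
  5 7(PA 1 2 4 5 7 8)(PA 3 4 5 6 7 8))(PA 1 2 3 4 5 6)))), ([f,f,f,t,f,f,t,t], BR 4 6(BR 1 3(PA 0 1 3 4 6 7)(BR 2 7(BR
  4 8(PA 1 2 7 8 4 5)(PA 5 4 3 2 7 8))(PA 1 2 3 4 6 7)))(BR 1 3(PA 1 3 4 5 6 7)(PA 1 2 3 4 5 6))), ([f,f,f,t,t,f,t,f],
  BR 4 7(BR 1 3(PA 0 1 3 4 7 8)(PA 1 2 3 4 7 8))(PA 3 4 5 6 7 8)), ([f,f,f,t,t,f,t,t], BR 1 5(PA 0 1 5 6 7 8)(BR 1
  3(PA 0 1 3 4 5 6)(BR 4 7(BR 2 8(PA 1 2 8 7 4 5)(PA 1 2 3 4 7 8))(PA 3 4 5 6 7 8)))), ([f,t,f,f,t,f,t,f], BR 4 7(BR 2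
  4(BR 1 6(PA 0 1 6 7 4 3)(PA 0 1 2 4 7 6))(PA 0 1 2 3 4 7))(PA 3 4 5 6 7 8)), ([f,t,f,f,t,f,t,t], BR 4 7(BR 2 4(BR 1
  6(PA 0 1 6 7 4 3)(PA 0 1 2 4 7 6))(PA 0 1 2 3 4 7))(PA 3 4 5 6 7 8)), ([t,f,t,t,f,f,t,f], BR 2 6(PA 0 1 2 6 7 8)(BR
  4 6(PA 1 2 3 4 6 7)(PA 2 3 4 5 6 7))), ([f,t,f,t,t,f,f,t], BR 3 7(PA 0 1 2 3 7 8)(BR 5 7(PA 2 3 4 5 7 8)(PA 3 4 5 6
  7 8))), ([f,t,t,f,t,f,f,t], BR 2 5(BR 5 7(BR 1 8(BR 0 4(PA 6 5 4 0 1 8)(PA 0 1 8 7 5 4))(PA 0 1 2 5 7 8))(PA 0 1 2 5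
  6 7))(PA 1 2 3 4 5 6)), ([t,f,f,f,t,t,f,t], BR 1 3(PA 0 1 3 4 5 6)(BR 2 4(BR 2 6(BR 0 8(PA 4 2 1 0 8 7)(PA 0 1 2 6 7
  8))(PA 0 1 2 4 5 6))(PA 0 1 2 3 4 5))), ([t,f,t,f,t,f,f,t], BR 2 5(BR 1 7(PA 4 3 2 1 7 6)(BR 5 7(PA 0 1 2 5 7 8)(PA
  1 2 5 6 7 8)))(PA 1 2 3 4 5 6)), ([t,f,f,t,t,f,t,t], BR 4 7(BR 1 3(PA 0 1 3 4 7 8)(PA 0 1 2 3 4 7))(PA 3 4 5 6 7
  8)), ([t,f,t,t,f,f,t,t], BR 1 5(PA 0 1 5 6 7 8)(BR 0 3(BR 4 6(PA 1 0 3 4 6 7)(PA 1 0 3 4 5 6))(PA 0 1 2 3 4 5))),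
  ([f,f,f,f,f,t,t,f,t], BR 2 4(PA 1 2 4 5 6 7)(BR 1 8(PA 2 1 8 7 6 5)(BR 4 8(BR 1 3(PA 0 1 3 4 8 9)(PA 1 2 3 4 8
  9))(BR 6 9(BR 3 5(PA 2 3 5 6 9 8)(PA 3 4 5 6 9 8))(PA 4 5 6 7 8 9))))), ([f,f,f,f,t,f,t,f,t], BR 2 8(PA 3 2 8 7 6
  5)(BR 1 3(PA 0 1 3 4 5 6)(BR 1 7(PA 3 2 1 7 6 5)(BR 2 4(BR 4 7(PA 1 2 4 7 8 9)(PA 1 2 4 5 6 7))(PA 1 2 3 4 5 6))))),
  ([f,f,f,f,t,f,t,t,f], BR 4 7(BR 2 4(BR 0 2(PA 0 2 4 7 8 9)(PA 0 1 2 4 5 6))(PA 2 3 4 7 8 9))(PA 3 4 5 6 7 8)),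
  ([f,t,f,f,t,t,f,f,f], BR 3 7(PA 0 1 2 3 7 8)(BR 7 9(PA 3 4 5 6 7 9)(BR 4 8(BR 2 4(PA 0 1 2 4 8 7)(PA 0 1 2 3 4
  8))(BR 6 8(PA 3 4 5 6 8 9)(PA 4 5 6 7 8 9))))), ([f,f,t,t,f,t,t,f,t], BR 3 6(BR 2 8(BR 0 2(PA 0 2 8 7 6 5)(BR 6 9(PA
  0 1 2 8 9 6)(PA 5 6 3 2 8 9)))(BR 6 9(PA 1 2 3 6 9 8)(PA 2 3 6 7 8 9)))(PA 2 3 4 5 6 7)), ([f,t,f,f,f,f,f,f,t], BR 3
  5(PA 0 1 2 3 5 6)(BR 2 4(BR 4 6(BR 2 7(PA 0 1 2 7 8 9)(PA 0 1 2 4 6 7))(PA 0 1 2 4 5 6))(PA 0 1 2 3 4 5))),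
  ([f,t,f,f,f,f,f,t,f], BR 3 5(PA 0 1 2 3 5 6)(BR 5 7(PA 3 4 5 7 8 9)(BR 2 4(BR 4 6(BR 2 7(PA 0 1 2 7 6 5)(PA 2 4 6 7
  8 9))(PA 3 4 5 6 7 8))(PA 0 1 2 3 4 5)))), ([f,t,f,f,f,f,f,t,t], BR 3 5(PA 0 1 2 3 5 6)(BR 2 4(BR 4 6(PA 3 4 6 7 8
  9)(PA 0 1 2 4 5 6))(PA 0 1 2 3 4 5))), ([f,t,f,f,t,t,f,f,t], BR 4 8(BR 2 4(PA 0 1 2 4 8 7)(PA 0 1 2 3 4 8))(BR 6
  8(PA 3 4 5 6 8 9)(PA 4 5 6 7 8 9))), ([f,t,f,t,t,f,t,t,f], BR 1 4(BR 4 7(BR 5 9(PA 0 1 4 5 9 8)(BR 2 8(PA 5 4 1 2 8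
  9)(PA 2 1 4 7 8 9)))(PA 1 4 5 6 7 8))(PA 0 1 2 3 4 5)), ([f,t,t,f,t,t,f,t,t], BR 5 8(BR 2 5(BR 1 9(BR 3 9(PA 1 9 3 4
  5 6)(PA 1 9 8 5 4 3))(PA 0 1 2 5 8 9))(PA 1 2 3 4 5 8))(PA 4 5 6 7 8 9)), ([t,f,f,f,f,f,f,t,t], BR 1 6(PA 0 1 6 7 8
  9)(BR 4 6(PA 3 4 6 7 8 9)(BR 2 4(PA 0 1 2 4 5 6)(BR 3 5(BR 1 3(BR 5 9(PA 0 1 3 5 9 8)(BR 5 7(PA 1 3 5 7 8 9)(PA 0 1
  3 5 6 7)))(PA 0 1 2 3 5 6))(BR 1 3(BR 5 7(PA 0 1 3 4 5 7)(PA 3 4 5 6 7 8))(PA 0 1 2 3 4 5)))))),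
  ([t,f,f,f,f,t,t,f,t], BR 1 8(PA 2 1 8 7 6 5)(BR 0 6(PA 2 1 0 6 7 8)(BR 2 4(PA 0 1 2 4 5 6)(BR 1 3(BR 3 7(PA 0 1 3 7
  8 9)(BR 3 5(PA 0 1 3 5 6 7)(PA 0 1 3 4 5 6)))(BR 3 5(PA 0 1 2 3 5 6)(PA 0 1 2 3 4 5)))))), ([t,f,f,t,f,t,f,f,t], BR
  2 8(PA 5 4 3 2 8 7)(BR 4 9(PA 2 3 4 9 8 7)(BR 6 8(BR 3 6(BR 1 3(PA 0 1 3 6 8 9)(PA 1 2 3 6 8 9))(PA 3 4 5 6 8 9))(PA
  4 5 6 7 8 9)))), ([t,f,t,t,f,t,t,f,t], BR 3 6(BR 1 7(BR 1 5(BR 0 3(PA 3 0 1 7 8 9)(BR 4 8(PA 0 1 7 8 4 3)(PA 3 4 5 1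
  7 8)))(PA 2 1 7 6 5 4))(BR 0 3(PA 1 0 3 6 7 8)(PA 0 1 2 3 6 7)))(PA 2 3 4 5 6 7)), ([f,f,f,f,f,f,f,f,t,f], BR 5 7(PA
  4 5 7 8 9 10)(BR 6 8(BR 4 6(BR 1 6(PA 2 1 6 8 9 10)(BR 3 8(BR 1 3(PA 0 1 3 4 6 7)(PA 1 2 3 8 9 10))(PA 3 4 6 8 9
  10)))(PA 4 5 6 8 9 10))(PA 5 6 7 8 9 10))), ([t,f,f,t,f,t,f,f,f,f], BR 3 6(BR 1 7(PA 2 1 7 6 5 4)(BR 1 3(BR 6 8(BR 8
  10(BR 1 10(PA 1 10 8 6 5 4)(PA 0 1 3 6 8 10))(PA 4 5 6 8 9 10))(PA 0 1 3 6 7 8))(PA 0 1 2 3 6 7)))(PA 2 3 4 5 6 7)),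
  ([f,f,f,t,t,f,f,f,f,t], BR 2 9(PA 5 4 3 2 9 8)(BR 4 10(PA 2 3 4 10 9 8)(BR 6 8(PA 4 5 6 8 9 10)(BR 7 9(BR 2 6(PA 1 2
  6 7 9 10)(BR 5 7(BR 3 7(BR 1 5(PA 2 1 5 7 9 10)(BR 0 2(PA 0 2 3 4 5 6)(BR 1 3(BR 0 7(PA 2 1 0 7 5 4)(PA 0 1 3 7 9
  10))(PA 1 2 3 4 5 6))))(PA 3 4 5 7 9 10))(PA 4 5 6 7 9 10)))(BR 5 7(PA 4 5 7 8 9 10)(PA 5 6 7 8 9 10)))))),
  ([f,t,f,f,f,f,f,f,f,t], BR 3 5(PA 0 1 2 3 5 6)(BR 2 4(BR 4 6(BR 4 9(PA 0 1 2 4 9 8)(BR 2 7(BR 7 9(PA 3 4 6 7 9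
  10)(PA 4 2 7 8 9 10))(PA 0 1 2 4 6 7)))(PA 0 1 2 4 5 6))(PA 0 1 2 3 4 5))), ([t,f,f,t,t,f,f,f,f,t], BR 6 8(PA 3 4 5
  6 8 9)(BR 4 10(PA 6 5 4 10 9 8)(BR 2 9(PA 5 4 3 2 9 10)(BR 7 9(BR 5 7(BR 1 5(PA 0 1 5 7 9 10)(BR 3 7(BR 1 3(PA 0 1 3
  4 5 6)(PA 1 2 3 7 9 10))(PA 3 4 5 7 9 10)))(PA 4 5 6 7 9 10))(BR 5 7(PA 4 5 7 8 9 10)(PA 5 6 7 8 9 10)))))),
  ([f,f,f,f,t,f,t,f,f,f,f], BR 3 9(PA 6 5 4 3 9 8)(BR 4 7(BR 8 10(PA 5 6 7 8 10 11)(BR 4 10(PA 6 5 4 10 9 8)(BR 7 9(BR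
  2 4(BR 0 2(BR 0 9(PA 6 5 4 2 0 9)(PA 0 2 4 7 9 10))(PA 0 1 2 4 5 6))(PA 2 3 4 7 9 10))(PA 5 6 7 8 9 10))))(PA 3 4 5
  6 7 8))), ([f,f,f,t,t,f,f,t,t,f,f,f], BR 1 10(PA 2 1 10 9 8 7)(BR 2 11(PA 5 4 3 2 11 10)(BR 6 10(PA 3 4 5 6 10
  11)(BR 2 6(PA 2 6 7 8 9 10)(BR 10 12(PA 6 7 8 9 10 12)(BR 0 2(PA 0 2 3 4 5 6)(BR 0 12(PA 2 1 0 12 11 10)(BR 1 3(BR 1
  5(BR 3 12(PA 0 1 3 12 11 10)(BR 5 12(PA 3 1 5 12 11 10)(BR 5 7(BR 5 9(BR 9 11(PA 2 1 5 9 11 12)(PA 2 1 5 9 10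
  11))(PA 1 5 7 8 9 10))(PA 2 1 5 6 7 8))))(PA 0 1 3 4 5 6))(BR 1 5(BR 3 12(PA 0 1 2 3 12 11)(BR 5 12(PA 3 2 1 5 12
  11)(BR 5 7(BR 5 9(BR 9 11(PA 2 1 5 9 11 12)(PA 2 1 5 9 10 11))(PA 1 5 7 8 9 10))(PA 2 1 5 6 7 8))))(PA 0 1 2 3 4
  5)))))))))), ([f,f,f,t,t,f,f,t,t,f,f,t], BR 2 6(PA 1 2 6 7 8 9)(BR 0 2(PA 0 2 3 4 5 6)(BR 2 11(PA 6 5 4 3 2 11)(BR 3
  9(BR 5 9(BR 9 11(BR 1 3(BR 1 5(PA 2 1 5 9 11 12)(BR 0 9(PA 2 1 0 9 5 6)(PA 0 1 3 9 5 6)))(PA 1 2 3 9 11 12))(PA 2 3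
  9 10 11 12))(PA 6 5 4 3 9 8))(BR 3 7(PA 4 3 7 8 9 10)(BR 5 9(PA 2 3 4 5 9 10)(BR 5 7(PA 3 4 5 7 8 9)(PA 3 4 5 6 7
  8)))))))), ([t,f,f,f,f,f,f,f,f,f,t,t], BR 1 9(PA 0 1 9 10 11 12)(BR 7 9(PA 6 7 9 10 11 12)(BR 2 7(PA 0 1 2 7 8 9)(BR
  4 9(PA 3 4 9 10 11 12)(BR 5 10(BR 1 6(PA 0 1 6 5 10 11)(BR 2 10(PA 0 1 2 10 5 6)(BR 2 4(PA 1 2 4 5 10 9)(BR 3 5(BR 1
  3(PA 0 1 3 5 10 11)(PA 0 1 2 3 5 6))(PA 2 3 4 5 10 9)))))(BR 5 12(PA 6 5 12 11 10 9)(BR 8 10(BR 5 7(PA 4 5 7 8 10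
  11)(BR 2 10(PA 0 1 2 10 8 7)(BR 6 8(BR 8 12(BR 2 12(PA 3 2 12 11 10 9)(BR 4 6(BR 2 4(PA 2 4 6 8 12 11)(BR 3 8(BR 1
  3(PA 0 1 3 8 12 11)(PA 1 2 3 8 12 11))(PA 2 3 4 6 8 9)))(PA 4 5 6 8 10 11)))(PA 5 6 8 10 11 12))(PA 5 6 7 8 10
  11))))(BR 6 8(PA 5 6 8 9 10 11)(BR 8 12(PA 6 7 8 12 11 10)(PA 7 8 9 10 11 12)))))))))), ([t,f,f,t,t,f,f,t,t,f,f,t],
  BR 2 11(PA 5 4 3 2 11 10)(BR 4 12(PA 2 3 4 12 11 10)(BR 6 10(PA 4 5 6 10 11 12)(BR 2 6(PA 2 6 7 8 9 10)(BR 0 8(PA 2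
  1 0 8 7 6)(BR 3 9(BR 9 11(BR 1 3(PA 0 1 3 9 11 12)(PA 0 1 2 3 9 8))(PA 2 3 9 10 11 12))(BR 3 7(PA 2 3 7 8 9 10)(BR 5
  9(PA 2 3 4 5 9 10)(BR 5 7(PA 3 4 5 7 8 9)(PA 3 4 5 6 7 8)))))))))), ([t,t,f,f,f,f,f,f,f,f,t,t], BR 3 5(PA 0 1 2 3 5
  6)(BR 3 8(PA 0 1 2 3 8 9)(BR 7 9(PA 6 7 9 10 11 12)(BR 4 9(PA 3 4 9 10 11 12)(BR 5 7(PA 3 4 5 7 8 9)(BR 2 4(BR 2
  7(PA 5 4 2 7 8 9)(BR 0 7(PA 3 2 1 0 7 6)(BR 4 6(BR 0 4(BR 6 8(PA 1 0 4 6 8 9)(PA 2 4 6 7 8 9))(PA 0 1 2 4 6 7))(PA 1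
  2 4 5 6 7))))(BR 4 6(BR 2 7(PA 4 3 2 7 8 9)(PA 1 2 3 4 6 7))(PA 1 2 3 4 5 6)))))))), ([t,f,f,f,f,f,f,f,t,t,f,f,f],
  BR 5 7(PA 4 5 7 8 9 10)(BR 1 11(PA 2 1 11 10 9 8)(BR 0 9(PA 2 1 0 9 10 11)(BR 2 7(PA 0 1 2 7 8 9)(BR 1 6(BR 6 8(BR 6
  10(BR 7 11(PA 0 1 6 7 11 12)(BR 10 12(BR 6 13(BR 11 13(PA 7 8 9 10 11 13)(PA 0 1 6 13 12 11))(PA 0 1 6 10 12 13))(PA
  0 1 6 10 11 12)))(PA 2 1 6 8 9 10))(PA 2 1 6 7 8 9))(BR 1 3(BR 4 6(PA 0 1 3 4 6 7)(BR 3 5(PA 0 1 3 5 6 7)(PA 0 1 3 4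
  5 6)))(BR 3 5(PA 0 1 2 3 5 6)(BR 2 4(BR 4 6(BR 6 8(PA 1 2 4 6 8 9)(PA 2 4 6 7 8 9))(PA 0 1 2 4 5 6))(PA 0 1 2 3 4
  5))))))))), ([t,f,f,f,f,f,f,f,t,t,f,f,t], BR 4 11(PA 5 4 11 10 9 8)(BR 5 7(PA 4 5 7 8 9 10)(BR 2 7(PA 1 2 7 8 9
  10)(BR 0 9(PA 2 1 0 9 8 7)(BR 6 10(BR 3 10(BR 10 12(BR 1 3(PA 0 1 3 10 12 13)(PA 0 1 2 3 10 9))(PA 4 3 10 11 12
  13))(BR 3 5(PA 2 3 5 6 10 9)(BR 4 6(BR 10 12(PA 3 4 6 10 12 13)(PA 3 4 6 10 11 12))(PA 3 4 5 6 10 9))))(BR 6 8(PA 5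
  6 8 9 10 11)(PA 5 6 7 8 9 10))))))), ([t,f,f,f,f,f,f,f,f,f,f,f,f,t], BR 5 13(BR 1 6(PA 0 1 6 5 13 14)(BR 1 12(PA 0 1
  12 13 5 6)(BR 2 13(PA 0 1 2 13 5 6)(BR 2 4(PA 0 1 2 4 5 13)(BR 3 5(BR 1 3(PA 0 1 3 5 13 12)(PA 1 2 3 5 13 14))(PA 2
  3 4 5 13 14))))))(BR 8 13(BR 1 9(PA 0 1 9 8 13 14)(BR 4 9(PA 5 4 9 8 13 14)(BR 1 12(PA 0 1 12 13 8 9)(BR 5 7(PA 4 5
  7 8 13 14)(BR 4 12(PA 5 4 12 13 8 9)(BR 6 8(BR 4 6(BR 3 8(BR 1 3(PA 0 1 3 8 13 12)(PA 0 1 2 3 8 9))(PA 3 4 6 8 13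
  12))(PA 4 5 6 8 13 12))(PA 5 6 7 8 13 14)))))))(BR 11 13(BR 8 10(PA 7 8 10 11 13 14)(BR 5 10(PA 4 5 10 11 13 14)(BR
  9 11(BR 4 9(PA 5 4 9 11 13 14)(BR 7 9(BR 5 7(PA 5 7 9 11 13 14)(BR 4 6(PA 3 4 6 7 9 10)(PA 4 5 6 7 9 10)))(PA 7 8 9
  11 13 14)))(PA 8 9 10 11 13 14))))(BR 6 11(PA 5 6 11 12 13 14)(BR 9 11(PA 8 9 11 12 13 14)(BR 10 12(BR 5 10(PA 6 5
  10 12 13 14)(BR 8 10(BR 6 8(PA 6 8 10 12 13 14)(BR 5 7(PA 4 5 7 8 10 11)(PA 5 6 7 8 10 11)))(PA 8 9 10 12 13
  14)))(PA 9 10 11 12 13 14))))))), ([f,f,f,t,t,f,f,f,f,f,t,t,f,f,f], BR 7 9(PA 6 7 9 10 11 12)(BR 6 8(PA 3 4 5 6 8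
  9)(BR 5 7(BR 8 10(BR 8 12(BR 5 12(BR 9 13(PA 4 5 7 8 9 13)(BR 2 6(PA 2 6 7 8 10 11)(BR 1 13(PA 1 13 12 11 10 9)(BR
  13 15(PA 9 10 11 12 13 15)(BR 2 14(PA 6 5 4 3 2 14)(BR 1 5(BR 5 15(PA 2 1 5 15 14 13)(BR 12 14(PA 2 1 5 12 14 15)(PA
  2 1 5 12 13 14)))(BR 1 3(PA 0 1 3 4 5 6)(PA 1 2 3 4 5 6))))))))(PA 4 5 7 8 12 13))(PA 6 7 8 10 11 12))(PA 6 7 8 9 10
  11))(PA 4 5 6 7 8 9)))), ([t,f,f,t,t,f,f,f,f,f,t,t,f,f,f], BR 1 13(PA 2 1 13 12 11 10)(BR 0 11(PA 2 1 0 11 12 13)(BR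
  6 8(PA 3 4 5 6 8 9)(BR 7 9(PA 6 7 9 10 11 12)(BR 5 7(BR 3 7(BR 9 13(PA 4 3 7 8 9 13)(BR 8 10(BR 5 10(BR 5 12(BR 3
  12(BR 3 10(BR 13 15(PA 9 10 11 12 13 15)(BR 1 3(BR 12 14(BR 3 15(BR 10 14(PA 0 1 3 10 14 13)(PA 11 10 3 15 14
  13))(PA 0 1 3 12 14 15))(PA 0 1 3 12 13 14))(PA 0 1 2 3 12 11)))(PA 2 3 7 5 10 11))(PA 2 3 7 5 12 13))(PA 7 5 10 11
  12 13))(PA 4 5 7 8 10 11))(PA 6 7 8 9 10 11)))(PA 3 4 5 7 8 9))(PA 4 5 6 7 8 9)))))),
  ([t,f,f,t,t,f,f,f,f,f,t,t,f,f,t], BR 6 8(PA 3 4 5 6 8 9)(BR 2 9(PA 5 4 3 2 9 8)(BR 0 11(PA 2 1 0 11 10 9)(BR 1 13(PA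
  0 1 13 12 11 10)(BR 7 9(PA 6 7 9 10 11 12)(BR 5 7(BR 3 7(BR 4 15(PA 9 8 7 3 4 15)(BR 8 10(BR 5 10(BR 5 12(BR 3 10(BR
  3 12(BR 2 14(PA 5 4 3 2 14 15)(BR 12 14(BR 2 6(PA 2 6 7 8 10 11)(BR 10 14(BR 1 5(PA 2 1 5 10 14 13)(BR 1 3(PA 0 1 3
  12 5 6)(PA 1 2 3 10 5 6)))(PA 9 10 5 12 14 15)))(PA 4 3 12 13 14 15)))(PA 2 3 7 5 12 11))(PA 2 3 7 5 10 11))(PA 7 5
  10 11 12 13))(PA 4 5 7 8 10 11))(PA 6 7 8 9 10 11)))(PA 3 4 5 7 8 9))(PA 4 5 6 7 8 9))))))),
  ([t,t,f,f,f,f,f,f,f,f,f,f,f,t,t], BR 4 12(PA 3 4 12 13 14 15)(BR 3 5(PA 0 1 2 3 5 6)(BR 7 12(PA 6 7 12 13 14 15)(BR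
  3 11(PA 0 1 2 3 11 12)(BR 10 12(PA 9 10 12 13 14 15)(BR 3 8(PA 0 1 2 3 8 9)(BR 0 4(BR 0 10(PA 3 4 0 10 11 12)(BR 0
  7(BR 2 7(BR 8 10(PA 1 0 7 8 10 11)(BR 7 9(BR 9 11(PA 1 2 7 9 11 12)(PA 0 7 9 10 11 12))(PA 1 0 7 8 9 10)))(PA 3 2 1
  0 7 6))(BR 5 7(PA 1 0 4 5 7 8)(BR 4 6(BR 6 8(BR 6 11(PA 1 0 4 6 11 12)(BR 4 9(BR 9 11(PA 5 6 8 9 11 12)(PA 6 4 9 10
  11 12))(PA 1 0 4 6 8 9)))(PA 1 0 4 6 7 8))(PA 1 0 4 5 6 7)))))(BR 2 4(BR 4 9(PA 0 1 2 4 9 8)(BR 4 6(BR 6 8(PA 0 1 2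
  4 6 8)(BR 7 9(PA 3 4 6 7 9 10)(PA 3 4 6 7 8 9)))(PA 0 1 2 4 5 6)))(PA 0 1 2 3 4 5))))))))),
  ([f,f,f,f,f,f,f,f,f,f,f,t,t,f,f,f], BR 4 14(PA 5 4 14 13 12 11)(BR 8 10(PA 7 8 10 11 12 13)(BR 5 10(PA 4 5 10 11 12
  13)(BR 1 14(PA 2 1 14 13 12 11)(BR 7 14(PA 8 7 14 13 12 11)(BR 11 15(BR 9 13(BR 6 11(BR 5 15(BR 13 15(BR 10 14(PA 6
  5 15 14 10 9)(BR 4 9(PA 10 9 4 5 15 14)(PA 4 5 15 13 9 10)))(PA 4 5 15 14 13 12))(BR 4 6(BR 3 11(BR 3 5(BR 2 15(PA 6
  5 3 2 15 14)(BR 1 6(PA 2 1 6 11 15 14)(BR 1 3(PA 0 1 3 4 6 7)(PA 1 2 3 11 15 14))))(PA 5 4 3 11 15 14))(PA 3 4 6 11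
  15 14))(PA 4 5 6 11 15 14)))(BR 6 13(PA 7 6 13 12 11 10)(BR 6 8(PA 5 6 8 9 13 12)(BR 7 9(BR 9 11(PA 6 7 9 11 15
  14)(PA 6 7 9 13 12 11))(PA 6 7 8 9 13 12)))))(BR 9 11(PA 8 9 11 12 13 14)(BR 10 14(PA 8 9 10 14 13 12)(PA 9 10 11 12
  13 14))))(BR 13 15(PA 10 11 12 13 15 16)(BR 10 14(BR 8 15(PA 8 15 14 13 12 11)(BR 7 9(PA 6 7 9 10 14 15)(PA 7 8 9 10
  14 15)))(PA 10 11 12 13 14 15))))))))), ([f,f,f,f,f,f,f,f,f,f,f,t,t,f,f,t], BR 2 10(PA 1 2 10 11 12 13)(BR 5 10(PA 4
  5 10 11 12 13)(BR 7 14(PA 8 7 14 13 12 11)(BR 8 10(PA 7 8 10 11 12 13)(BR 9 13(BR 6 13(BR 6 11(BR 13 15(BR 11 15(BR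
  5 15(BR 4 9(PA 10 9 4 5 15 16)(PA 4 5 15 13 9 10))(BR 4 9(PA 5 4 9 13 15 16)(BR 4 6(BR 7 9(PA 3 4 6 7 9 10)(BR 3
  13(BR 6 8(BR 2 4(PA 2 4 6 13 9 10)(BR 2 15(PA 6 4 3 2 15 16)(BR 9 11(BR 2 7(PA 2 7 8 9 11 12)(BR 8 15(BR 1 3(BR 0
  13(BR 1 6(PA 2 1 6 8 15 16)(BR 0 2(PA 0 2 3 4 6 7)(PA 2 1 0 13 6 4)))(PA 0 1 3 13 15 16))(PA 1 2 3 13 15 16))(PA 7 8
  9 11 15 16)))(PA 7 8 9 10 11 12))))(PA 4 6 7 8 9 10))(PA 3 4 6 13 9 10)))(PA 4 5 6 13 15 16))))(PA 10 11 6 13 15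
  16))(PA 7 6 13 14 15 16))(PA 7 6 13 12 11 10))(BR 6 8(PA 5 6 8 9 13 12)(BR 7 9(BR 13 15(PA 6 7 9 13 15 16)(PA 6 7 9
  13 14 15))(PA 6 7 8 9 13 12))))(BR 9 11(PA 8 9 11 12 13 14)(BR 10 14(PA 8 9 10 14 13 12)(PA 9 10 11 12 13
  14)))))))), ([t,f,f,f,f,f,f,f,f,f,f,t,t,f,f,f], BR 8 10(PA 7 8 10 11 12 13)(BR 2 10(PA 1 2 10 11 12 13)(BR 0 12(PA 2
  1 0 12 11 10)(BR 1 14(PA 0 1 14 13 12 11)(BR 7 14(PA 8 7 14 13 12 11)(BR 11 15(BR 9 13(BR 3 11(BR 1 3(PA 0 1 3 11 15
  14)(PA 0 1 2 3 11 10))(BR 6 11(BR 3 5(PA 2 3 5 6 11 12)(BR 4 6(BR 2 4(BR 1 6(PA 0 1 6 11 15 14)(PA 1 2 4 6 11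
  12))(PA 2 3 4 6 11 12))(PA 3 4 5 6 11 12)))(BR 6 13(PA 7 6 13 12 11 10)(BR 6 8(PA 5 6 8 9 13 14)(BR 7 9(BR 9 11(PA 6
  7 9 11 15 14)(PA 6 7 9 13 12 11))(PA 6 7 8 9 13 12))))))(BR 9 11(PA 8 9 11 12 13 14)(BR 10 14(PA 8 9 10 14 13 12)(PA
  9 10 11 12 13 14))))(BR 13 15(PA 10 11 12 13 15 16)(BR 8 15(PA 8 15 14 13 12 11)(BR 10 14(BR 7 9(PA 6 7 9 10 14
  15)(PA 7 8 9 10 14 15))(PA 10 11 12 13 14 15)))))))))), ([t,f,f,t,t,f,f,f,f,f,f,f,f,f,f,t], BR 6 8(PA 3 4 5 6 8
  9)(BR 6 14(PA 3 4 5 6 14 15)(BR 4 16(PA 6 5 4 16 15 14)(BR 6 11(PA 3 4 5 6 11 12)(BR 1 3(BR 1 5(BR 5 7(BR 3 7(BR 5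
  13(BR 13 15(PA 0 1 5 13 15 16)(PA 4 5 13 14 15 16))(BR 8 13(PA 4 5 7 8 13 14)(BR 7 12(PA 0 1 5 7 12 13)(BR 1 11(PA 6
  7 3 1 11 12)(BR 7 9(BR 10 12(PA 6 7 9 10 12 13)(BR 9 11(PA 4 3 7 9 11 12)(PA 6 7 9 10 11 12)))(BR 9 11(PA 4 5 7 8 9
  11)(BR 1 8(BR 8 10(BR 10 12(PA 0 1 8 10 12 13)(PA 0 1 8 10 11 12))(PA 6 7 8 9 10 11))(PA 0 1 5 7 8 9))))))))(PA 2 3
  4 5 7 8))(BR 7 9(PA 0 1 5 6 7 9)(PA 4 5 6 7 8 9)))(PA 0 1 3 4 5 6))(BR 1 5(BR 1 8(PA 3 4 5 1 8 9)(BR 3 7(PA 0 1 2 3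
  7 8)(BR 5 7(PA 3 2 1 5 7 8)(PA 0 1 5 6 7 8))))(PA 0 1 2 3 4 5))))))), ([t,f,f,f,f,f,f,f,f,f,f,f,f,f,f,f,t], BR 1
  12(BR 11 16(PA 0 1 12 11 16 17)(BR 2 16(PA 11 12 1 2 16 17)(BR 1 15(PA 11 12 1 15 16 17)(BR 13 15(PA 0 1 12 13 15
  16)(BR 12 14(BR 14 16(PA 0 1 12 14 16 17)(PA 2 1 12 14 15 16))(PA 0 1 12 13 14 15))))))(BR 1 9(BR 8 16(PA 0 1 9 8 16
  17)(BR 10 12(PA 0 1 9 10 12 13)(BR 2 16(PA 8 9 1 2 16 17)(BR 8 13(PA 0 1 9 8 13 12)(BR 2 13(PA 8 9 1 2 13 12)(BR 9
  11(BR 11 13(BR 9 14(BR 14 16(PA 2 1 9 14 16 17)(PA 8 9 14 15 16 17))(PA 2 1 9 11 13 14))(PA 0 1 9 11 12 13))(PA 0 1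
  9 10 11 12)))))))(BR 1 6(BR 7 12(PA 0 1 6 7 12 13)(BR 7 9(PA 0 1 6 7 9 10)(BR 5 13(PA 0 1 6 5 13 12)(BR 2 13(PA 5 6
  1 2 13 12)(BR 6 8(BR 8 10(BR 6 11(BR 11 13(BR 6 14(BR 12 14(BR 10 12(PA 0 1 6 8 10 12)(PA 7 8 10 11 12 14))(PA 2 1 6
  14 13 12))(PA 2 1 6 11 13 14))(PA 0 1 6 11 12 13))(PA 0 1 6 8 10 11))(PA 0 1 6 8 9 10))(PA 0 1 6 7 8 9))))))(BR 1
  3(BR 4 9(PA 0 1 3 4 9 10)(BR 4 6(PA 0 1 3 4 6 7)(BR 3 5(BR 5 7(BR 7 9(PA 0 1 3 5 7 9)(BR 9 11(PA 4 5 7 8 9 11)(BR 5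
  10(PA 0 1 3 5 10 9)(BR 8 10(PA 4 5 7 8 10 11)(PA 5 7 8 9 10 11)))))(PA 0 1 3 5 6 7))(PA 0 1 3 4 5 6))))(BR 3 5(PA 0
  1 2 3 5 6)(BR 3 8(PA 0 1 2 3 8 9)(BR 2 4(BR 4 9(PA 0 1 2 4 9 8)(BR 4 6(BR 6 8(PA 0 1 2 4 6 8)(BR 7 9(PA 3 4 6 7 9
  10)(PA 3 4 6 7 8 9)))(PA 0 1 2 4 5 6)))(PA 0 1 2 3 4 5)))))))), ([t,f,f,f,f,f,f,f,f,f,f,f,f,f,f,t,t], BR 9 14(PA 8 9
  14 15 16 17)(BR 3 14(PA 2 3 14 15 16 17)(BR 12 14(PA 11 12 14 15 16 17)(BR 6 14(PA 5 6 14 15 16 17)(BR 13 15(BR 5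
  13(BR 1 6(PA 0 1 6 5 13 14)(BR 2 13(PA 0 1 2 13 5 6)(BR 2 4(PA 0 1 2 4 5 13)(BR 3 5(PA 2 3 5 13 15 16)(PA 2 3 4 5 13
  14)))))(BR 8 13(BR 13 17(BR 5 7(PA 4 5 7 8 13 14)(BR 6 8(PA 5 6 8 13 17 16)(PA 5 6 7 8 13 14)))(PA 9 8 13 15 16
  17))(BR 11 13(BR 8 10(PA 7 8 10 11 13 14)(BR 9 11(PA 8 9 11 13 15 16)(PA 8 9 10 11 13 14)))(BR 9 11(PA 9 11 12 13 15
  16)(BR 13 17(BR 10 12(BR 10 17(BR 8 10(BR 5 10(PA 6 5 10 17 13 14)(BR 7 17(BR 5 7(PA 4 5 7 8 10 11)(PA 5 6 7 17 13
  14))(PA 7 8 10 17 13 14)))(PA 8 9 10 17 13 14))(PA 9 10 12 13 17 16))(PA 9 10 11 12 13 14))(PA 11 12 13 15 16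
  17))))))(BR 8 13(PA 9 8 13 14 15 16)(BR 11 13(BR 9 11(PA 9 11 13 14 15 16)(BR 8 10(PA 7 8 10 11 13 14)(PA 8 9 10 11
  13 14)))(PA 11 12 13 14 15 16)))))))), ([t,f,f,f,f,f,f,f,f,f,f,f,f,f,f,f,f,f,t], BR 13 18(BR 10 18(BR 5 13(BR 5
  10(BR 1 9(PA 0 1 9 10 5 13)(BR 1 6(PA 0 1 6 5 10 9)(BR 2 10(PA 0 1 2 10 5 6)(BR 2 4(PA 0 1 2 4 5 10)(BR 3 5(PA 2 3 5
  10 18 19)(BR 1 3(BR 4 9(PA 0 1 3 4 9 10)(PA 1 3 4 5 10 9))(PA 1 2 3 4 5 10)))))))(PA 6 5 13 18 10 9))(BR 6 14(PA 5 6
  14 13 18 19)(BR 5 10(PA 6 5 10 18 13 14)(BR 7 18(BR 5 7(BR 8 10(PA 4 5 7 8 10 11)(BR 8 13(PA 4 5 7 8 13 14)(BR 9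
  14(PA 8 9 14 13 18 19)(PA 8 9 10 18 13 14))))(PA 5 6 7 18 13 14))(BR 7 9(PA 6 7 9 10 18 19)(BR 8 10(BR 6 8(PA 5 6 8
  10 18 19)(PA 6 7 8 10 18 19))(PA 7 8 9 10 18 19)))))))(BR 10 12(PA 9 10 12 13 18 19)(BR 9 14(PA 10 9 14 13 18 19)(BR
  11 13(BR 9 17(PA 10 9 17 18 13 14)(BR 9 11(BR 8 13(BR 8 10(BR 7 18(PA 11 10 8 7 18 19)(BR 6 11(PA 7 6 11 13 18
  19)(BR 6 8(PA 5 6 8 9 11 12)(PA 6 7 8 13 18 19))))(PA 10 9 8 13 18 17))(PA 8 9 11 13 18 19))(PA 9 10 11 13 18
  19)))(PA 10 11 12 13 18 19)))))(BR 16 18(BR 13 15(PA 12 13 15 16 18 19)(BR 14 16(BR 12 14(BR 11 16(BR 11 13(BR 10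
  18(PA 14 13 11 10 18 17)(BR 9 14(PA 10 9 14 16 18 19)(BR 9 11(PA 8 9 11 12 14 15)(PA 9 10 11 16 18 19))))(PA 13 12
  11 16 18 19))(PA 11 12 14 16 18 19))(PA 12 13 14 16 18 19))(PA 13 14 15 16 18 19)))(BR 14 16(PA 13 14 16 17 18
  19)(BR 15 17(BR 13 15(BR 5 13(PA 5 13 15 17 18 19)(BR 2 13(PA 2 13 15 17 18 19)(BR 11 13(PA 11 13 15 17 18 19)(BR 12
  17(BR 8 13(PA 8 13 15 17 18 19)(BR 2 16(PA 3 2 16 15 13 12)(BR 8 16(PA 9 8 16 15 13 12)(BR 5 16(PA 6 5 16 15 13
  12)(BR 6 11(PA 5 6 11 12 13 15)(BR 3 11(PA 2 3 11 12 13 15)(BR 9 11(PA 8 9 11 12 13 15)(BR 12 14(BR 10 15(BR 10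
  18(BR 10 12(BR 5 10(BR 11 16(PA 4 5 10 11 16 17)(BR 6 17(PA 11 10 5 6 17 16)(PA 6 5 10 12 17 16)))(BR 6 17(PA 5 6 17
  18 10 11)(BR 7 12(BR 7 15(BR 7 18(BR 5 7(BR 3 5(PA 3 5 7 15 10 11)(BR 4 18(BR 4 12(BR 1 3(PA 0 1 3 4 5 7)(BR 3 17(PA
  7 5 4 3 17 16)(BR 2 4(BR 1 18(BR 1 12(PA 3 2 1 12 17 16)(PA 0 1 18 4 12 11))(PA 0 1 2 4 18 19))(PA 0 1 2 3 4
  5))))(PA 3 4 18 7 12 11))(PA 3 4 5 7 18 19)))(PA 5 6 7 12 17 16))(PA 8 7 12 17 18 19))(PA 6 7 12 13 15 16))(BR 7
  9(PA 6 7 9 10 12 13)(BR 8 10(PA 7 8 10 12 17 16)(PA 7 8 9 10 12 13))))))(PA 12 14 15 10 18 19))(PA 11 10 15 17 18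
  19))(BR 10 12(PA 9 10 12 13 15 16)(PA 9 10 11 12 13 15)))(PA 14 13 12 17 18 19)))))))))(PA 12 13 15 17 18 19)))))(PA
  13 14 15 17 18 19))(PA 14 15 16 17 18 19))))), ([t,f,f,f,f,f,f,f,f,f,f,f,f,f,f,f,f,f,f,t], BR 1 15(BR 14 19(PA 0 1
  15 14 19 20)(BR 2 19(PA 14 15 1 2 19 20)(BR 1 18(PA 14 15 1 18 19 20)(BR 16 18(PA 1 15 16 18 19 20)(BR 15 17(BR 17
  19(PA 2 1 15 17 19 20)(PA 0 1 15 17 18 19))(PA 0 1 15 16 17 18))))))(BR 2 16(BR 14 16(BR 2 13(BR 13 15(BR 1 12(PA 0
  1 12 13 15 16)(BR 11 13(BR 11 16(PA 0 1 2 16 11 12)(PA 10 11 13 14 16 17))(PA 0 1 2 13 12 11)))(PA 0 1 2 13 14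
  15))(PA 0 1 2 16 14 13))(PA 0 1 2 16 15 14))(BR 1 12(BR 11 19(PA 0 1 12 11 19 20)(BR 1 18(PA 11 12 1 18 19 20)(BR 2
  19(PA 11 12 1 2 19 20)(BR 13 15(PA 0 1 12 13 15 16)(BR 12 14(BR 14 16(BR 12 17(BR 17 19(PA 2 1 12 17 19 20)(PA 2 1
  12 17 18 19))(PA 2 1 12 14 16 17))(PA 2 1 12 14 15 16))(PA 0 1 12 13 14 15))))))(BR 2 13(BR 13 15(PA 0 1 2 13 15
  16)(PA 0 1 2 13 14 15))(BR 2 10(BR 10 12(PA 0 1 2 10 12 13)(PA 0 1 2 10 11 12))(BR 1 9(BR 8 19(PA 0 1 9 8 19 20)(BR
  10 12(PA 0 1 9 10 12 13)(BR 1 18(PA 8 9 1 18 19 20)(BR 9 11(BR 11 16(PA 0 1 9 11 16 15)(BR 11 13(BR 11 19(PA 0 1 9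
  11 19 18)(BR 9 14(BR 12 14(BR 14 16(BR 9 17(BR 17 19(BR 12 17(PA 10 11 12 17 19 20)(PA 10 11 12 14 16 17))(PA 8 9 17
  18 19 20))(PA 2 1 9 14 16 17))(PA 2 1 9 14 15 16))(PA 2 1 9 14 13 12))(PA 0 1 9 11 13 14)))(PA 0 1 9 11 12 13)))(PA
  0 1 9 10 11 12)))))(BR 1 6(BR 7 9(PA 0 1 6 7 9 10)(BR 7 12(PA 0 1 6 7 12 13)(BR 7 15(PA 0 1 6 7 15 16)(BR 6 8(BR 8
  16(PA 0 1 6 8 16 15)(BR 8 13(PA 0 1 6 8 13 12)(BR 8 10(BR 10 12(PA 0 1 6 8 10 12)(BR 10 15(PA 0 1 6 8 10 15)(BR 6
  11(BR 12 14(PA 7 8 10 11 12 14)(BR 9 14(PA 7 8 9 14 13 12)(BR 11 13(BR 11 16(PA 7 8 10 11 16 15)(BR 13 15(PA 7 6 11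
  13 15 16)(BR 6 14(PA 9 8 6 14 13 12)(PA 7 6 11 13 14 15))))(PA 7 8 10 11 12 13))))(PA 1 6 8 10 11 12))))(PA 2 1 6 8
  9 10))))(PA 0 1 6 7 8 9)))))(BR 1 3(BR 4 6(PA 0 1 3 4 6 7)(BR 3 5(BR 5 7(BR 5 10(PA 0 1 3 5 10 9)(BR 7 12(PA 0 1 3 5
  7 12)(BR 7 9(PA 0 1 3 5 7 9)(BR 8 10(PA 4 5 7 8 10 11)(BR 9 11(PA 5 7 8 9 11 12)(PA 5 7 8 9 10 11))))))(PA 0 1 3 5 6
  7))(PA 0 1 3 4 5 6)))(BR 3 8(PA 0 1 2 3 8 9)(BR 3 5(PA 0 1 2 3 5 6)(BR 2 4(BR 4 6(BR 4 9(PA 0 1 2 4 9 8)(BR 6 8(PA 0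
  1 2 4 6 8)(BR 7 9(PA 3 4 6 7 9 10)(PA 3 4 6 7 8 9))))(PA 0 1 2 4 5 6))(PA 0 1 2 3 4 5)))))))))))),
  ([t,t,f,f,f,f,f,f,f,f,f,f,f,f,f,f,f,f,t,t], BR 3 14(PA 0 1 2 3 14 15)(BR 3 11(PA 0 1 2 3 11 12)(BR 12 17(PA 11 12 17
  18 19 20)(BR 15 17(PA 14 15 17 18 19 20)(BR 3 5(PA 0 1 2 3 5 6)(BR 3 17(PA 0 1 2 3 17 18)(BR 3 8(PA 0 1 2 3 8 9)(BR
  4 12(BR 2 4(BR 0 4(BR 11 16(PA 3 4 12 11 16 17)(BR 2 16(PA 11 12 4 2 16 17)(BR 0 16(PA 11 12 4 0 16 17)(BR 4 15(PA
  11 12 4 15 16 17)(BR 12 14(PA 1 2 4 12 14 15)(BR 2 13(BR 13 15(PA 4 2 13 15 16 17)(BR 14 16(BR 0 13(PA 4 0 13 14 16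
  17)(PA 0 4 2 13 14 15))(PA 4 2 13 14 15 16)))(PA 1 2 4 12 13 14)))))))(PA 0 1 2 4 12 11))(PA 1 2 3 4 12 11))(BR 5
  10(BR 10 12(BR 4 9(PA 3 4 9 10 12 13)(BR 5 13(BR 9 14(PA 3 4 5 10 9 14)(BR 8 10(BR 8 13(PA 3 4 5 13 8 9)(BR 5 7(BR
  11 13(BR 7 9(BR 9 11(PA 4 5 13 11 9 8)(PA 7 9 10 11 13 14))(PA 9 8 7 5 13 14))(PA 3 4 5 13 12 11))(PA 7 8 10 5 13
  14)))(PA 3 4 5 10 9 8)))(PA 3 4 5 10 12 13)))(PA 3 4 5 10 11 12))(BR 4 6(BR 4 9(BR 2 4(BR 10 12(PA 3 4 9 10 12
  13)(BR 0 4(BR 9 11(PA 1 0 4 9 11 12)(PA 3 4 9 10 11 12))(PA 0 1 2 4 9 8)))(PA 1 2 3 4 9 8))(BR 7 9(PA 3 4 6 7 9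
  10)(BR 6 8(BR 2 4(PA 1 2 4 6 8 9)(PA 2 3 4 6 8 9))(PA 3 4 6 7 8 9))))(BR 2 4(BR 6 8(PA 1 2 4 5 6 8)(BR 6 11(PA 1 2 4
  5 6 11)(BR 0 4(BR 2 10(PA 6 5 4 2 10 11)(BR 5 7(BR 2 7(BR 8 10(PA 4 2 7 8 10 11)(BR 0 7(BR 7 12(PA 3 4 0 7 12 11)(BR
  7 9(BR 9 11(PA 1 2 7 9 11 12)(PA 3 2 7 9 10 11))(PA 1 2 7 8 9 10)))(PA 1 0 4 5 7 8)))(PA 1 2 4 5 7 8))(PA 3 4 5 6 7
  8)))(PA 0 1 2 4 5 6))))(PA 1 2 3 4 5 6)))))))))))), ([t,t,f,f,f,f,f,f,f,f,f,f,f,f,f,f,f,f,f,f,f], BR 3 11(PA 0 1 2 3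
  11 12)(BR 3 17(PA 0 1 2 3 17 18)(BR 3 14(PA 0 1 2 3 14 15)(BR 3 5(PA 0 1 2 3 5 6)(BR 3 8(PA 0 1 2 3 8 9)(BR 2 4(BR 2
  7(BR 2 10(BR 2 13(BR 2 16(BR 8 13(BR 9 17(PA 1 2 13 8 9 17)(BR 8 16(BR 4 9(PA 3 4 9 8 16 17)(BR 5 16(PA 3 4 5 16 8
  9)(PA 5 4 2 16 8 9)))(PA 9 8 13 2 16 17)))(BR 9 14(PA 1 2 13 14 9 8)(BR 8 16(PA 9 8 16 2 13 12)(BR 8 10(BR 11 16(PA
  7 8 10 11 16 17)(BR 11 13(PA 7 8 10 11 13 14)(BR 12 17(PA 1 2 16 17 12 11)(PA 11 12 13 2 16 17))))(PA 8 9 10 2 13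
  14)))))(BR 0 16(PA 3 2 1 0 16 15)(BR 14 16(PA 1 2 13 14 16 17)(BR 13 15(BR 10 15(BR 7 15(BR 15 17(BR 0 13(BR 13
  18(BR 16 18(BR 2 19(PA 3 2 19 18 16 15)(BR 18 20(BR 15 20(PA 1 2 13 15 20 19)(PA 14 15 17 18 20 21))(PA 1 2 13 18 19
  20)))(PA 1 0 13 18 17 16))(PA 1 2 13 15 17 18))(PA 0 1 2 13 15 16))(PA 3 2 7 15 16 17))(PA 6 7 2 10 15 16))(PA 9 10
  2 13 15 16))(PA 1 2 13 14 15 16)))))(BR 0 13(PA 3 2 1 0 13 12)(BR 11 13(PA 1 2 10 11 13 14)(BR 10 12(BR 7 12(BR 12
  14(BR 0 10(BR 10 15(BR 7 15(BR 13 15(BR 2 16(PA 1 2 16 15 13 12)(BR 15 17(BR 12 17(PA 1 2 7 12 17 16)(PA 11 12 14 15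
  17 18))(PA 1 2 7 15 16 17)))(PA 1 0 10 15 14 13))(PA 6 7 12 10 15 16))(PA 1 2 10 12 14 15))(PA 0 1 2 10 12 13))(PA 3
  2 7 12 13 14))(PA 6 7 2 10 12 13))(PA 1 2 10 11 12 13)))))(BR 0 10(PA 3 2 1 0 10 9)(BR 8 10(PA 1 2 7 8 10 11)(BR 7
  9(BR 9 11(BR 0 7(BR 7 12(BR 10 12(BR 2 13(PA 1 2 13 12 10 9)(BR 12 14(BR 9 14(PA 1 2 7 9 14 13)(PA 8 9 11 12 14
  15))(PA 1 2 7 12 13 14)))(PA 1 0 7 12 11 10))(PA 1 2 7 9 11 12))(PA 0 1 2 7 9 10))(PA 3 2 7 9 10 11))(PA 1 2 7 8 9
  10)))))(BR 0 7(PA 3 2 1 0 7 6)(BR 5 7(PA 1 2 4 5 7 8)(BR 4 6(BR 6 8(BR 0 4(BR 4 9(BR 7 9(BR 2 10(PA 1 2 10 9 7 6)(BR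
  6 11(PA 1 2 4 6 11 10)(BR 9 11(PA 5 6 8 9 11 12)(PA 1 2 4 9 10 11))))(PA 1 0 4 9 8 7))(PA 1 0 4 6 8 9))(PA 0 1 2 4 6
  7))(PA 1 2 4 6 7 8))(PA 1 2 4 5 6 7)))))(BR 4 6(BR 2 7(BR 4 9(PA 1 2 3 4 9 8)(BR 2 10(PA 6 4 3 2 10 9)(BR 7 9(PA 4 3
  2 7 9 10)(PA 4 3 2 7 8 9))))(PA 1 2 3 4 6 7))(PA 1 2 3 4 5 6)))))))),
  ([t,f,f,f,f,f,f,f,f,f,f,f,f,f,f,f,f,f,f,f,f,t], BR 10 21(BR 13 21(BR 5 13(BR 5 10(BR 6 14(PA 14 6 5 10 21 22)(BR 1
  6(PA 0 1 6 5 13 14)(BR 2 10(PA 0 1 2 10 5 6)(BR 3 11(PA 2 3 11 10 21 22)(BR 2 4(PA 1 2 4 5 10 11)(BR 3 5(PA 2 3 5 10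
  21 22)(PA 2 3 4 5 10 11)))))))(PA 6 5 13 21 10 9))(BR 6 14(PA 5 6 14 13 21 22)(BR 6 20(PA 5 6 20 21 13 14)(BR 5
  10(PA 6 5 10 21 13 14)(BR 7 21(BR 5 7(BR 4 21(BR 8 10(PA 4 5 7 8 10 11)(BR 8 13(PA 4 5 7 8 13 14)(BR 4 9(BR 9 14(PA
  8 9 14 13 21 22)(PA 8 9 4 21 13 14))(PA 5 4 21 10 9 8))))(PA 4 5 7 21 10 11))(PA 5 6 7 21 13 14))(BR 7 9(PA 6 7 9 10
  21 22)(BR 8 10(BR 6 8(PA 5 6 8 10 21 22)(PA 6 7 8 10 21 20))(PA 7 8 9 10 21 22))))))))(BR 11 13(PA 14 13 11 10 21
  20)(BR 10 12(BR 12 14(BR 10 15(BR 13 15(BR 16 21(PA 12 13 15 16 21 22)(BR 15 17(BR 12 17(PA 16 17 12 10 21 22)(PA 11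
  12 14 15 17 18))(PA 17 16 15 10 21 22)))(PA 13 14 15 10 21 22))(PA 15 14 12 10 21 22))(PA 14 13 12 10 21 22))(PA 13
  12 11 10 21 22))))(BR 13 21(BR 9 14(PA 10 9 14 13 21 22)(BR 10 12(PA 9 10 12 13 21 22)(BR 11 13(BR 9 20(PA 10 9 20
  21 13 14)(BR 9 11(BR 8 13(BR 8 10(BR 7 21(PA 11 10 8 7 21 20)(BR 6 8(BR 6 11(PA 7 6 11 13 21 22)(PA 5 6 8 9 11
  12))(PA 6 7 8 13 21 22)))(PA 10 9 8 13 21 20))(PA 8 9 11 13 21 22))(PA 9 10 11 13 21 22)))(PA 10 11 12 13 21
  22))))(BR 16 21(BR 9 17(PA 10 9 17 16 21 22)(BR 10 15(PA 9 10 15 16 21 22)(BR 12 17(PA 13 12 17 16 21 22)(BR 13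
  15(PA 12 13 15 16 21 22)(BR 9 20(PA 10 9 20 21 16 17)(BR 14 16(BR 12 20(PA 13 12 20 21 16 17)(BR 12 14(BR 11 16(BR
  10 12(PA 10 12 14 16 21 22)(BR 9 11(BR 8 10(PA 8 10 11 12 14 15)(BR 8 16(PA 10 9 8 16 21 20)(PA 8 9 11 16 21
  20)))(PA 9 10 11 16 21 20)))(PA 11 12 14 16 21 20))(PA 12 13 14 16 21 22)))(PA 13 14 15 16 21 22)))))))(BR 19 21(BR
  13 18(PA 12 13 18 19 21 22)(BR 16 18(PA 15 16 18 19 21 22)(BR 17 19(BR 15 17(BR 12 17(PA 13 12 17 19 21 22)(BR 13
  15(PA 13 15 17 19 21 22)(BR 12 14(PA 11 12 14 15 17 18)(PA 12 13 14 15 17 18))))(PA 15 16 17 19 21 22))(PA 16 17 18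
  19 21 22))))(BR 14 19(PA 13 14 19 20 21 22)(BR 17 19(PA 16 17 19 20 21 22)(BR 18 20(BR 13 18(PA 14 13 18 20 21
  22)(BR 16 18(BR 15 20(BR 13 15(PA 12 13 15 16 18 19)(BR 15 17(PA 13 14 15 17 18 19)(PA 13 14 15 20 18 17)))(PA 15 16
  18 20 21 22))(PA 16 17 18 20 21 22)))(PA 17 18 19 20 21 22)))))))),
  ([t,f,f,f,f,f,f,f,f,f,f,f,f,f,f,f,f,f,f,f,f,f,f], BR 1 9(BR 1 12(BR 1 15(BR 1 18(BR 8 19(BR 8 16(PA 0 1 15 16 8
  19)(PA 16 15 1 9 8 19))(BR 5 19(PA 5 19 18 1 9 8)(BR 8 16(BR 8 13(PA 0 1 12 13 8 16)(PA 13 12 1 9 8 16))(BR 5 16(PA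
  5 16 15 1 9 8)(BR 14 22(BR 14 19(PA 0 1 18 19 14 22)(PA 19 18 1 15 14 22))(BR 11 19(BR 11 16(PA 0 1 15 16 11 19)(PA
  16 15 1 12 11 19))(BR 11 22(PA 19 18 1 12 11 22)(BR 14 19(BR 20 22(PA 13 14 19 20 22 23)(BR 8 13(PA 7 8 13 14 19
  20)(BR 13 18(BR 12 14(BR 9 14(BR 19 21(PA 11 12 14 19 21 22)(BR 13 21(BR 9 17(PA 8 9 17 18 13 21)(PA 8 9 14 13 18
  17))(PA 13 14 19 20 21 22)))(PA 8 9 1 18 19 14))(PA 0 1 12 13 14 19))(PA 0 1 18 19 14 13))))(BR 5 13(BR 8 13(PA 0 1
  9 8 13 5)(PA 5 13 12 1 9 8))(BR 11 16(BR 16 18(BR 9 11(PA 8 9 11 16 18 19)(PA 0 1 9 10 11 16))(PA 0 1 18 17 16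
  11))(BR 13 18(BR 6 14(PA 5 6 14 13 18 19)(BR 1 6(PA 5 6 1 18 13 14)(BR 6 8(PA 0 1 9 8 6 5)(BR 7 9(BR 5 7(BR 7 18(BR
  4 9(BR 4 18(BR 8 13(PA 4 5 7 8 13 14)(BR 9 14(PA 8 9 14 13 18 19)(PA 8 9 4 18 13 14)))(PA 3 4 9 7 18 13))(PA 0 1 9 7
  5 4))(PA 6 7 9 1 18 19))(PA 0 1 9 7 6 5))(PA 0 1 9 8 7 6)))))(BR 2 13(PA 14 13 2 1 18 17)(BR 8 13(PA 8 13 12 1 18
  19)(BR 13 15(BR 11 13(PA 11 13 15 1 18 19)(BR 2 16(PA 3 2 16 15 13 12)(BR 3 11(PA 2 3 11 12 13 15)(BR 9 11(PA 8 9 11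
  12 13 15)(BR 16 18(PA 12 13 15 16 18 19)(BR 6 11(PA 6 11 12 13 15 16)(BR 10 18(BR 1 6(BR 5 10(PA 0 1 6 5 10 11)(PA 5
  6 1 18 10 11))(BR 5 10(PA 0 1 9 10 5 6)(BR 6 8(PA 0 1 9 8 6 5)(BR 7 9(BR 5 7(BR 7 18(BR 3 5(PA 3 5 7 9 10 11)(BR 1
  3(PA 0 1 3 4 5 7)(BR 3 17(PA 7 5 4 3 17 16)(BR 2 7(PA 3 2 7 18 17 16)(PA 3 2 1 9 7 5)))))(PA 6 7 9 1 18 19))(PA 0 1
  9 7 6 5))(PA 0 1 9 8 7 6)))))(PA 11 10 9 1 18 19))))))))(PA 13 14 15 1 18 19)))))))))))))))(BR 14 19(PA 0 1 15 14 19
  18)(BR 16 18(PA 0 1 15 16 18 19)(BR 2 19(PA 14 15 1 2 19 18)(BR 15 17(BR 17 19(BR 12 17(BR 12 20(BR 18 20(BR 15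
  20(BR 1 21(PA 2 1 21 20 18 17)(BR 20 22(BR 17 22(PA 0 1 12 17 22 21)(PA 16 17 19 20 22 23))(PA 0 1 15 20 21 22)))(PA
  2 1 15 17 19 20))(PA 2 1 12 20 19 18))(PA 2 1 12 17 19 20))(PA 11 12 1 15 17 18))(PA 0 1 15 17 18 19))(PA 0 1 15 16
  17 18))))))(BR 8 16(PA 0 1 9 8 16 15)(BR 13 15(PA 0 1 12 13 15 16)(BR 11 16(PA 0 1 12 11 16 15)(BR 2 16(PA 11 12 1 2
  16 15)(BR 12 14(BR 14 16(BR 9 14(BR 8 13(PA 7 8 13 14 16 17)(BR 12 17(BR 9 17(BR 8 19(PA 13 12 1 9 8 19)(BR 15 17(BR
  1 18(PA 0 1 18 17 15 14)(BR 13 18(PA 0 1 12 13 18 19)(BR 11 19(PA 0 1 12 11 19 18)(BR 2 19(PA 11 12 1 2 19 18)(BR 14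
  19(PA 0 1 9 14 19 18)(BR 17 19(BR 16 18(PA 0 1 12 14 16 18)(BR 18 20(PA 13 14 16 17 18 20)(BR 9 20(PA 13 14 9 20 19
  18)(BR 9 11(BR 12 20(PA 8 9 11 12 20 19)(PA 2 1 12 17 19 20))(PA 11 10 9 17 19 20)))))(PA 0 1 12 17 18 19)))))))(PA
  0 1 12 17 16 15)))(PA 2 1 9 14 16 17))(PA 2 1 12 14 16 17)))(PA 8 9 1 12 14 15))(PA 0 1 12 14 15 16))(PA 0 1 12 13
  14 15)))))))(BR 10 12(PA 0 1 9 10 12 13)(BR 8 13(PA 0 1 9 8 13 12)(BR 2 13(PA 8 9 1 2 13 12)(BR 9 11(BR 11 13(BR 9
  14(BR 12 14(BR 1 15(PA 0 1 15 14 12 11)(BR 10 15(PA 0 1 9 10 15 16)(BR 8 16(PA 0 1 9 8 16 15)(BR 2 16(PA 8 9 1 2 16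
  15)(BR 14 16(BR 13 15(PA 0 1 9 11 13 15)(BR 15 17(PA 10 11 13 14 15 17)(BR 9 17(PA 2 1 9 17 16 15)(PA 2 1 9 14 16
  17))))(PA 0 1 9 14 15 16))))))(PA 2 1 9 14 13 12))(PA 2 1 9 11 13 14))(PA 0 1 9 11 12 13))(PA 0 1 9 10 11
  12))))))(BR 1 6(BR 7 9(PA 0 1 6 7 9 10)(BR 5 10(PA 0 1 6 5 10 9)(BR 6 8(BR 2 10(PA 5 6 1 2 10 9)(BR 8 10(BR 6 11(BR
  9 11(BR 1 12(PA 2 1 12 11 9 8)(BR 8 13(PA 0 1 6 8 13 12)(BR 11 13(PA 7 8 10 11 13 14)(PA 0 1 6 11 12 13))))(PA 2 1 6
  11 10 9))(PA 0 1 6 8 10 11))(PA 2 1 6 8 9 10)))(PA 0 1 6 7 8 9))))(BR 1 3(BR 4 6(PA 0 1 3 4 6 7)(BR 4 9(PA 0 1 3 4 9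
  10)(BR 3 5(BR 5 10(PA 0 1 3 5 10 9)(BR 5 7(BR 7 9(PA 0 1 3 5 7 9)(BR 8 10(PA 4 5 7 8 10 11)(PA 4 5 7 8 9 10)))(PA 0
  1 3 5 6 7)))(PA 0 1 3 4 5 6))))(BR 3 8(PA 0 1 2 3 8 9)(BR 3 5(PA 0 1 2 3 5 6)(BR 2 4(BR 4 6(BR 4 9(PA 0 1 2 4 9
  8)(BR 6 8(PA 0 1 2 4 6 8)(BR 7 9(PA 3 4 6 7 9 10)(PA 3 4 6 7 8 9))))(PA 0 1 2 4 5 6))(PA 0 1 2 3 4 5))))))),
  ([t,f,f,f,f,f,f,f,f,f,f,f,f,f,f,f,f,f,f,f,f,f,t], BR 5 22(BR 1 6(PA 0 1 6 5 22 23)(BR 2 22(PA 0 1 2 22 5 6)(BR 2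
  4(PA 1 2 4 5 22 23)(BR 3 5(BR 1 3(PA 0 1 3 5 22 23)(PA 1 2 3 5 22 23))(PA 2 3 4 5 22 23)))))(BR 8 22(BR 1 9(PA 0 1 9
  8 22 23)(BR 5 7(PA 4 5 7 8 22 23)(BR 4 9(PA 5 4 9 8 22 23)(BR 2 22(PA 0 1 2 22 8 9)(BR 6 8(BR 4 21(PA 5 4 21 22 8
  9)(BR 4 6(BR 1 6(PA 2 1 6 8 22 23)(BR 3 8(BR 3 5(BR 1 3(PA 0 1 3 5 6 7)(PA 0 1 2 3 8 9))(PA 5 4 3 8 22 21))(PA 3 4 6
  8 22 21)))(PA 4 5 6 8 22 23)))(PA 5 6 7 8 22 23))))))(BR 11 22(BR 5 10(PA 4 5 10 11 22 23)(BR 8 10(PA 7 8 10 11 22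
  23)(BR 7 12(PA 8 7 12 11 22 23)(BR 4 12(PA 5 4 12 11 22 23)(BR 4 21(PA 5 4 21 22 11 12)(BR 9 11(BR 7 21(PA 8 7 21 22
  11 12)(BR 7 9(BR 6 11(BR 5 7(PA 5 7 9 11 22 23)(BR 4 9(PA 5 4 9 11 22 21)(BR 4 6(BR 6 8(BR 3 5(PA 3 5 6 7 9 10)(BR 3
  8(PA 5 4 3 8 9 10)(PA 3 4 6 8 9 10)))(PA 8 7 6 11 22 21))(PA 4 5 6 11 22 21))))(PA 6 7 9 11 22 21))(PA 7 8 9 11 22
  23)))(PA 8 9 10 11 22 23)))))))(BR 7 21(BR 6 11(PA 11 6 7 21 22 23)(BR 7 12(PA 11 12 7 21 22 23)(BR 7 9(BR 9 11(PA
  11 9 7 21 22 23)(BR 10 12(PA 6 7 9 10 12 13)(PA 6 7 9 10 11 12)))(PA 9 8 7 21 22 23))))(BR 10 21(BR 8 10(PA 7 8 10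
  21 22 23)(PA 8 9 10 21 22 23))(BR 14 22(BR 8 13(PA 7 8 13 14 22 23)(BR 11 13(PA 10 11 13 14 22 23)(BR 12 14(BR 10
  12(BR 9 14(BR 7 12(PA 8 7 12 14 22 21)(BR 8 10(PA 8 10 12 14 22 23)(BR 9 11(BR 6 8(PA 6 8 9 10 12 13)(BR 7 9(BR 6
  11(PA 8 7 6 11 12 13)(PA 6 7 9 11 12 13))(PA 7 8 9 11 12 13)))(PA 11 10 9 14 22 21))))(PA 9 10 12 14 22 21))(PA 10
  11 12 14 22 23))(PA 11 12 13 14 22 23))))(BR 13 21(BR 11 13(PA 10 11 13 21 22 23)(PA 11 12 13 21 22 23))(BR 16 21(BR
  14 16(PA 13 14 16 21 22 23)(PA 14 15 16 21 22 23))(BR 17 22(BR 10 18(PA 11 10 18 17 22 23)(BR 14 16(PA 13 14 16 17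
  22 23)(BR 11 16(PA 10 11 16 17 22 23)(BR 15 17(BR 10 15(PA 11 10 15 17 22 23)(BR 13 15(BR 12 17(BR 11 13(PA 11 13 15
  17 22 23)(BR 10 12(BR 8 10(PA 8 10 12 17 22 21)(BR 9 17(BR 9 11(PA 9 11 12 13 15 16)(BR 9 14(PA 11 10 9 14 15 16)(PA
  11 10 9 17 15 14)))(PA 8 9 10 12 17 18)))(PA 10 11 12 17 22 21)))(PA 12 13 15 17 22 21))(PA 13 14 15 17 22 21)))(PA
  14 15 16 17 22 23)))))(BR 20 22(BR 14 19(PA 13 14 19 20 22 23)(BR 17 19(PA 16 17 19 20 22 23)(BR 18 20(BR 16 18(BR
  14 16(PA 14 16 18 20 22 23)(BR 13 18(PA 14 13 18 20 22 23)(BR 13 15(PA 12 13 15 16 18 19)(PA 13 14 15 16 18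
  19))))(PA 16 17 18 20 22 23))(PA 17 18 19 20 22 23))))(BR 18 20(PA 17 18 20 21 22 23)(BR 19 21(BR 17 19(PA 16 17 19
  21 22 23)(PA 17 18 19 21 22 23))(PA 18 19 20 21 22 23))))))))))))),
  ([f,f,f,f,f,f,f,f,f,f,f,f,f,f,f,f,f,f,f,f,f,f,f,f], BR 1 12(BR 1 15(BR 8 16(BR 1 9(BR 8 13(BR 5 16(PA 5 16 8 9 1
  12)(BR 11 16(BR 2 16(BR 12 17(BR 4 12(PA 5 4 12 11 16 8)(BR 3 5(PA 6 5 3 2 16 15)(BR 4 15(PA 5 4 15 16 11 12)(BR 2
  4(PA 5 4 2 16 17 12)(PA 5 4 3 2 16 15)))))(PA 1 12 13 8 16 17))(PA 2 1 12 11 16 8))(PA 8 16 15 1 12 11)))(PA 13 12 1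
  9 8 16))(PA 9 8 16 15 1 12))(BR 11 19(BR 5 19(PA 5 19 11 12 1 15)(BR 11 16(BR 1 18(BR 14 19(BR 5 16(PA 4 5 16 11 19
  20)(BR 2 19(BR 4 15(PA 5 4 15 16 11 19)(BR 3 5(PA 6 5 3 2 19 18)(BR 4 18(PA 5 4 18 19 14 15)(BR 4 12(PA 5 4 12 11 19
  18)(BR 2 4(PA 5 4 2 19 11 12)(PA 5 4 3 2 19 18))))))(PA 2 1 15 14 19 11)))(PA 11 19 18 1 15 14))(PA 15 1 12 11 19
  18))(PA 16 15 1 12 11 19)))(BR 5 16(BR 6 8(PA 9 8 6 5 16 15)(BR 1 6(BR 11 16(BR 1 9(PA 5 16 15 1 9 8)(BR 7 9(PA 0 1
  6 7 9 10)(BR 8 10(PA 7 8 10 11 16 17)(PA 1 6 7 8 9 10))))(PA 5 16 15 1 12 11))(PA 6 5 16 15 1 12)))(BR 11 22(BR 19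
  21(PA 12 11 22 21 19 18)(BR 1 18(PA 19 18 1 12 11 22)(BR 1 21(BR 18 20(PA 2 1 21 20 18 17)(BR 2 19(PA 11 12 1 2 19
  18)(PA 2 1 21 20 19 18)))(PA 15 1 12 11 22 21))))(BR 2 22(BR 3 11(PA 12 11 3 2 22 21)(BR 5 22(PA 5 22 2 1 12 11)(BR
  1 21(BR 12 23(BR 2 19(PA 11 12 23 22 2 19)(BR 3 23(BR 3 5(PA 6 5 3 2 22 21)(BR 5 19(PA 19 5 4 3 23 22)(BR 15 23(BR 4
  12(BR 2 4(BR 19 21(PA 3 2 22 21 19 18)(BR 14 19(PA 2 1 21 20 19 14)(BR 20 22(PA 5 4 2 22 20 19)(BR 15 20(PA 2 22 23
  15 20 19)(BR 21 23(PA 14 15 23 21 20 19)(PA 15 23 22 21 20 19))))))(PA 2 22 23 12 4 5))(PA 5 4 3 23 12 11))(PA 16 15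
  1 12 23 22))))(PA 3 2 22 23 12 11)))(PA 11 12 1 2 22 23))(PA 11 12 1 2 22 21))))(BR 17 22(BR 11 16(PA 10 11 16 17 22
  23)(BR 2 16(PA 1 2 16 17 22 23)(BR 15 17(BR 8 22(PA 2 1 15 17 22 8)(BR 5 22(PA 2 1 15 17 22 5)(BR 12 17(BR 1 21(BR 1
  18(BR 16 21(BR 14 22(PA 2 1 18 17 22 14)(BR 14 16(PA 13 14 16 17 22 23)(BR 9 14(PA 9 14 15 16 21 22)(BR 6 14(PA 6 14
  15 16 21 22)(BR 12 14(PA 12 14 15 16 21 22)(BR 3 14(PA 3 14 15 16 21 22)(BR 13 21(BR 9 17(PA 9 17 16 21 13 14)(BR 3
  17(PA 3 17 16 21 13 14)(BR 6 17(PA 6 17 16 21 13 14)(BR 9 11(PA 9 11 12 17 15 14)(BR 6 11(PA 6 11 12 17 15 14)(BR 10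
  12(BR 8 10(BR 1 3(BR 3 5(PA 5 3 1 18 17 22)(BR 4 12(BR 4 6(BR 6 8(PA 6 8 10 12 17 16)(PA 4 6 7 8 10 11))(PA 6 5 4 12
  17 16))(PA 5 4 3 1 12 17)))(PA 3 2 1 18 17 22))(PA 8 9 10 12 17 22))(PA 9 10 11 12 17 16)))))))(PA 14 13 12 1 21
  22))))))))(PA 2 1 21 22 17 16))(PA 2 1 21 22 17 18))(PA 2 1 15 17 22 21))(PA 11 12 1 15 17 22))))(PA 2 1 15 16 17
  22))))(BR 2 19(BR 20 22(PA 1 2 19 20 22 23)(BR 3 11(PA 12 11 3 2 19 18)(BR 1 18(BR 12 20(BR 12 23(PA 19 2 1 12 23
  22)(BR 3 20(BR 22 24(PA 2 3 20 21 22 24)(BR 21 23(BR 1 21(BR 1 24(PA 20 12 1 24 23 22)(BR 18 23(PA 11 12 1 18 23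
  22)(PA 17 18 1 21 23 24)))(PA 2 1 12 20 21 22))(PA 11 12 20 21 22 23)))(PA 3 2 19 20 12 11)))(PA 11 12 1 2 19
  20))(PA 11 12 1 2 19 18))))(BR 17 19(BR 2 16(PA 1 2 16 17 19 20)(BR 11 16(PA 10 11 16 17 19 20)(BR 20 22(PA 16 17 19
  20 22 23)(BR 15 17(BR 12 17(BR 19 21(PA 11 12 17 19 21 22)(BR 16 21(PA 11 12 17 16 21 22)(PA 16 17 19 20 21 22)))(PA
  11 12 1 15 17 19))(PA 2 1 15 16 17 19)))))(BR 1 18(BR 5 19(PA 5 19 18 1 12 11)(BR 8 19(PA 8 19 18 1 12 11)(BR 4
  18(BR 4 15(BR 4 12(BR 7 18(BR 7 12(BR 7 15(BR 3 11(PA 3 11 12 7 18 19)(BR 10 18(BR 10 15(BR 2 7(BR 2 10(BR 6 20(PA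
  10 2 7 6 20 19)(BR 3 20(PA 11 10 2 3 20 19)(BR 3 23(PA 11 10 2 3 23 22)(BR 18 23(PA 3 2 10 18 23 22)(BR 18 20(BR 20
  22(PA 2 10 18 20 22 23)(BR 7 21(BR 21 23(PA 17 18 20 21 23 24)(PA 3 2 7 21 22 23))(PA 6 7 18 20 21 22)))(PA 3 2 10
  18 19 20))))))(PA 3 2 7 18 10 11))(BR 2 10(PA 3 2 10 15 7 6)(BR 3 8(PA 2 3 8 7 12 11)(BR 2 4(BR 5 10(PA 1 2 4 5 10
  11)(BR 5 7(PA 1 2 4 5 7 8)(BR 6 14(PA 5 6 14 15 10 18)(BR 6 11(PA 5 6 11 10 15 14)(PA 5 6 7 15 10 11)))))(PA 2 3 4
  18 7 8)))))(PA 11 10 18 4 15 14))(BR 8 10(PA 11 10 8 7 18 17)(BR 5 10(PA 11 10 5 4 18 17)(BR 10 15(PA 11 10 15 7 18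
  19)(BR 7 9(BR 10 12(BR 4 9(BR 5 13(PA 6 5 13 12 10 9)(BR 13 15(PA 9 10 12 13 15 16)(BR 9 14(BR 13 18(PA 9 10 12 13
  18 19)(BR 14 19(PA 5 4 18 19 14 13)(PA 13 14 9 4 18 19)))(PA 10 9 4 15 14 13))))(PA 3 4 18 7 9 10))(PA 10 11 12 1 18
  19))(PA 10 9 8 7 18 19)))))))(PA 8 7 18 1 15 14))(PA 8 7 18 1 12 11))(BR 5 7(PA 8 7 5 4 18 17)(BR 0 8(PA 4 18 1 0 8
  7)(BR 7 12(PA 8 7 12 4 18 19)(BR 4 6(BR 1 6(BR 8 13(PA 0 1 12 13 8 7)(BR 6 8(BR 4 9(BR 7 9(BR 10 18(PA 6 7 9 10 18
  19)(BR 10 12(PA 6 7 9 10 12 13)(PA 10 11 12 1 18 19)))(PA 7 8 9 4 12 13))(PA 9 8 6 4 18 19))(PA 8 7 6 1 12 13)))(PA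
  0 1 18 4 6 7))(PA 7 6 5 4 18 19))))))(PA 5 4 18 1 12 11))(PA 5 4 18 1 15 14))(BR 2 4(PA 5 4 2 1 18 17)(BR 0 5(PA 4 5
  0 1 18 19)(BR 1 3(BR 3 5(BR 4 12(PA 5 4 12 1 18 19)(BR 4 15(PA 5 4 15 1 18 19)(BR 5 13(PA 0 1 12 13 5 4)(BR 1 6(BR 4
  6(BR 7 15(PA 3 4 6 7 15 16)(BR 6 8(BR 3 8(PA 7 8 3 1 15 16)(PA 2 3 5 6 8 9))(PA 8 7 6 1 15 16)))(PA 4 5 6 1 12
  13))(PA 6 5 3 1 15 16)))))(PA 5 4 3 1 18 19))(PA 4 3 2 1 18 19)))))))(BR 16 18(PA 0 1 15 16 18 19)(BR 15 17(PA 2 1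
  15 17 18 19)(PA 1 15 16 17 18 19))))))))))))(BR 13 15(PA 0 1 12 13 15 16)(BR 2 13(BR 15 17(PA 1 2 13 14 15 17)(BR 2
  16(BR 11 16(BR 0 11(BR 4 15(PA 1 0 11 16 15 4)(BR 5 16(BR 1 6(PA 12 1 6 5 16 15)(PA 6 5 16 2 1 12))(BR 3 5(PA 6 5 3
  2 16 15)(BR 4 12(PA 5 4 12 11 16 15)(BR 2 4(PA 5 4 2 16 11 12)(PA 5 4 3 2 16 15))))))(PA 0 1 12 11 16 15))(PA 11 12
  1 2 16 15))(BR 14 16(PA 1 2 13 14 16 17)(PA 2 13 14 15 16 17))))(BR 12 14(BR 2 16(PA 13 12 1 2 16 15)(BR 14 16(BR 12
  17(BR 15 17(BR 1 18(PA 2 1 18 17 15 14)(BR 13 18(PA 0 1 12 13 18 19)(BR 2 19(PA 13 12 1 2 19 18)(BR 16 18(PA 2 1 12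
  14 16 18)(BR 18 20(PA 13 14 16 17 18 20)(BR 17 19(BR 12 20(PA 2 1 12 20 19 18)(PA 2 1 12 17 19 20))(PA 2 1 12 17 18
  19)))))))(PA 2 1 12 17 16 15))(PA 2 1 12 14 16 17))(PA 2 1 12 14 15 16)))(PA 2 1 12 13 14 15)))))(BR 2 13(BR 2 10(BR
  1 6(BR 7 12(PA 0 1 6 7 12 13)(BR 5 13(BR 0 5(BR 2 7(BR 1 9(PA 9 1 6 5 13 12)(BR 7 9(PA 0 1 6 7 9 10)(BR 9 20(PA 1 2
  7 8 9 20)(BR 9 17(PA 1 2 7 8 9 17)(BR 9 14(PA 1 2 7 8 9 14)(BR 6 20(PA 9 10 2 1 6 20)(BR 6 17(PA 9 10 2 1 6 17)(BR 6
  14(PA 9 10 2 1 6 14)(BR 8 13(BR 0 20(PA 7 6 1 0 20 19)(BR 0 17(PA 7 6 1 0 17 16)(BR 12 17(PA 6 7 2 13 12 17)(BR 0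
  14(PA 7 6 1 0 14 13)(BR 6 8(BR 1 15(PA 9 8 6 1 15 14)(BR 0 8(BR 13 15(BR 8 16(BR 15 17(PA 1 0 8 13 15 17)(BR 1 21(PA
  9 8 0 1 21 20)(BR 16 21(PA 1 0 8 16 21 20)(BR 1 18(PA 9 8 0 1 18 17)(BR 5 16(BR 16 18(BR 13 18(PA 1 0 5 13 18 17)(BR
  17 19(PA 12 13 15 16 17 19)(BR 8 19(PA 12 13 8 19 18 17)(BR 18 20(PA 6 8 16 18 20 21)(PA 6 8 16 18 19 20)))))(PA 1 0
  5 16 17 18))(PA 4 5 0 8 16 17))))))(PA 1 0 8 13 15 16))(PA 1 6 8 13 14 15))(PA 0 1 6 8 13 14)))(PA 1 6 7 8 13
  14))))))(PA 9 8 7 2 13 14))))))))))(PA 7 6 1 2 13 12))(PA 0 1 6 5 13 12))(PA 5 6 1 2 13 12)))(BR 1 9(BR 10 12(PA 0 1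
  9 10 12 13)(BR 6 8(PA 2 1 9 8 6 5)(BR 5 13(PA 6 5 13 2 1 9)(BR 8 13(BR 12 14(PA 1 2 10 11 12 14)(BR 5 7(PA 4 5 7 8
  13 14)(BR 6 14(PA 1 2 13 14 6 5)(BR 7 12(PA 5 6 7 12 13 14)(PA 5 6 7 8 13 12)))))(PA 8 9 1 2 13 12)))))(BR 9 14(BR 1
  15(PA 2 1 15 14 9 8)(BR 9 17(PA 1 2 13 14 9 17)(BR 8 13(BR 6 14(PA 1 2 10 9 14 6)(BR 10 15(BR 15 17(PA 8 9 14 15 17
  18)(BR 3 17(PA 3 17 16 15 10 9)(BR 6 17(PA 6 17 16 15 10 9)(BR 6 8(PA 5 6 8 9 14 15)(BR 2 16(BR 2 7(BR 14 16(BR 7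
  9(PA 6 7 9 14 16 17)(PA 6 7 2 16 14 9))(PA 9 14 13 2 16 17))(PA 1 2 13 8 7 6))(PA 3 2 10 15 16 17))))))(PA 1 2 10 9
  14 15)))(PA 1 2 13 14 9 8))))(BR 6 14(PA 6 14 13 2 10 9)(BR 9 20(PA 14 13 2 10 9 20)(BR 9 17(PA 14 13 2 10 9 17)(BR
  9 23(PA 14 13 2 10 9 23)(BR 12 17(BR 1 18(PA 2 1 18 17 12 11)(BR 10 12(BR 2 16(BR 12 20(PA 1 2 16 17 12 20)(BR 17
  19(PA 9 10 12 17 19 20)(BR 2 19(PA 1 2 19 18 17 12)(BR 16 18(BR 18 20(PA 11 12 17 18 20 21)(PA 1 2 16 18 19 20))(PA
  1 2 16 17 18 19)))))(PA 1 2 13 12 17 16))(PA 1 2 10 11 12 17)))(BR 3 17(BR 4 12(PA 13 12 4 3 17 16)(BR 6 17(PA 6 17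
  3 2 13 12)(BR 13 18(BR 10 18(BR 3 14(PA 9 10 18 17 3 14)(BR 4 18(BR 4 6(PA 7 6 4 3 17 16)(BR 5 13(BR 5 10(BR 3 5(BR
  14 16(PA 4 3 17 16 14 13)(BR 15 17(PA 6 5 3 17 15 14)(BR 10 15(PA 14 15 10 5 3 17)(BR 4 15(PA 11 10 18 4 15 14)(BR
  16 18(PA 3 4 18 16 15 14)(PA 4 18 17 16 15 14))))))(PA 3 17 18 10 5 6))(PA 6 5 13 18 10 9))(PA 6 5 4 18 13 12)))(PA
  4 3 17 18 13 12)))(PA 9 10 2 3 17 18))(PA 12 13 2 3 17 18))))(BR 3 20(BR 4 9(PA 10 9 4 3 20 19)(BR 17 19(PA 4 3 20
  19 17 16)(BR 6 20(PA 6 20 3 2 10 9)(BR 10 21(BR 2 19(BR 4 21(BR 6 17(PA 3 2 19 18 17 6)(BR 10 18(BR 4 6(PA 7 6 4 3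
  20 19)(BR 18 20(BR 5 10(BR 3 5(PA 6 5 3 20 18 17)(PA 3 20 18 10 5 6))(PA 6 5 4 21 10 9))(PA 3 20 21 10 18 17)))(PA 9
  10 2 19 18 17)))(PA 4 3 20 21 10 9))(PA 9 10 2 3 20 19))(PA 9 10 2 3 20 21)))))(BR 3 14(BR 15 17(PA 2 3 14 15 17
  18)(BR 10 18(PA 14 3 2 10 18 17)(BR 10 15(BR 16 18(PA 9 10 15 16 18 19)(PA 9 10 15 16 17 18))(PA 9 10 2 3 14
  15))))(BR 5 13(BR 6 17(PA 1 2 13 5 6 17)(BR 6 20(PA 1 2 13 5 6 20)(BR 6 23(PA 1 2 13 5 6 23)(BR 5 10(BR 2 16(BR 12
  20(PA 17 16 2 13 12 20)(BR 5 16(BR 5 19(BR 2 19(BR 1 15(PA 6 5 19 2 1 15)(BR 14 19(BR 15 23(PA 1 2 19 14 15 23)(BR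
  10 15(BR 14 22(PA 9 10 15 14 22 23)(BR 11 22(PA 14 15 10 11 22 23)(BR 10 18(BR 15 20(BR 20 22(PA 11 10 15 20 22
  23)(BR 10 21(BR 21 23(BR 18 23(PA 14 15 10 18 23 22)(BR 22 24(PA 14 15 20 21 22 24)(BR 10 24(PA 14 15 10 24 23
  22)(PA 17 18 10 21 23 24))))(PA 14 15 10 21 22 23))(PA 6 5 10 15 20 21)))(PA 9 10 15 14 19 20))(PA 9 10 15 14 19
  18))))(PA 9 10 5 19 14 15)))(BR 15 20(PA 1 2 19 20 15 14)(BR 13 15(BR 14 16(BR 10 15(PA 14 15 10 2 19 20)(BR 12
  14(PA 12 14 16 2 19 20)(BR 10 12(PA 9 10 12 13 15 16)(BR 17 19(PA 13 14 16 17 19 20)(BR 7 12(PA 6 7 12 13 14 16)(BR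
  10 18(BR 2 7(BR 6 11(PA 1 2 7 6 11 12)(PA 6 7 2 10 11 12))(BR 7 18(PA 3 2 19 18 7 6)(BR 5 7(BR 8 10(BR 4 18(PA 8 7 5
  4 18 17)(BR 2 4(PA 1 2 4 5 7 8)(BR 3 8(PA 4 3 8 10 18 17)(PA 4 3 2 10 8 7))))(PA 1 2 10 5 7 8))(PA 1 2 10 5 6
  7))))(PA 9 10 5 19 18 17)))))))(PA 14 15 16 2 19 20))(PA 15 14 13 2 19 20)))))(PA 1 2 16 5 19 20))(BR 17 19(PA 4 5
  16 17 19 20)(BR 16 18(BR 2 19(PA 6 5 16 2 19 20)(BR 13 18(BR 18 20(BR 16 21(BR 19 21(BR 13 21(BR 5 22(PA 6 5 22 21
  19 18)(BR 17 22(PA 6 5 13 21 22 17)(BR 21 23(BR 13 24(BR 18 23(PA 6 5 16 18 23 22)(BR 22 24(BR 20 22(PA 5 13 18 20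
  22 23)(PA 17 18 20 21 22 24))(PA 6 5 13 24 23 22)))(PA 6 5 13 21 23 24))(PA 6 5 13 21 22 23))))(PA 12 13 2 16 21
  19))(PA 3 2 16 21 20 19))(PA 6 5 16 18 20 21))(PA 6 5 16 18 19 20))(PA 12 13 5 16 18 19)))(PA 6 5 16 17 18 19))))(PA
  6 5 10 2 16 17)))(BR 14 16(PA 1 2 13 14 16 17)(BR 5 16(PA 1 2 13 5 16 17)(BR 13 15(BR 10 15(BR 15 17(BR 13 18(BR 16
  18(BR 2 19(PA 3 2 19 18 16 15)(BR 18 20(BR 15 20(PA 3 2 13 15 20 19)(PA 14 15 17 18 20 21))(PA 3 2 13 18 19 20)))(PA
  6 5 13 18 17 16))(PA 6 5 13 15 17 18))(PA 6 5 10 15 16 17))(PA 9 10 5 13 15 16))(PA 3 2 13 14 15 16)))))(PA 6 5 13 2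
  10 9)))))(BR 3 5(PA 6 5 3 2 13 12)(BR 5 10(PA 6 5 10 2 13 14)(BR 2 4(BR 6 11(PA 1 2 10 11 6 5)(BR 4 6(BR 2 7(BR 5
  7(BR 8 13(PA 4 5 7 8 13 14)(BR 8 10(PA 4 5 7 8 10 11)(PA 8 9 10 2 13 14)))(PA 5 6 7 2 10 11))(PA 7 6 4 2 10 11))(PA
  6 5 4 2 10 11)))(PA 5 4 3 2 13 14))))))))))))))))(BR 10 12(PA 3 2 13 12 10 9)(BR 1 9(PA 10 9 1 2 13 12)(BR 11 13(BR
  9 11(BR 8 13(BR 8 10(BR 2 7(PA 1 2 7 8 10 11)(BR 7 12(PA 3 2 13 12 7 6)(BR 1 6(PA 7 6 1 2 13 12)(BR 6 11(PA 1 2 13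
  11 6 7)(BR 6 8(BR 7 9(PA 2 13 11 9 7 6)(BR 5 7(PA 5 7 8 9 11 12)(BR 5 13(PA 1 2 13 5 6 7)(PA 1 2 13 8 6 5))))(PA 1 2
  13 8 7 6))))))(PA 1 2 13 8 9 10))(PA 1 2 13 11 9 8))(PA 1 2 13 11 10 9))(PA 1 2 13 12 11 10)))))(BR 4 12(BR 1 3(PA 0
  1 3 4 12 13)(BR 2 4(BR 0 2(BR 5 13(PA 1 2 4 5 13 14)(BR 12 14(BR 0 5(PA 1 0 5 4 12 13)(BR 0 14(PA 5 4 2 0 14 13)(BR
  1 15(PA 2 1 15 14 12 11)(BR 0 11(PA 2 0 11 12 14 15)(BR 4 15(BR 13 15(BR 2 16(PA 1 2 16 15 13 12)(BR 11 16(PA 0 2 4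
  15 16 11)(BR 15 17(BR 0 17(PA 1 0 17 15 4 5)(BR 4 18(BR 12 17(PA 1 2 4 12 17 16)(BR 14 16(PA 2 4 12 14 16 17)(BR 16
  18(PA 11 12 14 15 16 18)(PA 0 2 4 18 17 16))))(PA 0 2 4 15 17 18)))(PA 1 2 4 15 16 17))))(PA 0 2 4 15 14 13))(PA 0 2
  4 12 14 15))))))(PA 1 2 4 12 13 14)))(PA 0 1 2 4 12 13))(PA 1 2 3 4 12 13)))(BR 2 10(BR 11 13(PA 1 2 10 11 13 14)(BR
  10 12(BR 12 14(BR 2 4(BR 1 6(PA 6 1 2 10 12 13)(BR 4 6(PA 6 4 2 10 12 13)(BR 5 10(BR 6 14(PA 1 2 10 12 14 6)(BR 4
  15(PA 5 4 15 14 12 11)(BR 10 15(BR 5 13(PA 1 2 4 5 13 14)(BR 6 17(PA 1 2 4 5 6 17)(BR 13 15(BR 2 16(PA 4 2 16 15 13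
  12)(BR 5 16(PA 2 4 5 16 15 13)(BR 15 17(BR 10 18(BR 13 18(PA 6 5 10 18 13 14)(BR 16 18(PA 12 13 15 16 18 19)(PA 6 5
  10 18 17 16)))(PA 6 5 10 15 17 18))(PA 6 5 10 15 16 17))))(PA 4 2 10 15 14 13))))(PA 6 5 10 12 14 15))))(PA 6 5 4 2
  10 12))))(PA 4 3 2 10 12 13))(PA 1 2 10 12 13 14))(PA 1 2 10 11 12 13)))(BR 1 9(BR 10 12(PA 0 1 9 10 12 13)(BR 9
  11(BR 11 13(BR 9 14(BR 12 14(BR 1 15(PA 2 1 15 14 12 11)(BR 10 15(PA 0 1 9 10 15 16)(BR 2 16(PA 10 9 1 2 16 15)(BR
  14 16(BR 13 15(PA 2 1 9 11 13 15)(BR 15 17(PA 10 11 13 14 15 17)(BR 9 17(PA 2 1 9 17 16 15)(PA 2 1 9 14 16 17))))(PA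
  2 1 9 14 15 16)))))(PA 2 1 9 14 13 12))(PA 2 1 9 11 13 14))(PA 2 1 9 11 12 13))(PA 2 1 9 10 11 12)))(BR 2 7(BR 8
  10(PA 1 2 7 8 10 11)(BR 8 13(PA 1 2 7 8 13 14)(BR 7 9(BR 9 11(BR 9 14(PA 1 2 7 9 14 13)(BR 0 2(BR 0 14(PA 10 9 7 2 0
  14)(BR 11 13(PA 2 7 9 11 13 14)(BR 7 12(BR 12 14(BR 13 15(PA 8 9 11 12 13 15)(BR 10 15(PA 8 9 10 15 14 13)(BR 7
  15(PA 10 9 7 15 14 13)(BR 2 16(PA 10 9 7 2 16 15)(BR 14 16(BR 9 17(PA 2 7 9 17 16 14)(BR 12 17(PA 8 9 11 12 17
  18)(PA 9 7 12 14 16 17)))(PA 9 7 12 14 15 16))))))(PA 0 2 7 12 13 14))(PA 2 7 9 11 12 13))))(PA 0 1 2 7 9 10)))(PA 1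
  2 7 9 10 11))(PA 1 2 7 8 9 10))))(BR 1 15(BR 9 14(PA 2 1 15 14 9 8)(BR 12 14(PA 2 1 15 14 12 11)(BR 13 15(BR 11
  13(BR 8 13(PA 2 1 15 13 8 9)(BR 1 3(BR 3 8(PA 8 3 1 15 13 12)(BR 9 11(PA 2 1 15 13 11 9)(BR 10 15(BR 8 10(BR 7 15(BR
  7 9(PA 7 9 10 11 13 14)(BR 7 12(PA 9 8 7 12 13 14)(PA 9 8 7 15 13 12)))(PA 3 1 15 10 8 7))(PA 3 1 15 10 9 8))(PA 2 1
  15 13 11 10))))(PA 3 2 1 15 13 12)))(PA 2 1 15 13 12 11))(PA 2 1 15 14 13 12))))(BR 4 9(BR 1 3(PA 0 1 3 4 9 10)(BR
  10 12(PA 3 4 9 10 12 13)(BR 2 4(BR 9 11(PA 1 2 4 9 11 12)(PA 2 4 9 10 11 12))(PA 1 2 3 4 9 10))))(BR 1 6(BR 7 9(PA 0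
  1 6 7 9 10)(BR 7 12(PA 0 1 6 7 12 13)(BR 7 15(PA 0 1 6 7 15 16)(BR 6 8(BR 8 10(BR 2 16(PA 7 6 1 2 16 15)(BR 10 12(PA
  2 1 6 8 10 12)(BR 6 11(BR 12 14(PA 7 8 10 11 12 14)(BR 8 13(PA 2 1 6 8 13 12)(BR 8 16(PA 2 1 6 8 16 15)(BR 6 14(PA
  10 8 6 14 13 12)(BR 11 13(BR 13 15(BR 11 16(PA 7 8 10 11 16 17)(PA 8 6 11 13 15 16))(PA 8 6 11 13 14 15))(PA 8 6 11
  12 13 14))))))(PA 1 6 8 10 11 12))))(PA 2 1 6 8 9 10))(PA 2 1 6 7 8 9)))))(BR 4 6(BR 1 3(PA 0 1 3 4 6 7)(BR 7 9(PA 3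
  4 6 7 9 10)(BR 2 4(BR 6 8(PA 1 2 4 6 8 9)(PA 2 4 6 7 8 9))(PA 1 2 3 4 6 7))))(BR 2 4(BR 5 7(PA 1 2 4 5 7 8)(BR 6
  8(PA 2 4 5 6 8 9)(PA 2 4 5 6 7 8)))(BR 1 3(BR 4 15(PA 0 1 3 4 15 16)(BR 3 5(BR 3 8(BR 3 11(BR 8 13(BR 0 8(BR 0 2(BR
  8 16(BR 11 16(BR 0 11(BR 2 16(PA 1 2 16 8 13 12)(BR 0 5(BR 4 18(PA 9 8 0 5 4 18)(BR 4 21(PA 9 8 0 5 4 21)(BR 5 16(BR
  5 13(BR 12 20(PA 4 5 16 11 12 20)(BR 9 17(PA 4 5 13 8 9 17)(BR 3 17(BR 10 18(PA 2 3 17 18 10 9)(BR 9 11(BR 5 10(PA 9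
  10 5 3 17 18)(BR 8 10(BR 7 18(PA 11 10 8 7 18 17)(BR 12 17(PA 8 9 11 12 17 18)(BR 5 7(PA 4 5 7 8 10 11)(BR 6 17(BR
  13 18(PA 2 3 17 18 13 12)(PA 12 13 5 6 17 18))(PA 7 6 5 3 17 18)))))(PA 10 9 8 3 17 18)))(PA 9 10 11 3 17 18)))(BR
  10 18(PA 4 3 11 10 18 17)(BR 16 18(BR 13 18(PA 2 3 8 13 18 17)(BR 1 18(PA 10 11 3 1 18 17)(BR 2 19(PA 3 2 19 18 16
  15)(BR 13 15(PA 12 13 15 16 18 19)(BR 8 19(BR 11 19(BR 18 20(PA 12 13 8 16 18 20)(BR 0 20(PA 2 0 20 19 18 16)(BR 14
  19(BR 3 20(PA 0 1 3 20 19 18)(BR 15 20(PA 2 3 8 19 20 15)(BR 19 21(BR 1 21(PA 2 1 21 19 14 15)(BR 2 22(PA 4 3 2 22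
  21 19)(BR 11 22(BR 20 22(PA 15 16 18 19 20 22)(BR 16 21(PA 1 0 5 16 21 20)(PA 18 16 11 22 21 20)))(PA 2 3 11 19 21
  22))))(PA 2 3 8 19 20 21))))(PA 15 14 13 8 19 18))))(PA 4 3 11 16 18 19))(PA 12 13 8 16 18 19))))))(PA 2 3 8 16 17
  18))))))(PA 4 5 0 8 13 12))(PA 4 5 0 11 16 15))))(BR 5 7(PA 1 0 8 7 5 4)(BR 6 8(PA 1 0 8 6 5 4)(PA 1 0 8 7 6
  5)))))(PA 1 0 8 16 11 12))(PA 12 11 3 8 16 15))(BR 14 16(PA 7 8 13 14 16 17)(BR 7 15(PA 4 3 8 7 15 16)(BR 13 15(PA 4
  3 8 13 15 16)(PA 7 8 13 14 15 16)))))(PA 2 1 0 8 13 12))(PA 0 1 3 8 13 12))(BR 7 12(PA 4 3 8 7 12 13)(BR 5 13(PA 9 8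
  3 5 13 12)(BR 11 13(BR 3 14(BR 5 10(PA 4 5 10 11 13 14)(BR 8 10(PA 7 8 10 11 13 14)(BR 9 14(BR 6 14(PA 4 5 6 14 9
  10)(PA 6 5 3 14 9 10))(PA 10 9 8 3 14 13))))(PA 7 8 3 11 13 14))(PA 7 8 3 11 12 13)))))(BR 0 11(PA 4 3 1 0 11 10)(BR
  9 11(PA 2 3 8 9 11 12)(BR 8 10(BR 10 12(BR 0 8(BR 0 2(BR 8 13(BR 11 13(BR 0 14(PA 2 0 14 13 11 10)(BR 12 14(PA 2 0 8
  10 12 14)(BR 3 14(PA 0 2 3 14 13 11)(BR 13 15(BR 8 16(BR 9 14(PA 2 0 8 9 14 15)(BR 14 16(PA 9 10 12 13 14 16)(PA 1 0
  8 16 15 14)))(PA 4 3 8 13 15 16))(PA 2 3 8 13 14 15)))))(PA 1 0 8 13 12 11))(PA 4 3 8 10 12 13))(PA 2 1 0 8 10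
  11))(PA 0 1 3 8 10 11))(PA 2 3 8 10 11 12))(PA 2 3 8 9 10 11)))))(BR 0 8(PA 4 3 1 0 8 7)(BR 6 8(PA 2 3 5 6 8 9)(BR 5
  7(BR 7 9(BR 0 5(BR 0 2(BR 5 10(BR 8 10(BR 0 11(PA 2 0 11 10 8 7)(BR 9 11(PA 2 0 5 7 9 11)(BR 3 11(PA 0 2 3 11 10
  8)(BR 10 12(BR 5 13(BR 6 11(PA 2 0 5 6 11 12)(BR 11 13(PA 6 7 9 10 11 13)(PA 1 0 5 13 12 11)))(PA 1 0 5 10 12
  13))(PA 2 3 5 10 11 12)))))(PA 1 0 5 10 9 8))(PA 1 0 5 7 9 10))(PA 2 1 0 5 7 8))(PA 0 1 3 5 7 8))(PA 2 3 5 7 8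
  9))(PA 2 3 5 6 7 8)))))(BR 5 10(PA 2 3 4 5 10 9)(BR 5 7(BR 7 9(PA 3 4 5 7 9 10)(BR 8 10(PA 4 5 7 8 10 11)(PA 4 5 7 8
  9 10)))(PA 2 3 4 5 6 7)))))(BR 3 5(BR 5 10(PA 1 2 3 5 10 9)(BR 5 7(BR 3 8(BR 8 10(PA 4 5 7 8 10 11)(BR 6 8(PA 4 5 6
  8 9 10)(PA 6 5 3 8 9 10)))(PA 1 2 3 5 7 8))(PA 1 2 3 5 6 7)))(PA 1 2 3 4 5 6))))))))))))))])"

lemma P6_certs_refute: "list_all (\<lambda>(w, t). refuted_pattern w t) P6_certs"
  by code_simp

lemma P6_certs_nonempty: "list_all (\<lambda>(w, t). w \<noteq> []) P6_certs"
  by code_simp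

lemma P6_certs_cover: "covered (foldr trie_insert (map fst P6_certs @ map (rev \<circ> fst) P6_certs) Tip) 24 []"
  by code_simp

theorem P6_free_no_chain:
  assumes sym: "\<And>u v. E u v \<Longrightarrow> E v u" and P6: "P6_free_on E V"
  shows "\<not> chain E V 25 v c"
proof
  assume ch: "chain E V 25 v c"
  \<comment> \<open>A chain of 25 vertices carries the colours \<open>c 0\<close> to
    \<open>c 25\<close>, which allow 24 comparisons of colours two apart.\<close>
  define ts where "ts = map (\<lambda>i. c (Suc (Suc i)) = c i) [0..<24]"
  obtain k where "trie_hit (foldr trie_insert (map fst P6_certs @ map (rev \<circ> fst) P6_certs) Tip) (drop k ts)"
    using covered_sound[OF P6_certs_cover, of "rev ts"] by (auto simp: ts_def)
  from trie_hit_foldr[OF this] obtain w where w: "w \<in> set (map fst P6_certs @ map (rev \<circ> fst) P6_certs)" "take (length w) (drop k ts) = w" by blast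
  \<comment> \<open>An empty pattern would match at every \<open>k\<close>, even past the end of
    \<open>ts\<close>, and give no bound on \<open>k\<close>.\<close>
  have ne: "w \<noteq> []"
    using w(1) P6_certs_nonempty by (auto simp: list_all_iff)
  have len: "k + length w \<le> 24" using arg_cong[OF w(2), of length] length_greater_0_conv[of w] ne by (auto simp: ts_def min_def simp del: length_greater_0_conv split: if_splits)
  have wi: "w ! i = (c (k + Suc (Suc i)) = c (k + i))" if "i < length w" for i
  proof -
    have "w ! i = take (length w) (drop k ts) ! i" by (simp only: w(2))
    also have "\<dots> = ts ! (k + i)" using that len by (simp add: ts_def)
    also have "\<dots> = (c (k + Suc (Suc i)) = c (k + i))" using that len by (simp add: ts_def)
    finally show ?thesis .
  qed
  have chw: "chain E V (Suc (length w)) (\<lambda>i. v (k + i)) (\<lambda>i. c (k + i))"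
    by (rule chain_window[OF ch]) (use len in simp)
  consider t where "(w, t) \<in> set P6_certs" | t where "(rev w, t) \<in> set P6_certs" using w(1) by force
  then show False
  proof cases
    case 1
    then have "refuted_pattern w t" using P6_certs_refute by (auto simp: list_all_iff)
    then show False using pattern_refuted[OF sym P6 chw] wi by simp
  next
    case 2
    then have r: "refuted_pattern (rev w) t" using P6_certs_refute by (auto simp: list_all_iff)
    let ?n = "Suc (length w)"
    \<comment> \<open>The certificate is for the reverse of \<open>w\<close>, so the window of the
      chain is read backwards.\<close>
    have chr: "chain E V (Suc (length (rev w))) (\<lambda>i. v (k + (?n - 1 - i))) (\<lambda>i. c (k + (?n - i)))"
      using chain_rev[OF chw sym] by simp
    have "\<not> refuted_pattern (rev w) t"
    proof (rule pattern_refuted[OF sym P6 chr])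
      fix i assume i: "i < length (rev w)"
      then have "rev w ! i = (c (k + Suc (Suc (length w - Suc i))) = c (k + (length w - Suc i)))"
        by (simp add: rev_nth wi)
      moreover have "Suc (Suc (length w - Suc i)) = ?n - i" "length w - Suc i = ?n - Suc (Suc i)" using i by simp_all
      ultimately show "(c (k + (?n - Suc (Suc i))) = c (k + (?n - i))) = rev w ! i" by (metis)
    qed
    then show False using r by blast
  qed
qed

section \<open>Modules and connectedness\<close>

lemma third_colour:
  assumes "x \<in> {1,2,3::nat}" "y \<in> {1,2,3}" "x \<noteq> y"
  obtains e where "e \<in> {1,2,3}" "e \<noteq> x" "e \<noteq> y" "\<forall>c\<in>{1,2,3}. c = x \<or> c = y \<or> c = e"
proof -
  have "6 - x - y \<in> {1,2,3} \<and> 6 - x - y \<noteq> x \<and> 6 - x - y \<noteq> y \<and> (\<forall>c\<in>{1,2,3}. c = x \<or> c = y \<or> c = 6 - x - y)"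
    using assms by auto
  then show ?thesis using that by blast
qed

text \<open>Each component of \<open>Q\<close> behaves like a single vertex. Its neighbours outside
  \<open>Q\<close> are complete to it, avoid a colour \<open>a\<close>, and exist; hence the
  component uses at most \<open>a\<close> and one more colour \<open>e\<close>, and only
  \<open>e\<close> restricts the neighbours. A component that can be coloured by \<open>a\<close>
  alone is dropped. Any other is represented by one vertex, whose colour stands for \<open>e\<close>
  and whose list lies in the two colours other than \<open>a\<close>. The quotient and the
  components with two colours are both within reach of \<open>T2\<close>.\<close>

lemma small_obs_modules:
  fixes E :: "'a \<Rightarrow> 'a \<Rightarrow> bool"
  assumes sym: "\<And>u v. E u v \<Longrightarrow> E v u" and irr: "\<And>v. \<not> E v v"
    and L3: "\<And>v. v \<in> V \<Longrightarrow> L v \<subseteq> {1,2,3}"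
    and T2: "\<And>W M. W \<subseteq> V \<Longrightarrow> (\<And>v. v \<in> W \<Longrightarrow> M v \<subseteq> {1,2,3} \<and> card (M v) \<le> 2)
        \<Longrightarrow> \<not> lcol E W M \<Longrightarrow> small_obs E m W M"
    and Q: "Q \<subseteq> V" and two: "\<And>v. v \<in> V - Q \<Longrightarrow> card (L v) \<le> 2"
    and hom: "\<And>v d d'. v \<in> V - Q \<Longrightarrow> d \<in> Q \<Longrightarrow> d' \<in> Q \<Longrightarrow> E d d' \<Longrightarrow> E v d \<Longrightarrow> E v d'"
    and att: "\<And>d. d \<in> Q \<Longrightarrow> \<exists>v\<in>V - Q. E v d"
    and avoids: "\<And>d. d \<in> Q \<Longrightarrow> \<exists>a\<in>{1,2,3}. \<forall>v\<in>V - Q. E v d \<longrightarrow> a \<notin> L v"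
    and nc: "\<not> lcol E V L"
  shows "small_obs E (m + m * (1 + 4 * m)) V L"
proof -
  define r where "r = {(x, y). x \<in> Q \<and> y \<in> Q \<and> E x y}"
  define C where "C x = r\<^sup>* `` {x}" for x
  define rep where "rep x = (SOME y. y \<in> C x)" for x
  have "sym r" using sym unfolding r_def sym_def by blast
  then have symr: "sym (r\<^sup>*)" by (rule sym_rtrancl)
  have Cself: "x \<in> C x" for x unfolding C_def by simp
  have CQ: "y \<in> Q" if "y \<in> C x" "x \<in> Q" for x y
  proof -
    have "(x, y) \<in> r\<^sup>*" using that(1) unfolding C_def by simp
    then show ?thesis using that(2) by (induction) (auto simp: r_def)
  qed
  have Ceq: "C y = C x" if "y \<in> C x" for x y
    using that symr unfolding C_def by (auto elim: symE intro: rtrancl_trans)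
  have Cedge: "C y = C x" if "x \<in> Q" "y \<in> Q" "E x y" for x y
  proof -
    have "(x, y) \<in> r" using that unfolding r_def by simp
    then show ?thesis by (intro Ceq) (auto simp: C_def)
  qed
  have repC: "rep x \<in> C x" for x unfolding rep_def using someI[of "\<lambda>y. y \<in> C x" x] Cself by blast
  have repeq: "C y = C x \<Longrightarrow> rep y = rep x" for x y unfolding rep_def by simp
  have homC: "E v y" if v: "v \<in> V - Q" "x \<in> Q" "y \<in> C x" "E v x" for v x y
  proof -
    have "(x, y) \<in> r\<^sup>*" using v(3) unfolding C_def by simp
    then show ?thesis
      by (induction) (use v(4) in simp, auto simp: r_def intro: hom[OF v(1)])
  qed
  define a where "a d = (SOME a. a \<in> {1,2,3} \<and> (\<forall>v\<in>V - Q. E v d \<longrightarrow> a \<notin> L v))" for d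
  have a: "a d \<in> {1,2,3}" "\<And>v. v \<in> V - Q \<Longrightarrow> E v d \<Longrightarrow> a d \<notin> L v" if "d \<in> Q" for d
  proof -
    have "\<exists>a. a \<in> {1,2,3} \<and> (\<forall>v\<in>V - Q. E v d \<longrightarrow> a \<notin> L v)" using avoids[OF that] by blast
    from someI_ex[OF this] show "a d \<in> {1,2,3}" "\<And>v. v \<in> V - Q \<Longrightarrow> E v d \<Longrightarrow> a d \<notin> L v"
      unfolding a_def by blast+
  qed
  define pal where "pal d B \<longleftrightarrow> lcol E (C d) (\<lambda>v. L v \<inter> B)" for d B
  define D where "D = {d \<in> Q. rep d = d \<and> \<not> pal d {a d}}"
  define L' where "L' v = (if v \<in> Q then {e \<in> {1,2,3}. e \<noteq> a v \<and> pal v {a v, e}} else L v)" for v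
  define V' where "V' = (V - Q) \<union> D"
  have DQ: "D \<subseteq> Q" unfolding D_def by blast
  have V'V: "V' \<subseteq> V" using DQ Q unfolding V'_def by blast
  have nc': "\<not> lcol E V' L'"
  proof
    assume "lcol E V' L'"
    then obtain f where f: "\<And>v. v \<in> V' \<Longrightarrow> f v \<in> L' v" "\<And>u v. u \<in> V' \<Longrightarrow> v \<in> V' \<Longrightarrow> E u v \<Longrightarrow> f u \<noteq> f v"
      by (erule lcolE)
    \<comment> \<open>A dropped component uses only \<open>a d\<close>, which its neighbours avoid;
      a kept one may also use the colour of its representative, which they avoid as well.\<close>
    define B where "B d = (if d \<in> D then {a d, f d} else {a d})" for d
    let ?R = "{d \<in> Q. rep d = d}"
    have "\<forall>d\<in>?R. \<exists>g. (\<forall>v\<in>C d. g v \<in> L v \<inter> B d) \<and> (\<forall>u\<in>C d. \<forall>v\<in>C d. E u v \<longrightarrow> g u \<noteq> g v)"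
    proof
      fix d assume d: "d \<in> ?R"
      have "pal d (B d)"
      proof (cases "d \<in> D")
        case True
        then have "f d \<in> L' d" using f(1) unfolding V'_def by blast
        then show ?thesis using True DQ unfolding L'_def B_def by auto
      next
        case False then show ?thesis using d unfolding D_def B_def by auto
      qed
      then show "\<exists>g. (\<forall>v\<in>C d. g v \<in> L v \<inter> B d) \<and> (\<forall>u\<in>C d. \<forall>v\<in>C d. E u v \<longrightarrow> g u \<noteq> g v)"
        unfolding pal_def lcol_def .
    qed
    from bchoice[OF this] obtain g where g0: "\<forall>d\<in>?R. (\<forall>v\<in>C d. g d v \<in> L v \<inter> B d)
        \<and> (\<forall>u\<in>C d. \<forall>v\<in>C d. E u v \<longrightarrow> g d u \<noteq> g d v)" ..
    have rR: "rep x \<in> ?R" if "x \<in> Q" for x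
      using CQ[OF repC that] repeq[OF Ceq[OF repC]] by simp
    have xC: "x \<in> C (rep x)" for x using Ceq[OF repC[of x]] Cself by blast
    have g1: "g (rep x) x \<in> L x" "g (rep x) x \<in> B (rep x)" if "x \<in> Q" for x
      using g0 rR[OF that] xC[of x] by blast+
    let ?h = "\<lambda>x. if x \<in> Q then g (rep x) x else f x"
    have mix: "f u \<noteq> g (rep v) v" if uv: "u \<in> V - Q" "v \<in> Q" "E u v" for u v
    proof -
      have e: "E u (rep v)" using homC[OF uv(1,2) repC uv(3)] .
      have rQ: "rep v \<in> Q" using rR[OF uv(2)] by blast
      have "f u \<in> L u" using f(1)[of u] uv(1) unfolding V'_def L'_def by auto
      then have "f u \<noteq> a (rep v)" using a(2)[OF rQ uv(1) e] by auto
      moreover have "f u \<noteq> f (rep v)" if "rep v \<in> D"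
        using f(2)[of u "rep v"] that uv(1) e unfolding V'_def by blast
      ultimately show ?thesis using g1(2)[OF uv(2)] unfolding B_def by (auto split: if_splits)
    qed
    have "lcol E V L"
    proof (rule lcolI[of V ?h])
      fix v assume "v \<in> V"
      then show "?h v \<in> L v" using g1(1)[of v] f(1)[of v] unfolding V'_def L'_def by auto
    next
      fix u v assume uv: "u \<in> V" "v \<in> V" "E u v"
      consider "u \<in> Q" "v \<in> Q" | "u \<in> Q" "v \<in> V - Q" | "u \<in> V - Q" "v \<in> Q" | "u \<in> V - Q" "v \<in> V - Q"
        using uv by blast
      then show "?h u \<noteq> ?h v"
      proof cases
        case 1
        have "rep v = rep u" by (rule repeq[OF Cedge[OF 1 uv(3)]])
        moreover have "u \<in> C (rep u)" "v \<in> C (rep u)" using xC[of u] xC[of v] \<open>rep v = rep u\<close> by simp_all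
        ultimately show ?thesis using g0 rR[OF 1(1)] uv(3) 1 by auto
      next
        case 2 then show ?thesis using mix[OF 2(2,1) sym[OF uv(3)]] by auto
      next
        case 3 then show ?thesis using mix[OF 3 uv(3)] by auto
      next
        case 4 then show ?thesis using f(2)[of u v] uv(3) unfolding V'_def by auto
      qed
    qed
    then show False using nc by blast
  qed
  have small: "card B \<le> 2 \<Longrightarrow> finite B \<Longrightarrow> card (L v \<inter> B) \<le> 2" for B v
    using card_mono[of B "L v \<inter> B"] by auto
  have L'2: "L' v \<subseteq> {1,2,3} \<and> card (L' v) \<le> 2" if "v \<in> V'" for v
  proof (cases "v \<in> Q")
    case True
    have "L' v \<subseteq> {1,2,3} - {a v}" using True unfolding L'_def by auto
    moreover have "card ({1,2,3} - {a v}) = 2" using a(1)[OF True] by (auto simp: card_Diff_singleton)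
    ultimately show ?thesis using card_mono[of "{1,2,3} - {a v}" "L' v"] by auto
  next
    case False
    then show ?thesis using L3[of v] two[of v] that V'V unfolding L'_def by auto
  qed
  have CV: "C d \<subseteq> V" if "d \<in> Q" for d using CQ[OF _ that] Q by blast
  have "small_obs E m V' L'" by (rule T2[OF V'V _ nc']) (rule L'2)
  then obtain X where X: "X \<subseteq> V'" "finite X" "card X \<le> m" "\<not> lcol E X L'"
    unfolding small_obs_def by (elim exE conjE)
  define Z where "Z d B = (SOME X. X \<subseteq> C d \<and> finite X \<and> card X \<le> m \<and> \<not> lcol E X (\<lambda>v. L v \<inter> B))" for d B
  have Z: "Z d B \<subseteq> C d \<and> finite (Z d B) \<and> card (Z d B) \<le> m \<and> \<not> lcol E (Z d B) (\<lambda>v. L v \<inter> B)"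
    if d: "d \<in> Q" "\<not> pal d B" "card B \<le> 2" "finite B" for d B
  proof -
    have "L v \<inter> B \<subseteq> {1,2,3} \<and> card (L v \<inter> B) \<le> 2" if "v \<in> C d" for v
      using L3[OF subsetD[OF CV[OF d(1)] that]] small[OF d(3,4), of v] by blast
    from T2[OF CV[OF d(1)] this d(2)[unfolded pal_def]]
    have "\<exists>X. X \<subseteq> C d \<and> finite X \<and> card X \<le> m \<and> \<not> lcol E X (\<lambda>v. L v \<inter> B)"
      unfolding small_obs_def .
    from someI_ex[OF this] show ?thesis unfolding Z_def .
  qed
  have "\<forall>d\<in>Q. \<exists>w. w \<in> V - Q \<and> E w d" using att by blast
  from bchoice[OF this] obtain w where w: "\<forall>d\<in>Q. w d \<in> V - Q \<and> E (w d) d" ..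
  define Ze where "Ze d e = (if e \<noteq> a d \<and> \<not> pal d {a d, e} then Z d {a d, e} else {})" for d e
  \<comment> \<open>For a component that occurs in the refutation of the quotient this collects a
    neighbour, a refutation of colouring by \<open>a d\<close> alone and refutations of the
    impossible palettes of two colours. They suffice to read off a colour for the
    representative.\<close>
  define Y where "Y d = insert (w d) (Z d {a d}) \<union> (Ze d 1 \<union> Ze d 2 \<union> Ze d 3)" for d
  have Ze: "Ze d e \<subseteq> C d \<and> finite (Ze d e) \<and> card (Ze d e) \<le> m" if "d \<in> D" for d e
  proof (cases "e \<noteq> a d \<and> \<not> pal d {a d, e}")
    case True
    have "card {a d, e} \<le> 2" by (simp add: card_insert_if)
    then show ?thesis using Z[of d "{a d, e}"] True subsetD[OF DQ that] unfolding Ze_def by simp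
  next
    case False
    then have "Ze d e = {}" unfolding Ze_def by (rule if_not_P)
    then show ?thesis by simp
  qed
  have Za: "Z d {a d} \<subseteq> C d \<and> finite (Z d {a d}) \<and> card (Z d {a d}) \<le> m \<and> \<not> lcol E (Z d {a d}) (\<lambda>v. L v \<inter> {a d})"
    if "d \<in> D" for d
    using Z[of d "{a d}"] that unfolding D_def by auto
  have Y: "Y d \<subseteq> V \<and> finite (Y d) \<and> card (Y d) \<le> 1 + 4 * m" if d: "d \<in> D" for d
  proof -
    have dQ: "d \<in> Q" using d DQ by blast
    have "card (Y d) \<le> card (insert (w d) (Z d {a d})) + (card (Ze d 1) + card (Ze d 2) + card (Ze d 3))"
      unfolding Y_def by (meson card_Un_le le_trans add_mono order_refl)
    moreover have "card (insert (w d) (Z d {a d})) \<le> Suc (card (Z d {a d}))" by (rule card_insert_le_m1) auto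
    ultimately have "card (Y d) \<le> 1 + 4 * m" using Za[OF d] Ze[OF d, of 1] Ze[OF d, of 2] Ze[OF d, of 3] by linarith
    moreover have "Y d \<subseteq> V" using CV[OF dQ] Za[OF d] Ze[OF d] w dQ unfolding Y_def by blast
    moreover have "finite (Y d)" using Za[OF d] Ze[OF d] unfolding Y_def by simp
    ultimately show ?thesis by blast
  qed
  have XD: "X \<inter> Q \<subseteq> D" using X(1) unfolding V'_def by blast
  let ?Z = "(X - Q) \<union> (\<Union>d\<in>X \<inter> Q. Y d)"
  have "\<not> lcol E ?Z L"
  proof
    assume "lcol E ?Z L"
    then obtain f where f: "\<And>v. v \<in> ?Z \<Longrightarrow> f v \<in> L v" "\<And>u v. u \<in> ?Z \<Longrightarrow> v \<in> ?Z \<Longrightarrow> E u v \<Longrightarrow> f u \<noteq> f v"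
      by (erule lcolE)
    have YZ: "Y d \<subseteq> ?Z" if "d \<in> X" "d \<in> Q" for d using that by blast
    \<comment> \<open>The colour of \<open>w d\<close> is one of the two other than
      \<open>a d\<close> and is excluded from the whole component. The remaining colour
      \<open>e\<close> must occur, since \<open>a d\<close> alone is refuted by
      \<open>Z d {a d}\<close>, and it lies in \<open>L' d\<close>, since otherwise the refutation
      of the palette formed by \<open>a d\<close> and \<open>e\<close> would be present.\<close>
    have key: "\<exists>e\<in>L' d. \<exists>z\<in>Z d {a d}. f z = e" if d: "d \<in> X" "d \<in> Q" for d
    proof -
      have dD: "d \<in> D" using d XD by blast
      have wd: "w d \<in> V - Q" "E (w d) d" using w d by blast+
      have wZ: "w d \<in> ?Z" using YZ[OF d] unfolding Y_def by blast
      have fw: "f (w d) \<in> L (w d)" by (rule f(1)[OF wZ])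
      have fwa: "f (w d) \<noteq> a d" using a(2)[OF d(2) wd] fw by auto
      have fw3: "f (w d) \<in> {1,2,3}" using L3[of "w d"] wd fw by blast
      obtain e where e: "e \<in> {1,2,3}" "e \<noteq> a d" "e \<noteq> f (w d)"
        and e3: "\<forall>c\<in>{1,2,3}. c = a d \<or> c = f (w d) \<or> c = e"
        by (rule third_colour[OF a(1)[OF d(2)] fw3 fwa[symmetric]])
      have inC: "f z \<in> L z \<inter> {a d, e}" if z: "z \<in> Y d" "z \<in> C d" for z
      proof -
        have zZ: "z \<in> ?Z" using YZ[OF d] z by blast
        have "E (w d) z" by (rule homC[OF wd(1) d(2) z(2) wd(2)])
        then have "f (w d) \<noteq> f z" by (rule f(2)[OF wZ zZ])
        moreover have "f z \<in> {1,2,3}" using f(1)[OF zZ] L3[of z] CV[OF d(2)] z(2) by blast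
        then have "f z = a d \<or> f z = f (w d) \<or> f z = e" by (rule bspec[OF e3])
        ultimately have "f z \<in> {a d, e}" by auto
        then show ?thesis using f(1)[OF zZ] by blast
      qed
      have lc: "lcol E S (\<lambda>v. L v \<inter> B)" if S: "S \<subseteq> Y d" "S \<subseteq> C d" "\<And>z. z \<in> S \<Longrightarrow> f z \<in> B" for S B
      proof (rule lcolI[of S f])
        fix v assume "v \<in> S" then show "f v \<in> L v \<inter> B" using S inC[of v] by blast
      next
        fix u v assume uv: "u \<in> S" "v \<in> S" "E u v"
        have "S \<subseteq> ?Z" using S(1) YZ[OF d] by (rule subset_trans)
        then show "f u \<noteq> f v" by (intro f(2) uv(3)) (erule subsetD, rule uv)+
      qed
      have "pal d {a d, e}"
      proof (rule ccontr)
        assume np: "\<not> pal d {a d, e}"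
        then have ze: "Ze d e = Z d {a d, e}" using e(2) unfolding Ze_def by simp
        have zp: "\<not> lcol E (Z d {a d, e}) (\<lambda>v. L v \<inter> {a d, e})" "Z d {a d, e} \<subseteq> C d"
          using Z[OF d(2) np] e(2) by (simp_all add: card_insert_if)
        have "Z d {a d, e} \<subseteq> Y d" using e(1) ze unfolding Y_def by auto
        then have "lcol E (Z d {a d, e}) (\<lambda>v. L v \<inter> {a d, e})" using zp(2) inC by (intro lc) blast+
        then show False using zp(1) by blast
      qed
      then have "e \<in> L' d" using e d unfolding L'_def by auto
      moreover have "\<exists>z\<in>Z d {a d}. f z = e"
      proof (rule ccontr)
        assume no: "\<not> (\<exists>z\<in>Z d {a d}. f z = e)"
        have sub: "Z d {a d} \<subseteq> Y d" unfolding Y_def by blast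
        then have "f z \<in> {a d}" if "z \<in> Z d {a d}" for z using inC[of z] Za[OF dD] no that by blast
        then have "lcol E (Z d {a d}) (\<lambda>v. L v \<inter> {a d})" using sub Za[OF dD] by (intro lc) blast+
        then show False using Za[OF dD] by blast
      qed
      ultimately show ?thesis by blast
    qed
    then have "\<forall>d\<in>X \<inter> Q. \<exists>e. e \<in> L' d \<and> (\<exists>z\<in>Z d {a d}. f z = e)" by blast
    from bchoice[OF this] obtain h where h: "\<forall>d\<in>X \<inter> Q. h d \<in> L' d \<and> (\<exists>z\<in>Z d {a d}. f z = h d)" ..
    have mix: "f v \<noteq> h d" if vd: "v \<in> X" "v \<notin> Q" "d \<in> X" "d \<in> Q" "E v d" for v d
    proof -
      obtain z where z: "z \<in> Z d {a d}" "f z = h d" using h vd by blast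
      have dD: "d \<in> D" using vd XD by blast
      have "z \<in> C d" using z Za[OF dD] by blast
      then have "E v z" using homC[of v d z] vd X(1) V'V by blast
      moreover have "z \<in> ?Z" using z(1) YZ[OF vd(3,4)] unfolding Y_def by blast
      moreover have "v \<in> ?Z" using vd by blast
      ultimately show ?thesis using f(2) z(2) by metis
    qed
    have "lcol E X L'"
    proof (rule lcolI[of X "\<lambda>v. if v \<in> Q then h v else f v"])
      fix v assume v: "v \<in> X"
      show "(if v \<in> Q then h v else f v) \<in> L' v"
      proof (cases "v \<in> Q")
        case True then show ?thesis using h v by simp
      next
        case False then show ?thesis using f(1)[of v] v unfolding L'_def by simp
      qed
    next
      fix u v assume uv: "u \<in> X" "v \<in> X" "E u v"
      show "(if u \<in> Q then h u else f u) \<noteq> (if v \<in> Q then h v else f v)"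
      proof (cases "u \<in> Q"; cases "v \<in> Q")
        assume q: "u \<in> Q" "v \<in> Q"
        then have "rep v = rep u" using repeq[OF Cedge[OF q uv(3)]] by simp
        moreover have "rep u = u" "rep v = v" using q uv XD unfolding D_def by blast+
        ultimately have "u = v" by simp
        then show ?thesis using uv(3) irr by blast
      next
        assume "u \<in> Q" "v \<notin> Q" then show ?thesis using mix[of v u] uv sym by auto
      next
        assume "u \<notin> Q" "v \<in> Q" then show ?thesis using mix[of u v] uv by auto
      next
        assume "u \<notin> Q" "v \<notin> Q" then show ?thesis using f(2)[of u v] uv by simp
      qed
    qed
    then show False using X(4) by blast
  qed
  moreover have "?Z \<subseteq> V"
  proof -
    have "X - Q \<subseteq> V" using X(1) V'V by blast
    moreover have "Y d \<subseteq> V" if "d \<in> X \<inter> Q" for d using Y[of d] XD that by blast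
    ultimately show ?thesis by blast
  qed
  moreover have "finite ?Z"
  proof (intro finite_UnI finite_UN_I)
    show "finite (X - Q)" "finite (X \<inter> Q)" using X(2) by simp_all
    show "finite (Y d)" if "d \<in> X \<inter> Q" for d using Y[of d] XD that by blast
  qed
  moreover have "card ?Z \<le> m + m * (1 + 4 * m)"
  proof -
    have "card (\<Union>d\<in>X \<inter> Q. Y d) \<le> (\<Sum>d\<in>X \<inter> Q. card (Y d))"
      using X(2) by (intro card_UN_le) simp
    also have "\<dots> \<le> of_nat (card (X \<inter> Q)) * (1 + 4 * m)"
      by (rule sum_bounded_above) (use Y XD in blast)
    also have "\<dots> \<le> m * (1 + 4 * m)"
      using X card_mono[of X "X \<inter> Q"] by (intro mult_right_mono) auto
    finally show ?thesis
      using card_Un_le[of "X - Q" "\<Union>d\<in>X \<inter> Q. Y d"] X(3) card_mono[of X "X - Q"] X(2) by auto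
  qed
  ultimately show ?thesis unfolding small_obs_def by blast
qed

section \<open>Connected obstructions\<close>

definition conn :: "('a \<Rightarrow> 'a \<Rightarrow> bool) \<Rightarrow> 'a set \<Rightarrow> bool" where
  "conn E V \<longleftrightarrow> (\<forall>A\<subseteq>V. A \<noteq> {} \<longrightarrow> A \<noteq> V \<longrightarrow> (\<exists>x\<in>A. \<exists>y\<in>V - A. E x y))"

lemma connected_obstruction:
  assumes sym: "\<And>u v. E u v \<Longrightarrow> E v u" and "finite V" and "\<not> lcol E V L"
  shows "\<exists>W\<subseteq>V. W \<noteq> {} \<and> conn E W \<and> \<not> lcol E W L"
  using assms(2,3)
proof (induction V rule: finite_psubset_induct)
  case (psubset V)
  show ?case
  proof (cases "conn E V")
    case True
    moreover have "V \<noteq> {}" using psubset.prems unfolding lcol_def by auto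
    ultimately show ?thesis using psubset.prems by blast
  next
    case False
    then obtain A where A: "A \<subseteq> V" "A \<noteq> {}" "A \<noteq> V" and no: "\<And>x y. x \<in> A \<Longrightarrow> y \<in> V - A \<Longrightarrow> \<not> E x y"
      unfolding conn_def by blast
    have "\<not> lcol E A L \<or> \<not> lcol E (V - A) L"
    proof (rule ccontr)
      assume "\<not> (\<not> lcol E A L \<or> \<not> lcol E (V - A) L)"
      then have lc: "lcol E A L" "lcol E (V - A) L" by auto
      obtain f where f: "\<And>v. v \<in> A \<Longrightarrow> f v \<in> L v" "\<And>u v. u \<in> A \<Longrightarrow> v \<in> A \<Longrightarrow> E u v \<Longrightarrow> f u \<noteq> f v"
        using lc(1) by (erule lcolE)
      obtain g where g: "\<And>v. v \<in> V - A \<Longrightarrow> g v \<in> L v" "\<And>u v. u \<in> V - A \<Longrightarrow> v \<in> V - A \<Longrightarrow> E u v \<Longrightarrow> g u \<noteq> g v"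
        using lc(2) by (erule lcolE)
      have "lcol E V L"
      proof (rule lcolI[of V "\<lambda>v. if v \<in> A then f v else g v"])
        fix v assume "v \<in> V" then show "(if v \<in> A then f v else g v) \<in> L v" using f(1) g(1) by simp
      next
        fix u v assume "u \<in> V" "v \<in> V" "E u v"
        then show "(if u \<in> A then f u else g u) \<noteq> (if v \<in> A then f v else g v)"
          using f(2)[of u v] g(2)[of u v] no[of u v] no[of v u] sym[of u v] by auto
      qed
      then show False using psubset.prems by blast
    qed
    moreover have "A \<subset> V" "V - A \<subset> V" using A by blast+
    ultimately show ?thesis using psubset.IH by (meson dual_order.strict_implies_order order_trans)
  qed
qed

section \<open>Colourings of an induced five-cycle\<close>

text \<open>The assumption \<open>T2\<close> is the theorem on lists of size two; it makes the bound \<open>m\<close> a parameter.\<close>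

locale p6_free =
  fixes E :: "'a \<Rightarrow> 'a \<Rightarrow> bool" and V :: "'a set" and m :: nat
  assumes sym: "\<And>u v. E u v \<Longrightarrow> E v u" and irr: "\<And>v. \<not> E v v" and finV: "finite V"
    and T2: "\<And>W M. W \<subseteq> V \<Longrightarrow> (\<And>v. v \<in> W \<Longrightarrow> M v \<subseteq> {1,2,3} \<and> card (M v) \<le> 2)
        \<Longrightarrow> \<not> lcol E W M \<Longrightarrow> small_obs E m W M"
    and no_P6: "\<And>a b c d e f. a \<in> V \<Longrightarrow> b \<in> V \<Longrightarrow> c \<in> V \<Longrightarrow> d \<in> V \<Longrightarrow> e \<in> V \<Longrightarrow> f \<in> V
      \<Longrightarrow> E a b \<Longrightarrow> E b c \<Longrightarrow> E c d \<Longrightarrow> E d e \<Longrightarrow> E e f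
      \<Longrightarrow> \<not> E a c \<Longrightarrow> \<not> E a d \<Longrightarrow> \<not> E a e \<Longrightarrow> \<not> E a f \<Longrightarrow> \<not> E b d \<Longrightarrow> \<not> E b e \<Longrightarrow> \<not> E b f
      \<Longrightarrow> \<not> E c e \<Longrightarrow> \<not> E c f \<Longrightarrow> \<not> E d f \<Longrightarrow> False"
begin

lemma Ecomm: "E x y = E y x"
  using sym by blast

lemma card_le_2_of_missing:
  assumes "S \<subseteq> {1,2,3::nat}" "x \<in> {1,2,3}" "x \<notin> S"
  shows "card S \<le> 2"
proof -
  have "card S \<le> card ({1,2,3} - {x})" by (rule card_mono) (use assms in auto)
  also have "\<dots> = 2" using assms(2) by (subst card_Diff_singleton) auto
  finally show ?thesis .
qed

lemma small_obs_mod: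
  assumes "W \<subseteq> V" "\<And>v. v \<in> W \<Longrightarrow> L v \<subseteq> {1,2,3}" "Q \<subseteq> W" "\<And>v. v \<in> W - Q \<Longrightarrow> card (L v) \<le> 2"
    and "\<And>v d d'. v \<in> W - Q \<Longrightarrow> d \<in> Q \<Longrightarrow> d' \<in> Q \<Longrightarrow> E d d' \<Longrightarrow> E v d \<Longrightarrow> E v d'"
    and "\<And>d. d \<in> Q \<Longrightarrow> \<exists>v\<in>W - Q. E v d"
    and "\<And>d. d \<in> Q \<Longrightarrow> \<exists>a\<in>{1,2,3}. \<forall>v\<in>W - Q. E v d \<longrightarrow> a \<notin> L v"
    and "\<not> lcol E W L"
  shows "small_obs E (m + m * (1 + 4 * m)) W L"
proof (rule small_obs_modules[of E W L m Q])
  show "small_obs E m X M" if "X \<subseteq> W" "\<And>v. v \<in> X \<Longrightarrow> M v \<subseteq> {1,2,3} \<and> card (M v) \<le> 2" "\<not> lcol E X M" for X M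
    by (rule T2[OF subset_trans[OF that(1) assms(1)] that(2,3)])
  show "E v u" if "E u v" for u v by (rule sym[OF that])
  show "\<not> E v v" for v by (rule irr)
  show "E v d'" if "v \<in> W - Q" "d \<in> Q" "d' \<in> Q" "E d d'" "E v d" for v d d' by (rule assms(5)[OF that])
  show "card (L v) \<le> 2" if "v \<in> W - Q" for v by (rule assms(4)[OF that])
  show "L v \<subseteq> {1,2,3}" if "v \<in> W" for v by (rule assms(2)[OF that])
  show "\<exists>v\<in>W - Q. E v d" if "d \<in> Q" for d by (rule assms(6)[OF that])
  show "\<exists>a\<in>{1,2,3}. \<forall>v\<in>W - Q. E v d \<longrightarrow> a \<notin> L v" if "d \<in> Q" for d by (rule assms(7)[OF that])
qed (fact assms)+

lemma T2V: "W \<subseteq> V \<Longrightarrow> (\<And>v. v \<in> W \<Longrightarrow> M v \<subseteq> {1,2,3}) \<Longrightarrow> (\<And>v. v \<in> W \<Longrightarrow> card (M v) \<le> 2)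
  \<Longrightarrow> \<not> lcol E W M \<Longrightarrow> small_obs E (m + m * (1 + 4 * m)) W M"
proof -
  assume a: "W \<subseteq> V" "\<And>v. v \<in> W \<Longrightarrow> M v \<subseteq> {1,2,3}" "\<And>v. v \<in> W \<Longrightarrow> card (M v) \<le> 2" "\<not> lcol E W M"
  have "small_obs E m W M" by (rule T2[OF a(1) _ a(4)]) (use a(2,3) in blast)
  then show ?thesis by (rule small_obs_mono) auto
qed

text \<open>The bound of \<open>small_obs_modules\<close>. Cases settled by lists of size two alone
  are weakened to it in \<open>T2V\<close>, so that all final cases share one bound.\<close>

abbreviation "K0 \<equiv> m + m * (1 + 4 * m)"

text \<open>The cycle is coloured a, b, a, b, c. By P6-freeness, a vertex that sees only one colour
  of the cycle and has a neighbour in \<open>Z\<close> is adjacent exactly to both cycle vertices of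
  colour a, or exactly to both of colour b. These sets \<open>W\<close> and \<open>U\<close> have
  lists inside {b, c} and {a, c}, so the guesses concern only their common colour c.\<close>

lemma C5_coloured:
  fixes a b c :: nat
  assumes conn: "conn E V" and L3: "\<And>v. v \<in> V \<Longrightarrow> L v \<subseteq> {1,2,3}"
    and abc: "{1,2,3} = {a, b, c}" "a \<noteq> b" "b \<noteq> c" "a \<noteq> c"
    and sV: "s1 \<in> V" "s2 \<in> V" "s3 \<in> V" "s4 \<in> V" "s5 \<in> V"
    and sE: "E s1 s2" "E s2 s3" "E s3 s4" "E s4 s5" "E s5 s1"
    and sN: "\<not> E s1 s3" "\<not> E s1 s4" "\<not> E s2 s4" "\<not> E s2 s5" "\<not> E s3 s5"
    and Ls: "L s1 \<subseteq> {a}" "L s3 \<subseteq> {a}" "L s2 \<subseteq> {b}" "L s4 \<subseteq> {b}" "L s5 \<subseteq> {c}"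
    and nc: "\<not> lcol E V L"
  shows "small_obs E ((((K0 * 16) + (K0 * 16) * ((K0 * 16) + (K0 * 16) * (K0 * 16)) + 1) * 4) * 4) V L"
proof -
  define S where "S = {s1, s2, s3, s4, s5}"
  define N1 where "N1 = {y \<in> V - S. \<exists>s\<in>S. E y s}"
  define Z where "Z = V - S - N1"
  define L1 where "L1 = prop_lists E V L"
  \<comment> \<open>Besides the cycle, the vertices that see two of its colours. Propagation leaves
    them at most one colour, and they are deleted before the structure of \<open>Z\<close> is
    studied.\<close>
  define R where "R = S \<union> {y \<in> N1. (E y s1 \<or> E y s3) \<and> (E y s2 \<or> E y s4) \<or> (E y s1 \<or> E y s3) \<and> E y s5
     \<or> (E y s2 \<or> E y s4) \<and> E y s5}"
  define L2 where "L2 = prop_lists E V L1"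
  define V2 where "V2 = V - R"
  define W where "W = {w \<in> V - S. E w s1 \<and> E w s3 \<and> \<not> E w s2 \<and> \<not> E w s4 \<and> \<not> E w s5}"
  define U where "U = {w \<in> V - S. E w s2 \<and> E w s4 \<and> \<not> E w s1 \<and> \<not> E w s3 \<and> \<not> E w s5}"
  have SV: "S \<subseteq> V" using sV unfolding S_def by blast
  have L1L: "L1 v \<subseteq> L v" for v unfolding L1_def by (rule prop_lists_sub)
  have L2L1: "L2 v \<subseteq> L1 v" for v unfolding L2_def by (rule prop_lists_sub)
  have L13: "L1 v \<subseteq> {1,2,3}" if "v \<in> V" for v using L1L[of v] L3[OF that] by blast
  have L1abc: "L1 v \<subseteq> {a, b, c}" if "v \<in> V" for v using L13[OF that] unfolding abc(1) .
  have L23: "L2 v \<subseteq> {1,2,3}" if "v \<in> V" for v using L2L1[of v] L13[OF that] by blast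
  have ZS: "\<not> E z s" "\<not> E s z" if "z \<in> Z" "s \<in> S" for z s
    using that sym unfolding Z_def N1_def by blast+
  have sees: "E y s1 \<or> E y s3 \<Longrightarrow> a \<notin> L1 y" "E y s2 \<or> E y s4 \<Longrightarrow> b \<notin> L1 y" "E y s5 \<Longrightarrow> c \<notin> L1 y" for y
    using prop_listsD[of _ E V L y] Ls sV unfolding L1_def by blast+
  have ZV: "Z \<subseteq> V2" unfolding Z_def V2_def R_def by blast
  have V2V: "V2 \<subseteq> V" unfolding V2_def by blast
  \<comment> \<open>If \<open>y\<close> sees \<open>s5\<close>, or just one of \<open>s1\<close> and
    \<open>s3\<close>, or just one of \<open>s2\<close> and \<open>s4\<close>, then
    \<open>z\<close>, \<open>y\<close> and four consecutive cycle vertices induce a P6.\<close>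
  have att: "y \<in> W \<union> U" if y: "y \<in> V2" "y \<notin> Z" "z \<in> Z" "E y z" for y z
  proof -
    have yn: "y \<in> V" "y \<notin> S" "y \<in> N1" "z \<in> V" using y unfolding V2_def R_def Z_def by blast+
    have zs: "\<not> E z s1" "\<not> E z s2" "\<not> E z s3" "\<not> E z s4" "\<not> E z s5" using ZS[OF y(3)] unfolding S_def by blast+
    have nR: "\<not> ((E y s1 \<or> E y s3) \<and> (E y s2 \<or> E y s4))" "\<not> ((E y s1 \<or> E y s3) \<and> E y s5)"
      "\<not> ((E y s2 \<or> E y s4) \<and> E y s5)" using y(1) yn unfolding V2_def R_def by blast+
    have some: "E y s1 \<or> E y s2 \<or> E y s3 \<or> E y s4 \<or> E y s5" using yn(3) unfolding N1_def S_def by blast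
    note F = yn(1,4) sV sE sN zs y(4)
    have n5: "\<not> E y s5"
    proof
      assume "E y s5" then show False using no_P6[of z y s5 s4 s3 s2] F nR by (auto simp: Ecomm)
    qed
    have n13: "E y s1 \<longleftrightarrow> E y s3"
    proof (rule ccontr)
      assume "\<not> ?thesis"
      then show False using no_P6[of z y s1 s5 s4 s3] no_P6[of z y s1 s2 s3 s4] no_P6[of z y s3 s4 s5 s1] no_P6[of z y s3 s2 s1 s5] F nR n5 by (auto simp: Ecomm)
    qed
    have n24: "E y s2 \<longleftrightarrow> E y s4"
    proof (rule ccontr)
      assume "\<not> ?thesis"
      then show False using no_P6[of z y s2 s3 s4 s5] no_P6[of z y s2 s1 s5 s4] no_P6[of z y s4 s3 s2 s1] no_P6[of z y s4 s5 s1 s2] F nR n5 by (auto simp: Ecomm)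
    qed
    show ?thesis using some n5 n13 n24 nR yn unfolding W_def U_def by blast
  qed
  have WUV: "v \<in> V2" "v \<notin> Z" "v \<in> V" "v \<in> N1" if "v \<in> W \<union> U" for v
    using that sE irr sV unfolding W_def U_def V2_def R_def Z_def N1_def S_def by blast+
  \<comment> \<open>A split edge of \<open>Z\<close> continues through \<open>v\<close> and three
    cycle vertices to an induced P6. Hence components of \<open>Z\<close> are modules for
    \<open>W\<close> and \<open>U\<close>.\<close>
  have homWU: "E v d'" if v: "v \<in> W \<union> U" "d \<in> Z" "d' \<in> Z" "E d d'" "E v d" for v d d'
  proof (rule ccontr)
    assume n: "\<not> E v d'"
    have zs: "\<not> E d s" "\<not> E d' s" if "s \<in> S" for s using ZS v that by blast+
    have dV: "d \<in> V" "d' \<in> V" using v unfolding Z_def by blast+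
    have zz: "\<not> E d s1" "\<not> E d s2" "\<not> E d s3" "\<not> E d s4" "\<not> E d s5" "\<not> E d' s1" "\<not> E d' s2" "\<not> E d' s3" "\<not> E d' s4" "\<not> E d' s5"
      using zs unfolding S_def by blast+
    from v(1) consider "v \<in> W" | "v \<in> U" by blast
    then show False
    proof cases
      case 1
      then show False using no_P6[of d' d v s3 s4 s5] n v dV zz sE sN sV unfolding W_def by (auto simp: Ecomm)
    next
      case 2
      then show False using no_P6[of d' d v s2 s1 s5] n v dV zz sE sN sV unfolding U_def by (auto simp: Ecomm)
    qed
  qed
  \<comment> \<open>A vertex seeing just one of the two starts an induced P6 that leads through it,
    \<open>s1\<close>, \<open>s5\<close>, \<open>s4\<close> (in one of the two directions) to the
    other.\<close>
  have eqWU: "E w z \<longleftrightarrow> E u z" if wu: "w \<in> W" "u \<in> U" "\<not> E w u" "z \<in> Z" for w u z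
  proof (rule ccontr)
    assume n: "\<not> ?thesis"
    have zs: "\<not> E z s1" "\<not> E z s2" "\<not> E z s3" "\<not> E z s4" "\<not> E z s5" "z \<in> V"
      using ZS[OF wu(4)] wu(4) unfolding S_def Z_def by blast+
    show False using no_P6[of z w s1 s5 s4 u] no_P6[of z u s4 s5 s1 w] n wu zs sE sN sV unfolding W_def U_def by (auto simp: Ecomm)
  qed
  define rz where "rz = {(x, y). x \<in> Z \<and> y \<in> Z \<and> E x y}"
  define Cz where "Cz x = rz\<^sup>* `` {x}" for x
  have symrz: "sym (rz\<^sup>*)" by (rule sym_rtrancl) (use sym in \<open>auto simp: rz_def sym_def\<close>)
  have CzZ: "y \<in> Z" if "y \<in> Cz x" "x \<in> Z" for x y
  proof -
    have "(x, y) \<in> rz\<^sup>*" using that(1) unfolding Cz_def by simp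
    then show ?thesis using that(2) by (induction) (auto simp: rz_def)
  qed
  have Czeq: "Cz y = Cz x" if "x \<in> Z" "y \<in> Z" "E x y" for x y
  proof -
    have "(x, y) \<in> rz\<^sup>*" "(y, x) \<in> rz\<^sup>*" using that sym unfolding rz_def by blast+
    then show ?thesis unfolding Cz_def by (auto intro: rtrancl_trans)
  qed
  \<comment> \<open>Under \<open>cond\<close> no guess is left. A component attached to
    \<open>W\<close> or \<open>U\<close> either has lost a colour everywhere or fits
    \<open>small_obs_modules\<close> with the missing colour \<open>t\<close>. A component attached
    to neither has, by connectedness, a deleted neighbour \<open>yy\<close>, whose single colour is
    already missing at all neighbours of \<open>yy\<close>.\<close>
  have fin: "small_obs E K0 V2 M"
    if ne: "\<And>v. v \<in> V \<Longrightarrow> L1 v \<noteq> {}" and ML2: "\<And>v. M v \<subseteq> L2 v" and ncM: "\<not> lcol E V2 M"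
    and cond: "\<And>z. z \<in> Z \<Longrightarrow> \<exists>v\<in>W \<union> U. E v z \<Longrightarrow>
      (\<exists>v\<in>W \<union> U. \<exists>e\<in>{1,2,3}. E v z \<and> (\<forall>z'\<in>Z. E v z' \<longrightarrow> e \<notin> M z')) \<or>
      (\<exists>t\<in>{1,2,3}. \<forall>v\<in>W \<union> U. E v z \<longrightarrow> t \<notin> M v)" for M
  proof -
    define att where "att z \<longleftrightarrow> (\<exists>v\<in>W \<union> U. E v z)" for z
    define hit where "hit z \<longleftrightarrow> (\<exists>v\<in>W \<union> U. \<exists>e\<in>{1,2,3}. E v z \<and> (\<forall>z'\<in>Z. E v z' \<longrightarrow> e \<notin> M z'))" for z
    define yy where "yy z = (SOME y. y \<in> R \<and> y \<in> V \<and> (\<exists>x\<in>Cz z. E y x))" for z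
    define Q1 where "Q1 = {z \<in> Z. att z \<and> \<not> hit z}"
    \<comment> \<open>In an unattached component the neighbours of \<open>yy\<close> have lost a
      colour. The other vertices form modules with respect to them, and all of those neighbours miss
      the same colour.\<close>
    define Q2 where "Q2 = {z \<in> Z. \<not> att z \<and> \<not> E (yy z) z}"
    have att_eq: "att x = att y" and hit_eq: "hit x = hit y" if "x \<in> Z" "y \<in> Z" "E x y" for x y
      using homWU that sym unfolding att_def hit_def by metis+
    have yy_eq: "yy x = yy y" if "x \<in> Z" "y \<in> Z" "E x y" for x y
      using Czeq[OF that] unfolding yy_def by simp
    have atC: "att x = att z" if "x \<in> Cz z" "z \<in> Z" for x z
    proof -
      have "(z, x) \<in> rz\<^sup>*" using that(1) unfolding Cz_def by simp
      then show ?thesis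
      proof (induction)
        case (step y x) then show ?case using att_eq[of y x] unfolding rz_def by simp
      qed simp
    qed
    have yyp: "yy z \<in> R" "yy z \<in> V" "\<exists>x\<in>Cz z. E (yy z) x" if z: "z \<in> Z" "\<not> att z" for z
    proof -
      have sub: "Cz z \<subseteq> V" using CzZ[OF _ z(1)] unfolding Z_def by blast
      have "z \<in> Cz z" unfolding Cz_def by simp
      moreover have "s1 \<notin> Cz z" using CzZ[OF _ z(1)] unfolding Z_def S_def by blast
      ultimately obtain x y where xy: "x \<in> Cz z" "y \<in> V - Cz z" "E x y"
        using conn sub sV(1) unfolding conn_def by blast
      have xZ: "x \<in> Z" using CzZ[OF xy(1) z(1)] .
      have "y \<notin> Z"
      proof
        assume "y \<in> Z"
        then have "(x, y) \<in> rz" using xZ xy(3) unfolding rz_def by simp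
        then have "y \<in> Cz z" using xy(1) unfolding Cz_def by (auto intro: rtrancl_into_rtrancl)
        then show False using xy(2) by blast
      qed
      have "y \<in> R"
      proof (rule ccontr)
        assume "y \<notin> R"
        then have "y \<in> W \<union> U" using att[of y x] xy xZ \<open>y \<notin> Z\<close> sym unfolding V2_def by blast
        then have "att x" using sym[OF xy(3)] unfolding att_def by blast
        then show False using atC[OF xy(1) z(1)] z(2) by blast
      qed
      then have "\<exists>y. y \<in> R \<and> y \<in> V \<and> (\<exists>x\<in>Cz z. E y x)" using xy sym by blast
      from someI_ex[OF this] show "yy z \<in> R" "yy z \<in> V" "\<exists>x\<in>Cz z. E (yy z) x" unfolding yy_def by blast+
    qed
    have yN: "yy z \<in> N1" if z: "z \<in> Z" "\<not> att z" for z
    proof -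
      obtain x where "x \<in> Cz z" "E (yy z) x" using yyp(3)[OF z] by blast
      then have "yy z \<notin> S" using ZS(2)[of x "yy z"] CzZ[OF _ z(1)] by blast
      then show ?thesis using yyp(1)[OF z] unfolding R_def by blast
    qed
    have yL: "\<exists>e\<in>{1,2,3}. L1 (yy z) = {e} \<and> (\<forall>u. E u (yy z) \<longrightarrow> e \<notin> M u)" if z: "z \<in> Z" "\<not> att z" for z
    proof -
      have y: "yy z \<in> V" "yy z \<in> R" "yy z \<in> N1" "yy z \<notin> S" using yyp[OF z] yN[OF z] unfolding N1_def by blast+
      have "\<exists>e. L1 (yy z) \<subseteq> {e}"
        using y(2,4) sees[of "yy z"] L1abc[OF y(1)] unfolding R_def by auto
      then obtain e where e: "L1 (yy z) = {e}" using ne[OF y(1)] by blast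
      moreover have "e \<in> {1,2,3}" using L13[OF y(1)] e by blast
      moreover have "e \<notin> M u" if "E u (yy z)" for u
        using prop_listsD[of e E V L1 u "yy z"] y(1) that e ML2[of u] unfolding L2_def by blast
      ultimately show ?thesis by blast
    qed
    \<comment> \<open>A vertex adjacent to the whole cycle would see all three colours and have an
      empty list. The edge found here prolongs paths that leave a component through
      \<open>yy\<close>.\<close>
    have inward: "\<exists>s s'. s \<in> S \<and> s' \<in> S \<and> E (yy z) s \<and> \<not> E (yy z) s' \<and> E s s'" if z: "z \<in> Z" "\<not> att z" for z
    proof (rule ccontr)
      assume no: "\<not> ?thesis"
      have p: "E (yy z) s'" if "s \<in> S" "s' \<in> S" "E s s'" "E (yy z) s" for s s'
        using no that by blast
      have "\<exists>s\<in>S. E (yy z) s" using yN[OF z] unfolding N1_def by blast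
      moreover
      have "E (yy z) s1 \<longleftrightarrow> E (yy z) s2" using p[of s1 s2] p[of s2 s1] sE(1) sym[OF sE(1)] unfolding S_def by blast
      moreover have "E (yy z) s2 \<longleftrightarrow> E (yy z) s3" using p[of s2 s3] p[of s3 s2] sE(2) sym[OF sE(2)] unfolding S_def by blast
      moreover have "E (yy z) s3 \<longleftrightarrow> E (yy z) s4" using p[of s3 s4] p[of s4 s3] sE(3) sym[OF sE(3)] unfolding S_def by blast
      moreover have "E (yy z) s4 \<longleftrightarrow> E (yy z) s5" using p[of s4 s5] p[of s5 s4] sE(4) sym[OF sE(4)] unfolding S_def by blast
      ultimately have all: "E (yy z) s1 \<and> E (yy z) s2 \<and> E (yy z) s5" unfolding S_def by blast
      have "a \<notin> L1 (yy z)" "b \<notin> L1 (yy z)" "c \<notin> L1 (yy z)" using all sees[of "yy z"] by auto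
      then have "L1 (yy z) = {}" using L1abc[OF yyp(2)[OF z]] by auto
      then show False using ne[OF yyp(2)[OF z]] by blast
    qed
    have homy: "E v x'" if h: "z \<in> Z" "\<not> att z" "v \<in> Z" "x \<in> Z" "x' \<in> Z" "E x x'" "E (yy z) v" "\<not> E (yy z) x" "\<not> E (yy z) x'" "E v x"
      for z v x x'
    proof (rule ccontr)
      assume n: "\<not> E v x'"
      obtain s s' where s: "s \<in> S" "s' \<in> S" "E (yy z) s" "\<not> E (yy z) s'" "E s s'" using inward[OF h(1,2)] by blast
      have "\<not> E v s" "\<not> E v s'" "\<not> E x s" "\<not> E x s'" "\<not> E x' s" "\<not> E x' s'" "v \<in> V" "x \<in> V" "x' \<in> V" "s \<in> V" "s' \<in> V"
        using ZS h s SV unfolding Z_def by blast+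
      then show False using no_P6[of x' x v "yy z" s s'] h s n yyp(2)[OF h(1,2)] by (auto simp: Ecomm)
    qed
    have Q2v: "v \<in> Z \<Longrightarrow> v \<notin> Q1 \<union> Q2 \<Longrightarrow> d \<in> Q2 \<Longrightarrow> E v d \<Longrightarrow> E (yy d) v" for v d
      using att_eq[of v d] yy_eq[of v d] unfolding Q2_def by auto
    have Q1v: "v \<in> Z \<Longrightarrow> d \<in> Q1 \<Longrightarrow> E v d \<Longrightarrow> v \<in> Q1" for v d
      using att_eq[of v d] hit_eq[of v d] unfolding Q1_def by auto
    have Q2Z: "d \<in> Q2 \<Longrightarrow> d \<in> Z \<and> \<not> att d \<and> \<not> E (yy d) d" for d unfolding Q2_def by blast
    have nWU: "v \<in> V2 \<Longrightarrow> d \<in> Z \<Longrightarrow> E v d \<Longrightarrow> v \<in> Z \<or> v \<in> W \<union> U" for v d using att by blast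
    show ?thesis
    proof (rule small_obs_mod[of V2 M "Q1 \<union> Q2"])
      show "M v \<subseteq> {1,2,3}" if "v \<in> V2" for v using ML2[of v] L23[of v] V2V that by blast
      show "Q1 \<union> Q2 \<subseteq> V2" using ZV unfolding Q1_def Q2_def by blast
      show "card (M v) \<le> 2" if v: "v \<in> V2 - (Q1 \<union> Q2)" for v
      proof -
        have M3: "M v \<subseteq> {1,2,3}" using ML2[of v] L23[of v] V2V v by blast
        have "\<exists>x\<in>{1,2,3}. x \<notin> M v"
        proof (cases "v \<in> Z")
          case True
          show ?thesis
          proof (cases "att v")
            case True
            then have "hit v" using v \<open>v \<in> Z\<close> unfolding Q1_def by blast
            then show ?thesis using \<open>v \<in> Z\<close> unfolding hit_def by blast
          next
            case False
            then have "E (yy v) v" using v True unfolding Q2_def by blast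
            then show ?thesis using yL[OF True False] sym by blast
          qed
        next
          case False
          then have "v \<in> N1" using v V2V unfolding Z_def V2_def R_def by blast
          then have "E v s1 \<or> E v s3 \<or> E v s2 \<or> E v s4 \<or> E v s5" unfolding N1_def S_def by blast
          then have "a \<notin> L1 v \<or> b \<notin> L1 v \<or> c \<notin> L1 v" using sees[of v] by auto
          then show ?thesis using ML2[of v] L2L1[of v] unfolding abc(1) by auto
        qed
        then show ?thesis using card_le_2_of_missing[OF M3] by blast
      qed
      show "E v d'" if h: "v \<in> V2 - (Q1 \<union> Q2)" "d \<in> Q1 \<union> Q2" "d' \<in> Q1 \<union> Q2" "E d d'" "E v d" for v d d'
      proof -
        have dZ: "d \<in> Z" "d' \<in> Z" using h unfolding Q1_def Q2_def by blast+
        from nWU[of v d] h dZ consider "v \<in> W \<union> U" | "v \<in> Z" by blast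
        then show ?thesis
        proof cases
          case 1 then show ?thesis using homWU dZ h by blast
        next
          case 2
          then have d: "d \<in> Q2" using Q1v[of v d] h by blast
          then have "\<not> att d'" using att_eq[OF dZ h(4)] Q2Z by blast
          then have d': "d' \<in> Q2" using h(3) unfolding Q1_def by blast
          have "yy d' = yy d" using yy_eq[OF dZ h(4)] by simp
          then show ?thesis using homy[of d v d d'] Q2Z[OF d] Q2Z[OF d'] Q2v[OF 2 _ d h(5)] h 2 by auto
        qed
      qed
      show "\<exists>v\<in>V2 - (Q1 \<union> Q2). E v d" if "d \<in> Q1 \<union> Q2" for d
        using that
      proof
        assume "d \<in> Q1"
        then obtain v where "v \<in> W \<union> U" "E v d" unfolding Q1_def att_def by blast
        then show ?thesis using WUV[of v] unfolding Q1_def Q2_def by blast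
      next
        assume d: "d \<in> Q2"
        then have dz: "d \<in> Z" "\<not> att d" "\<not> E (yy d) d" using Q2Z by blast+
        obtain x where x: "x \<in> Cz d" "E (yy d) x" using yyp(3)[OF dz(1,2)] by blast
        have "(d, x) \<in> rz\<^sup>*" using x unfolding Cz_def by simp
        then have "(\<exists>v\<in>Z. E (yy d) v \<and> E v d) \<or> (\<not> E (yy d) x \<and> (\<forall>v\<in>Z. E (yy d) v \<longrightarrow> E v x \<longrightarrow> E v d))"
        proof (induction)
          case base then show ?case using dz by blast
        next
          case (step x x')
          have xx: "x \<in> Z" "x' \<in> Z" "E x x'" "E x' x" using step(2) sym unfolding rz_def by blast+
          show ?case using step.IH homy[OF dz(1,2), of _ x' x] xx by blast
        qed
        then obtain v where v: "v \<in> Z" "E (yy d) v" "E v d" using x by blast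
        have "att v = att d" "yy v = yy d" using att_eq[OF v(1) dz(1) v(3)] yy_eq[OF v(1) dz(1) v(3)] by blast+
        then have "v \<notin> Q1 \<union> Q2" using v dz unfolding Q1_def Q2_def by auto
        then show ?thesis using v ZV by blast
      qed
      show "\<exists>t\<in>{1,2,3}. \<forall>v\<in>V2 - (Q1 \<union> Q2). E v d \<longrightarrow> t \<notin> M v" if "d \<in> Q1 \<union> Q2" for d
        using that
      proof
        assume d: "d \<in> Q1"
        then have dz: "d \<in> Z" "att d" "\<not> hit d" unfolding Q1_def by blast+
        then obtain t where t: "t \<in> {1,2,3}" "\<forall>v\<in>W \<union> U. E v d \<longrightarrow> t \<notin> M v"
          using cond[of d] unfolding att_def hit_def by blast
        have "t \<notin> M v" if "v \<in> V2 - (Q1 \<union> Q2)" "E v d" for v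
          using nWU[of v d] that dz(1) Q1v[of v d] d t(2) by blast
        then show ?thesis using t(1) by blast
      next
        assume d: "d \<in> Q2"
        then have dz: "d \<in> Z" "\<not> att d" "\<not> E (yy d) d" using Q2Z by blast+
        obtain e where e: "e \<in> {1,2,3}" "\<forall>u. E u (yy d) \<longrightarrow> e \<notin> M u" using yL[OF dz(1,2)] by blast
        have "e \<notin> M v" if v: "v \<in> V2 - (Q1 \<union> Q2)" "E v d" for v
        proof -
          have "v \<notin> W \<union> U" using dz(2) v unfolding att_def by blast
          then have "v \<in> Z" using nWU[of v d] v dz(1) by blast
          then have "E (yy d) v" using Q2v[of v d] v d by blast
          then show ?thesis using e(2) sym by blast
        qed
        then show ?thesis using e(1) by blast
      qed
    qed (use V2V ncM in auto)
  qed
  have main: "small_obs E ((K0 * 16) + (K0 * 16) * ((K0 * 16) + (K0 * 16) * (K0 * 16))) V2 L2"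
    if ne: "\<And>v. v \<in> V \<Longrightarrow> L1 v \<noteq> {}" and nc2: "\<not> lcol E V2 L2"
  proof -
    \<comment> \<open>The first propagation carries the guessed colours into \<open>W\<close> and
      \<open>U\<close>, the second from there into \<open>Z\<close>; this is the factor 16.\<close>
    have pp: "small_obs E (K0 * 16) V2 M" if M: "\<And>v. M v \<subseteq> L2 v" and
      cond: "\<And>z. z \<in> Z \<Longrightarrow> \<exists>v\<in>W \<union> U. E v z \<Longrightarrow>
      (\<exists>v\<in>W \<union> U. \<exists>e\<in>{1,2,3}. E v z \<and> (\<forall>z'\<in>Z. E v z' \<longrightarrow> e \<notin> prop_lists E V2 (prop_lists E V2 M) z')) \<or>
      (\<exists>t\<in>{1,2,3}. \<forall>v\<in>W \<union> U. E v z \<longrightarrow> t \<notin> prop_lists E V2 (prop_lists E V2 M) v)" for M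
    proof -
      let ?M1 = "prop_lists E V2 M" let ?M2 = "prop_lists E V2 ?M1"
      have s1: "?M1 v \<subseteq> M v" "?M2 v \<subseteq> ?M1 v" for v by (rule prop_lists_sub)+
      have s2: "?M2 v \<subseteq> L2 v" for v using s1(1)[of v] s1(2)[of v] M[of v] by blast
      have "\<not> lcol E V2 ?M2" using nc2 lcol_mono[of E V2 ?M2 V2 L2] s2 by blast
      from fin[OF ne s2 this cond] have "small_obs E K0 V2 ?M2" by simp
      then have "small_obs E (K0 * 4) V2 ?M1"
        by (rule small_obs_prop[rotated]) (use s1(1) M L23 V2V in blast)
      then have "small_obs E (K0 * 4 * 4) V2 M"
        by (rule small_obs_prop[rotated]) (use M L23 V2V in blast)
      then show ?thesis by (simp add: mult.assoc)
    qed
    have Wb: "L2 w \<subseteq> {b, c}" if "w \<in> W" for w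
      using that sees(1)[of w] L2L1[of w] L1abc[of w] unfolding W_def by auto
    have Ub: "L2 u \<subseteq> {a, c}" if "u \<in> U" for u
      using that sees(2)[of u] L2L1[of u] L1abc[of u] unfolding U_def by auto
    have abc3: "a \<in> {1,2,3}" "b \<in> {1,2,3}" "c \<in> {1,2,3}" unfolding abc(1) by simp_all
    have single: "e \<notin> prop_lists E V2 M z'" if "M v \<subseteq> {e}" "v \<in> W \<union> U" "z' \<in> Z" "E v z'" for M v e z'
      using prop_listsD[of e E V2 M z' v] WUV[OF that(2)] that sym by blast
    have hitI: "\<exists>v\<in>W \<union> U. \<exists>e\<in>{1,2,3}. E v z \<and> (\<forall>z'\<in>Z. E v z' \<longrightarrow> e \<notin> prop_lists E V2 M z')"
      if h: "M v \<subseteq> {e}" "v \<in> W \<union> U" "E v z" "e \<in> {1,2,3}" for M v e z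
    proof (intro bexI[of _ v] bexI[of _ e] conjI ballI impI)
      show "e \<notin> prop_lists E V2 M z'" if "z' \<in> Z" "E v z'" for z' by (rule single[of M v e z', OF h(1,2) that])
    qed (use h in auto)
    show ?thesis
    proof (rule small_obs_avoid[where W=W and c=c])
      \<comment> \<open>If no vertex of \<open>W\<close> takes c, all of \<open>W\<close> has colour
        b at most: components attached to \<open>W\<close> lose b, and for those attached only to
        \<open>U\<close> the colour b is missing at all these neighbours.\<close>
      show "small_obs E (K0 * 16) V2 (\<lambda>v. if v \<in> W then L2 v - {c} else L2 v)" (is "small_obs E _ V2 ?M")
      proof (rule pp)
        show "?M v \<subseteq> L2 v" for v by auto
        let ?M1 = "prop_lists E V2 ?M"
        fix z assume z: "z \<in> Z" and "\<exists>v\<in>W \<union> U. E v z"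
        show "(\<exists>v\<in>W \<union> U. \<exists>e\<in>{1,2,3}. E v z \<and> (\<forall>z'\<in>Z. E v z' \<longrightarrow> e \<notin> prop_lists E V2 ?M1 z')) \<or>
          (\<exists>t\<in>{1,2,3}. \<forall>v\<in>W \<union> U. E v z \<longrightarrow> t \<notin> prop_lists E V2 ?M1 v)"
        proof (cases "\<exists>v\<in>W. E v z")
          case True
          then obtain v where v: "v \<in> W" "E v z" by blast
          have "?M v \<subseteq> {b}" using Wb[OF v(1)] v(1) by auto
          then have "?M1 v \<subseteq> {b}" by (rule subset_trans[OF prop_lists_sub])
          then show ?thesis by (intro disjI1 hitI[of ?M1 v b]) (use v abc3 in auto)
        next
          case False
          have "b \<notin> prop_lists E V2 ?M1 v" if v: "v \<in> W \<union> U" "E v z" for v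
          proof -
            have "v \<in> U" using v False by blast
            then have "b \<notin> L2 v" using Ub[of v] abc(2,3) by auto
            moreover have "prop_lists E V2 ?M1 v \<subseteq> ?M v"
              by (rule prop_lists_sub2)
            then have "prop_lists E V2 ?M1 v \<subseteq> L2 v" by (rule subset_trans) auto
            ultimately show ?thesis by blast
          qed
          then show ?thesis using abc3(2) by (intro disjI2 bexI[of _ b]) auto
        qed
      qed
    next
      fix w assume w: "w \<in> W" "w \<in> V2" "c \<in> L2 w"
      show "small_obs E ((K0 * 16) + (K0 * 16) * (K0 * 16)) V2 (L2(w := {c}))"
      proof (rule small_obs_avoid[where W=U and c=c])
        show "small_obs E (K0 * 16) V2 (\<lambda>v. if v \<in> U then (L2(w := {c})) v - {c} else (L2(w := {c})) v)" (is "small_obs E _ V2 ?M")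
        proof (rule pp)
          show sub: "?M v \<subseteq> L2 v" for v using w by auto
          let ?M1 = "prop_lists E V2 ?M"
          fix z assume z: "z \<in> Z" and "\<exists>v\<in>W \<union> U. E v z"
          show "(\<exists>v\<in>W \<union> U. \<exists>e\<in>{1,2,3}. E v z \<and> (\<forall>z'\<in>Z. E v z' \<longrightarrow> e \<notin> prop_lists E V2 ?M1 z')) \<or>
            (\<exists>t\<in>{1,2,3}. \<forall>v\<in>W \<union> U. E v z \<longrightarrow> t \<notin> prop_lists E V2 ?M1 v)"
          proof (cases "\<exists>v\<in>U. E v z")
            case True
            then obtain v where v: "v \<in> U" "E v z" by blast
            have "?M v \<subseteq> {a}" using Ub[OF v(1)] v(1) sub[of v] by auto
            then have "?M1 v \<subseteq> {a}" by (rule subset_trans[OF prop_lists_sub])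
            then show ?thesis by (intro disjI1 hitI[of ?M1 v a]) (use v abc3 in auto)
          next
            case False
            have "a \<notin> prop_lists E V2 ?M1 v" if v: "v \<in> W \<union> U" "E v z" for v
            proof -
              have "v \<in> W" using v False by blast
              then have "a \<notin> L2 v" using Wb[of v] abc(2,4) by auto
              moreover have "prop_lists E V2 ?M1 v \<subseteq> ?M v"
                by (rule prop_lists_sub2)
              then have "prop_lists E V2 ?M1 v \<subseteq> L2 v" using sub[of v] by (rule subset_trans)
              ultimately show ?thesis by blast
            qed
            then show ?thesis using abc3(1) by (intro disjI2 bexI[of _ a]) auto
          qed
        qed
      next
        fix u assume u: "u \<in> U" "u \<in> V2" "c \<in> (L2(w := {c})) u"
        have uw: "u \<noteq> w" using u w unfolding W_def U_def by blast
        let ?M = "L2(w := {c}, u := {c})"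
        show "small_obs E (K0 * 16) V2 ?M"
        proof (cases "E w u")
          case True
          then have "small_obs E 2 V2 ?M"
            by (rule small_obs_edge[of w V2 u E ?M c 2, OF w(2) u(2)]) (use uw in auto)
          moreover have "m \<ge> 1 \<or> m = 0" by auto
          \<comment> \<open>One vertex with an empty list is non-colourable, but the empty set does
            not refute it; hence \<open>T2\<close> makes \<open>m\<close> positive and the bound is
            at least 2.\<close>
          moreover have "m \<noteq> 0"
          proof
            assume "m = 0"
            have "small_obs E m {w} (\<lambda>_. {})" by (rule T2) (use w V2V in \<open>auto simp: lcol_def\<close>)
            then show False using \<open>m = 0\<close> unfolding small_obs_def lcol_def by auto
          qed
          ultimately show ?thesis by (elim small_obs_mono) auto
        next
          \<comment> \<open>By \<open>eqWU\<close> the nonadjacent pair has the same neighbours in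
            \<open>Z\<close>. If \<open>z\<close> is seen by neither, any \<open>v\<close> in
            \<open>W\<close> that sees \<open>z\<close> is adjacent to \<open>u\<close>, and any
            such \<open>v\<close> in \<open>U\<close> is adjacent to \<open>w\<close>, again by
            \<open>eqWU\<close>; so \<open>v\<close> loses c and has at most one colour
            left.\<close>
          case False
          show ?thesis
          proof (rule pp)
            show sub: "?M v \<subseteq> L2 v" for v using w u uw by auto
            let ?M1 = "prop_lists E V2 ?M"
            fix z assume z: "z \<in> Z" and "\<exists>v\<in>W \<union> U. E v z"
            then obtain v where v: "v \<in> W \<union> U" "E v z" by blast
            have M1: "?M1 x \<subseteq> ?M x" for x by (rule prop_lists_sub)
            have "\<exists>v\<in>W \<union> U. \<exists>e\<in>{1,2,3}. E v z \<and> (\<forall>z'\<in>Z. E v z' \<longrightarrow> e \<notin> prop_lists E V2 ?M1 z')"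
            proof (cases "E w z")
              case True
              have "?M1 w \<subseteq> {c}" using M1[of w] uw by auto
              then show ?thesis by (rule hitI[of ?M1 w c]) (use w(1) True abc3 in auto)
            next
              case nwz: False
              then have nuz: "\<not> E u z" using eqWU[OF w(1) u(1) False z] by blast
              have dist: "v \<noteq> w" "v \<noteq> u" using v nwz nuz by auto
              have "\<exists>e\<in>{1,2,3}. ?M1 v \<subseteq> {e}"
              proof (cases "v \<in> W")
                case True
                then have "E v u" using eqWU[OF True u(1) _ z] v nuz by blast
                then have "c \<notin> ?M1 v" using prop_listsD[of c E V2 ?M v u] u(2) by auto
                moreover have "?M1 v \<subseteq> {b, c}" using subset_trans[OF M1[of v] subset_trans[OF sub[of v] Wb[OF True]]] .
                ultimately show ?thesis using abc3(2) by (intro bexI[of _ b]) auto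
              next
                case False
                then have vU: "v \<in> U" using v by blast
                then have "E w v" using eqWU[OF w(1) vU _ z] v nwz by blast
                then have "c \<notin> ?M1 v" using prop_listsD[of c E V2 ?M v w] w(2) sym uw by auto
                moreover have "?M1 v \<subseteq> {a, c}" using subset_trans[OF M1[of v] subset_trans[OF sub[of v] Ub[OF vU]]] .
                ultimately show ?thesis using abc3(1) by (intro bexI[of _ a]) auto
              qed
              then obtain e where "e \<in> {1,2,3}" "?M1 v \<subseteq> {e}" by blast
              then show ?thesis using v by (intro hitI[of ?M1 v e])
            qed
            then show "(\<exists>v\<in>W \<union> U. \<exists>e\<in>{1,2,3}. E v z \<and> (\<forall>z'\<in>Z. E v z' \<longrightarrow> e \<notin> prop_lists E V2 ?M1 z')) \<or>
              (\<exists>t\<in>{1,2,3}. \<forall>v\<in>W \<union> U. E v z \<longrightarrow> t \<notin> prop_lists E V2 ?M1 v)" ..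
          qed
        qed
      qed
    qed
  qed
  have nc1: "\<not> lcol E V L1" using nc lcol_mono[of E V L1 V L] L1L by blast
  let ?n = "(K0 * 16) + (K0 * 16) * ((K0 * 16) + (K0 * 16) * (K0 * 16))"
  have res: "small_obs E ((?n + 1) * 4) V L1"
  proof (cases "\<exists>v\<in>V. L1 v = {}")
    case True
    then obtain v where "v \<in> V" "L1 v = {}" by blast
    then show ?thesis by (rule small_obs_empty_list) simp
  next
    case False
    show ?thesis
    proof (rule small_obs_prop_delete[where R=R])
      show "\<exists>e. L1 r \<subseteq> {e}" if rR: "r \<in> R" "r \<in> V" for r
      proof (cases "r \<in> S")
        case True
        then have "\<exists>e. L r \<subseteq> {e}" using Ls unfolding S_def by blast
        then show ?thesis using L1L[of r] by (meson subset_trans)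
      next
        case False
        then consider "a \<notin> L1 r" "b \<notin> L1 r" | "a \<notin> L1 r" "c \<notin> L1 r" | "b \<notin> L1 r" "c \<notin> L1 r"
          using rR(1) sees[of r] unfolding R_def by auto
        then show ?thesis
        proof cases
          case 1 then show ?thesis using L1abc[OF rR(2)] by (intro exI[of _ c]) auto
        next
          case 2 then show ?thesis using L1abc[OF rR(2)] by (intro exI[of _ b]) auto
        next
          case 3 then show ?thesis using L1abc[OF rR(2)] by (intro exI[of _ a]) auto
        qed
      qed
      show "small_obs E ?n (V - R) (prop_lists E V L1)" if "\<not> lcol E (V - R) (prop_lists E V L1)"
        by (rule main[unfolded V2_def L2_def]) (use False that in auto)
      show "L1 v \<subseteq> {1,2,3}" if "v \<in> V" for v by (rule L13[OF that])
      show "\<not> lcol E V L1" by (rule nc1)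
    qed (use sym irr in blast)+
  qed
  show ?thesis
    by (rule small_obs_prop[OF L3 res[unfolded L1_def]])
qed

end

section \<open>Dominating cliques\<close>

locale p6_c5_free = p6_free +
  assumes no_C5: "\<And>a b c d e. a \<in> V \<Longrightarrow> b \<in> V \<Longrightarrow> c \<in> V \<Longrightarrow> d \<in> V \<Longrightarrow> e \<in> V
      \<Longrightarrow> E a b \<Longrightarrow> E b c \<Longrightarrow> E c d \<Longrightarrow> E d e \<Longrightarrow> E e a
      \<Longrightarrow> \<not> E a c \<Longrightarrow> \<not> E a d \<Longrightarrow> \<not> E b d \<Longrightarrow> \<not> E b e \<Longrightarrow> \<not> E c e \<Longrightarrow> False"
begin

definition reach2 :: "'a set \<Rightarrow> 'a set" where
  "reach2 S = {v \<in> V. v \<in> S \<or> (\<exists>s\<in>S. E v s) \<or> (\<exists>y\<in>V. \<exists>s\<in>S. E v y \<and> E y s)}"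

text \<open>The clique is chosen to reach as many vertices as possible within distance two and,
  among those, to be largest. If \<open>q\<close> is just out of reach, the vertex \<open>y\<close>
  between the clique and the neighbour \<open>n\<close> of \<open>q\<close> forms, together with its
  neighbours in the clique, a clique that reaches \<open>q\<close>. It must then miss some vertex
  \<open>v\<close> that \<open>S\<close> reaches, and the way to \<open>v\<close> leaves
  \<open>S\<close> at a vertex not adjacent to \<open>y\<close>. The two ways together contain an
  induced P6 or C5.\<close>

lemma dominating_clique:
  assumes conn: "conn E V" and "V \<noteq> {}"
  shows "\<exists>S\<subseteq>V. S \<noteq> {} \<and> (\<forall>x\<in>S. \<forall>y\<in>S. x \<noteq> y \<longrightarrow> E x y) \<and> (\<forall>v\<in>V - S. \<exists>s\<in>S. \<not> E v s) \<and> V \<subseteq> reach2 S"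
proof -
  define A where "A = {S. S \<subseteq> V \<and> S \<noteq> {} \<and> (\<forall>x\<in>S. \<forall>y\<in>S. x \<noteq> y \<longrightarrow> E x y)}"
  \<comment> \<open>The factor \<open>card V + 1\<close> makes the comparison lexicographic, because
    a clique has at most \<open>card V\<close> vertices.\<close>
  define f where "f S = card (reach2 S) * (card V + 1) + card S" for S
  have finA: "finite A" unfolding A_def using finV by simp
  obtain v0 where "v0 \<in> V" using \<open>V \<noteq> {}\<close> by blast
  then have "{v0} \<in> A" unfolding A_def by blast
  then have "f ` A \<noteq> {}" by blast
  then have "Max (f ` A) \<in> f ` A" using finA by (intro Max_in) auto
  then obtain S where S: "S \<in> A" "Max (f ` A) = f S" by blast
  have max: "f T \<le> f S" if "T \<in> A" for T
    using Max_ge[of "f ` A" "f T"] finA that S(2) by simp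
  have SA: "S \<subseteq> V" "S \<noteq> {}" "\<And>x y. x \<in> S \<Longrightarrow> y \<in> S \<Longrightarrow> x \<noteq> y \<Longrightarrow> E x y" using S(1) unfolding A_def by blast+
  have finr: "finite (reach2 T)" for T unfolding reach2_def using finV by simp
  have big: "\<not> card (reach2 S) < card (reach2 T)" if "T \<in> A" for T
  proof
    assume "card (reach2 S) < card (reach2 T)"
    then have "Suc (card (reach2 S)) * (card V + 1) \<le> card (reach2 T) * (card V + 1)" by (intro mult_right_mono) auto
    moreover have "card S \<le> card V" using SA(1) finV by (intro card_mono)
    ultimately have "f S < f T" unfolding f_def by simp
    then show False using max[OF that] by simp
  qed
  have maxi: "\<exists>s\<in>S. \<not> E v s" if v: "v \<in> V - S" for v
  proof (rule ccontr)
    assume "\<not> ?thesis"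
    then have "insert v S \<in> A" using v SA sym unfolding A_def by auto
    moreover have "reach2 S \<subseteq> reach2 (insert v S)" unfolding reach2_def by blast
    then have "card (reach2 S) \<le> card (reach2 (insert v S))" using finr by (intro card_mono)
    then have "card (reach2 S) * (card V + 1) \<le> card (reach2 (insert v S)) * (card V + 1)" by (rule mult_right_mono) simp
    moreover have "card (insert v S) = Suc (card S)" using v SA(1) finV finite_subset by (intro card_insert_disjoint) auto
    ultimately show False using max[of "insert v S"] unfolding f_def by simp
  qed
  have "V \<subseteq> reach2 S"
  proof (rule ccontr)
    assume n: "\<not> V \<subseteq> reach2 S"
    have "S \<subseteq> reach2 S" unfolding reach2_def using SA(1) by blast
    then have "reach2 S \<noteq> {}" "reach2 S \<subseteq> V" "reach2 S \<noteq> V" using SA(2) n unfolding reach2_def by blast+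
    then obtain n q where nq: "n \<in> reach2 S" "q \<in> V - reach2 S" "E n q"
      using conn unfolding conn_def by blast
    have qS: "\<not> E q s" "q \<notin> S" if "s \<in> S" for s using nq(2) that unfolding reach2_def by blast+
    have qq: "\<not> E q x" if "x \<in> V" "s \<in> S" "E x s" for x s using nq(2) that unfolding reach2_def by blast
    have nV: "n \<in> V" using nq(1) unfolding reach2_def by blast
    have nS: "\<not> E n s" if "s \<in> S" for s using qq[OF nV that] nq(3) sym by blast
    have "n \<notin> S" using qS(1) nq(3) sym by blast
    then obtain y s where y: "y \<in> V" "s \<in> S" "E n y" "E y s" using nq(1) nS unfolding reach2_def by blast
    have yS: "y \<notin> S" using y(3) nS by blast
    define T where "T = {s \<in> S. E y s}"
    have sT: "s \<in> T" using y unfolding T_def by blast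
    obtain c where c: "c \<in> S" "\<not> E y c" using maxi[of y] y(1) yS by blast
    have TA: "insert y T \<in> A" using y(1) SA sT sym unfolding A_def T_def by auto
    have qr: "q \<in> reach2 (insert y T)" using nq y nV sym unfolding reach2_def by blast
    have "\<not> reach2 S \<subseteq> reach2 (insert y T)"
    proof
      assume "reach2 S \<subseteq> reach2 (insert y T)"
      then have "reach2 S \<subset> reach2 (insert y T)" using qr nq(2) by blast
      then show False using big[OF TA] psubset_card_mono[OF finr] by blast
    qed
    then obtain v where v: "v \<in> reach2 S" "v \<notin> reach2 (insert y T)" by blast
    have vV: "v \<in> V" using v(1) unfolding reach2_def by blast
    have v1: "\<not> E v x" "v \<noteq> x" if "x \<in> insert y T" for x using v(2) vV that unfolding reach2_def by blast+
    have v2: "\<not> E x t" if "x \<in> V" "E v x" "t \<in> insert y T" for x t using v(2) vV that unfolding reach2_def by blast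
    have sV: "s \<in> V" using y(2) SA(1) by blast
    have vS: "v \<notin> S" using SA(3)[of v s] y(2) v1[of s] sT by blast
    have vnS: "\<not> E v u" if u: "u \<in> S" for u
    proof
      assume vu: "E v u"
      then have "u \<noteq> s" using v1(1)[of s] sT by blast
      then have "E u s" using SA(3) u y(2) by blast
      then show False using v2[of u s] vu u SA(1) sT by blast
    qed
    obtain mm d where md: "mm \<in> V" "d \<in> S" "E v mm" "E mm d" using v(1) vS vnS unfolding reach2_def by blast
    have dT: "d \<notin> T" using v2[OF md(1,3)] md(4) by blast
    then have yd: "\<not> E y d" using md(2) unfolding T_def by blast
    have sd: "E s d" using SA(3)[OF y(2) md(2)] dT sT by blast
    have mo: "\<not> E mm s" "\<not> E mm y" using v2[OF md(1,3)] sT by blast+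
    have dV: "d \<in> V" using md(2) SA(1) by blast
    have qm: "\<not> E q mm" using qq[OF md(1,2,4)] .
    have qy: "\<not> E q y" using qq[OF y(1,2,4)] .
    \<comment> \<open>The only possible chord between the two ways out of the clique; it closes a
      C5.\<close>
    have nm: "\<not> E n mm"
    proof
      assume "E n mm"
      then show False using no_C5[of n y s d mm] nV y(1,3,4) sV dV md(1,4) sd yd mo nS[OF y(2)] nS[OF md(2)] by (auto simp: Ecomm)
    qed
    show False
      using no_P6[of q n y s d mm] nq nV y(1,3,4) sV dV md(1,4) sd yd mo nS[OF y(2)] nS[OF md(2)] nm qm qy qS(1)[OF y(2)] qS(1)[OF md(2)]
      by (auto simp: Ecomm)
  qed
  then show ?thesis
    using SA maxi by (intro exI[of _ S] conjI ballI impI) simp_all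
qed

end

text \<open>The situation after the clique has received the injective colouring \<phi> and the
  colours have been propagated once: \<open>LN\<close> records what the neighbours have
  lost.\<close>

locale dom_clique = p6_c5_free +
  fixes S :: "'a set" and \<phi> :: "'a \<Rightarrow> nat" and L :: "'a \<Rightarrow> nat set"
  assumes SV: "S \<subseteq> V" and clique: "\<And>x y. x \<in> S \<Longrightarrow> y \<in> S \<Longrightarrow> x \<noteq> y \<Longrightarrow> E x y"
    and maxi: "\<And>v. v \<in> V \<Longrightarrow> v \<notin> S \<Longrightarrow> \<exists>s\<in>S. \<not> E v s" and dom: "V \<subseteq> reach2 S"
    and inj: "inj_on \<phi> S" and phi: "\<And>s. s \<in> S \<Longrightarrow> \<phi> s \<in> {1,2,3}"
    and L3: "\<And>v. v \<in> V \<Longrightarrow> L v \<subseteq> {1,2,3}"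
    and LS: "\<And>s. s \<in> S \<Longrightarrow> L s \<subseteq> {\<phi> s}"
    and LN: "\<And>s v. s \<in> S \<Longrightarrow> v \<in> V \<Longrightarrow> E v s \<Longrightarrow> \<phi> s \<notin> L v"
    and ncL: "\<not> lcol E V L"
begin

definition "N1 = {y \<in> V - S. \<exists>s\<in>S. E y s}"
definition "Z = V - S - N1"
text \<open>The private neighbours of \<open>s\<close>. Every other vertex of \<open>N1\<close> sees
  two colours of the clique and keeps at most one, so the undecided vertices of \<open>N1\<close>
  are all private.\<close>

definition "Y s = {y \<in> N1. \<forall>t\<in>S. E y t \<longleftrightarrow> t = s}"

lemma ZV: "z \<in> Z \<Longrightarrow> z \<in> V" and N1V: "y \<in> N1 \<Longrightarrow> y \<in> V" and N1Z: "y \<in> N1 \<Longrightarrow> y \<notin> Z" and YN: "y \<in> Y s \<Longrightarrow> y \<in> N1"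
  and N1S: "y \<in> N1 \<Longrightarrow> y \<notin> S" and Zn: "z \<in> Z \<Longrightarrow> z \<notin> S"
  unfolding Z_def N1_def Y_def by blast+

lemma V_cases: "v \<in> V \<Longrightarrow> v \<in> S \<or> v \<in> N1 \<or> v \<in> Z"
  unfolding Z_def by blast

lemma ZS: "z \<in> Z \<Longrightarrow> s \<in> S \<Longrightarrow> \<not> E z s" "z \<in> Z \<Longrightarrow> s \<in> S \<Longrightarrow> \<not> E s z"
  using sym unfolding Z_def N1_def by blast+

lemma Zdom: "z \<in> Z \<Longrightarrow> \<exists>y\<in>N1. E y z"
proof -
  assume z: "z \<in> Z"
  then obtain y s where "y \<in> V" "s \<in> S" "E z y" "E y s" using dom ZV[OF z] ZS(1)[OF z] Zn[OF z] unfolding reach2_def by blast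
  then show ?thesis using ZS(1)[OF z] sym unfolding N1_def by blast
qed

lemma phi_neq: "s \<in> S \<Longrightarrow> s' \<in> S \<Longrightarrow> s \<noteq> s' \<Longrightarrow> \<phi> s \<noteq> \<phi> s'"
  using inj unfolding inj_on_def by blast

lemma YE: "y \<in> Y s \<Longrightarrow> t \<in> S \<Longrightarrow> t \<noteq> s \<Longrightarrow> \<not> E y t" "y \<in> Y s \<Longrightarrow> s \<in> S \<Longrightarrow> E y s"
  unfolding Y_def by blast+

lemma N1_inout: "y \<in> N1 \<Longrightarrow> \<exists>s\<in>S. \<exists>s'\<in>S. E y s \<and> \<not> E y s' \<and> E s s'"
proof -
  assume y: "y \<in> N1"
  then obtain s where s: "s \<in> S" "E y s" unfolding N1_def by blast
  obtain s' where s': "s' \<in> S" "\<not> E y s'" using maxi[OF N1V[OF y] N1S[OF y]] by blast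
  have "s \<noteq> s'" using s s' by blast
  then show ?thesis using s s' clique by blast
qed

text \<open>Otherwise \<open>z y s s' y' z'\<close> is an induced P6, unless one of
  \<open>z\<close>, \<open>z'\<close> is adjacent to both \<open>y\<close> and \<open>y'\<close> and
  closes a C5 with the clique edge.\<close>

lemma cross:
  assumes "y \<in> N1" "y' \<in> N1" "s \<in> S" "s' \<in> S" "E y s" "\<not> E y' s" "E y' s'" "\<not> E y s'" "\<not> E y y'"
    and z: "z \<in> Z" "z' \<in> Z" "E y z" "E y' z'"
  shows "E z z'"
proof (rule ccontr)
  assume n: "\<not> E z z'"
  have "s \<noteq> s'" using assms by blast
  then have ss: "E s s'" using clique assms by blast
  have zs: "\<not> E z s" "\<not> E z s'" "\<not> E z' s" "\<not> E z' s'" using ZS z assms by blast+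
  have VV: "y \<in> V" "y' \<in> V" "z \<in> V" "z' \<in> V" "s \<in> V" "s' \<in> V" using N1V ZV SV assms by blast+
  have a1: "\<not> E y z'"
  proof
    assume "E y z'" then show False using no_C5[of s y z' y' s'] assms ss zs VV by (auto simp: Ecomm)
  qed
  have a2: "\<not> E y' z"
  proof
    assume "E y' z" then show False using no_C5[of s y z y' s'] assms ss zs VV by (auto simp: Ecomm)
  qed
  show False using no_P6[of z y s s' y' z'] assms ss zs VV n a1 a2 by (auto simp: Ecomm)
qed

text \<open>A split edge would give an induced P6 \<open>d' d n t s s'\<close> that ends with a
  clique edge at which only \<open>s\<close> is seen by \<open>t\<close>.\<close>

lemma unmixed:
  assumes "n \<in> Z" "d \<in> Z" "d' \<in> Z" "t \<in> N1" "E n t" "E n d" "E d d'" "\<not> E t d" "\<not> E t d'"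
  shows "E n d'"
proof (rule ccontr)
  assume nn: "\<not> E n d'"
  obtain s s' where s: "s \<in> S" "s' \<in> S" "E t s" "\<not> E t s'" "E s s'" using N1_inout[OF assms(4)] by blast
  have "\<not> E n s" "\<not> E n s'" "\<not> E d s" "\<not> E d s'" "\<not> E d' s" "\<not> E d' s'" using ZS assms s by blast+
  moreover have "n \<in> V" "d \<in> V" "d' \<in> V" "t \<in> V" "s \<in> V" "s' \<in> V" using ZV N1V SV assms s by blast+
  ultimately show False using no_P6[of d' d n t s s'] assms s nn by (auto simp: Ecomm)
qed

text \<open>Nonadjacent private neighbours of the same clique vertex are joined by the path
  \<open>w o1 w'\<close>. With a neighbour of \<open>z\<close> in front and \<open>x\<close> behind
  it becomes \<open>z' z w o1 w' x\<close>, and only an edge from \<open>z'\<close> to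
  \<open>x\<close> prevents this from being an induced P6.\<close>

lemma private_parts:
  assumes "o1 \<in> S" "w \<in> Y o1" "w' \<in> Y o1" "\<not> E w w'" and z: "z \<in> Z" "x \<in> Z" "z' \<in> Z"
    and e: "E w z" "\<not> E w' z" "E w' x" "\<not> E w x" "E z z'" "\<not> E w z'"
  shows "E z' x" and "\<not> E w' z'"
proof -
  have VV: "o1 \<in> V" "w \<in> V" "w' \<in> V" "z \<in> V" "x \<in> V" "z' \<in> V" using assms SV N1V YN ZV by blast+
  have os: "E w o1" "E w' o1" "\<not> E z o1" "\<not> E x o1" "\<not> E z' o1" using YE ZS assms by blast+
  have a: "\<not> E x z"
  proof
    assume "E x z" then show False using no_C5[of o1 w z x w'] assms(4) e os VV by (auto simp: Ecomm)
  qed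
  show b: "\<not> E w' z'"
  proof
    assume "E w' z'" then show False using no_C5[of o1 w z z' w'] assms(4) e os VV by (auto simp: Ecomm)
  qed
  show "E z' x"
  proof (rule ccontr)
    assume "\<not> E z' x"
    then show False using no_P6[of z' z w o1 w' x] assms(4) e os VV a b by (auto simp: Ecomm)
  qed
qed

lemma LN1: "y \<in> N1 \<Longrightarrow> \<exists>x\<in>{1,2,3}. x \<notin> L y"
proof -
  assume y: "y \<in> N1"
  then obtain s where "s \<in> S" "E y s" unfolding N1_def by blast
  then show ?thesis using LN phi N1V[OF y] by blast
qed

lemma single_in:
  fixes A :: "nat set"
  assumes "A \<subseteq> {1,2,3}" "\<exists>x. A \<subseteq> {x}" "a \<in> {1,2,3}" "a \<notin> A"
  shows "\<exists>x\<in>{1,2,3}. x \<noteq> a \<and> A \<subseteq> {x}"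
proof (cases "A = {}")
  case True
  have "\<exists>x\<in>{1,2,3}. x \<noteq> a" using assms(3) by auto
  then show ?thesis using True by blast
next
  case False
  then obtain x where x: "A = {x}" using assms(2) by blast
  then have "x \<in> {1,2,3}" "x \<noteq> a" using assms(1,4) by (simp_all only: insert_subset singletonD) auto
  then show ?thesis using x by (intro bexI[of _ x]) simp_all
qed

lemma single_of_two_missing:
  fixes A :: "nat set"
  assumes "A \<subseteq> {1,2,3}" "p \<in> {1,2,3}" "q \<in> {1,2,3}" "p \<noteq> q" "p \<notin> A" "q \<notin> A"
  shows "\<exists>x. A \<subseteq> {x} \<and> x \<in> {1,2,3} \<and> x \<noteq> p \<and> x \<noteq> q"
proof -
  obtain e where e: "e \<in> {1,2,3}" "e \<noteq> p" "e \<noteq> q" and e3: "\<forall>c\<in>{1,2,3}. c = p \<or> c = q \<or> c = e"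
    by (rule third_colour[OF assms(2-4)])
  have "c = e" if "c \<in> A" for c
  proof -
    have "c = p \<or> c = q \<or> c = e" by (rule bspec[OF e3 subsetD[OF assms(1) that]])
    then show ?thesis using assms(5,6) that by auto
  qed
  then show ?thesis using e by blast
qed

lemma not_Y_single:
  assumes "t \<in> N1" "o1 \<in> S" "E t o1" "t \<notin> Y o1"
  shows "\<exists>x. L t \<subseteq> {x} \<and> x \<in> {1,2,3} \<and> x \<noteq> \<phi> o1"
proof -
  obtain p where p: "p \<in> S" "p \<noteq> o1" "E t p" using assms unfolding Y_def by blast
  have tV: "t \<in> V" by (rule N1V[OF assms(1)])
  have "\<phi> o1 \<noteq> \<phi> p" using phi_neq[OF assms(2) p(1)] p(2) by blast
  from single_of_two_missing[OF L3[OF tV] phi[OF assms(2)] phi[OF p(1)] this LN[OF assms(2) tV assms(3)] LN[OF p(1) tV p(3)]]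
  show ?thesis by blast
qed

lemma all_hit:
  assumes M: "\<And>v. v \<in> V \<Longrightarrow> M v \<subseteq> L v"
    and Z2: "\<And>z. z \<in> Z \<Longrightarrow> \<exists>x\<in>{1,2,3}. x \<notin> M z"
  shows "small_obs E K0 V M"
proof (rule T2V)
  show "M v \<subseteq> {1,2,3}" if "v \<in> V" for v using M[OF that] L3[OF that] by (rule subset_trans)
  show "\<not> lcol E V M" using ncL lcol_mono[of E V M V L] M by blast
  show "card (M v) \<le> 2" if v: "v \<in> V" for v
  proof -
    from V_cases[OF v] consider "v \<in> S" | "v \<in> N1" | "v \<in> Z" by blast
    then show ?thesis
    proof cases
      case 1
      then have "M v \<subseteq> {\<phi> v}" using M[OF v] LS by blast
      then have "card (M v) \<le> card {\<phi> v}" by (intro card_mono) auto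
      then show ?thesis by simp
    next
      case 2
      then obtain x where "x \<in> {1,2,3}" "x \<notin> L v" using LN1 by blast
      then show ?thesis using card_le_2_of_missing[of "M v" x] M[OF v] L3[OF v] by blast
    next
      case 3
      then obtain x where "x \<in> {1,2,3}" "x \<notin> M v" using Z2 by blast
      then show ?thesis using card_le_2_of_missing[of "M v" x] M[OF v] L3[OF v] by blast
    qed
  qed
qed simp

lemma prop_missing:
  assumes "u \<in> V" "E z u" "M u \<subseteq> {x}" shows "x \<notin> prop_lists E V M z"
  using prop_listsD[of x E V M z u] assms by blast

lemma prop_missing':
  assumes "u \<in> V" "E z u" "M u \<subseteq> {1,2,3}" "\<exists>x. M u \<subseteq> {x}"
  shows "\<exists>x\<in>{1,2,3}. x \<notin> prop_lists E V M z"
proof (cases "M u = {}")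
  case True
  then have "1 \<notin> prop_lists E V M z" using prop_missing[OF assms(1,2), of M 1] by simp
  then show ?thesis by blast
next
  case False
  then obtain x where "M u = {x}" using assms(4) by blast
  then show ?thesis using prop_missing[OF assms(1,2), of M x] assms(3) by blast
qed

text \<open>Let \<open>z\<close> have a neighbour \<open>t\<close> that is private to
  \<open>p\<close>. If \<open>t\<close> misses \<open>y\<close> or \<open>y'\<close>, whichever is
  attached to a clique vertex other than \<open>p\<close>, then \<open>cross\<close> makes
  \<open>z\<close> a neighbour of \<open>d\<close> or \<open>d'\<close>. Otherwise, if
  \<open>p\<close> is \<open>s\<close> or \<open>s'\<close>, this adjacency takes \<open>k\<close>
  away from \<open>t\<close>, which keeps at most one colour; if \<open>p\<close> is a third clique
  vertex, adjacency to both would close a C5. Either way \<open>z\<close> loses a colour.\<close>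

lemma double_colour:
  assumes M: "\<And>v. v \<in> V \<Longrightarrow> M v \<subseteq> L v"
    and s: "s \<in> S" "s' \<in> S" "s \<noteq> s'" and k: "k \<in> {1,2,3}" "k \<noteq> \<phi> s" "k \<noteq> \<phi> s'"
    and y: "y \<in> Y s" "y' \<in> Y s'" "M y \<subseteq> {k}" "M y' \<subseteq> {k}" "\<not> E y y'"
    and d: "d \<in> Z" "d' \<in> Z" "E y d" "E y' d'" "\<exists>x. M d \<subseteq> {x}" "\<exists>x. M d' \<subseteq> {x}"
  shows "small_obs E (K0 * 16) V M"
proof -
  let ?M1 = "prop_lists E V M" let ?M2 = "prop_lists E V ?M1"
  have M1: "?M1 v \<subseteq> M v" for v by (rule prop_lists_sub)
  have M3: "M v \<subseteq> {1,2,3}" if "v \<in> V" for v using M[OF that] L3[OF that] by (rule subset_trans)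
  have M13: "?M1 v \<subseteq> {1,2,3}" if "v \<in> V" for v using M1 M3[OF that] by (rule subset_trans)
  have VV: "y \<in> V" "y' \<in> V" "d \<in> V" "d' \<in> V" "s \<in> V" "s' \<in> V" "y \<in> N1" "y' \<in> N1"
    using y d s YN N1V ZV SV by blast+
  have ys: "E y s" "\<not> E y s'" "E y' s'" "\<not> E y' s" using YE y s by blast+
  have ss: "E s s'" using clique s by blast
  have hit: "\<exists>x\<in>{1,2,3}. x \<notin> ?M2 z" if "u \<in> V" "E z u" "\<exists>x. ?M1 u \<subseteq> {x}" for z u
    by (rule prop_missing'[where M="?M1", OF that(1,2) M13[OF that(1)] that(3)])
  have "\<exists>x\<in>{1,2,3}. x \<notin> ?M2 z" if z: "z \<in> Z" for z
  proof -
    obtain t where t: "t \<in> N1" "E t z" using Zdom[OF z] by blast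
    have tV: "t \<in> V" using t N1V by blast
    have hd: "\<exists>x\<in>{1,2,3}. x \<notin> ?M2 z" if "E z d" using hit[OF VV(3) that] d(5) M1[of d] by (meson subset_trans)
    have hd': "\<exists>x\<in>{1,2,3}. x \<notin> ?M2 z" if "E z d'" using hit[OF VV(4) that] d(6) M1[of d'] by (meson subset_trans)
    have ht: "\<exists>x\<in>{1,2,3}. x \<notin> ?M2 z" if "\<exists>x. ?M1 t \<subseteq> {x}" using hit[OF tV sym[OF t(2)] that] .
    obtain p where p: "p \<in> S" "E t p" using t(1) unfolding N1_def by blast
    show ?thesis
    proof (cases "t \<in> Y p")
      case False
      then obtain x where "L t \<subseteq> {x}" using not_Y_single[OF t(1) p] by blast
      then have "?M1 t \<subseteq> {x}" using M1[of t] M[OF tV] by blast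
      then show ?thesis using ht by blast
    next
      case True
      have two: "\<exists>x. ?M1 t \<subseteq> {x}" if "k \<notin> ?M1 t" "k \<noteq> \<phi> p"
      proof -
        have "\<phi> p \<notin> ?M1 t" using LN[OF p(1) tV p(2)] M1[of t] M[OF tV] by blast
        then show ?thesis using single_of_two_missing[OF M13[OF tV] k(1) phi[OF p(1)] that(2,1)] by blast
      qed
      consider "p = s" | "p = s'" | "p \<noteq> s" "p \<noteq> s'" by blast
      then show ?thesis
      proof cases
        case 1
        show ?thesis
        proof (cases "E t y'")
          case True
          have "k \<notin> ?M1 t" by (rule prop_missing[where M=M, OF VV(2) True y(4)])
          then show ?thesis using ht two k(2) 1 by blast
        next
          case False
          have "E z d'"
            by (rule cross[OF t(1) VV(8) s(1,2) _ ys(4) ys(3) _ False z d(2) t(2) d(4)])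
              (use p 1 YE(1)[OF \<open>t \<in> Y p\<close> s(2)] s(3) in auto)
          then show ?thesis by (rule hd')
        qed
      next
        case 2
        show ?thesis
        proof (cases "E t y")
          case True
          have "k \<notin> ?M1 t" by (rule prop_missing[where M=M, OF VV(1) True y(3)])
          then show ?thesis using ht two k(3) 2 by blast
        next
          case False
          have "E z d"
            by (rule cross[OF t(1) VV(7) s(2,1) _ ys(2) ys(1) _ False z d(1) t(2) d(3)])
              (use p 2 YE(1)[OF \<open>t \<in> Y p\<close> s(1)] s(3) in auto)
          then show ?thesis by (rule hd)
        qed
      next
        case 3
        have tn: "\<not> E t s" "\<not> E t s'" using YE(1)[OF \<open>t \<in> Y p\<close>] s 3 by blast+
        have yn: "\<not> E y p" "\<not> E y' p" using YE(1) y p 3 by blast+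
        consider "\<not> E t y" | "\<not> E t y'" | "E t y" "E t y'" by blast
        then show ?thesis
        proof cases
          case 1
          have "E z d" by (rule cross[OF t(1) VV(7) p(1) s(1) p(2) yn(1) ys(1) tn(1) 1 z d(1) t(2) d(3)])
          then show ?thesis by (rule hd)
        next
          case 2
          have "E z d'" by (rule cross[OF t(1) VV(8) p(1) s(2) p(2) yn(2) ys(3) tn(2) 2 z d(2) t(2) d(4)])
          then show ?thesis by (rule hd')
        next
          case 3
          then show ?thesis using no_C5[of y t y' s' s] VV tV ys ss tn y(5) by (auto simp: Ecomm)
        qed
      qed
    qed
  qed
  then have "small_obs E K0 V ?M2" by (intro all_hit) (use M prop_lists_sub2[of E V M] in blast)+
  then have "small_obs E (K0 * 4) V ?M1" by (rule small_obs_prop[rotated]) (rule M13)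
  then have "small_obs E (K0 * 4 * 4) V M" by (rule small_obs_prop[rotated]) (rule M3)
  then show ?thesis by (rule small_obs_mono) simp_all
qed

end

section \<open>Vertices attached to one vertex of the clique\<close>

text \<open>All vertices of \<open>N1\<close> that see \<open>Z\<close> but not \<open>o1\<close>
  are confined to the colour of \<open>o1\<close>, and those that see \<open>o1\<close> lack this
  colour. Hence only the private neighbours of \<open>o1\<close> are undecided, between the two
  other colours.\<close>

locale star_centre = dom_clique +
  fixes o1 :: 'a and M :: "'a \<Rightarrow> nat set"
  assumes oS: "o1 \<in> S" and MsubL: "\<And>v. v \<in> V \<Longrightarrow> M v \<subseteq> L v"
    and out: "\<And>t z. t \<in> N1 \<Longrightarrow> z \<in> Z \<Longrightarrow> E t z \<Longrightarrow> \<not> E t o1 \<Longrightarrow> M t \<subseteq> {\<phi> o1}"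
begin

abbreviation "a0 \<equiv> \<phi> o1"

lemma a0: "a0 \<in> {1,2,3}" by (rule phi[OF oS])

lemma M3: "v \<in> V \<Longrightarrow> M v \<subseteq> {1,2,3}"
  using MsubL L3 by (rule subset_trans)

definition "T1 = {t \<in> N1. t \<notin> Y o1 \<and> E t o1}"

lemma T1_single: "t \<in> T1 \<Longrightarrow> \<exists>x\<in>{1,2,3}. x \<noteq> a0 \<and> M t \<subseteq> {x}"
proof -
  assume t: "t \<in> T1"
  then have tn: "t \<in> N1" "t \<notin> Y o1" "E t o1" unfolding T1_def by blast+
  obtain x where x: "L t \<subseteq> {x}" "x \<in> {1,2,3}" "x \<noteq> a0" using not_Y_single[OF tn(1) oS tn(3,2)] by blast
  have "M t \<subseteq> {x}" using MsubL[OF N1V[OF tn(1)]] x(1) by (rule subset_trans)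
  then show ?thesis using x by blast
qed

lemma Ya: "w \<in> Y o1 \<Longrightarrow> a0 \<notin> M w"
  using LN[OF oS _ YE(2)[OF _ oS]] MsubL N1V YN by blast

end

text \<open>\<open>G\<close> and \<open>H\<close> hold the vertices whose colours have been
  guessed.\<close>

locale star_guess = star_centre +
  fixes G :: "'a set" and H :: "'a set"
  assumes GY: "G \<subseteq> Y o1" and HZ: "H \<subseteq> Z" and HG: "\<And>h. h \<in> H \<Longrightarrow> \<exists>w\<in>G. E h w"
    and Gs: "\<And>g. g \<in> G \<union> H \<Longrightarrow> \<exists>x. M g \<subseteq> {x}"
begin

text \<open>The private neighbours of \<open>o1\<close> left undecided by the guesses and by
  \<open>T1\<close>. Vertices of \<open>Z\<close> outside \<open>U\<close> lose a colour within two
  propagations. Those in \<open>U\<close> outside \<open>U'\<close> lose one in a third, through a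
  vertex of \<open>Yu\<close> that is adjacent to a decided private neighbour.\<close>

definition "Yu = {w \<in> Y o1. w \<notin> G \<and> (\<forall>g\<in>G \<union> T1. \<not> E w g)}"
definition "U = {z \<in> Z. z \<notin> H \<and> (\<forall>h\<in>H. \<not> E z h) \<and> (\<forall>t\<in>N1. E t z \<longrightarrow> t \<in> Yu)}"
definition "U' = {z \<in> U. \<forall>y\<in>Yu. E y z \<longrightarrow> (\<forall>r\<in>Y o1 - Yu. \<not> E y r)}"
definition "Yq = {y \<in> Yu. \<exists>e\<in>U'. E y e}"
text \<open>The neighbours of \<open>U'\<close> in \<open>Z\<close> that may still use
  \<open>a0\<close>, because a decided neighbour of theirs sees \<open>o1\<close> and therefore has
  another colour. They stand in the way of applying \<open>small_obs_modules\<close> with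
  \<open>a0\<close> as the missing colour; \<open>Q\<close> is the part of \<open>U'\<close> away
  from them.\<close>

definition "Ns = {n \<in> Z - U. (\<exists>d\<in>U'. E n d) \<and> (\<exists>t\<in>N1 - Yu. E n t \<and> E t o1)}"
definition "Q = {z \<in> U'. \<forall>n\<in>Ns. \<not> E n z}"

lemma UZ: "z \<in> U \<Longrightarrow> z \<in> Z" and U'U: "z \<in> U' \<Longrightarrow> z \<in> U" and QU': "z \<in> Q \<Longrightarrow> z \<in> U'"
  and YuY: "y \<in> Yu \<Longrightarrow> y \<in> Y o1" and NsZ: "n \<in> Ns \<Longrightarrow> n \<in> Z" and YqYu: "y \<in> Yq \<Longrightarrow> y \<in> Yu"
  unfolding U_def U'_def Q_def Yu_def Ns_def Yq_def by blast+

lemma UN1: "z \<in> U \<Longrightarrow> t \<in> N1 \<Longrightarrow> E t z \<Longrightarrow> t \<in> Yu"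
  unfolding U_def by blast

lemma UH: "z \<in> U \<Longrightarrow> h \<in> H \<Longrightarrow> \<not> E z h"
  unfolding U_def by blast

lemma G_facts: "g \<in> G \<Longrightarrow> g \<in> N1 \<and> g \<notin> Yu \<and> g \<in> V \<and> E g o1"
  using GY YN N1V YE(2)[OF _ oS] unfolding Yu_def by blast

text \<open>Otherwise \<open>n\<close> is outside \<open>U\<close> only because of some
  \<open>h\<close> in \<open>H\<close>, whose neighbour \<open>w\<close> in \<open>G\<close> leads
  to the clique: \<open>d n h w o1 s\<close> is then an induced P6.\<close>

lemma outer_neighbour:
  assumes n: "n \<in> Z" "n \<notin> U" and d: "d \<in> U" "E n d"
  shows "\<exists>t\<in>N1 - Yu. E n t"
proof (rule ccontr)
  assume no: "\<not> ?thesis"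
  then have all: "\<And>t. t \<in> N1 \<Longrightarrow> E n t \<Longrightarrow> t \<in> Yu" by blast
  have "n \<notin> H"
  proof
    assume "n \<in> H"
    then obtain w where "w \<in> G" "E n w" using HG by blast
    then show False using all G_facts by blast
  qed
  then obtain h where h: "h \<in> H" "E n h" using n all sym unfolding U_def by blast
  obtain w where w: "w \<in> G" "E h w" using HG[OF h(1)] by blast
  note wf = G_facts[OF w(1)]
  have nw: "\<not> E n w" using all[of w] wf by blast
  have dw: "\<not> E d w" using UN1[OF d(1), of w] wf sym by blast
  have dh: "\<not> E d h" by (rule UH[OF d(1) h(1)])
  have hZ: "h \<in> Z" using h HZ by blast
  have wY: "w \<in> Y o1" using w GY by blast
  obtain s where s: "s \<in> S" "\<not> E w s" using maxi[of w] wf N1S by blast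
  have so: "s \<noteq> o1" using s wf by blast
  have os: "E o1 s" using clique[OF oS s(1)] so by blast
  have "\<not> E d o1" "\<not> E n o1" "\<not> E h o1" "\<not> E d s" "\<not> E n s" "\<not> E h s" using ZS(1) UZ[OF d(1)] n(1) hZ oS s by blast+
  moreover have "d \<in> V" "n \<in> V" "h \<in> V" "w \<in> V" "o1 \<in> V" "s \<in> V" using ZV UZ[OF d(1)] n(1) hZ wf SV oS s by blast+
  ultimately show False
    using no_P6[of d n h w o1 s] d(2) h(2) w(2) wf os nw dw dh s(2) by (auto simp: Ecomm)
qed

lemma outer_unmixed:
  assumes n: "n \<in> Z" "n \<notin> U" and d: "d \<in> U" "d' \<in> U" "E d d'" "E n d"
  shows "E n d'"
proof -
  obtain t where t: "t \<in> N1 - Yu" "E n t" using outer_neighbour[OF n d(1,4)] by blast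
  have td: "\<not> E t d" "\<not> E t d'" using UN1 d t by blast+
  show ?thesis
    by (rule unmixed[of n d d' t]) (use n d t td UZ in auto)
qed

end

text \<open>The guesses in \<open>star_case\<close> are made to secure this homogeneity.\<close>

locale star_hom = star_guess +
  assumes hom: "\<And>w d d'. w \<in> Yu \<Longrightarrow> d \<in> U \<Longrightarrow> d' \<in> U \<Longrightarrow> E d d' \<Longrightarrow> E w d \<Longrightarrow> E w d'"
begin

text \<open>Otherwise \<open>d n t o1 y e\<close> is an induced P6, the possible chords from
  \<open>y\<close> to \<open>d\<close> and from \<open>n\<close> to \<open>e\<close> closing a C5.
  Completeness means that no colour occurs both in \<open>Ns\<close> and in
  \<open>Yq\<close>.\<close>

lemma Ns_complete:
  assumes n: "n \<in> Ns" and y: "y \<in> Yq"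
  shows "E y n"
proof (rule ccontr)
  assume yn: "\<not> E y n"
  obtain d t where d: "d \<in> U'" "E n d" and t: "t \<in> N1 - Yu" "E n t" "E t o1" and nZ: "n \<in> Z"
    using n unfolding Ns_def by blast
  obtain e where e: "e \<in> U'" "E y e" and yu: "y \<in> Yu" using y unfolding Yq_def by blast
  have yY: "y \<in> Y o1" by (rule YuY[OF yu])
  have yo: "E y o1" by (rule YE(2)[OF yY oS])
  have yt: "\<not> E y t"
  proof (cases "t \<in> Y o1")
    case True
    then show ?thesis using e yu t unfolding U'_def by blast
  next
    case False
    then have "t \<in> T1" using t unfolding T1_def by blast
    then show ?thesis using yu unfolding Yu_def by blast
  qed
  have dU: "d \<in> U" "e \<in> U" "d \<in> Z" "e \<in> Z" using d e U'U UZ by blast+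
  have td: "\<not> E t d" "\<not> E t e" using UN1 dU t by blast+
  have zo: "\<not> E d o1" "\<not> E e o1" "\<not> E n o1" using ZS(1) dU nZ oS by blast+
  have VV: "d \<in> V" "e \<in> V" "n \<in> V" "t \<in> V" "o1 \<in> V" "y \<in> V" using ZV N1V YN SV dU nZ t yY oS by blast+
  have yd: "\<not> E y d"
  proof
    assume "E y d" then show False using no_C5[of o1 y d n t] yo d t yn yt td zo VV by (auto simp: Ecomm)
  qed
  have ne: "\<not> E n e"
  proof
    assume "E n e" then show False using no_C5[of o1 y e n t] yo e t yn yt td zo VV by (auto simp: Ecomm)
  qed
  have de: "\<not> E d e" using hom[OF yu dU(2,1) _ e(2)] yd sym by blast
  show False using no_P6[of d n t o1 y e] yo d e t yn yt td zo VV yd ne de by (auto simp: Ecomm)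
qed

text \<open>Three propagations take a colour from every vertex of \<open>Z\<close> outside
  \<open>U'\<close>. By \<open>Ns_complete\<close>, each of the two colours other than
  \<open>a0\<close> is absent from \<open>Yq\<close> or from \<open>Ns\<close>. If one is absent
  from \<open>Yq\<close>, these vertices keep one colour and all of \<open>U'\<close> loses a
  colour. If both are absent from \<open>Ns\<close>, that set is confined to \<open>a0\<close>, so
  its neighbours lose \<open>a0\<close>, and \<open>small_obs_modules\<close> applies to
  \<open>Q\<close>, whose outside neighbours all avoid \<open>a0\<close>.\<close>

lemma star_small_obs: "small_obs E (K0 * 12 * 64) V M"
proof -
  let ?M1 = "prop_lists E V M"
  let ?M2 = "prop_lists E V ?M1"
  let ?M3 = "prop_lists E V ?M2"
  have M1: "?M1 v \<subseteq> M v" for v by (rule prop_lists_sub)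
  have M2: "?M2 v \<subseteq> ?M1 v" for v by (rule prop_lists_sub)
  have M3': "?M3 v \<subseteq> ?M2 v" for v by (rule prop_lists_sub)
  have M2M: "?M2 v \<subseteq> M v" for v by (rule prop_lists_sub2)
  have M3M: "?M3 v \<subseteq> M v" for v using M3' M2M by (rule subset_trans)
  have M13: "?M1 v \<subseteq> {1,2,3}" if "v \<in> V" for v using M1 M3[OF that] by (rule subset_trans)
  have M23: "?M2 v \<subseteq> {1,2,3}" if "v \<in> V" for v using M2M M3[OF that] by (rule subset_trans)
  have M33: "?M3 v \<subseteq> {1,2,3}" if "v \<in> V" for v using M3M M3[OF that] by (rule subset_trans)
  have M3L: "?M3 v \<subseteq> L v" if "v \<in> V" for v using M3M MsubL[OF that] by (rule subset_trans)
  have YV: "y \<in> V" if "y \<in> Y o1" for y using N1V[OF YN[OF that]] .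
  have Yr: "\<exists>x\<in>{1,2,3}. x \<noteq> a0 \<and> ?M1 r \<subseteq> {x}" if r: "r \<in> Y o1" "r \<notin> Yu" for r
  proof -
    have ar: "a0 \<notin> ?M1 r" using Ya[OF r(1)] M1[of r] by blast
    have rV: "r \<in> V" by (rule YV[OF r(1)])
    have "\<exists>x. ?M1 r \<subseteq> {x}"
    proof (cases "r \<in> G")
      case True
      then obtain x where "M r \<subseteq> {x}" using Gs by blast
      then have "?M1 r \<subseteq> {x}" by (rule subset_trans[OF M1])
      then show ?thesis by blast
    next
      case False
      then obtain g where g: "g \<in> G \<union> T1" "E r g" using r unfolding Yu_def by blast
      have "\<exists>x\<in>{1,2,3}. x \<noteq> a0 \<and> M g \<subseteq> {x}"
      proof (cases "g \<in> G")
        case True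
        then have gY: "g \<in> Y o1" using GY by blast
        show ?thesis
          by (rule single_in[OF M3[OF YV[OF gY]] _ a0 Ya[OF gY]]) (use Gs True in blast)
      next
        case False then show ?thesis using g T1_single by blast
      qed
      then obtain x where x: "x \<in> {1,2,3}" "x \<noteq> a0" "M g \<subseteq> {x}" by blast
      have gV: "g \<in> V" using g(1) GY YV N1V unfolding T1_def by blast
      have "x \<notin> ?M1 r" by (rule prop_missing[where M=M, OF gV g(2) x(3)])
      then show ?thesis using single_of_two_missing[OF M13[OF rV] x(1) a0 x(2) _ ar] by blast
    qed
    then show ?thesis by (rule single_in[OF M13[OF rV] _ a0 ar])
  qed
  have tsing: "\<exists>x. ?M1 t \<subseteq> {x}" if t: "t \<in> N1" "t \<notin> Yu" "z \<in> Z" "E t z" for t z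
  proof (cases "t \<in> Y o1")
    case True then show ?thesis using Yr t by blast
  next
    case False
    show ?thesis
    proof (cases "E t o1")
      case True
      then have "t \<in> T1" using False t unfolding T1_def by blast
      then obtain x where "M t \<subseteq> {x}" using T1_single by blast
      then have "?M1 t \<subseteq> {x}" by (rule subset_trans[OF M1])
      then show ?thesis by blast
    next
      case nE: False
      have "M t \<subseteq> {a0}" by (rule out[OF t(1,3,4) nE])
      then have "?M1 t \<subseteq> {a0}" by (rule subset_trans[OF M1])
      then show ?thesis by blast
    qed
  qed
  have ZU: "\<exists>x\<in>{1,2,3}. x \<notin> ?M2 z" if z: "z \<in> Z" "z \<notin> U" for z
  proof -
    have zV: "z \<in> V" by (rule ZV[OF z(1)])
    consider "z \<in> H" | h where "h \<in> H" "E z h" | t where "t \<in> N1" "E t z" "t \<notin> Yu" using z unfolding U_def by blast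
    then show ?thesis
    proof cases
      case 1
      then obtain x where "M z \<subseteq> {x}" using Gs by blast
      then have s: "?M2 z \<subseteq> {x}" by (rule subset_trans[OF M2M])
      have "\<exists>c\<in>{1,2,3::nat}. c \<noteq> x" by (rule bexI[of _ "if x = 1 then 2 else 1"]) auto
      then show ?thesis using s by blast
    next
      case 2
      have hV: "h \<in> V" using 2 HZ ZV by blast
      have "\<exists>x. M h \<subseteq> {x}" using Gs 2 by blast
      from prop_missing'[where M=M, OF hV 2(2) M3[OF hV] this] show ?thesis using M2[of z] by blast
    next
      case 3
      have "\<exists>x. ?M1 t \<subseteq> {x}" by (rule tsing[OF 3(1,3) z(1) 3(2)])
      from prop_missing'[where M="?M1", OF N1V[OF 3(1)] sym[OF 3(2)] M13[OF N1V[OF 3(1)]] this] show ?thesis .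
    qed
  qed
  have UU: "\<exists>x\<in>{1,2,3}. x \<notin> ?M3 z" if z: "z \<in> U" "z \<notin> U'" for z
  proof -
    obtain y r where y: "y \<in> Yu" "E y z" "r \<in> Y o1" "r \<notin> Yu" "E y r" using z unfolding U'_def by blast
    obtain x where x: "x \<in> {1,2,3}" "x \<noteq> a0" "?M1 r \<subseteq> {x}" using Yr[OF y(3,4)] by blast
    have yV: "y \<in> V" by (rule YV[OF YuY[OF y(1)]])
    have "x \<notin> ?M2 y" by (rule prop_missing[where M="?M1", OF YV[OF y(3)] y(5) x(3)])
    moreover have "a0 \<notin> ?M2 y" using Ya[OF YuY[OF y(1)]] M2M[of y] by blast
    ultimately have "\<exists>c. ?M2 y \<subseteq> {c}" using single_of_two_missing[OF M23[OF yV] x(1) a0 x(2)] by blast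
    from prop_missing'[where M="?M2", OF yV sym[OF y(2)] M23[OF yV] this] show ?thesis .
  qed
  obtain b where b: "b \<in> {1,2,3}" "b \<noteq> a0"
  proof -
    have "\<exists>b\<in>{1,2,3::nat}. b \<noteq> a0" by (rule bexI[of _ "if a0 = 1 then 2 else 1"]) auto
    then show ?thesis using that by blast
  qed
  obtain c where c: "c \<in> {1,2,3}" "c \<noteq> a0" "c \<noteq> b" and abc: "\<forall>x\<in>{1,2,3}. x = a0 \<or> x = b \<or> x = c"
    by (rule third_colour[OF a0 b(1) b(2)[symmetric]])
  \<comment> \<open>The decided neighbour that puts a vertex into \<open>Ns\<close> sees
    \<open>o1\<close>, so the colour it takes away is b or c.\<close>
  have Nsx: "b \<notin> ?M3 n \<or> c \<notin> ?M3 n" if n: "n \<in> Ns" for n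
  proof -
    obtain t where t: "t \<in> N1 - Yu" "E n t" "E t o1" using n unfolding Ns_def by blast
    have tV: "t \<in> V" using N1V t by blast
    have "\<exists>x\<in>{1,2,3}. x \<noteq> a0 \<and> ?M1 t \<subseteq> {x}"
    proof (cases "t \<in> Y o1")
      case True then show ?thesis using Yr t by blast
    next
      case False
      then have "t \<in> T1" using t unfolding T1_def by blast
      then obtain x where "x \<in> {1,2,3}" "x \<noteq> a0" "M t \<subseteq> {x}" using T1_single by blast
      then show ?thesis using M1[of t] by (intro bexI[of _ x]) auto
    qed
    then obtain x where x: "x \<in> {1,2,3}" "x \<noteq> a0" "?M1 t \<subseteq> {x}" by blast
    have "x \<notin> ?M2 n" by (rule prop_missing[where M="?M1", OF tV t(2) x(3)])
    then have "x \<notin> ?M3 n" using M3'[of n] by blast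
    moreover have "x = b \<or> x = c" using bspec[OF abc x(1)] x(2) by blast
    ultimately show ?thesis by blast
  qed
  have Uq: "\<exists>y\<in>Yq. E y z" if zU: "z \<in> U'" for z
  proof -
    obtain y where y: "y \<in> N1" "E y z" using Zdom[OF UZ[OF U'U[OF zU]]] by blast
    then have "y \<in> Yu" using UN1[OF U'U[OF zU]] by blast
    then show ?thesis using y zU unfolding Yq_def by blast
  qed
  have mono: "small_obs E K0 V (prop_lists E V M') \<Longrightarrow> small_obs E (K0 * 4) V M'"
    if "\<And>v. v \<in> V \<Longrightarrow> M' v \<subseteq> ?M3 v" for M'
    by (rule small_obs_prop[rotated]) (use that M33 in blast)+
  have Yq_case: "small_obs E (K0 * 4) V M'"
    if sub: "\<And>v. v \<in> V \<Longrightarrow> M' v \<subseteq> ?M3 v" and x: "x \<in> {1,2,3}" "x \<noteq> a0" and av: "\<And>y. y \<in> Yq \<Longrightarrow> x \<notin> M' y" for M' x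
  proof (rule mono[OF sub])
    show "small_obs E K0 V (prop_lists E V M')"
    proof (rule all_hit)
      fix v assume v: "v \<in> V"
      have "M' v \<subseteq> L v" using sub[OF v] M3L[OF v] by (rule subset_trans)
      then show "prop_lists E V M' v \<subseteq> L v" by (rule subset_trans[OF prop_lists_sub])
    next
      fix z assume z: "z \<in> Z"
      have s: "prop_lists E V M' z \<subseteq> ?M3 z" using sub[OF ZV[OF z]] by (rule subset_trans[OF prop_lists_sub])
      show "\<exists>c\<in>{1,2,3}. c \<notin> prop_lists E V M' z"
      proof (cases "z \<in> U'")
        case True
        then obtain y where y: "y \<in> Yq" "E y z" using Uq by blast
        have yY: "y \<in> Y o1" by (rule YuY[OF YqYu[OF y(1)]])
        have yV: "y \<in> V" by (rule YV[OF yY])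
        have M'3: "M' y \<subseteq> {1,2,3}" using sub[OF yV] M33[OF yV] by (rule subset_trans)
        have "a0 \<notin> M' y" using Ya[OF yY] sub[OF yV] M3M[of y] by blast
        then have "\<exists>c. M' y \<subseteq> {c}" using single_of_two_missing[OF M'3 x(1) a0 x(2) av[OF y(1)]] by blast
        from prop_missing'[where M=M', OF yV sym[OF y(2)] M'3 this] show ?thesis .
      next
        case False
        have "\<exists>c\<in>{1,2,3}. c \<notin> ?M3 z"
        proof (cases "z \<in> U")
          case True then show ?thesis using UU False by blast
        next
          case nU: False
          then show ?thesis using ZU[OF z nU] M3'[of z] by blast
        qed
        then show ?thesis using s by blast
      qed
    qed
  qed
  have final: "small_obs E (K0 * 4) V M'"
    if sub: "\<And>v. v \<in> V \<Longrightarrow> M' v \<subseteq> ?M3 v" and Na: "\<And>n. n \<in> Ns \<Longrightarrow> M' n \<subseteq> {a0}" for M'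
  proof (rule mono[OF sub])
    let ?M5 = "prop_lists E V M'"
    have s5: "?M5 v \<subseteq> ?M3 v" if "v \<in> V" for v using sub[OF that] by (rule subset_trans[OF prop_lists_sub])
    have s53: "?M5 v \<subseteq> {1,2,3}" if "v \<in> V" for v using s5[OF that] M33[OF that] by (rule subset_trans)
    \<comment> \<open>A component of \<open>U\<close> lies inside \<open>Q\<close> or avoids it:
      both \<open>Yu\<close> and the vertices of \<open>Z\<close> outside \<open>U\<close> treat
      adjacent vertices of \<open>U\<close> alike.\<close>
    have UQ: "v \<in> Q" if v: "v \<in> U" "d \<in> Q" "E v d" for v d
    proof -
      have dU: "d \<in> U" "d \<in> U'" using v(2) QU' U'U by blast+
      have "E y d" if "y \<in> Yu" "E y v" for y by (rule hom[OF that(1) v(1) dU(1) v(3) that(2)])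
      then have "v \<in> U'" using v(1) dU(2) unfolding U'_def by blast
      moreover have "\<not> E n v" if n: "n \<in> Ns" for n
      proof
        assume "E n v"
        then have "E n d" using outer_unmixed[of n v d] n v(1,3) dU(1) unfolding Ns_def by blast
        then show False using n v(2) unfolding Q_def by blast
      qed
      ultimately show ?thesis unfolding Q_def by blast
    qed
    have nb: "v \<in> Yu \<or> (v \<in> Z \<and> v \<notin> U)" if v: "v \<in> V - Q" "d \<in> Q" "E v d" for v d
    proof -
      have dU: "d \<in> U" "d \<in> Z" using v(2) QU' U'U UZ by blast+
      have "v \<notin> S" using ZS(2)[OF dU(2)] v(3) by blast
      then consider "v \<in> N1" | "v \<in> Z" using V_cases[of v] v(1) by blast
      then show ?thesis
      proof cases
        case 1 then show ?thesis using UN1[OF dU(1) 1 v(3)] by blast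
      next
        case 2 then show ?thesis using UQ[of v d] v by blast
      qed
    qed
    show "small_obs E K0 V ?M5"
    proof (rule small_obs_mod[of V ?M5 Q])
      show "?M5 v \<subseteq> {1,2,3}" if "v \<in> V" for v by (rule s53[OF that])
      show "Q \<subseteq> V" using QU' U'U UZ ZV by blast
      show "\<not> lcol E V ?M5"
      proof
        assume "lcol E V ?M5"
        then have "lcol E V L" by (rule lcol_mono[OF _ subset_refl]) (rule subset_trans[OF s5 M3L])
        then show False using ncL by blast
      qed
      show "card (?M5 v) \<le> 2" if v: "v \<in> V - Q" for v
      proof -
        have vV: "v \<in> V" using v by blast
        consider "v \<in> S" | "v \<in> N1" | "v \<in> Z" using V_cases[OF vV] by blast
        then show ?thesis
        proof cases
          case 1
          have "?M5 v \<subseteq> {\<phi> v}" by (rule subset_trans[OF subset_trans[OF s5[OF vV] M3L[OF vV]] LS[OF 1]])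
          then have "card (?M5 v) \<le> card {\<phi> v}" by (intro card_mono) simp_all
          then show ?thesis by simp
        next
          case 2
          then obtain x where x: "x \<in> {1,2,3}" "x \<notin> L v" using LN1 by blast
          then have "x \<notin> ?M5 v" using s5[OF vV] M3L[OF vV] by blast
          then show ?thesis by (rule card_le_2_of_missing[OF s53[OF vV] x(1)])
        next
          case 3
          have "\<exists>x\<in>{1,2,3}. x \<notin> ?M5 v"
          proof -
            consider "v \<notin> U" | "v \<in> U" "v \<notin> U'" | n where "n \<in> Ns" "E n v" using v unfolding Q_def by blast
            then show ?thesis
            proof cases
              case 1
              then obtain x where "x \<in> {1,2,3}" "x \<notin> ?M2 v" using ZU[OF 3 1] by blast
              then show ?thesis using s5[OF vV] M3'[of v] by blast
            next
              case 2
              then obtain x where "x \<in> {1,2,3}" "x \<notin> ?M3 v" using UU by blast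
              then show ?thesis using s5[OF vV] by blast
            next
              case 3
              have "a0 \<notin> ?M5 v"
                by (rule prop_missing[where M=M', OF ZV[OF NsZ[OF 3(1)]] sym[OF 3(2)] Na[OF 3(1)]])
              then show ?thesis using a0 by blast
            qed
          qed
          then show ?thesis using card_le_2_of_missing[OF s53[OF vV]] by blast
        qed
      qed
      show "E v d'" if h: "v \<in> V - Q" "d \<in> Q" "d' \<in> Q" "E d d'" "E v d" for v d d'
      proof -
        have dU: "d \<in> U" "d' \<in> U" using h QU' U'U by blast+
        from nb[OF h(1,2,5)] show ?thesis
        proof
          assume "v \<in> Yu" then show ?thesis using hom[OF _ dU h(4,5)] by blast
        next
          assume "v \<in> Z \<and> v \<notin> U" then show ?thesis using outer_unmixed[OF _ _ dU h(4,5)] by blast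
        qed
      qed
      show "\<exists>v\<in>V - Q. E v d" if dQ: "d \<in> Q" for d
      proof -
        obtain y where y: "y \<in> N1" "E y d" using Zdom[OF UZ[OF U'U[OF QU'[OF dQ]]]] by blast
        then have "y \<in> V - Q" using N1V N1Z QU' U'U UZ by blast
        then show ?thesis using y by blast
      qed
      show "\<exists>a\<in>{1,2,3}. \<forall>v\<in>V - Q. E v d \<longrightarrow> a \<notin> ?M5 v" if d: "d \<in> Q" for d
      proof (intro bexI[of _ a0] ballI impI a0)
        fix v assume v: "v \<in> V - Q" "E v d"
        have vV: "v \<in> V" using v by blast
        have s1: "?M5 v \<subseteq> ?M1 v" "?M5 v \<subseteq> M v" using s5[OF vV] M3'[of v] M2[of v] M1[of v] by blast+
        from nb[OF v(1) d v(2)] show "a0 \<notin> ?M5 v"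
        proof
          assume "v \<in> Yu"
          then show ?thesis using Ya[OF YuY] s1(2) by blast
        next
          assume n: "v \<in> Z \<and> v \<notin> U"
          have dU: "d \<in> U" "d \<in> U'" using d QU' U'U by blast+
          obtain t where t: "t \<in> N1 - Yu" "E v t" using outer_neighbour[OF _ _ dU(1) v(2)] n by blast
          have "\<not> E t o1"
          proof
            assume "E t o1"
            then have "v \<in> Ns" using n t dU(2) v(2) unfolding Ns_def by blast
            then show False using d v(2) unfolding Q_def by blast
          qed
          then have "M t \<subseteq> {a0}" using out[of t v] t n sym by blast
          then have "a0 \<notin> ?M1 v" using prop_missing[where M=M and u=t and z=v and x=a0] N1V t by blast
          then show ?thesis using s1(1) by blast
        qed
      qed
    qed simp
  qed
  \<comment> \<open>\<open>A1\<close> and \<open>B1\<close> take one colour from \<open>Yq\<close>;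
    \<open>A2\<close> followed by \<open>B2\<close> confines \<open>Ns\<close> to \<open>a0\<close>,
    because each of its vertices already lacks b or c by \<open>Nsx\<close>. Three branches of size
    \<open>K0 * 4\<close> and three propagations make up \<open>K0 * 12 * 64\<close>.\<close>
  define A1 where "A1 = (\<lambda>v. if v \<in> Yq then ?M3 v - {c} else ?M3 v)"
  define A2 where "A2 = (\<lambda>v. if v \<in> Ns \<and> b \<notin> ?M3 v then ?M3 v - {c} else ?M3 v)"
  define B1 where "B1 = (\<lambda>v. if v \<in> Yq then A2 v - {b} else A2 v)"
  define B2 where "B2 = (\<lambda>v. if v \<in> Ns \<and> c \<notin> ?M3 v then A2 v - {b} else A2 v)"
  have split: "lcol E X (\<lambda>v. if v \<in> Yq then F v - {x} else F v) \<or> lcol E X (\<lambda>v. if v \<in> Ns \<and> P v then F v - {x} else F v)"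
    if lc: "lcol E X F" for X F x P
  proof -
    obtain f where f: "\<And>v. v \<in> X \<Longrightarrow> f v \<in> F v" "\<And>u v. u \<in> X \<Longrightarrow> v \<in> X \<Longrightarrow> E u v \<Longrightarrow> f u \<noteq> f v"
      using lc by (erule lcolE)
    show ?thesis
    proof (cases "\<exists>n\<in>X. n \<in> Ns \<and> f n = x")
      case True
      then obtain n where n: "n \<in> X" "n \<in> Ns" "f n = x" by blast
      have "f y \<noteq> x" if "y \<in> X" "y \<in> Yq" for y using f(2)[OF that(1) n(1) Ns_complete[OF n(2) that(2)]] n(3) by simp
      then have "lcol E X (\<lambda>v. if v \<in> Yq then F v - {x} else F v)"
        using f by (intro lcolI[of X f]) auto
      then show ?thesis ..
    next
      case False
      then have "lcol E X (\<lambda>v. if v \<in> Ns \<and> P v then F v - {x} else F v)"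
        using f by (intro lcolI[of X f]) auto
      then show ?thesis ..
    qed
  qed
  have A2s: "A2 v \<subseteq> ?M3 v" for v unfolding A2_def by auto
  have a1: "small_obs E (K0 * 4) V A1"
    by (rule Yq_case[OF _ c(1,2)]) (auto simp: A1_def)
  have b1: "small_obs E (K0 * 4) V B1"
  proof (rule Yq_case[OF _ b])
    show "B1 v \<subseteq> ?M3 v" for v using A2s[of v] unfolding B1_def by auto
  qed (auto simp: B1_def)
  have b2: "small_obs E (K0 * 4) V B2"
  proof (rule final)
    show "B2 v \<subseteq> ?M3 v" for v using A2s[of v] unfolding B2_def by auto
    fix n assume n: "n \<in> Ns"
    have nV: "n \<in> V" by (rule ZV[OF NsZ[OF n]])
    have "b \<notin> B2 n" "c \<notin> B2 n" using Nsx[OF n] n unfolding B2_def A2_def by auto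
    moreover have "x = a0 \<or> x = b \<or> x = c" if "x \<in> B2 n" for x
    proof -
      have "x \<in> ?M3 n" using that A2s[of n] unfolding B2_def by (auto split: if_splits)
      then show ?thesis using bspec[OF abc subsetD[OF M33[OF nV]]] by blast
    qed
    ultimately show "B2 n \<subseteq> {a0}" by blast
  qed
  have a2: "small_obs E (K0 * 4 + K0 * 4) V A2"
    by (rule small_obs_or[OF b1 b2]) (unfold B1_def B2_def, rule split)
  have "small_obs E (K0 * 4 + (K0 * 4 + K0 * 4)) V ?M3"
    by (rule small_obs_or[OF a1 a2]) (unfold A1_def A2_def, rule split)
  then have "small_obs E (K0 * 12) V ?M3" by (rule small_obs_mono) simp_all
  then have "small_obs E (K0 * 12 * 4) V ?M2" by (rule small_obs_prop[rotated]) (rule M23)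
  then have "small_obs E (K0 * 12 * 4 * 4) V ?M1" by (rule small_obs_prop[rotated]) (rule M13)
  then have "small_obs E (K0 * 12 * 4 * 4 * 4) V M" by (rule small_obs_prop[rotated]) (rule M3)
  then show ?thesis by (rule small_obs_mono) simp_all
qed

end

section \<open>Graphs with a dominating clique\<close>

context star_centre begin

lemma star_centre_mono:
  assumes "\<And>v. v \<in> V \<Longrightarrow> M' v \<subseteq> M v"
  shows "star_centre E V m S \<phi> L o1 M'"
proof (unfold_locales)
  show "o1 \<in> S" by (rule oS)
  show "M' v \<subseteq> L v" if "v \<in> V" for v using assms[OF that] MsubL[OF that] by (rule subset_trans)
  show "M' t \<subseteq> {a0}" if "t \<in> N1" "z \<in> Z" "E t z" "\<not> E t o1" for t z
    using assms[OF N1V[OF that(1)]] out[OF that] by (rule subset_trans)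
qed

text \<open>The first guess \<open>y0\<close> has a largest neighbourhood in \<open>Z\<close> among
  the private neighbours of \<open>o1\<close>. If this does not yet give homogeneity, some
  \<open>ws\<close> splits an edge away from \<open>y0\<close>, and \<open>ws\<close> and its
  neighbour \<open>zs\<close> are guessed too. A vertex \<open>w\<close> splitting an edge
  \<open>d d'\<close> of \<open>U\<close> after that leads to an edge from \<open>d'\<close> to
  \<open>zs\<close>, which \<open>U\<close> excludes: directly by comparing \<open>w\<close> with
  \<open>ws\<close> if \<open>w\<close> misses \<open>zs\<close>, and otherwise by comparing
  \<open>w\<close> with \<open>y0\<close> twice.\<close>

lemma star_case: "small_obs E (3 * (3 * (3 * (K0 * 12 * 64) + 1) + 1) + 1) V M"
proof (cases "Y o1 = {}")
  case True
  interpret sg: star_guess E V m S \<phi> L o1 M "{}" "{}"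
    by unfold_locales auto
  interpret star_hom E V m S \<phi> L o1 M "{}" "{}"
    by unfold_locales (use True in \<open>auto simp: sg.Yu_def\<close>)
  show ?thesis by (rule small_obs_mono[OF star_small_obs]) simp_all
next
  case False
  define A where "A w = {z \<in> Z. E w z}" for w
  have finA: "finite (A w)" for w unfolding A_def Z_def using finV by simp
  have "Y o1 \<subseteq> V" using YN N1V by blast
  then have finY: "finite (Y o1)" using finV finite_subset by blast
  then have "Max ((\<lambda>w. card (A w)) ` Y o1) \<in> (\<lambda>w. card (A w)) ` Y o1" using False by (intro Max_in) auto
  then obtain y0 where y0: "y0 \<in> Y o1" "Max ((\<lambda>w. card (A w)) ` Y o1) = card (A y0)" by blast
  have y0max: "card (A w) \<le> card (A y0)" if "w \<in> Y o1" for w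
    using Max_ge[of "(\<lambda>w. card (A w)) ` Y o1" "card (A w)"] finY that y0(2) by simp
  have y0V: "y0 \<in> V" using y0 YN N1V by blast
  define P where "P w z z' \<longleftrightarrow> w \<in> Y o1 \<and> z \<in> Z \<and> z' \<in> Z \<and> E z z' \<and> E w z \<and> \<not> E w z' \<and> \<not> E w y0 \<and> w \<noteq> y0
      \<and> \<not> E y0 z \<and> \<not> E y0 z'" for w z z'
  show ?thesis
  proof (cases "\<exists>w z z'. P w z z'")
    case False
    have "small_obs E (3 * (K0 * 12 * 64) + 1) V M"
    proof (rule small_obs_guess[where L=M, OF y0V M3[OF y0V]])
      fix a assume a: "a \<in> M y0"
      let ?M = "M(y0 := {a})"
      interpret s1: star_centre E V m S \<phi> L o1 ?M
        by (rule star_centre_mono) (use a in auto)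
      interpret sg: star_guess E V m S \<phi> L o1 ?M "{y0}" "{}"
        by unfold_locales (use y0 in auto)
      have "E w d'" if h: "w \<in> sg.Yu" "d \<in> sg.U" "d' \<in> sg.U" "E d d'" "E w d" for w d d'
      proof (rule ccontr)
        assume n: "\<not> E w d'"
        have "w \<in> Y o1" "w \<noteq> y0" "\<not> E w y0" using h(1) unfolding sg.Yu_def by blast+
        moreover have "y0 \<in> N1" "y0 \<notin> sg.Yu" using y0 YN unfolding sg.Yu_def by blast+
        then have "\<not> E y0 d" "\<not> E y0 d'" using sg.UN1 h by blast+
        ultimately have "P w d d'" using h n sg.UZ unfolding P_def by blast
        then show False using False by blast
      qed
      then interpret star_hom E V m S \<phi> L o1 ?M "{y0}" "{}" by unfold_locales
      show "small_obs E (K0 * 12 * 64) V ?M" by (rule star_small_obs)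
    qed
    then show ?thesis by (rule small_obs_mono) simp_all
  next
    case True
    define Pw where "Pw = {w. \<exists>z z'. P w z z'}"
    have "Pw \<subseteq> Y o1" unfolding Pw_def P_def by blast
    then have finP: "finite Pw" using finY finite_subset by blast
    have "Pw \<noteq> {}" using True unfolding Pw_def by blast
    then have "Max ((\<lambda>w. card (A w)) ` Pw) \<in> (\<lambda>w. card (A w)) ` Pw" using finP by (intro Max_in) auto
    then obtain ws where ws: "ws \<in> Pw" "Max ((\<lambda>w. card (A w)) ` Pw) = card (A ws)" by blast
    have wmax: "card (A w) \<le> card (A ws)" if "P w z z'" for w z z'
    proof -
      have "w \<in> Pw" using that unfolding Pw_def by blast
      then show ?thesis using Max_ge[of "(\<lambda>w. card (A w)) ` Pw" "card (A w)"] finP ws(2) by simp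
    qed
    obtain zs zs' where zs: "P ws zs zs'" using ws(1) unfolding Pw_def by blast
    have wsf: "ws \<in> Y o1" "ws \<in> V" "zs \<in> Z" "zs \<in> V" "E ws zs" "\<not> E y0 zs" "\<not> E ws y0" "ws \<noteq> y0"
      using zs YN N1V ZV unfolding P_def by blast+
    have core: "small_obs E (K0 * 12 * 64) V M'"
      if M': "\<And>v. v \<in> V \<Longrightarrow> M' v \<subseteq> M v" "\<exists>x. M' y0 \<subseteq> {x}" "\<exists>x. M' ws \<subseteq> {x}" "\<exists>x. M' zs \<subseteq> {x}" for M'
    proof -
      interpret s1: star_centre E V m S \<phi> L o1 M' by (rule star_centre_mono[OF M'(1)])
      interpret sg: star_guess E V m S \<phi> L o1 M' "{y0, ws}" "{zs}"
        by unfold_locales (use y0 wsf M' sym in auto)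
      have "E w d'" if h: "w \<in> sg.Yu" "d \<in> sg.U" "d' \<in> sg.U" "E d d'" "E w d" for w d d'
      proof (rule ccontr)
        assume n: "\<not> E w d'"
        have w: "w \<in> Y o1" "w \<noteq> y0" "\<not> E w y0" "\<not> E w ws" using h(1) unfolding sg.Yu_def by blast+
        have yN: "y0 \<in> N1" "ws \<in> N1" "y0 \<notin> sg.Yu" "ws \<notin> sg.Yu" using y0 wsf YN unfolding sg.Yu_def by blast+
        have dn: "\<not> E y0 d" "\<not> E y0 d'" "\<not> E ws d" "\<not> E ws d'" using sg.UN1 h yN by blast+
        have dZ: "d \<in> Z" "d' \<in> Z" using h sg.UZ by blast+
        have dz: "\<not> E d' zs" using sg.UH[OF h(3)] by blast
        have Pw: "P w d d'" using h n w dn dZ unfolding P_def by blast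
        \<comment> \<open>\<open>d\<close> is seen by \<open>w\<close> and not by \<open>v\<close>,
          so if \<open>v\<close> has at least as many neighbours in \<open>Z\<close>, one of them is
          missed by \<open>w\<close>.\<close>
        have diff: "\<exists>x. x \<in> Z \<and> E v x \<and> \<not> E w x" if "card (A w) \<le> card (A v)" "\<not> E v d" for v
        proof (rule ccontr)
          assume "\<not> ?thesis"
          then have "A v \<subseteq> A w" unfolding A_def by blast
          moreover have "d \<in> A w - A v" using dZ h(5) that(2) unfolding A_def by blast
          ultimately have "A v \<subset> A w" by blast
          then have "card (A v) < card (A w)" by (rule psubset_card_mono[OF finA])
          then show False using that(1) by simp
        qed
        show False
        proof (cases "E w zs")
          case False
          have "E d' zs"
            by (rule private_parts(1)[of o1 w ws d zs d']) (use oS w wsf dZ h dn n False in auto)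
          then show False using dz by blast
        next
          case True
          obtain x0 where x0: "x0 \<in> Z" "E y0 x0" "\<not> E w x0" using diff[of y0] y0max[OF w(1)] dn(1) by blast
          have dx: "E d' x0"
            by (rule private_parts(1)[of o1 w y0 d x0 d']) (use oS w y0 dZ h dn n x0 in auto)
          have "E d' zs"
            by (rule private_parts(1)[of o1 y0 w x0 zs d']) (use oS w y0 wsf dZ dn n x0 dx True sym in auto)
          then show False using dz by blast
        qed
      qed
      then interpret star_hom E V m S \<phi> L o1 M' "{y0, ws}" "{zs}" by unfold_locales
      show ?thesis by (rule star_small_obs)
    qed
    have ne: "y0 \<noteq> zs" "ws \<noteq> zs" using y0 wsf YN N1Z by blast+
    show ?thesis
    proof (rule small_obs_guess[where L=M, OF y0V M3[OF y0V]])
      fix a assume a: "a \<in> M y0"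
      show "small_obs E (3 * (3 * (K0 * 12 * 64) + 1) + 1) V (M(y0 := {a}))"
      proof (rule small_obs_guess[OF wsf(2)])
        show "(M(y0 := {a})) ws \<subseteq> {1,2,3}" using M3[OF wsf(2)] wsf(8) by simp
        fix b assume b: "b \<in> (M(y0 := {a})) ws"
        show "small_obs E (3 * (K0 * 12 * 64) + 1) V (M(y0 := {a}, ws := {b}))"
        proof (rule small_obs_guess[OF wsf(4)])
          show "(M(y0 := {a}, ws := {b})) zs \<subseteq> {1,2,3}" using M3[OF wsf(4)] ne by simp
          fix c assume c: "c \<in> (M(y0 := {a}, ws := {b})) zs"
          show "small_obs E (K0 * 12 * 64) V (M(y0 := {a}, ws := {b}, zs := {c}))"
            by (rule core) (use a b c ne wsf(8) in \<open>auto split: if_splits\<close>)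
        qed
      qed
    qed
  qed
qed

end

section \<open>Separating the private neighbourhoods of the clique\<close>

context dom_clique begin

abbreviation "Kc \<equiv> 3 * (3 * (3 * (K0 * 12 * 64) + 1) + 1) + 1"

definition "Ys s = {y \<in> Y s. \<exists>z\<in>Z. E y z}"

definition "separated s s' k M \<longleftrightarrow> (\<forall>y\<in>Ys s. k \<notin> M y) \<or> (\<forall>y\<in>Ys s'. k \<notin> (M y :: nat set))"

text \<open>If a private vertex of \<open>s\<close> with a neighbour in \<open>Z\<close> keeps two
  colours, these are all colours but that of \<open>s\<close>. Separation then takes from the
  private vertices of any other \<open>p\<close> the colour different from those of \<open>s\<close>
  and \<open>p\<close>, which leaves them only the colour of \<open>s\<close>: this is
  \<open>star_centre\<close> at \<open>s\<close>. If no such vertex exists, every neighbour of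
  \<open>Z\<close> in \<open>N1\<close> has at most one colour and all of \<open>Z\<close> loses
  one.\<close>

lemma separated_case:
  assumes M: "\<And>v. v \<in> V \<Longrightarrow> M v \<subseteq> L v"
    and sep: "\<And>s s' k. s \<in> S \<Longrightarrow> s' \<in> S \<Longrightarrow> s \<noteq> s' \<Longrightarrow> k \<in> {1,2,3} \<Longrightarrow> k \<noteq> \<phi> s \<Longrightarrow> k \<noteq> \<phi> s' \<Longrightarrow> separated s s' k M"
  shows "small_obs E (Kc + K0 * 4) V M"
proof -
  have M3: "M v \<subseteq> {1,2,3}" if "v \<in> V" for v using M[OF that] L3[OF that] by (rule subset_trans)
  show ?thesis
  proof (cases "\<forall>s\<in>S. \<forall>y\<in>Ys s. \<exists>x. M y \<subseteq> {x}")
    case True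
    have "small_obs E K0 V (prop_lists E V M)"
    proof (rule all_hit)
      show "prop_lists E V M v \<subseteq> L v" if "v \<in> V" for v using M[OF that] by (rule subset_trans[OF prop_lists_sub])
      fix z assume z: "z \<in> Z"
      obtain t where t: "t \<in> N1" "E t z" using Zdom[OF z] by blast
      have tV: "t \<in> V" by (rule N1V[OF t(1)])
      obtain p where p: "p \<in> S" "E t p" using t(1) unfolding N1_def by blast
      have "\<exists>x. M t \<subseteq> {x}"
      proof (cases "t \<in> Y p")
        case tY: True
        then have "t \<in> Ys p" using t z unfolding Ys_def by blast
        then show ?thesis using True p(1) by blast
      next
        case False
        then obtain x where "L t \<subseteq> {x}" using not_Y_single[OF t(1) p] by blast
        then have "M t \<subseteq> {x}" by (rule subset_trans[OF M[OF tV]])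
        then show ?thesis by blast
      qed
      from prop_missing'[where M=M, OF tV sym[OF t(2)] M3[OF tV] this]
      show "\<exists>x\<in>{1,2,3}. x \<notin> prop_lists E V M z" .
    qed
    then have "small_obs E (K0 * 4) V M" by (rule small_obs_prop[rotated]) (rule M3)
    then show ?thesis by (rule small_obs_mono) simp_all
  next
    case False
    then obtain s y where s: "s \<in> S" "y \<in> Ys s" "\<not> (\<exists>x. M y \<subseteq> {x})" by blast
    have yY: "y \<in> Y s" using s(2) unfolding Ys_def by blast
    have yV: "y \<in> V" by (rule N1V[OF YN[OF yY]])
    have ys: "\<phi> s \<notin> M y" using LN[OF s(1) yV YE(2)[OF yY s(1)]] M[OF yV] by blast
    have other: "M t \<subseteq> {\<phi> s}" if t: "t \<in> Ys p" "p \<in> S" "p \<noteq> s" for t p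
    proof -
      have neq: "\<phi> s \<noteq> \<phi> p" using phi_neq[OF s(1) t(2)] t(3) by blast
      obtain k where k: "k \<in> {1,2,3}" "k \<noteq> \<phi> s" "k \<noteq> \<phi> p" and k3: "\<forall>c\<in>{1,2,3}. c = \<phi> s \<or> c = \<phi> p \<or> c = k"
        by (rule third_colour[OF phi[OF s(1)] phi[OF t(2)] neq])
      have "k \<in> M y"
      proof (rule ccontr)
        assume "k \<notin> M y"
        then show False using single_of_two_missing[OF M3[OF yV] k(1) phi[OF s(1)] k(2) _ ys] s(3) by blast
      qed
      then have kt: "k \<notin> M t" using sep[OF s(1) t(2) _ k] t s(2) unfolding separated_def by blast
      have tY: "t \<in> Y p" using t(1) unfolding Ys_def by blast
      have tV: "t \<in> V" by (rule N1V[OF YN[OF tY]])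
      have "\<phi> p \<notin> M t" using LN[OF t(2) tV YE(2)[OF tY t(2)]] M[OF tV] by blast
      moreover have "c = \<phi> s \<or> c = \<phi> p \<or> c = k" if "c \<in> M t" for c
        by (rule bspec[OF k3 subsetD[OF M3[OF tV] that]])
      ultimately show ?thesis using kt by blast
    qed
    interpret star_centre E V m S \<phi> L s M
    proof (unfold_locales)
      show "s \<in> S" by fact
      show "M v \<subseteq> L v" if "v \<in> V" for v by (rule M[OF that])
      show "M t \<subseteq> {\<phi> s}" if t: "t \<in> N1" "z \<in> Z" "E t z" "\<not> E t s" for t z
      proof -
        obtain p where p: "p \<in> S" "E t p" using t(1) unfolding N1_def by blast
        have ps: "p \<noteq> s" using p t(4) by blast
        show ?thesis
        proof (cases "t \<in> Y p")
          case True
          then have "t \<in> Ys p" using t unfolding Ys_def by blast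
          then show ?thesis using other p ps by blast
        next
          case False
          then obtain q where q: "q \<in> S" "q \<noteq> p" "E t q" using p t(1) unfolding Y_def by blast
          have qs: "q \<noteq> s" using q t(4) by blast
          have tV: "t \<in> V" by (rule N1V[OF t(1)])
          have n: "\<phi> p \<noteq> \<phi> q" "\<phi> s \<noteq> \<phi> p" "\<phi> s \<noteq> \<phi> q"
            using phi_neq[OF p(1) q(1)] phi_neq[OF s(1) p(1)] phi_neq[OF s(1) q(1)] q(2) ps qs by blast+
          have nm: "\<phi> p \<notin> M t" "\<phi> q \<notin> M t" using LN[OF p(1) tV p(2)] LN[OF q(1) tV q(3)] M[OF tV] by blast+
          obtain k where k3: "\<forall>c\<in>{1,2,3}. c = \<phi> p \<or> c = \<phi> q \<or> c = k"
            by (rule third_colour[OF phi[OF p(1)] phi[OF q(1)] n(1)])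
          have "k = \<phi> s" using bspec[OF k3 phi[OF s(1)]] n by auto
          moreover have "c = \<phi> p \<or> c = \<phi> q \<or> c = k" if "c \<in> M t" for c
            by (rule bspec[OF k3 subsetD[OF M3[OF tV] that]])
          ultimately show ?thesis using nm by blast
        qed
      qed
    qed
    show ?thesis by (rule small_obs_mono[OF star_case]) simp_all
  qed
qed

text \<open>Either one of the two private sets avoids \<open>k\<close>, which is separation, or both
  contain a vertex of colour \<open>k\<close>. These two are adjacent and contradict each other, or
  they are nonadjacent, and after guessing a neighbour of each in \<open>Z\<close> the case falls to
  \<open>double_colour\<close>.\<close>

lemma pair_step:
  assumes M: "\<And>v. v \<in> V \<Longrightarrow> M v \<subseteq> L v"
    and s: "s \<in> S" "s' \<in> S" "s \<noteq> s'" and k: "k \<in> {1,2,3}" "k \<noteq> \<phi> s" "k \<noteq> \<phi> s'"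
    and n: "3 * (3 * (K0 * 16) + 1) + 1 \<le> n"
    and sep: "\<And>M'. (\<And>v. v \<in> V \<Longrightarrow> M' v \<subseteq> M v) \<Longrightarrow> separated s s' k M' \<Longrightarrow> small_obs E n V M'"
  shows "small_obs E (n + n * (n + n * n)) V M"
proof -
  have M3: "M v \<subseteq> {1,2,3}" if "v \<in> V" for v using M[OF that] L3[OF that] by (rule subset_trans)
  show ?thesis
  proof (rule small_obs_avoid[where W="Ys s" and c=k])
    show "small_obs E n V (\<lambda>v. if v \<in> Ys s then M v - {k} else M v)"
      by (rule sep) (auto simp: separated_def)
    fix w assume w: "w \<in> Ys s" "w \<in> V" "k \<in> M w"
    show "small_obs E (n + n * n) V (M(w := {k}))"
    proof (rule small_obs_avoid[where W="Ys s'" and c=k])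
      show "small_obs E n V (\<lambda>v. if v \<in> Ys s' then (M(w := {k})) v - {k} else (M(w := {k})) v)"
        by (rule sep) (use w in \<open>auto simp: separated_def\<close>)
      fix w' assume w': "w' \<in> Ys s'" "w' \<in> V" "k \<in> (M(w := {k})) w'"
      let ?M = "M(w := {k}, w' := {k})"
      have Msub: "?M v \<subseteq> M v" for v using w w' by (auto split: if_splits)
      have Mw: "?M w \<subseteq> {k}" "?M w' \<subseteq> {k}" by auto
      show "small_obs E n V ?M"
      proof (cases "E w w'")
        case True
        have "2 \<le> n" using n by simp
        then show ?thesis by (rule small_obs_edge[of w V w' E ?M k, OF w(2) w'(2) True Mw])
      next
        case False
        obtain d where d: "d \<in> Z" "E w d" using w(1) unfolding Ys_def by blast
        obtain d' where d': "d' \<in> Z" "E w' d'" using w'(1) unfolding Ys_def by blast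
        have wY: "w \<in> Y s" "w' \<in> Y s'" using w w' unfolding Ys_def by blast+
        have ne: "w \<noteq> d" "w \<noteq> d'" "w' \<noteq> d" "w' \<noteq> d'" using wY d d' YN N1Z by blast+
        have dV: "d \<in> V" "d' \<in> V" using d d' ZV by blast+
        have "small_obs E (3 * (3 * (K0 * 16) + 1) + 1) V ?M"
        proof (rule small_obs_guess[OF dV(1)])
          show "?M d \<subseteq> {1,2,3}" using Msub[of d] M3[OF dV(1)] by (rule subset_trans)
          fix x assume x: "x \<in> ?M d"
          show "small_obs E (3 * (K0 * 16) + 1) V (?M(d := {x}))"
          proof (rule small_obs_guess[OF dV(2)])
            show "(?M(d := {x})) d' \<subseteq> {1,2,3}" using x Msub[of d'] M3[OF dV(2)] Msub[of d] M3[OF dV(1)] by auto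
            fix x' assume x': "x' \<in> (?M(d := {x})) d'"
            let ?N = "?M(d := {x}, d' := {x'})"
            have Nsub: "?N v \<subseteq> ?M v" for v using x x' by (auto split: if_splits)
            show "small_obs E (K0 * 16) V ?N"
            proof (rule double_colour[OF _ s k wY])
              show "?N v \<subseteq> L v" if "v \<in> V" for v using subset_trans[OF Nsub Msub] M[OF that] by (rule subset_trans)
              show "?N w \<subseteq> {k}" "?N w' \<subseteq> {k}" using subset_trans[OF Nsub Mw(1)] subset_trans[OF Nsub Mw(2)] .
              show "\<not> E w w'" by fact
              show "d \<in> Z" "d' \<in> Z" "E w d" "E w' d'" by fact+
              show "\<exists>y. ?N d \<subseteq> {y}" by (cases "d = d'") auto
              show "\<exists>y. ?N d' \<subseteq> {y}" by auto
            qed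
          qed
        qed
        then show ?thesis using n by (rule small_obs_mono) simp
      qed
    qed
  qed
qed

text \<open>Separation survives the shrinking of lists, so the triples can be treated one after
  another; every triple applies the same function to the bound.\<close>

lemma pairs_step:
  assumes "\<And>v. v \<in> V \<Longrightarrow> M v \<subseteq> L v"
    and "\<And>s s' k. (s, s', k) \<in> set ps \<Longrightarrow> s \<in> S \<and> s' \<in> S \<and> s \<noteq> s' \<and> k \<in> {1,2,3} \<and> k \<noteq> \<phi> s \<and> k \<noteq> \<phi> s'"
    and "3 * (3 * (K0 * 16) + 1) + 1 \<le> n"
    and "\<And>M'. (\<And>v. v \<in> V \<Longrightarrow> M' v \<subseteq> M v) \<Longrightarrow> (\<And>s s' k. (s, s', k) \<in> set ps \<Longrightarrow> separated s s' k M') \<Longrightarrow> small_obs E n V M'"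
  shows "small_obs E (((\<lambda>n. n + n * (n + n * n)) ^^ length ps) n) V M"
  using assms
proof (induction ps arbitrary: M)
  case Nil
  show ?case using Nil(4)[of M] by simp
next
  case (Cons p ps)
  obtain s s' k where p: "p = (s, s', k)" by (cases p) auto
  let ?g = "\<lambda>n::nat. n + n * (n + n * n)"
  have ge: "n \<le> (?g ^^ j) n" for j by (induction j) (auto intro: le_trans trans_le_add1)
  have "small_obs E (?g ((?g ^^ length ps) n)) V M"
  proof (rule pair_step[OF Cons.prems(1)])
    show "s \<in> S" "s' \<in> S" "s \<noteq> s'" "k \<in> {1,2,3}" "k \<noteq> \<phi> s" "k \<noteq> \<phi> s'" using Cons.prems(2)[of s s' k] p by simp_all
    show "3 * (3 * (K0 * 16) + 1) + 1 \<le> (?g ^^ length ps) n" using Cons.prems(3) ge by (rule le_trans)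
    fix M' assume M': "\<And>v. v \<in> V \<Longrightarrow> M' v \<subseteq> M v" and sp: "separated s s' k M'"
    show "small_obs E ((?g ^^ length ps) n) V M'"
    proof (rule Cons.IH)
      show "M' v \<subseteq> L v" if "v \<in> V" for v using M'[OF that] Cons.prems(1)[OF that] by (rule subset_trans)
      show "a \<in> S \<and> b \<in> S \<and> a \<noteq> b \<and> c \<in> {1,2,3} \<and> c \<noteq> \<phi> a \<and> c \<noteq> \<phi> b" if "(a, b, c) \<in> set ps" for a b c
        using Cons.prems(2)[of a b c] that by simp
      show "3 * (3 * (K0 * 16) + 1) + 1 \<le> n" by (rule Cons.prems(3))
      fix M'' assume M'': "\<And>v. v \<in> V \<Longrightarrow> M'' v \<subseteq> M' v" and sp': "\<And>s s' k. (s, s', k) \<in> set ps \<Longrightarrow> separated s s' k M''"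
      have YsV: "y \<in> V" if "y \<in> Ys t" for y t using that YN N1V unfolding Ys_def by blast
      have "separated s s' k M''" using sp M'' YsV unfolding separated_def by blast
      then show "small_obs E n V M''"
        using Cons.prems(4)[of M''] M'' M' sp' p by (metis Pair_inject set_ConsD subset_trans)
    qed
  qed
  then show ?case by simp
qed

lemma dom_clique_small_obs:
  "small_obs E (((\<lambda>n. n + n * (n + n * n)) ^^ 27) (Kc + K0 * 4 + 3 * (3 * (K0 * 16) + 1) + 1)) V L"
proof -
  define PS where "PS = {(s, s', k). s \<in> S \<and> s' \<in> S \<and> s \<noteq> s' \<and> k \<in> {1,2,3} \<and> k \<noteq> \<phi> s \<and> k \<noteq> \<phi> s'}"
  have finS: "finite S" using SV finV finite_subset by blast
  have "card S \<le> card {1,2,3::nat}" by (rule card_inj_on_le[OF inj]) (use phi in auto)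
  then have c3: "card S \<le> 3" by simp
  have sub: "PS \<subseteq> S \<times> S \<times> {1,2,3}" unfolding PS_def by blast
  have fin: "finite (S \<times> S \<times> {1,2,3::nat})" using finS by simp
  have "card PS \<le> card (S \<times> S \<times> {1,2,3::nat})" by (rule card_mono[OF fin sub])
  also have "\<dots> = card S * (card S * 3)" by (simp add: card_cartesian_product)
  also have "\<dots> \<le> 3 * (3 * 3)" using c3 by (intro mult_mono) auto
  \<comment> \<open>At most three vertices for each of \<open>s\<close> and \<open>s'\<close>, since
    the clique is coloured injectively, and three colours for \<open>k\<close>.\<close>
  finally have c27: "card PS \<le> 27" by simp
  have finPS: "finite PS" using sub fin finite_subset by blast
  then obtain ps where ps: "set ps = PS" "distinct ps" using finite_distinct_list by blast
  have len: "length ps \<le> 27" using ps c27 distinct_card[of ps] by simp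
  let ?g = "\<lambda>n::nat. n + n * (n + n * n)"
  let ?n = "Kc + K0 * 4 + 3 * (3 * (K0 * 16) + 1) + 1"
  have "small_obs E ((?g ^^ length ps) ?n) V L"
  proof (rule pairs_step)
    show "s \<in> S \<and> s' \<in> S \<and> s \<noteq> s' \<and> k \<in> {1,2,3} \<and> k \<noteq> \<phi> s \<and> k \<noteq> \<phi> s'" if "(s, s', k) \<in> set ps" for s s' k
      using that by (simp add: ps(1) PS_def)
    fix M' assume M': "\<And>v. v \<in> V \<Longrightarrow> M' v \<subseteq> L v" "\<And>s s' k. (s, s', k) \<in> set ps \<Longrightarrow> separated s s' k M'"
    have "small_obs E (Kc + K0 * 4) V M'"
      by (rule separated_case[OF M'(1)]) (auto intro!: M'(2) simp: ps(1) PS_def)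
    then show "small_obs E ?n V M'" by (rule small_obs_mono) simp_all
  qed simp_all
  moreover have "(?g ^^ length ps) ?n \<le> (?g ^^ 27) ?n"
  proof -
    have "n \<le> (?g ^^ j) n" for j n by (induction j) (auto intro: le_trans trans_le_add1)
    from this[of "(?g ^^ length ps) ?n" "27 - length ps"] show ?thesis
      using len funpow_add[of "27 - length ps" "length ps" ?g] by (simp add: o_def)
  qed
  ultimately show ?thesis by (rule small_obs_mono) simp
qed

end

section \<open>Graphs without an induced six-vertex path\<close>

lemma small_obs_guess_set:
  assumes "finite T" "T \<subseteq> V" "\<And>v. v \<in> V \<Longrightarrow> L v \<subseteq> {1,2,3}"
    and "\<And>\<phi>. (\<And>t. t \<in> T \<Longrightarrow> \<phi> t \<in> L t) \<Longrightarrow> small_obs E n V (\<lambda>v. if v \<in> T then {\<phi> v} else L v)"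
  shows "small_obs E (((\<lambda>x. 3 * x + 1) ^^ card T) n) V L"
  using assms
proof (induction T arbitrary: L rule: finite_induct)
  case empty
  show ?case using empty.prems(3)[of "\<lambda>_. 0"] by simp
next
  case (insert x T)
  let ?f = "\<lambda>x::nat. 3 * x + 1"
  have xV: "x \<in> V" using insert.prems(1) by blast
  have "small_obs E (?f ((?f ^^ card T) n)) V L"
  proof (rule small_obs_guess[where L=L, OF xV insert.prems(2)[OF xV]])
    fix a assume a: "a \<in> L x"
    show "small_obs E ((?f ^^ card T) n) V (L(x := {a}))"
    proof (rule insert.IH)
      show "T \<subseteq> V" using insert.prems(1) by blast
      show "(L(x := {a})) v \<subseteq> {1,2,3}" if "v \<in> V" for v
        using insert.prems(2)[OF that] insert.prems(2)[OF xV] a by auto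
      fix \<phi> assume ph: "\<And>t. t \<in> T \<Longrightarrow> \<phi> t \<in> (L(x := {a})) t"
      have "small_obs E n V (\<lambda>v. if v \<in> insert x T then {(\<phi>(x := a)) v} else L v)"
      proof (rule insert.prems(3))
        fix t assume "t \<in> insert x T"
        then show "(\<phi>(x := a)) t \<in> L t" using ph[of t] a insert.hyps(2) by (cases "t = x") auto
      qed
      moreover have "(\<lambda>v. if v \<in> insert x T then {(\<phi>(x := a)) v} else L v) = (\<lambda>v. if v \<in> T then {\<phi> v} else (L(x := {a})) v)"
        using insert.hyps(2) by (intro ext) auto
      ultimately show "small_obs E n V (\<lambda>v. if v \<in> T then {\<phi> v} else (L(x := {a})) v)" by (simp only:)
    qed
  qed
  then show ?case using insert.hyps by simp
qed

lemma funpow_ge_self: "(n::nat) \<le> ((\<lambda>x. 3 * x + 1) ^^ k) n"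
  by (induction k) auto

lemma funpow_guess_mono: "j \<le> k \<Longrightarrow> ((\<lambda>x::nat. 3 * x + 1) ^^ j) n \<le> ((\<lambda>x. 3 * x + 1) ^^ k) n"
proof -
  assume "j \<le> k"
  then have "((\<lambda>x::nat. 3 * x + 1) ^^ k) n = ((\<lambda>x. 3 * x + 1) ^^ (k - j)) (((\<lambda>x. 3 * x + 1) ^^ j) n)"
    using funpow_add[of "k - j" j "\<lambda>x::nat. 3 * x + 1"] by (simp add: o_def)
  then show ?thesis using funpow_ge_self by simp
qed

context p6_c5_free begin

text \<open>The bound of \<open>dom_clique_small_obs\<close>, written out where the clique and its
  colouring are not yet fixed.\<close>

definition "Kdom = ((\<lambda>n. n + n * (n + n * n)) ^^ 27)
  (3 * (3 * (3 * (K0 * 12 * 64) + 1) + 1) + 1 + K0 * 4 + 3 * (3 * (K0 * 16) + 1) + 1)"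

text \<open>A dominating clique with at least four vertices contains a refutation. Otherwise its at
  most three colours are guessed; a guess that repeats a colour fails on an edge, and an injective
  one gives \<open>dom_clique\<close> after one propagation.\<close>

lemma c5_free_small_obs:
  assumes conn: "conn E V" and ne: "V \<noteq> {}" and L3: "\<And>v. v \<in> V \<Longrightarrow> L v \<subseteq> {1,2,3}" and nc: "\<not> lcol E V L"
  shows "small_obs E (((\<lambda>x. 3 * x + 1) ^^ 3) (Kdom * 4 + 4)) V L"
proof -
  obtain S where S: "S \<subseteq> V" "S \<noteq> {}" and cl0: "\<forall>x\<in>S. \<forall>y\<in>S. x \<noteq> y \<longrightarrow> E x y"
    and mx0: "\<forall>v\<in>V - S. \<exists>s\<in>S. \<not> E v s" and dm: "V \<subseteq> reach2 S"
    using dominating_clique[OF conn ne] by (elim exE conjE) (rule that)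
  have cl: "E x y" if "x \<in> S" "y \<in> S" "x \<noteq> y" for x y using cl0 that by blast
  have mx: "\<exists>s\<in>S. \<not> E v s" if "v \<in> V" "v \<notin> S" for v using mx0 that by blast
  have finS: "finite S" using S(1) finV finite_subset by blast
  show ?thesis
  proof (cases "card S \<le> 3")
    case False
    then have "4 \<le> card S" by simp
    then obtain T where T: "T \<subseteq> S" "card T = 4" by (rule obtain_subset_with_card_n)
    have "small_obs E 4 V L"
      by (rule K4_small_obs[OF subset_trans[OF T(1) S(1)] T(2) cl L3]) (use T(1) in blast)+
    moreover have "4 \<le> ((\<lambda>x. 3 * x + 1) ^^ 3) (Kdom * 4 + 4)" using funpow_ge_self[of "Kdom * 4 + 4" 3] by linarith
    ultimately show ?thesis by (rule small_obs_mono) simp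
  next
    case True
    have "small_obs E (((\<lambda>x. 3 * x + 1) ^^ card S) (Kdom * 4 + 4)) V L"
    proof (rule small_obs_guess_set[OF finS S(1) L3])
      fix \<phi> assume ph: "\<And>t. t \<in> S \<Longrightarrow> \<phi> t \<in> L t"
      let ?L = "\<lambda>v. if v \<in> S then {\<phi> v} else L v"
      show "small_obs E (Kdom * 4 + 4) V ?L"
      proof (cases "inj_on \<phi> S")
        case False
        then obtain x y where xy: "x \<in> S" "y \<in> S" "x \<noteq> y" "\<phi> x = \<phi> y" unfolding inj_on_def by blast
        show ?thesis
          by (rule small_obs_edge[of x V y E ?L "\<phi> x"]) (use xy S(1) cl in auto)
      next
        case inj: True
        have L3': "?L v \<subseteq> {1,2,3}" if "v \<in> V" for v using L3[OF that] ph[of v] by auto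
        have LL: "?L v \<subseteq> L v" for v using ph[of v] by auto
        interpret dom_clique E V m S \<phi> "prop_lists E V ?L"
        proof (unfold_locales)
          show "S \<subseteq> V" by fact
          show "E x y" if "x \<in> S" "y \<in> S" "x \<noteq> y" for x y by (rule cl[OF that])
          show "\<exists>s\<in>S. \<not> E v s" if "v \<in> V" "v \<notin> S" for v by (rule mx[OF that])
          show "V \<subseteq> reach2 S" by fact
          show "inj_on \<phi> S" by fact
          show "\<phi> s \<in> {1,2,3}" if "s \<in> S" for s using ph[OF that] L3[of s] S(1) that by blast
          show "prop_lists E V ?L v \<subseteq> {1,2,3}" if "v \<in> V" for v using L3'[OF that] by (rule subset_trans[OF prop_lists_sub])
          show "prop_lists E V ?L s \<subseteq> {\<phi> s}" if "s \<in> S" for s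
            by (rule subset_trans[OF prop_lists_sub]) (use that in simp)
          show "\<phi> s \<notin> prop_lists E V ?L v" if "s \<in> S" "v \<in> V" "E v s" for s v
            using prop_listsD[of "\<phi> s" E V ?L v s] that S(1) by auto
          show "\<not> lcol E V (prop_lists E V ?L)"
          proof
            assume "lcol E V (prop_lists E V ?L)"
            then have "lcol E V L" by (rule lcol_mono[OF _ subset_refl]) (rule order_trans, rule prop_lists_sub, rule LL)
            then show False using nc by blast
          qed
        qed
        have "small_obs E Kdom V (prop_lists E V ?L)" unfolding Kdom_def by (rule dom_clique_small_obs)
        then have "small_obs E (Kdom * 4) V ?L" by (rule small_obs_prop[rotated]) (rule L3')
        then show ?thesis by (rule small_obs_mono) simp_all
      qed
    qed
    then show ?thesis by (rule small_obs_mono[OF _ funpow_guess_mono[OF True]]) simp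
  qed
qed

end

text \<open>Up to rotation, a proper colouring of a five-cycle with three colours reads a, b, a, b,
  c. The five disjuncts are the rotations for which \<open>C5_guess\<close> is invoked.\<close>

lemma c5_colour_pattern:
  assumes "f1 \<in> {1,2,3::nat}" "f2 \<in> {1,2,3}" "f3 \<in> {1,2,3}" "f4 \<in> {1,2,3}" "f5 \<in> {1,2,3}"
    and "f1 \<noteq> f2" "f2 \<noteq> f3" "f3 \<noteq> f4" "f4 \<noteq> f5" "f5 \<noteq> f1"
  shows "(f1 = f3 \<and> f2 = f4) \<or> (f2 = f4 \<and> f3 = f5) \<or> (f3 = f5 \<and> f4 = f1) \<or> (f4 = f1 \<and> f5 = f2) \<or> (f5 = f2 \<and> f1 = f3)"
proof -
  consider "f1 = f3" | "f1 = f4" | "f2 = f4" "f2 \<noteq> f5" "f1 \<noteq> f3" | "f2 = f5" | "f1 \<noteq> f3" "f1 \<noteq> f4" "f2 \<noteq> f4" "f2 \<noteq> f5" by blast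
  then show ?thesis using assms by cases auto
qed

context p6_free begin

definition "Kc5 = ((((K0 * 16) + (K0 * 16) * ((K0 * 16) + (K0 * 16) * (K0 * 16)) + 1) * 4) * 4)"

lemma C5_guess:
  assumes conn: "conn E V" and L3: "\<And>v. v \<in> V \<Longrightarrow> L v \<subseteq> {1,2,3}"
    and sV: "s1 \<in> V" "s2 \<in> V" "s3 \<in> V" "s4 \<in> V" "s5 \<in> V"
    and sE: "E s1 s2" "E s2 s3" "E s3 s4" "E s4 s5" "E s5 s1"
    and sN: "\<not> E s1 s3" "\<not> E s1 s4" "\<not> E s2 s4" "\<not> E s2 s5" "\<not> E s3 s5"
    and f: "L s1 \<subseteq> {f1}" "L s2 \<subseteq> {f2}" "L s3 \<subseteq> {f1}" "L s4 \<subseteq> {f2}" "L s5 \<subseteq> {f5}"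
    and d: "f1 \<in> {1,2,3}" "f2 \<in> {1,2,3}" "f5 \<in> {1,2,3}" "f1 \<noteq> f2" "f2 \<noteq> f5" "f1 \<noteq> f5"
    and nc: "\<not> lcol E V L"
  shows "small_obs E (Kc5 + 2) V L"
proof -
  have "{f1, f2, f5} = {1,2,3}"
    by (rule card_subset_eq) (use d in \<open>simp_all add: card_insert_if\<close>)
  then have "small_obs E Kc5 V L"
    unfolding Kc5_def by (intro C5_coloured[OF conn L3 _ d(4-6) sV sE sN f(1,3,2,4,5) nc]) simp_all
  then show ?thesis by (rule small_obs_mono) simp_all
qed

lemma C5_small_obs:
  assumes conn: "conn E V" and L3: "\<And>v. v \<in> V \<Longrightarrow> L v \<subseteq> {1,2,3}"
    and sV: "s1 \<in> V" "s2 \<in> V" "s3 \<in> V" "s4 \<in> V" "s5 \<in> V"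
    and sE: "E s1 s2" "E s2 s3" "E s3 s4" "E s4 s5" "E s5 s1"
    and sN: "\<not> E s1 s3" "\<not> E s1 s4" "\<not> E s2 s4" "\<not> E s2 s5" "\<not> E s3 s5"
    and nc: "\<not> lcol E V L"
  shows "small_obs E (((\<lambda>x. 3 * x + 1) ^^ 5) (Kc5 + 2)) V L"
proof -
  let ?T = "{s1, s2, s3, s4, s5}"
  have "small_obs E (((\<lambda>x. 3 * x + 1) ^^ card ?T) (Kc5 + 2)) V L"
  proof (rule small_obs_guess_set[OF _ _ L3])
    show "finite ?T" by simp
    show "?T \<subseteq> V" using sV by simp
    fix \<phi> assume ph: "\<And>t. t \<in> ?T \<Longrightarrow> \<phi> t \<in> L t"
    define L' where "L' = (\<lambda>v. if v \<in> ?T then {\<phi> v} else L v)"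
    have Ls: "L' s1 \<subseteq> {\<phi> s1}" "L' s2 \<subseteq> {\<phi> s2}" "L' s3 \<subseteq> {\<phi> s3}" "L' s4 \<subseteq> {\<phi> s4}" "L' s5 \<subseteq> {\<phi> s5}" by (simp_all add: L'_def)
    have ph3: "\<phi> s1 \<in> {1,2,3}" "\<phi> s2 \<in> {1,2,3}" "\<phi> s3 \<in> {1,2,3}" "\<phi> s4 \<in> {1,2,3}" "\<phi> s5 \<in> {1,2,3}"
      using subsetD[OF L3[OF sV(1)] ph] subsetD[OF L3[OF sV(2)] ph] subsetD[OF L3[OF sV(3)] ph] subsetD[OF L3[OF sV(4)] ph] subsetD[OF L3[OF sV(5)] ph]
      by simp_all
    have L3': "L' v \<subseteq> {1,2,3}" if "v \<in> V" for v
    proof (cases "v \<in> ?T")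
      case True then show ?thesis using subsetD[OF L3[OF that] ph[OF True]] True by (simp add: L'_def)
    next
      case False then show ?thesis using L3[OF that] by (simp add: L'_def)
    qed
    have nc': "\<not> lcol E V L'"
    proof
      assume "lcol E V L'"
      then have "lcol E V L"
      proof (rule lcol_mono[OF _ subset_refl])
        fix v show "L' v \<subseteq> L v" using ph[of v] by (cases "v \<in> ?T") (simp_all add: L'_def)
      qed
      then show False using nc by blast
    qed
    have "small_obs E (Kc5 + 2) V L'"
    proof (cases "\<phi> s1 \<noteq> \<phi> s2 \<and> \<phi> s2 \<noteq> \<phi> s3 \<and> \<phi> s3 \<noteq> \<phi> s4 \<and> \<phi> s4 \<noteq> \<phi> s5 \<and> \<phi> s5 \<noteq> \<phi> s1")
      case False
      then consider "\<phi> s1 = \<phi> s2" | "\<phi> s2 = \<phi> s3" | "\<phi> s3 = \<phi> s4" | "\<phi> s4 = \<phi> s5" | "\<phi> s5 = \<phi> s1" by blast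
      then show ?thesis
      proof cases
        case 1 show ?thesis by (rule small_obs_edge[where L=L' and E=E, OF sV(1,2) sE(1) Ls(1)]) (use 1 Ls in simp_all)
      next
        case 2 show ?thesis by (rule small_obs_edge[where L=L' and E=E, OF sV(2,3) sE(2) Ls(2)]) (use 2 Ls in simp_all)
      next
        case 3 show ?thesis by (rule small_obs_edge[where L=L' and E=E, OF sV(3,4) sE(3) Ls(3)]) (use 3 Ls in simp_all)
      next
        case 4 show ?thesis by (rule small_obs_edge[where L=L' and E=E, OF sV(4,5) sE(4) Ls(4)]) (use 4 Ls in simp_all)
      next
        case 5 show ?thesis by (rule small_obs_edge[where L=L' and E=E, OF sV(5,1) sE(5) Ls(5)]) (use 5 Ls in simp_all)
      qed
    next
      case True
      note t = True
      have N: "\<not> E s3 s1" "\<not> E s4 s1" "\<not> E s4 s2" "\<not> E s5 s2" "\<not> E s5 s3" using sN sym by blast+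
      from c5_colour_pattern[OF ph3] t consider "\<phi> s1 = \<phi> s3" "\<phi> s2 = \<phi> s4" | "\<phi> s2 = \<phi> s4" "\<phi> s3 = \<phi> s5"
        | "\<phi> s3 = \<phi> s5" "\<phi> s4 = \<phi> s1" | "\<phi> s4 = \<phi> s1" "\<phi> s5 = \<phi> s2" | "\<phi> s5 = \<phi> s2" "\<phi> s1 = \<phi> s3" by blast
      then show ?thesis
      proof cases
        case 1
        show ?thesis
          by (rule C5_guess[OF conn L3' sV sE sN Ls(1,2) _ _ Ls(5) ph3(1,2,5) _ _ _ nc']) (use 1 t Ls in auto)
      next
        case 2
        show ?thesis
          by (rule C5_guess[OF conn L3' sV(2,3,4,5,1) sE(2,3,4,5,1) sN(3,4) sN(5) N(1,2) Ls(2,3) _ _ Ls(1) ph3(2,3,1) _ _ _ nc']) (use 2 t Ls in auto)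
      next
        case 3
        show ?thesis
          by (rule C5_guess[OF conn L3' sV(3,4,5,1,2) sE(3,4,5,1,2) sN(5) N(1,2,3,4) Ls(3,4) _ _ Ls(2) ph3(3,4,2) _ _ _ nc']) (use 3 t Ls in auto)
      next
        case 4
        show ?thesis
          by (rule C5_guess[OF conn L3' sV(4,5,1,2,3) sE(4,5,1,2,3) N(2,3) N(4,5) sN(1) Ls(4,5) _ _ Ls(3) ph3(4,5,3) _ _ _ nc']) (use 4 t Ls in auto)
      next
        case 5
        show ?thesis
          by (rule C5_guess[OF conn L3' sV(5,1,2,3,4) sE(5,1,2,3,4) N(4,5) sN(1,2,3) Ls(5,1) _ _ Ls(4) ph3(5,1,4) _ _ _ nc']) (use 5 t Ls in auto)
      qed
    qed
    then show "small_obs E (Kc5 + 2) V (\<lambda>v. if v \<in> ?T then {\<phi> v} else L v)" by (simp only: L'_def)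
  qed
  moreover have "card ?T \<le> 5" by (simp add: card_insert_if)
  ultimately show ?thesis by (rule small_obs_mono[OF _ funpow_guess_mono]) simp_all
qed

text \<open>The sum of the bounds for graphs with and without an induced C5. It depends on
  \<open>m\<close> alone, so it is the same for every connected part to which it is applied.\<close>

definition "K6 = ((\<lambda>x. 3 * x + 1) ^^ 5) (Kc5 + 2) + ((\<lambda>x. 3 * x + 1) ^^ 3)
  (((\<lambda>n. n + n * (n + n * n)) ^^ 27)
    (3 * (3 * (3 * (K0 * 12 * 64) + 1) + 1) + 1 + K0 * 4 + 3 * (3 * (K0 * 16) + 1) + 1) * 4 + 4)"

theorem p6_free_small_obs:
  assumes L3: "\<And>v. v \<in> V \<Longrightarrow> L v \<subseteq> {1,2,3}" and nc: "\<not> lcol E V L"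
  shows "small_obs E K6 V L"
proof -
  obtain W where W: "W \<subseteq> V" "W \<noteq> {}" "conn E W" "\<not> lcol E W L"
    using connected_obstruction[OF sym finV nc] by blast
  have finW: "finite W" using W(1) finV finite_subset by blast
  interpret W: p6_free E W m
  proof (unfold_locales)
    show "finite W" by (rule finW)
    show "small_obs E m X M" if "X \<subseteq> W" "\<And>v. v \<in> X \<Longrightarrow> M v \<subseteq> {1,2,3} \<and> card (M v) \<le> 2" "\<not> lcol E X M" for X M
      by (rule T2[OF subset_trans[OF that(1) W(1)] that(2,3)])
  qed (use sym irr no_P6 W(1) in blast)+
  have L3W: "L v \<subseteq> {1,2,3}" if "v \<in> W" for v using L3 W(1) that by blast
  show ?thesis
  proof (cases "\<exists>a\<in>W. \<exists>b\<in>W. \<exists>c\<in>W. \<exists>d\<in>W. \<exists>e\<in>W. E a b \<and> E b c \<and> E c d \<and> E d e \<and> E e a \<and>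
      \<not> E a c \<and> \<not> E a d \<and> \<not> E b d \<and> \<not> E b e \<and> \<not> E c e")
    case True
    then obtain a b c d e where C: "a \<in> W" "b \<in> W" "c \<in> W" "d \<in> W" "e \<in> W" "E a b" "E b c" "E c d" "E d e" "E e a"
      "\<not> E a c" "\<not> E a d" "\<not> E b d" "\<not> E b e" "\<not> E c e" by blast
    have "small_obs E (((\<lambda>x. 3 * x + 1) ^^ 5) (W.Kc5 + 2)) W L"
      by (rule W.C5_small_obs[OF W(3) L3W C W(4)])
    then show ?thesis
      by (rule small_obs_mono) (simp_all add: K6_def W(1))
  next
    case False
    interpret W5: p6_c5_free E W m
      by unfold_locales (use False in blast)
    show ?thesis
      by (rule small_obs_mono[OF W5.c5_free_small_obs[OF W(3,2) L3W W(4)]]) (simp_all add: W5.Kdom_def K6_def W(1))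
  qed
qed

end

section \<open>Graphs without an induced four-vertex path plus isolated vertices\<close>

definition P4kP1_free_on :: "nat \<Rightarrow> ('a \<Rightarrow> 'a \<Rightarrow> bool) \<Rightarrow> 'a set \<Rightarrow> bool" where
  "P4kP1_free_on k E V \<longleftrightarrow> \<not> (\<exists>a\<in>V. \<exists>b\<in>V. \<exists>c\<in>V. \<exists>d\<in>V. E a b \<and> E b c \<and> E c d \<and> \<not> E a c \<and> \<not> E a d \<and> \<not> E b d \<and>
    (\<exists>I\<subseteq>V. finite I \<and> card I = k \<and> (\<forall>x\<in>I. \<not> E a x \<and> \<not> E b x \<and> \<not> E c x \<and> \<not> E d x) \<and> (\<forall>x\<in>I. \<forall>y\<in>I. \<not> E x y)))"

context
  fixes E :: "'a \<Rightarrow> 'a \<Rightarrow> bool" and V :: "'a set" and N :: nat and v :: "nat \<Rightarrow> 'a" and c :: "nat \<Rightarrow> nat"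
  assumes sym: "\<And>u v. E u v \<Longrightarrow> E v u" and irr: "\<And>v. \<not> E v v" and ch: "chain E V N v c"
begin

lemma chainD:
  "i < N \<Longrightarrow> v i \<in> V" "inj_on v {..<N}" "Suc i < N \<Longrightarrow> E (v i) (v (Suc i))" "i \<le> N \<Longrightarrow> c i \<in> {1,2,3}"
  "i < N \<Longrightarrow> c i \<noteq> c (Suc i)"
  "i < j \<Longrightarrow> j < N \<Longrightarrow> j \<noteq> Suc i \<Longrightarrow> E (v i) (v j) \<Longrightarrow> c i = c (Suc j) \<and> c (Suc i) \<noteq> c j \<and> c (Suc i) \<noteq> c (Suc j)"
  using ch unfolding chain_def by blast+

lemma same_class_nonadj:
  assumes "i < N" "j < N" "c i = c j" "c (Suc i) = c (Suc j)"
  shows "\<not> E (v i) (v j)"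
proof -
  have *: "\<not> E (v i) (v j)" if "i < j" "j < N" "c i = c j" "c (Suc i) = c (Suc j)" for i j
    using chainD(5)[of i] chainD(5)[of j] chainD(6)[of i j] that by auto
  show ?thesis using *[of i j] *[of j i] assms sym irr by (metis linorder_neqE_nat)
qed

text \<open>
  A later vertex with the colours of \<open>i\<close> can only be adjacent to chain vertices whose first colour is
  \<open>c (Suc i)\<close> and whose second colour differs from \<open>c i\<close>.
\<close>

lemma recurring_class_extends_P4:
  assumes free: "P4kP1_free_on k E V" and M: "i1 < M" "i2 < M" "i3 < M" "i4 < M" "i < M" "M < N"
    and P4: "E (v i1) (v i2)" "E (v i2) (v i3)" "E (v i3) (v i4)" "\<not> E (v i1) (v i3)" "\<not> E (v i1) (v i4)" "\<not> E (v i2) (v i4)"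
    and free_class: "\<And>x. x \<in> {i1, i2, i3, i4} \<Longrightarrow> c x = c (Suc i) \<Longrightarrow> c (Suc x) = c i"
    and rec: "k \<le> card {j \<in> {Suc M..<N}. c j = c i \<and> c (Suc j) = c (Suc i)}"
  shows False
proof -
  obtain J where J: "J \<subseteq> {j \<in> {Suc M..<N}. c j = c i \<and> c (Suc j) = c (Suc i)}" "card J = k" "finite J"
    using obtain_subset_with_card_n[OF rec] by blast
  have JN: "j < N" "M < j" "c j = c i" "c (Suc j) = c (Suc i)" if "j \<in> J" for j using J(1) that by auto
  have inj: "inj_on v J" by (rule inj_on_subset[OF chainD(2)]) (use JN in blast)
  have nadj: "\<not> E (v x) (v j)" if "j \<in> J" "x \<in> {i1, i2, i3, i4}" for x j
  proof
    assume e: "E (v x) (v j)"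
    have "x < M" using that(2) M by blast
    then have "c x = c (Suc j) \<and> c (Suc x) \<noteq> c j" using chainD(6)[of x j] e JN[OF that(1)] by auto
    then show False using free_class[OF that(2)] JN[OF that(1)] by simp
  qed
  have nadj2: "\<not> E (v x) (v y)" if "x \<in> J" "y \<in> J" for x y
    by (rule same_class_nonadj) (use JN that in auto)
  have "v ` J \<subseteq> V" using chainD(1) JN by blast
  moreover have "finite (v ` J)" "card (v ` J) = k" using J(2,3) inj by (simp_all add: card_image)
  moreover have "\<forall>x\<in>v ` J. \<not> E (v i1) x \<and> \<not> E (v i2) x \<and> \<not> E (v i3) x \<and> \<not> E (v i4) x" using nadj by simp
  moreover have "\<forall>x\<in>v ` J. \<forall>y\<in>v ` J. \<not> E x y" using nadj2 by simp
  moreover have "v i1 \<in> V" "v i2 \<in> V" "v i3 \<in> V" "v i4 \<in> V" using chainD(1) M by simp_all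
  ultimately show False using free P4 unfolding P4kP1_free_on_def by blast
qed

text \<open>If every pair of consecutive colours from the first \<open>M\<close> vertices recurs
  \<open>k\<close> times, an induced P4 early in the chain suffices, because later vertices of a
  suitable class supply the isolated ones. Such a P4 is found where a colour returns after two steps
  and, in the absence of such returns, at a chord. With neither, the beginning of the chain is an
  induced path long enough to contain all of P4 + kP1.\<close>

lemma recurring_block:
  assumes free: "P4kP1_free_on k E V" and M: "2 * k + 12 \<le> M" "M < N"
    and rec: "\<And>i. i < M \<Longrightarrow> k \<le> card {j \<in> {Suc M..<N}. c j = c i \<and> c (Suc j) = c (Suc i)}"
  shows False
proof (cases "\<exists>i\<ge>1. i + 4 \<le> M \<and> c (Suc (Suc i)) = c i")
  case True
  then obtain i where "i \<ge> 1" and i: "i + 4 \<le> M" "c (Suc (Suc i)) = c i" by blast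
  then obtain h where h: "i = Suc h" by (cases i) auto
  let ?p = "c i" and ?q = "c (Suc i)"
  have ne: "c h \<noteq> ?p" "?p \<noteq> ?q" "c (Suc (Suc (Suc i))) \<noteq> ?p"
    using chainD(5)[of h] chainD(5)[of i] chainD(5)[of "Suc (Suc i)"] i M(2) h by auto
  show False
  proof (rule recurring_class_extends_P4[OF free, of h M i "Suc i" "Suc (Suc i)" i])
    show "h < M" "i < M" "Suc i < M" "Suc (Suc i) < M" "i < M" "M < N" using i h M(2) by simp_all
    show "E (v h) (v i)" "E (v i) (v (Suc i))" "E (v (Suc i)) (v (Suc (Suc i)))"
      using chainD(3)[of h] chainD(3)[of i] chainD(3)[of "Suc i"] i M(2) h by simp_all
    show "\<not> E (v h) (v (Suc i))" using chainD(6)[of h "Suc i"] i M(2) h ne by auto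
    show "\<not> E (v h) (v (Suc (Suc i)))" using chainD(6)[of h "Suc (Suc i)"] i M(2) h ne by auto
    show "\<not> E (v i) (v (Suc (Suc i)))" using chainD(6)[of i "Suc (Suc i)"] i M(2) ne by auto
    show "c (Suc x) = c i" if "x \<in> {h, i, Suc i, Suc (Suc i)}" "c x = c (Suc i)" for x
      using that ne i h by auto
    show "k \<le> card {j \<in> {Suc M..<N}. c j = c i \<and> c (Suc j) = c (Suc i)}" by (rule rec) (use i in simp)
  qed
next
  case False
  have noturn: "c (Suc (Suc i)) \<noteq> c i" if "i \<ge> 1" "i + 4 \<le> M" for i using False that by blast
  show False
  proof (cases "\<exists>i j. 2 \<le> i \<and> i < j \<and> j \<noteq> Suc i \<and> j + 4 \<le> M \<and> E (v i) (v j)")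
    case True
    then obtain i j where ij: "2 \<le> i" "i < j" "j \<noteq> Suc i" "j + 4 \<le> M" "E (v i) (v j)" by blast
    then obtain h where h: "i = Suc h" by (cases i) auto
    have cc: "c i = c (Suc j)" "c (Suc i) \<noteq> c j" "c (Suc i) \<noteq> c (Suc j)" using chainD(6)[of i j] ij M(2) by auto
    have ne: "c i \<noteq> c (Suc i)" "c j \<noteq> c (Suc j)" "c h \<noteq> c i" "c (Suc j) \<noteq> c (Suc (Suc j))" "c (Suc i) \<noteq> c h" "c (Suc (Suc j)) \<noteq> c j"
      using chainD(5)[of i] chainD(5)[of j] chainD(5)[of h] chainD(5)[of "Suc j"] noturn[of h] noturn[of j] ij M h by auto
    have m: "c i \<in> {1,2,3}" "c (Suc i) \<in> {1,2,3}" "c h \<in> {1,2,3}" "c j \<in> {1,2,3}" "c (Suc (Suc j)) \<in> {1,2,3}"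
      using chainD(4) ij M h by simp_all
    have hj: "c h = c j" and ij': "c (Suc (Suc j)) = c (Suc i)" using m ne cc by auto
    show False
    proof (rule recurring_class_extends_P4[OF free, of h M i j "Suc j" i])
      show "h < M" "i < M" "j < M" "Suc j < M" "i < M" "M < N" using ij h M(2) by simp_all
      show "E (v h) (v i)" "E (v i) (v j)" "E (v j) (v (Suc j))"
        using chainD(3)[of h] chainD(3)[of j] ij M(2) h by simp_all
      show "\<not> E (v h) (v j)" by (rule same_class_nonadj) (use ij h M(2) hj cc in auto)
      show "\<not> E (v i) (v (Suc j))" by (rule same_class_nonadj) (use ij h M(2) ij' cc in auto)
      show "\<not> E (v h) (v (Suc j))" using chainD(6)[of h "Suc j"] ij M(2) h hj ij' cc ne by auto
      show "c (Suc x) = c i" if "x \<in> {h, i, j, Suc j}" "c x = c (Suc i)" for x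
        using that ne hj cc by auto
      show "k \<le> card {j \<in> {Suc M..<N}. c j = c i \<and> c (Suc j) = c (Suc i)}" by (rule rec) (use ij in simp)
    qed
  next
    case False
    have nochord: "\<not> E (v i) (v j)" if "2 \<le> i" "i < j" "j \<noteq> Suc i" "j + 4 \<le> M" for i j using False that by blast
    \<comment> \<open>The path is \<open>v 2\<close> to \<open>v 5\<close>; every second vertex from
      \<open>v 7\<close> on is nonadjacent to it and to the others. The largest index used is
      \<open>2 * k + 5\<close>.\<close>
    define I where "I = (\<lambda>t. v (7 + 2 * t)) ` {..<k}"
    have "inj_on (\<lambda>t. v (7 + 2 * t)) {..<k}"
    proof (rule inj_onI)
      fix x y assume "x \<in> {..<k}" "y \<in> {..<k}" "v (7 + 2 * x) = v (7 + 2 * y)"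
      then show "x = y" using inj_onD[OF chainD(2), of "7 + 2 * x" "7 + 2 * y"] M by simp
    qed
    then have "finite I" "card I = k" unfolding I_def by (simp_all add: card_image)
    moreover have "I \<subseteq> V" unfolding I_def using chainD(1) M by auto
    moreover have "\<forall>x\<in>I. \<not> E (v 2) x \<and> \<not> E (v 3) x \<and> \<not> E (v 4) x \<and> \<not> E (v 5) x"
      unfolding I_def using nochord M by auto
    moreover have "\<not> E (v (7 + 2 * s)) (v (7 + 2 * t))" if "s < k" "t < k" for s t
    proof (cases s t rule: linorder_cases)
      case less
      then show ?thesis using nochord[of "7 + 2 * s" "7 + 2 * t"] that M by auto
    next
      case equal then show ?thesis using irr by simp
    next
      case greater
      then show ?thesis using nochord[of "7 + 2 * t" "7 + 2 * s"] that M sym by auto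
    qed
    then have "\<forall>x\<in>I. \<forall>y\<in>I. \<not> E x y" unfolding I_def by auto
    moreover have "v 2 \<in> V" "v 3 \<in> V" "v 4 \<in> V" "v 5 \<in> V" using chainD(1) M by simp_all
    moreover have "E (v 2) (v 3)" "E (v 3) (v 4)" "E (v 4) (v 5)"
      using chainD(3)[of 2] chainD(3)[of 3] chainD(3)[of 4] M by simp_all
    moreover have "\<not> E (v 2) (v 4)" "\<not> E (v 2) (v 5)" "\<not> E (v 3) (v 5)" using nochord M by simp_all
    ultimately show False using free unfolding P4kP1_free_on_def by blast
  qed
qed

end

text \<open>The second argument counts the pairs of consecutive colours that can occur. The summand
  \<open>2 * k + 13\<close> is the block for \<open>recurring_block\<close>. If a pair from it does
  not recur \<open>k\<close> times, one of the \<open>k\<close> windows after it avoids this pair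
  and falls under the bound for one pair less.\<close>

primrec chain_bound :: "nat \<Rightarrow> nat \<Rightarrow> nat" where
  "chain_bound k 0 = 1"
| "chain_bound k (Suc a) = 2 * k + 13 + k * chain_bound k a"

lemma P4kP1_free_chain_classes:
  assumes sym: "\<And>u v. E u v \<Longrightarrow> E v u" and irr: "\<And>v. \<not> E v v" and free: "P4kP1_free_on k E V"
  shows "finite A \<Longrightarrow> card A = a \<Longrightarrow> chain E V N v c \<Longrightarrow> (\<And>i. i < N \<Longrightarrow> (c i, c (Suc i)) \<in> A)
    \<Longrightarrow> chain_bound k a \<le> N \<Longrightarrow> False"
proof (induction a arbitrary: A N v c)
  case 0
  then show False by fastforce
next
  case (Suc a)
  let ?M = "2 * k + 12" and ?f = "chain_bound k a"
  let ?J = "\<lambda>i. {j \<in> {Suc ?M..<N}. c j = c i \<and> c (Suc j) = c (Suc i)}"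
  have MN: "?M < N" using Suc.prems(5) by simp
  show False
  proof (cases "\<forall>i<?M. k \<le> card (?J i)")
    case True
    show False by (rule recurring_block[OF sym irr Suc.prems(3) free le_refl MN]) (assumption | rule True[rule_format])+
  next
    case False
    then obtain i where i: "i < ?M" "card (?J i) < k" by (meson not_le)
    \<comment> \<open>Otherwise each of the \<open>k\<close> disjoint windows contains an occurrence
      of the pair, which makes \<open>k\<close> recurrences.\<close>
    have "\<exists>t<k. \<forall>j<?f. (c (Suc ?M + t * ?f + j), c (Suc (Suc ?M + t * ?f + j))) \<noteq> (c i, c (Suc i))"
    proof (rule ccontr)
      assume "\<not> ?thesis"
      then have "\<forall>t<k. \<exists>j<?f. c (Suc ?M + t * ?f + j) = c i \<and> c (Suc (Suc ?M + t * ?f + j)) = c (Suc i)" by simp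
      then obtain g where g: "\<And>t. t < k \<Longrightarrow> g t < ?f \<and> c (Suc ?M + t * ?f + g t) = c i \<and> c (Suc (Suc ?M + t * ?f + g t)) = c (Suc i)"
        by metis
      let ?h = "\<lambda>t. Suc ?M + t * ?f + g t"
      have lt: "?h s < ?h t" if "s < t" "t < k" for s t
      proof -
        have "Suc s * ?f \<le> t * ?f" using that(1) by (intro mult_le_mono1) simp
        then show ?thesis using g[of s] that by simp
      qed
      have "inj_on ?h {..<k}"
      proof (rule inj_onI)
        fix s t assume "s \<in> {..<k}" "t \<in> {..<k}" "?h s = ?h t"
        then show "s = t" using lt[of s t] lt[of t s] by (cases s t rule: linorder_cases) auto
      qed
      moreover have "?h ` {..<k} \<subseteq> ?J i"
      proof
        fix j assume "j \<in> ?h ` {..<k}"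
        then obtain t where t: "t < k" "j = ?h t" by blast
        have "Suc t * ?f \<le> k * ?f" using t(1) by (intro mult_le_mono1) simp
        then have "j < N" using g[OF t(1)] Suc.prems(5) t(2) by simp
        then show "j \<in> ?J i" using g[OF t(1)] t(2) by simp
      qed
      ultimately have "card {..<k} \<le> card (?J i)" by (intro card_inj_on_le) auto
      then show False using i(2) by simp
    qed
    then obtain t where t: "t < k" "\<And>j. j < ?f \<Longrightarrow> (c (Suc ?M + t * ?f + j), c (Suc (Suc ?M + t * ?f + j))) \<noteq> (c i, c (Suc i))" by blast
    let ?s = "Suc ?M + t * ?f"
    have "Suc t * ?f \<le> k * ?f" using t(1) by (intro mult_le_mono1) simp
    then have sN: "?s + ?f \<le> N" using Suc.prems(5) by simp
    have iN: "(c i, c (Suc i)) \<in> A" using Suc.prems(4) i(1) MN by simp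
    show False
    proof (rule Suc.IH)
      show "finite (A - {(c i, c (Suc i))})" using Suc.prems(1) by simp
      show "card (A - {(c i, c (Suc i))}) = a" using Suc.prems(1,2) iN by simp
      show "chain E V ?f (\<lambda>j. v (?s + j)) (\<lambda>j. c (?s + j))" by (rule chain_window[OF Suc.prems(3) sN])
      show "(c (?s + j), c (?s + Suc j)) \<in> A - {(c i, c (Suc i))}" if "j < ?f" for j
        using Suc.prems(4)[of "?s + j"] t(2)[OF that] sN that by simp
    qed simp
  qed
qed

theorem P4kP1_free_no_chain:
  assumes sym: "\<And>u v. E u v \<Longrightarrow> E v u" and irr: "\<And>v. \<not> E v v" and free: "P4kP1_free_on k E V"
  shows "\<not> chain E V (chain_bound k 9) v c"
proof
  assume ch: "chain E V (chain_bound k 9) v c"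
  show False
  proof (rule P4kP1_free_chain_classes[OF sym irr free _ _ ch])
    show "finite ({1,2,3::nat} \<times> {1,2,3::nat})" by simp
    show "card ({1,2,3::nat} \<times> {1,2,3::nat}) = 9" by (simp add: card_cartesian_product)
    show "(c i, c (Suc i)) \<in> {1,2,3} \<times> {1,2,3}" if "i < chain_bound k 9" for i
      using ch that unfolding chain_def by (metis Suc_leI less_imp_le mem_Sigma_iff)
  qed (assumption | rule le_refl)+
qed

section \<open>Bounded refutations for both kinds of excluded graph\<close>

lemma small_obs_two_lists_sub:
  assumes sym: "\<And>u v. E u v \<Longrightarrow> E v u" and irr: "\<And>v. \<not> E v v" and fin: "finite V"
    and nochain: "\<And>v c. \<not> chain E V N v c" and "W \<subseteq> V"
    and L: "\<And>v. v \<in> W \<Longrightarrow> L v \<subseteq> {1,2,3} \<and> card (L v) \<le> 2" and nc: "\<not> lcol E W L"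
  shows "small_obs E ((4 * N + 7) * (3 * N + 1)) W L"
  by (rule two_lists[OF sym irr finite_subset[OF \<open>W \<subseteq> V\<close> fin] L _ nc]) (use chain_subset[OF _ \<open>W \<subseteq> V\<close>] nochain in blast)+

theorem P6_free_small_obs:
  assumes sym: "\<And>u v. E u v \<Longrightarrow> E v u" and irr: "\<And>v. \<not> E v v" and fin: "finite V" and free: "P6_free_on E V"
    and L3: "\<And>v. v \<in> V \<Longrightarrow> L v \<subseteq> {1,2,3}" and nc: "\<not> lcol E V L"
  shows "small_obs E (p6_free.K6 ((4 * 25 + 7) * (3 * 25 + 1))) V L"
proof -
  interpret p6_free E V "(4 * 25 + 7) * (3 * 25 + 1)"
  proof unfold_locales
    show "small_obs E ((4 * 25 + 7) * (3 * 25 + 1)) W M"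
      if "W \<subseteq> V" "\<And>v. v \<in> W \<Longrightarrow> M v \<subseteq> {1,2,3} \<and> card (M v) \<le> 2" "\<not> lcol E W M" for W M
      by (rule small_obs_two_lists_sub[OF sym irr fin P6_free_no_chain[OF sym free] that])
    show False if "a \<in> V" "b \<in> V" "c \<in> V" "d \<in> V" "e \<in> V" "f \<in> V" "E a b" "E b c" "E c d" "E d e" "E e f"
      "\<not> E a c" "\<not> E a d" "\<not> E a e" "\<not> E a f" "\<not> E b d" "\<not> E b e" "\<not> E b f" "\<not> E c e" "\<not> E c f" "\<not> E d f" for a b c d e f
      using free that unfolding P6_free_on_def by blast
  qed (fact sym irr fin)+
  show ?thesis by (rule p6_free_small_obs[OF L3 nc])
qed

text \<open>Once a dominating set is coloured, one propagation leaves at most two colours at every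
  vertex, so the bound for lists of size two applies directly.\<close>

lemma P4kP1_free_dominated:
  assumes sym: "\<And>u v. E u v \<Longrightarrow> E v u" and irr: "\<And>v. \<not> E v v" and fin: "finite V"
    and T: "finite T" "T \<subseteq> V" "\<And>v. v \<in> V \<Longrightarrow> v \<notin> T \<Longrightarrow> \<exists>t\<in>T. E v t"
    and free: "P4kP1_free_on k E V" and L3: "\<And>v. v \<in> V \<Longrightarrow> L v \<subseteq> {1,2,3}" and nc: "\<not> lcol E V L"
  shows "small_obs E (((\<lambda>x. 3 * x + 1) ^^ card T) ((4 * chain_bound k 9 + 7) * (3 * chain_bound k 9 + 1) * 4)) V L"
proof (rule small_obs_guess_set[OF T(1,2) L3])
  fix \<phi> assume ph: "\<And>t. t \<in> T \<Longrightarrow> \<phi> t \<in> L t"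
  define L' where "L' = (\<lambda>v. if v \<in> T then {\<phi> v} else L v)"
  have LL: "L' v \<subseteq> L v" for v using ph[of v] unfolding L'_def by auto
  have L3': "L' v \<subseteq> {1,2,3}" if "v \<in> V" for v by (rule subset_trans[OF LL L3[OF that]])
  have "small_obs E ((4 * chain_bound k 9 + 7) * (3 * chain_bound k 9 + 1)) V (prop_lists E V L')"
  proof (rule two_lists[OF sym irr fin _ P4kP1_free_no_chain[OF sym irr free]])
    show "\<not> lcol E V (prop_lists E V L')"
    proof
      assume "lcol E V (prop_lists E V L')"
      then have "lcol E V L" by (rule lcol_mono[OF _ subset_refl]) (rule order_trans, rule prop_lists_sub, rule LL)
      then show False using nc by blast
    qed
    fix v assume v: "v \<in> V"
    have s: "prop_lists E V L' v \<subseteq> L' v" by (rule prop_lists_sub)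
    have sub: "prop_lists E V L' v \<subseteq> {1,2,3}" by (rule subset_trans[OF s L3'[OF v]])
    moreover have "card (prop_lists E V L' v) \<le> 2"
    proof (cases "v \<in> T")
      case True
      then have "prop_lists E V L' v \<subseteq> {\<phi> v}" using s unfolding L'_def by simp
      then have "card (prop_lists E V L' v) \<le> card {\<phi> v}" by (rule card_mono[rotated]) simp
      then show ?thesis by simp
    next
      case False
      then obtain t where t: "t \<in> T" "E v t" using T(3) v by blast
      have "\<phi> t \<notin> prop_lists E V L' v" using prop_listsD[of "\<phi> t" E V L' v t] t T(2) unfolding L'_def by auto
      then have "prop_lists E V L' v \<subseteq> {1,2,3} - {\<phi> t}" using sub by blast
      then have "card (prop_lists E V L' v) \<le> card ({1,2,3} - {\<phi> t})" by (rule card_mono[rotated]) simp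
      moreover have "\<phi> t \<in> {1,2,3}" using ph[OF t(1)] L3[of t] t(1) T(2) by blast
      ultimately show ?thesis by simp
    qed
    ultimately show "prop_lists E V L' v \<subseteq> {1,2,3} \<and> card (prop_lists E V L' v) \<le> 2" by blast
  qed
  then have "small_obs E ((4 * chain_bound k 9 + 7) * (3 * chain_bound k 9 + 1) * 4) V L'"
    by (rule small_obs_prop[rotated]) (rule L3')
  then show "small_obs E ((4 * chain_bound k 9 + 7) * (3 * chain_bound k 9 + 1) * 4) V (\<lambda>v. if v \<in> T then {\<phi> v} else L v)"
    unfolding L'_def .
qed

text \<open>Graphs without an induced P4 are covered by the P6-free case. Otherwise Ramsey's theorem
  is applied to the common non-neighbours of a P4: if there are at least \<open>r\<close> of them,
  they contain a K4, which is a refutation, or \<open>k\<close> independent vertices, which are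
  excluded. If there are fewer, they dominate together with the P4. The bound is existential because
  it contains the Ramsey number.\<close>

theorem P4kP1_free_small_obs:
  "\<exists>n. \<forall>E (V :: 'a set) L. (\<forall>u v. E u v \<longrightarrow> E v u) \<longrightarrow> (\<forall>v. \<not> E v v) \<longrightarrow> finite V \<longrightarrow> P4kP1_free_on k E V \<longrightarrow>
    (\<forall>v\<in>V. L v \<subseteq> {1,2,3}) \<longrightarrow> \<not> lcol E V L \<longrightarrow> small_obs E n V L"
proof -
  obtain r where r: "\<And>(V::'a set) (E::'a set set). finite V \<Longrightarrow> r \<le> card V \<Longrightarrow>
      \<exists>R\<subseteq>V. card R = 4 \<and> clique R E \<or> card R = k \<and> indep R E"
    using ramsey2[of 4 k] by metis
  let ?g = "(\<lambda>x::nat. 3 * x + 1)" and ?m = "(4 * chain_bound k 9 + 7) * (3 * chain_bound k 9 + 1) * 4"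
  let ?n = "(?g ^^ (4 + r)) ?m + p6_free.K6 ((4 * 25 + 7) * (3 * 25 + 1)) + 4"
  show ?thesis
  proof (intro exI[of _ ?n] allI impI)
    fix E and V :: "'a set" and L
    assume sym0: "\<forall>u v. E u v \<longrightarrow> E v u" and irr0: "\<forall>v. \<not> E v v" and fin: "finite V" and free: "P4kP1_free_on k E V"
      and L0: "\<forall>v\<in>V. L v \<subseteq> {1,2,3}" and nc: "\<not> lcol E V L"
    have sym: "\<And>u v. E u v \<Longrightarrow> E v u" and irr: "\<And>v. \<not> E v v" and L3: "\<And>v. v \<in> V \<Longrightarrow> L v \<subseteq> {1,2,3}"
      using sym0 irr0 L0 by blast+
    show "small_obs E ?n V L"
    proof (cases "P6_free_on E V")
      case True
      show ?thesis by (rule small_obs_mono[OF P6_free_small_obs[OF sym irr fin True L3 nc]]) simp_all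
    next
      case False
      then obtain a b c d where abcd: "a \<in> V" "b \<in> V" "c \<in> V" "d \<in> V" "E a b" "E b c" "E c d" "\<not> E a c" "\<not> E a d" "\<not> E b d"
        unfolding P6_free_on_def by blast
      define W where "W = {v \<in> V. \<not> E a v \<and> \<not> E b v \<and> \<not> E c v \<and> \<not> E d v}"
      have WV: "W \<subseteq> V" and finW: "finite W" using fin unfolding W_def by auto
      show ?thesis
      proof (cases "r \<le> card W")
        case True
        obtain R where R: "R \<subseteq> W" "card R = 4 \<and> clique R {{x, y} | x y. E x y} \<or> card R = k \<and> indep R {{x, y} | x y. E x y}"
          using r[OF finW True] by blast
        have edge: "{x, y} \<in> {{x, y} | x y. E x y} \<longleftrightarrow> E x y" for x y
          using sym by (auto simp: doubleton_eq_iff)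
        from R(2) show ?thesis
        proof
          assume "card R = 4 \<and> clique R {{x, y} | x y. E x y}"
          then have "card R = 4" "\<And>x y. x \<in> R \<Longrightarrow> y \<in> R \<Longrightarrow> x \<noteq> y \<Longrightarrow> E x y" unfolding clique_def edge by blast+
          then have "small_obs E 4 V L" using R(1) WV L3 by (intro K4_small_obs[of R]) blast+
          then show ?thesis by (rule small_obs_mono) simp_all
        next
          assume "card R = k \<and> indep R {{x, y} | x y. E x y}"
          then have "card R = k" "\<forall>x\<in>R. \<forall>y\<in>R. \<not> E x y" using irr unfolding indep_def edge by metis+
          moreover have "R \<subseteq> V" "finite R" using R(1) WV finW finite_subset by blast+
          moreover have "\<forall>x\<in>R. \<not> E a x \<and> \<not> E b x \<and> \<not> E c x \<and> \<not> E d x" using R(1) unfolding W_def by blast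
          ultimately show ?thesis using free abcd unfolding P4kP1_free_on_def by blast
        qed
      next
        case False
        let ?T = "{a, b, c, d} \<union> W"
        have "card ?T \<le> card {a, b, c, d} + card W" by (rule card_Un_le)
        moreover have "card {a, b, c, d} \<le> 4" by (simp add: card_insert_if)
        ultimately have cT: "card ?T \<le> 4 + r" using False by linarith
        have "small_obs E ((?g ^^ card ?T) ?m) V L"
        proof (rule P4kP1_free_dominated[OF sym irr fin _ _ _ free L3 nc])
          show "finite ?T" using finW by simp
          show "?T \<subseteq> V" using abcd(1-4) WV by simp
          show "\<exists>t\<in>?T. E v t" if "v \<in> V" "v \<notin> ?T" for v using that sym unfolding W_def by auto
        qed
        then show ?thesis by (rule small_obs_mono) (use funpow_guess_mono[OF cT, of ?m] in simp_all)
      qed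
    qed
  qed
qed

section \<open>Infinite families of minimal obstructions\<close>

definition embeds :: "'a set \<Rightarrow> ('a \<Rightarrow> 'a \<Rightarrow> bool) \<Rightarrow> 'b set \<Rightarrow> ('b \<Rightarrow> 'b \<Rightarrow> bool) \<Rightarrow> bool" where
  "embeds U D V E \<longleftrightarrow> (\<exists>f. inj_on f U \<and> f ` U \<subseteq> V \<and> (\<forall>u\<in>U. \<forall>v\<in>U. E (f u) (f v) \<longleftrightarrow> D u v))"

lemma embedsE:
  assumes "embeds U D V E"
  obtains f where "inj_on f U" "f ` U \<subseteq> V" "\<And>u v. u \<in> U \<Longrightarrow> v \<in> U \<Longrightarrow> E (f u) (f v) \<longleftrightarrow> D u v"
proof -
  from assms[unfolded embeds_def] obtain f where f: "inj_on f U" "f ` U \<subseteq> V" "\<forall>u\<in>U. \<forall>v\<in>U. E (f u) (f v) \<longleftrightarrow> D u v"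
    by (elim exE conjE) (rule that)
  show thesis by (rule that[OF f(1,2)]) (rule f(3)[rule_format])
qed

lemma embeds_trans:
  assumes "embeds U D V E" "embeds V E W F"
  shows "embeds U D W F"
proof -
  obtain f where f: "inj_on f U" "f ` U \<subseteq> V" "\<forall>u\<in>U. \<forall>v\<in>U. E (f u) (f v) \<longleftrightarrow> D u v"
    using assms(1) unfolding embeds_def by blast
  obtain g where g: "inj_on g V" "g ` V \<subseteq> W" "\<forall>u\<in>V. \<forall>v\<in>V. F (g u) (g v) \<longleftrightarrow> E u v"
    using assms(2) unfolding embeds_def by blast
  have "inj_on (g \<circ> f) U" using f(1) inj_on_subset[OF g(1) f(2)] by (rule comp_inj_on)
  moreover have "(g \<circ> f) ` U \<subseteq> W" using f(2) g(2) by fastforce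
  moreover have "\<forall>u\<in>U. \<forall>v\<in>U. F ((g \<circ> f) u) ((g \<circ> f) v) \<longleftrightarrow> D u v" using f(2,3) g(3) by (metis comp_apply image_subset_iff)
  ultimately show ?thesis unfolding embeds_def by blast
qed

text \<open>The colours along the forcing sequence run cyclically through 1, 2, 3. The last vertex
  is allowed only the colour that its predecessor is forced to take.\<close>

definition twist_lists :: "nat \<Rightarrow> nat \<Rightarrow> nat set" where
  "twist_lists m i = (if i = 0 then {1} else if i = m then {(m - 1) mod 3 + 1} else {(i - 1) mod 3 + 1, i mod 3 + 1})"

text \<open>A chord from \<open>x\<close> to a later \<open>y\<close> congruent to
  \<open>x + 2\<close> modulo 3 is harmless: its ends differ when both take their first-kind colour
  \<open>i mod 3 + 1\<close>, when both take the colour of \<open>i - 1\<close>, and when only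
  \<open>y\<close> has switched. These are the colourings that show minimality.\<close>

definition twisted :: "(nat \<Rightarrow> nat \<Rightarrow> bool) \<Rightarrow> bool" where
  "twisted E \<longleftrightarrow> (\<forall>x y. E x y \<longrightarrow> E y x) \<and> (\<forall>x. \<not> E x x) \<and> (\<forall>x. E x (Suc x)) \<and>
    (\<forall>x y. x < y \<longrightarrow> E x y \<longrightarrow> y = Suc x \<or> y mod 3 = Suc (Suc x) mod 3)"

lemma mod_3_cases: "n mod 3 \<in> {0, 1, 2::nat}"
  by auto

lemma step_mod_3: "y = Suc x \<or> y mod 3 = Suc (Suc x) mod 3 \<Longrightarrow> x mod 3 \<noteq> y mod 3"
  using mod_3_cases[of x] by (elim insertE emptyE) (auto simp: mod_Suc)

lemma Suc_mod_3_cancel: "Suc x mod 3 = Suc y mod 3 \<Longrightarrow> x mod 3 = y mod 3"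
  using mod_3_cases[of x] mod_3_cases[of y] by (elim insertE emptyE) (simp_all add: mod_Suc)

text \<open>
  Colouring the vertices in increasing order is forced; after deleting vertex \<open>i\<close> one uses the first colours
  up to \<open>i\<close> and the second ones, propagated from the other end, afterwards.
\<close>

lemma twisted_not_lcol:
  assumes "twisted E" "1 \<le> m"
  shows "\<not> lcol E {..m} (twist_lists m)"
proof
  assume "lcol E {..m} (twist_lists m)"
  then obtain f where f: "\<And>v. v \<in> {..m} \<Longrightarrow> f v \<in> twist_lists m v" "\<And>u v. u \<in> {..m} \<Longrightarrow> v \<in> {..m} \<Longrightarrow> E u v \<Longrightarrow> f u \<noteq> f v" by (erule lcolE)
  have step: "f i \<noteq> f (Suc i)" if "i < m" for i using f(2)[of i "Suc i"] assms(1) that unfolding twisted_def by simp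
  have "f i = i mod 3 + 1" if "i < m" for i
    using that
  proof (induction i)
    case 0 then show ?case using f(1)[of 0] by (simp add: twist_lists_def)
  next
    case (Suc i) then show ?case using f(1)[of "Suc i"] step[of i] by (auto simp: twist_lists_def)
  qed
  from this[of "m - 1"] show False using f(1)[of m] step[of "m - 1"] assms(2) by (simp add: twist_lists_def)
qed

lemma twisted_lcol_subset:
  assumes "twisted E" "W \<subset> {..m}"
  shows "lcol E W (twist_lists m)"
proof -
  obtain i where i: "i \<le> m" "i \<notin> W" using assms(2) by auto
  define f where "f x = (if x < i then x mod 3 + 1 else (x - 1) mod 3 + 1)" for x :: nat
  have *: "f x \<noteq> f y" if xy: "x < y" "E x y" "x \<noteq> i" "y \<noteq> i" for x y
  proof -
    have d: "y = Suc x \<or> y mod 3 = Suc (Suc x) mod 3" using assms(1) xy unfolding twisted_def by blast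
    consider "y < i" | "i < x" | "x < i" "i < y" using xy by linarith
    then show ?thesis
    proof cases
      case 1 then show ?thesis using step_mod_3[OF d] xy(1) unfolding f_def by simp
    next
      case 2
      then obtain x' y' where s: "x = Suc x'" "y = Suc y'" using xy(1) by (metis less_nat_zero_code not0_implies_Suc)
      have "y' = Suc x' \<or> y' mod 3 = Suc (Suc x') mod 3" using d Suc_mod_3_cancel[of y' "Suc (Suc x')"] unfolding s by blast
      from step_mod_3[OF this] show ?thesis using 2 xy(1) unfolding f_def s by simp
    next
      case 3
      then obtain y' where s: "y = Suc y'" by (cases y) auto
      have "y' mod 3 = Suc x mod 3" using d 3 Suc_mod_3_cancel[of y' "Suc x"] unfolding s by auto
      moreover have "x mod 3 \<noteq> Suc x mod 3" by (rule step_mod_3) simp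
      ultimately show ?thesis using 3 unfolding f_def s by simp
    qed
  qed
  show ?thesis
  proof (rule lcolI[of _ f])
    fix v assume "v \<in> W"
    then have "v \<le> m" "v \<noteq> i" using assms(2) i by auto
    then show "f v \<in> twist_lists m v" using i unfolding f_def twist_lists_def by auto
  next
    fix u v assume uv: "u \<in> W" "v \<in> W" "E u v"
    have "u \<noteq> i" "v \<noteq> i" "u \<noteq> v" "E v u" using uv i assms(1) unfolding twisted_def by auto
    then show "f u \<noteq> f v" using *[of u v] *[of v u] uv(3) by (metis linorder_neqE_nat)
  qed
qed

section \<open>The three families\<close>

definition path_adj :: "nat \<Rightarrow> nat \<Rightarrow> bool" where
  "path_adj x y \<longleftrightarrow> y = Suc x \<or> x = Suc y"

text \<open>All chords that \<open>twisted\<close> admits.\<close>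

definition skew_adj :: "nat \<Rightarrow> nat \<Rightarrow> bool" where
  "skew_adj x y \<longleftrightarrow> y = Suc x \<or> x = Suc y \<or> x < y \<and> y mod 3 = Suc (Suc x) mod 3 \<or> y < x \<and> x mod 3 = Suc (Suc y) mod 3"

text \<open>Of the admissible chords only those from residue 2 to residue 1, so that these two
  residue classes span a half graph.\<close>

definition half_adj :: "nat \<Rightarrow> nat \<Rightarrow> bool" where
  "half_adj x y \<longleftrightarrow> y = Suc x \<or> x = Suc y \<or> x < y \<and> x mod 3 = 2 \<and> y mod 3 = 1 \<or> y < x \<and> y mod 3 = 2 \<and> x mod 3 = 1"

lemma twisted_path_adj: "twisted path_adj"
  unfolding twisted_def path_adj_def by auto

lemma twisted_skew_adj: "twisted skew_adj"
  unfolding twisted_def skew_adj_def by auto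

lemma twisted_half_adj: "twisted half_adj"
  unfolding twisted_def half_adj_def by (auto simp: mod_Suc)

lemma skew_step_nonadj:
  assumes "\<not> skew_adj a z" "\<not> skew_adj (Suc a) z" "z \<noteq> a" "z \<noteq> Suc a"
  shows "Suc a < z \<and> z mod 3 = Suc a mod 3 \<or> z < a \<and> z mod 3 = a mod 3"
  using mod_3_cases[of a] mod_3_cases[of z] assms unfolding skew_adj_def by (elim insertE emptyE) (auto simp: mod_Suc)

lemma skew_chord_nonadj:
  assumes "a < b" "b mod 3 = Suc (Suc a) mod 3" "\<not> skew_adj a z" "\<not> skew_adj b z" "z \<noteq> a" "z \<noteq> b"
  shows "a < z \<and> z < b \<and> z mod 3 = Suc a mod 3 \<or> b < z \<and> z mod 3 = a mod 3 \<or> z < a \<and> z mod 3 = Suc (Suc a) mod 3"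
  using mod_3_cases[of a] mod_3_cases[of z] assms unfolding skew_adj_def by (elim insertE emptyE) (auto simp: mod_Suc)

text \<open>The common non-neighbours of two consecutive vertices form an independent set. For a
  chord from \<open>a\<close> to \<open>b\<close> they lie between \<open>a\<close> and
  \<open>b\<close>, above \<open>b\<close> or below \<open>a\<close>, with one residue for each
  place, and span a complete bipartite graph between the inner and the outer ones. Neither contains
  an edge together with a vertex nonadjacent to both its ends.\<close>

lemma skew_adj_no_2P2_P1:
  assumes ab: "skew_adj a b" and cd: "skew_adj c d"
    and n: "\<not> skew_adj a c" "\<not> skew_adj b c" "\<not> skew_adj a d" "\<not> skew_adj b d"
      "\<not> skew_adj a e" "\<not> skew_adj b e" "\<not> skew_adj c e" "\<not> skew_adj d e"
    and ne: "c \<notin> {a, b}" "d \<notin> {a, b}" "e \<notin> {a, b}"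
  shows False
proof -
  have main: False if ab: "a < b" "skew_adj a b" and n: "\<not> skew_adj a c" "\<not> skew_adj b c" "\<not> skew_adj a d" "\<not> skew_adj b d"
      "\<not> skew_adj a e" "\<not> skew_adj b e" and ne: "c \<notin> {a, b}" "d \<notin> {a, b}" "e \<notin> {a, b}" for a b
  proof (cases "b = Suc a")
    case True
    have "Suc a < z \<and> z mod 3 = Suc a mod 3 \<or> z < a \<and> z mod 3 = a mod 3" if "z \<in> {c, d}" for z
      by (rule skew_step_nonadj) (use True n ne that in auto)
    from this[of c] this[of d] cd mod_3_cases[of a] show False unfolding skew_adj_def
      by (elim insertE emptyE) (auto simp: mod_Suc split: if_splits, presburger+)
  next
    case False
    then have b: "b mod 3 = Suc (Suc a) mod 3" using ab unfolding skew_adj_def by auto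
    have *: "a < z \<and> z < b \<and> z mod 3 = Suc a mod 3 \<or> b < z \<and> z mod 3 = a mod 3 \<or> z < a \<and> z mod 3 = Suc (Suc a) mod 3" if "z \<in> {c, d, e}" for z
      by (rule skew_chord_nonadj[OF ab(1) b]) (use n ne that in auto)
    define mid where "mid z \<longleftrightarrow> a < z \<and> z < b" for z
    have same: "mid y \<noteq> mid z" if "y \<in> {c, d, e}" "z \<in> {c, d, e}" "skew_adj y z" for y z
      using *[OF that(1)] *[OF that(2)] that(3) ab(1) mod_3_cases[of a]
      unfolding mid_def skew_adj_def by (elim insertE[of "a mod 3"] emptyE) (auto simp: mod_Suc split: if_splits, (presburger+)?)
    have diff: "skew_adj y z" if "y \<in> {c, d, e}" "z \<in> {c, d, e}" "mid y" "\<not> mid z" for y z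
      using *[OF that(1)] *[OF that(2)] that(3,4) ab(1) mod_3_cases[of a]
      unfolding mid_def skew_adj_def by (elim insertE[of "a mod 3"] emptyE) (auto simp: mod_Suc split: if_splits, (presburger+)?)
    have sym: "skew_adj x y \<Longrightarrow> skew_adj y x" for x y unfolding skew_adj_def by blast
    show False using same[of c d] diff[of c e] diff[of d e] diff[of e c] diff[of e d] cd assms(9,10) sym by blast
  qed
  have sym: "skew_adj b a" using ab unfolding skew_adj_def by blast
  have "a \<noteq> b" using ab twisted_skew_adj unfolding twisted_def by blast
  then show False using main[of a b] main[of b a] ab sym n ne by (metis insert_iff linorder_neqE_nat)
qed

lemma half_edge_cases:
  assumes "half_adj x y"
  shows "x mod 3 = 1 \<and> y mod 3 = 2 \<and> y \<le> Suc x \<or> y mod 3 = 1 \<and> x mod 3 = 2 \<and> x \<le> Suc y \<or>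
    path_adj x y \<and> (x mod 3 = 0 \<or> y mod 3 = 0)"
proof -
  have *: "Suc x mod 3 = 2 \<and> x mod 3 = 1 \<or> x mod 3 = 0 \<or> Suc x mod 3 = 0" for x :: nat
    using mod_3_cases[of x] by (auto simp: mod_Suc)
  show ?thesis using assms *[of x] *[of y] unfolding half_adj_def path_adj_def by auto
qed

text \<open>Every induced P3 uses an edge between residues 1 and 2. Otherwise both of its edges are
  steps of the path with an end divisible by 3; then the middle vertex is divisible by 3, and the
  outer two, of residues 2 and 1, are joined by a chord.\<close>

lemma half_P3_edge:
  assumes "half_adj a b" "half_adj b c" "\<not> half_adj a c" "a \<noteq> c"
  shows "\<exists>y\<in>{a, b, c}. \<exists>z\<in>{a, b, c}. y mod 3 = 1 \<and> z mod 3 = 2 \<and> z \<le> Suc y"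
proof (rule ccontr)
  assume "\<not> ?thesis"
  then have n: "\<not> (y mod 3 = 1 \<and> z mod 3 = 2 \<and> z \<le> Suc y)" if "y \<in> {a, b, c}" "z \<in> {a, b, c}" for y z using that by blast
  have e: "path_adj a b" "a mod 3 = 0 \<or> b mod 3 = 0" "path_adj b c" "b mod 3 = 0 \<or> c mod 3 = 0"
    using half_edge_cases[OF assms(1)] half_edge_cases[OF assms(2)] n[of a b] n[of b a] n[of b c] n[of c b]
    by (simp_all only: insert_iff simp_thms)
  have *: "x mod 3 = 2 \<and> Suc (Suc x) mod 3 = 1"
    if "x mod 3 = 0 \<or> Suc x mod 3 = 0" "Suc x mod 3 = 0 \<or> Suc (Suc x) mod 3 = 0" for x :: nat
    using that mod_3_cases[of x] by (elim insertE emptyE) (simp_all add: mod_Suc)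
  from e assms(4) consider "b = Suc a" "c = Suc (Suc a)" | "b = Suc c" "a = Suc (Suc c)"
    unfolding path_adj_def by auto
  then show False
  proof cases
    case 1
    have "a mod 3 = 2 \<and> Suc (Suc a) mod 3 = 1" using e(2,4) unfolding 1 by - (rule *; blast)
    then have "half_adj a c" unfolding half_adj_def 1 by simp
    then show False using assms(3) by blast
  next
    case 2
    have "c mod 3 = 2 \<and> Suc (Suc c) mod 3 = 1" using *[of c] disj_commute[THEN iffD1, OF e(2)] disj_commute[THEN iffD1, OF e(4)] unfolding 2 by satx
    then have "half_adj a c" unfolding half_adj_def 2 by simp
    then show False using assms(3) by blast
  qed
qed

lemma half_adj_iff: "y mod 3 = 1 \<Longrightarrow> z mod 3 = 2 \<Longrightarrow> half_adj y z \<longleftrightarrow> z \<le> Suc y"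
  unfolding half_adj_def by (auto simp: mod_Suc le_Suc_eq split: if_splits)

lemma half_adj_no_2P3:
  assumes "half_adj a b" "half_adj b c" "\<not> half_adj a c" "a \<noteq> c"
    and "half_adj d e" "half_adj e f" "\<not> half_adj d f" "d \<noteq> f"
    and n: "\<And>x y. x \<in> {a, b, c} \<Longrightarrow> y \<in> {d, e, f} \<Longrightarrow> \<not> half_adj x y"
  shows False
proof -
  obtain y z where yz: "y \<in> {a, b, c}" "z \<in> {a, b, c}" "y mod 3 = 1" "z mod 3 = 2" "z \<le> Suc y"
    using half_P3_edge[OF assms(1-4)] by blast
  obtain y' z' where yz': "y' \<in> {d, e, f}" "z' \<in> {d, e, f}" "y' mod 3 = 1" "z' mod 3 = 2" "z' \<le> Suc y'"
    using half_P3_edge[OF assms(5-8)] by blast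
  have sym: "half_adj u v \<Longrightarrow> half_adj v u" for u v unfolding half_adj_def by blast
  have "\<not> half_adj y z'" "\<not> half_adj y' z" using n yz yz' sym by blast+
  then show False using yz(5) yz'(5) half_adj_iff[OF yz(3) yz'(4)] half_adj_iff[OF yz'(3) yz(4)] by simp
qed

section \<open>Linear forests without 2P2 + P1 and 2P3\<close>

definition star_adj :: "nat + nat \<Rightarrow> nat + nat \<Rightarrow> bool" where
  "star_adj x y \<longleftrightarrow> (\<exists>i j. x = Inl i \<and> y = Inl j \<and> path_adj i j)"

text \<open>Let the first edge start at \<open>i\<close> and the last at \<open>j\<close>. If they
  are close, all edges lie among four consecutive numbers, and the rest is isolated. Otherwise they
  form a 2P2, so every other vertex is adjacent to one of them, which leaves at most six vertices.
  Excluding 2P3 then reduces the far case to a subgraph of P3 + P2, an induced subgraph of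
  P6.\<close>

lemma path_subset_embeds:
  assumes fin: "finite A"
    and no1: "\<And>a b c d e. \<lbrakk>{a, b, c, d, e} \<subseteq> A; path_adj a b; path_adj c d; \<not> path_adj a c; \<not> path_adj a d; \<not> path_adj a e;
      \<not> path_adj b c; \<not> path_adj b d; \<not> path_adj b e; \<not> path_adj c e; \<not> path_adj d e; c \<notin> {a, b}; d \<notin> {a, b}; e \<notin> {a, b, c, d}\<rbrakk> \<Longrightarrow> False"
    and no2: "\<And>a b c d e f. \<lbrakk>{a, b, c, d, e, f} \<subseteq> A; path_adj a b; path_adj b c; \<not> path_adj a c; a \<noteq> c; path_adj d e; path_adj e f;
      \<not> path_adj d f; d \<noteq> f; \<forall>x\<in>{a, b, c}. \<forall>y\<in>{d, e, f}. \<not> path_adj x y\<rbrakk> \<Longrightarrow> False"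
  shows "embeds A path_adj {..<6} path_adj \<or> (\<exists>k. embeds A path_adj (Inl ` {..<4} \<union> Inr ` {..<k}) star_adj)"
proof -
  obtain num k where num: "bij_betw num A {..<k::nat}"
    using ex_bij_betw_finite_nat[OF fin] atLeast0LessThan by metis
  have numk: "num z < k" if "z \<in> A" for z using num that unfolding bij_betw_def by blast
  have numinj: "num y = num z \<longleftrightarrow> y = z" if "y \<in> A" "z \<in> A" for y z
    using num that unfolding bij_betw_def by (meson inj_on_eq_iff)
  have close: "embeds A path_adj (Inl ` {..<4} \<union> Inr ` {..<k}) star_adj"
    if far: "\<And>z. z \<in> A \<Longrightarrow> Suc z \<in> A \<Longrightarrow> i \<le> z \<and> z \<le> i + 2" for i
  proof -
    define g where "g z = (if i \<le> z \<and> z \<le> i + 3 then Inl (z - i) else Inr (num z))" for z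
    have "inj_on g A" by (rule inj_onI) (auto simp: g_def numinj split: if_splits)
    moreover have "g ` A \<subseteq> Inl ` {..<4} \<union> Inr ` {..<k}" using numk by (auto simp: g_def)
    moreover have "star_adj (g u) (g v) \<longleftrightarrow> path_adj u v" if "u \<in> A" "v \<in> A" for u v
      using far[of u] far[of v] that unfolding g_def star_adj_def path_adj_def by auto
    ultimately show ?thesis unfolding embeds_def by blast
  qed
  have shift: "embeds A path_adj {..<6} path_adj"
    if "inj_on g A" "g ` A \<subseteq> {..<6}" "\<And>u v. u \<in> A \<Longrightarrow> v \<in> A \<Longrightarrow> path_adj (g u) (g v) \<longleftrightarrow> path_adj u v" for g
    using that unfolding embeds_def by blast
  define S where "S = {z \<in> A. Suc z \<in> A}"
  have finS: "finite S" using fin unfolding S_def by simp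
  show ?thesis
  proof (cases "S = {}")
    case True
    then show ?thesis using close[of 0] unfolding S_def by blast
  next
    case False
    define i where "i = Min S"
    define j where "j = Max S"
    have ij: "i \<in> S" "j \<in> S" and bnd: "\<And>z. z \<in> S \<Longrightarrow> i \<le> z \<and> z \<le> j"
      using Min_in[OF finS False] Max_in[OF finS False] finS unfolding i_def j_def by simp_all
    have iA: "i \<in> A" "Suc i \<in> A" "j \<in> A" "Suc j \<in> A" using ij unfolding S_def by auto
    show ?thesis
    proof (cases "j \<le> i + 2")
      case True
      have "i \<le> z \<and> z \<le> i + 2" if "z \<in> A" "Suc z \<in> A" for z using bnd[of z] that True unfolding S_def by simp
      then show ?thesis using close[of i] by blast
    next
      case False
      \<comment> \<open>A further vertex must be adjacent to one of the two edges, and by the choice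
        of \<open>i\<close> and \<open>j\<close> it cannot lie directly before the first or directly
        after the last.\<close>
      have sub: "z \<in> {i, Suc i, i + 2, j - 1, j, Suc j}" if z: "z \<in> A" for z
      proof (rule ccontr)
        assume out: "z \<notin> {i, Suc i, i + 2, j - 1, j, Suc j}"
        have "Suc z \<noteq> i"
        proof
          assume "Suc z = i"
          then have "z \<in> S" using z iA unfolding S_def by simp
          then show False using bnd[of z] \<open>Suc z = i\<close> by simp
        qed
        moreover have "z \<noteq> Suc (Suc j)"
        proof
          assume "z = Suc (Suc j)"
          then have "Suc j \<in> S" using z iA unfolding S_def by simp
          then show False using bnd[of "Suc j"] by simp
        qed
        moreover have "j \<noteq> Suc z" using out by auto
        ultimately show False
          using no1[of i "Suc i" j "Suc j" z] z iA out False unfolding path_adj_def by auto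
      qed
      show ?thesis
      proof (cases "j \<le> i + 4")
        case True
        have r: "i \<le> z \<and> z \<le> i + 5" if "z \<in> A" for z using sub[OF that] True False by auto
        have "embeds A path_adj {..<6} path_adj"
        proof (rule shift[of "\<lambda>z. z - i"])
          show "inj_on (\<lambda>z. z - i) A"
          proof (rule inj_onI)
            fix x y assume "x \<in> A" "y \<in> A" "x - i = y - i"
            then show "x = y" using r[of x] r[of y] by arith
          qed
          show "(\<lambda>z. z - i) ` A \<subseteq> {..<6}" using r by fastforce
          show "path_adj (u - i) (v - i) \<longleftrightarrow> path_adj u v" if "u \<in> A" "v \<in> A" for u v
            using r[OF that(1)] r[OF that(2)] unfolding path_adj_def by auto
        qed
        then show ?thesis by blast
      next
        case far: False
        have nboth: "\<not> (i + 2 \<in> A \<and> j - 1 \<in> A)"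
        proof
          assume a: "i + 2 \<in> A \<and> j - 1 \<in> A"
          obtain h where h: "j = Suc h" using far by (cases j) auto
          show False
            using no2[of i "Suc i" "i + 2" h j "Suc j"] a iA far unfolding path_adj_def h by auto
        qed
        show ?thesis
        proof (cases "i + 2 \<in> A")
          case True
          have s: "z \<in> {i, Suc i, i + 2, j, Suc j}" if "z \<in> A" for z using sub[OF that] nboth True that by auto
          \<comment> \<open>The long gap between the two parts is closed up to the single missing
            number 3.\<close>
          have "embeds A path_adj {..<6} path_adj"
          proof (rule shift[of "\<lambda>z. if z \<le> i + 2 then z - i else z - j + 4"])
            show "inj_on (\<lambda>z. if z \<le> i + 2 then z - i else z - j + 4) A"
            proof (rule inj_onI)
              fix x y assume "x \<in> A" "y \<in> A" "(if x \<le> i + 2 then x - i else x - j + 4) = (if y \<le> i + 2 then y - i else y - j + 4)"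
              then show "x = y" using s[of x] s[of y] far by auto
            qed
            show "(\<lambda>z. if z \<le> i + 2 then z - i else z - j + 4) ` A \<subseteq> {..<6}" using s far by fastforce
            show "path_adj (if u \<le> i + 2 then u - i else u - j + 4) (if v \<le> i + 2 then v - i else v - j + 4) \<longleftrightarrow> path_adj u v"
              if "u \<in> A" "v \<in> A" for u v
              using s[OF that(1)] s[OF that(2)] far unfolding path_adj_def by auto
          qed
          then show ?thesis by blast
        next
          case False
          obtain h where h: "j = Suc h" using far by (cases j) auto
          have s: "z \<in> {i, Suc i, h, Suc h, Suc (Suc h)}" if "z \<in> A" for z using sub[OF that] False that h by auto
          have "embeds A path_adj {..<6} path_adj"
          proof (rule shift[of "\<lambda>z. if z \<le> i + 2 then z - i else z + 3 - h"])
            show "inj_on (\<lambda>z. if z \<le> i + 2 then z - i else z + 3 - h) A"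
            proof (rule inj_onI)
              fix x y assume "x \<in> A" "y \<in> A" "(if x \<le> i + 2 then x - i else x + 3 - h) = (if y \<le> i + 2 then y - i else y + 3 - h)"
              then show "x = y" using s[of x] s[of y] far h by auto
            qed
            show "(\<lambda>z. if z \<le> i + 2 then z - i else z + 3 - h) ` A \<subseteq> {..<6}" using s far h by fastforce
            show "path_adj (if u \<le> i + 2 then u - i else u + 3 - h) (if v \<le> i + 2 then v - i else v + 3 - h) \<longleftrightarrow> path_adj u v"
              if "u \<in> A" "v \<in> A" for u v
              using s[OF that(1)] s[OF that(2)] far h unfolding path_adj_def by auto
          qed
          then show ?thesis by blast
        qed
      qed
    qed
  qed
qed

section \<open>Isomorphism classes of minimal list obstructions\<close>

abbreviation adj :: "'a pair_pre_digraph \<Rightarrow> 'a \<Rightarrow> 'a \<Rightarrow> bool" where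
  "adj G u v \<equiv> (u, v) \<in> parcs G"

definition induce :: "'a pair_pre_digraph \<Rightarrow> 'a set \<Rightarrow> 'a pair_pre_digraph" where
  "induce G W = \<lparr> pverts = W, parcs = {(u, v) \<in> parcs G. u \<in> W \<and> v \<in> W} \<rparr>"

lemma adj_sym: "pair_graph G \<Longrightarrow> adj G u v \<Longrightarrow> adj G v u"
proof -
  assume "pair_graph G" "adj G u v"
  then interpret pair_graph G by simp
  show "adj G v u" using arcs_symmetric[OF \<open>adj G u v\<close>] .
qed

lemma adj_irrefl: "pair_graph G \<Longrightarrow> \<not> adj G v v"
proof
  assume "pair_graph G" "adj G v v"
  then interpret pair_graph G by simp
  show False using no_loops'[OF \<open>adj G v v\<close>] by simp
qed

lemma adj_verts: "pair_graph G \<Longrightarrow> adj G u v \<Longrightarrow> u \<in> pverts G \<and> v \<in> pverts G"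
proof -
  assume "pair_graph G" "adj G u v"
  then interpret pair_graph G by simp
  show ?thesis using in_arcsD1[OF \<open>adj G u v\<close>] in_arcsD2[OF \<open>adj G u v\<close>] by simp
qed

lemma finite_pverts: "pair_graph G \<Longrightarrow> finite (pverts G)"
proof -
  assume "pair_graph G"
  then interpret pair_graph G .
  show ?thesis by (rule pair_finite_verts)
qed

lemma pair_graphI:
  assumes "finite (pverts G)" "\<And>u v. adj G u v \<Longrightarrow> u \<in> pverts G \<and> v \<in> pverts G \<and> u \<noteq> v \<and> adj G v u"
  shows "pair_graph G"
proof -
  have "parcs G \<subseteq> pverts G \<times> pverts G" using assms(2) by auto
  then have "finite (parcs G)" using assms(1) finite_subset by blast
  then show ?thesis using assms
    by unfold_locales (auto simp: symmetric_def sym_def)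
qed

lemma induced_subgraph_iff:
  assumes "pair_graph G"
  shows "induced_subgraph (with_proj A) (with_proj G) \<longleftrightarrow> (\<exists>W\<subseteq>pverts G. A = induce G W)"
proof
  assume "induced_subgraph (with_proj A) (with_proj G)"
  then have "pverts A \<subseteq> pverts G" "parcs A = {e \<in> parcs G. fst e \<in> pverts A \<and> snd e \<in> pverts A}"
    unfolding induced_subgraph_def subgraph_def by simp_all
  then have "pverts A \<subseteq> pverts G" "A = induce G (pverts A)"
    unfolding induce_def by (auto intro: pair_pre_digraph.equality)
  then show "\<exists>W\<subseteq>pverts G. A = induce G W" by blast
next
  assume "\<exists>W\<subseteq>pverts G. A = induce G W"
  then obtain W where W: "W \<subseteq> pverts G" "A = induce G W" by blast
  interpret pair_graph G by fact
  have "wf_digraph (with_proj G)" by (simp add: wf_digraph_wp_iff) unfold_locales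
  moreover have "wf_digraph (with_proj A)" unfolding wf_digraph_wp_iff W(2) induce_def by unfold_locales auto
  ultimately show "induced_subgraph (with_proj A) (with_proj G)"
    using W unfolding induced_subgraph_def subgraph_def compatible_def by (auto simp: induce_def)
qed

lemma pair_graph_induce: "pair_graph G \<Longrightarrow> W \<subseteq> pverts G \<Longrightarrow> pair_graph (induce G W)"
  by (rule pair_graphI) (auto simp: induce_def adj_irrefl dest: adj_sym intro: finite_subset finite_pverts)

lemma digraph_iso_iff:
  assumes "pair_graph A" "pair_graph H"
  shows "digraph_iso (with_proj A) (with_proj H) \<longleftrightarrow>
    (\<exists>h. bij_betw h (pverts A) (pverts H) \<and> (\<forall>u\<in>pverts A. \<forall>v\<in>pverts A. adj H (h u) (h v) \<longleftrightarrow> adj A u v))"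
proof
  assume "digraph_iso (with_proj A) (with_proj H)"
  then obtain f where f: "pre_digraph.digraph_isomorphism (with_proj A) f" and eq: "with_proj H = app_iso f (with_proj A)"
    unfolding digraph_iso_def by blast
  have V: "pverts H = iso_verts f ` pverts A" and E: "parcs H = iso_arcs f ` parcs A"
    and t: "iso_tail f = fst" "iso_head f = snd"
    using arg_cong[OF eq, of verts] arg_cong[OF eq, of arcs] arg_cong[OF eq, of tail] arg_cong[OF eq, of head] by simp_all
  have inj: "inj_on (iso_verts f) (pverts A)"
    and ends: "\<And>a. a \<in> parcs A \<Longrightarrow> iso_arcs f a = (iso_verts f (fst a), iso_verts f (snd a))"
    using f unfolding pre_digraph.digraph_isomorphism_def by (simp_all add: t prod_eq_iff)
  have "adj H (iso_verts f u) (iso_verts f v) \<longleftrightarrow> adj A u v" if "u \<in> pverts A" "v \<in> pverts A" for u v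
  proof
    assume "adj H (iso_verts f u) (iso_verts f v)"
    then obtain x y where xy: "adj A x y" "iso_verts f x = iso_verts f u" "iso_verts f y = iso_verts f v"
      unfolding E by (auto simp: ends)
    then have "x = u" "y = v" using adj_verts[OF assms(1) xy(1)] that inj_onD[OF inj] by metis+
    then show "adj A u v" using xy(1) by simp
  next
    assume "adj A u v"
    then show "adj H (iso_verts f u) (iso_verts f v)" unfolding E using ends[of "(u, v)"] by (metis fst_conv image_eqI snd_conv)
  qed
  then show "\<exists>h. bij_betw h (pverts A) (pverts H) \<and> (\<forall>u\<in>pverts A. \<forall>v\<in>pverts A. adj H (h u) (h v) \<longleftrightarrow> adj A u v)"
    using inj V unfolding bij_betw_def by blast
next
  assume "\<exists>h. bij_betw h (pverts A) (pverts H) \<and> (\<forall>u\<in>pverts A. \<forall>v\<in>pverts A. adj H (h u) (h v) \<longleftrightarrow> adj A u v)"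
  then obtain h where inj: "inj_on h (pverts A)" and V: "pverts H = h ` pverts A"
    and E: "\<And>u v. u \<in> pverts A \<Longrightarrow> v \<in> pverts A \<Longrightarrow> adj H (h u) (h v) \<longleftrightarrow> adj A u v"
    unfolding bij_betw_def by blast
  interpret pair_graph A by fact
  have wf: "wf_digraph (with_proj A)" by (simp add: wf_digraph_wp_iff) unfold_locales
  let ?f = "\<lparr> iso_verts = h, iso_arcs = map_prod h h, iso_head = snd, iso_tail = fst \<rparr>"
  have "inj_on (map_prod h h) (parcs A)"
    by (rule inj_on_subset[OF map_prod_inj_on[OF inj inj]]) (auto dest: adj_verts[OF assms(1)])
  moreover have "parcs H = map_prod h h ` parcs A"
  proof (intro equalityI subrelI)
    fix x y assume xy: "adj H x y"
    then obtain u v where "u \<in> pverts A" "v \<in> pverts A" "x = h u" "y = h v"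
      using V adj_verts[OF assms(2) xy] by auto
    with xy show "(x, y) \<in> map_prod h h ` parcs A" by (auto simp: E intro: rev_image_eqI)
  qed (auto simp: E adj_verts[OF assms(1)])
  ultimately have "pre_digraph.digraph_isomorphism (with_proj A) ?f" "with_proj H = app_iso ?f (with_proj A)"
    using inj V wf by (auto simp: pre_digraph.digraph_isomorphism_def app_iso_def with_proj_def)
  then show "digraph_iso (with_proj A) (with_proj H)" unfolding digraph_iso_def by blast
qed

lemma is_induced_subgraph_of_iff:
  assumes H: "pair_graph H" and G: "pair_graph G"
  shows "is_induced_subgraph_of H G \<longleftrightarrow> embeds (pverts H) (adj H) (pverts G) (adj G)"
proof
  assume "is_induced_subgraph_of H G"
  then obtain W where W: "W \<subseteq> pverts G" "digraph_iso (with_proj (induce G W)) (with_proj H)"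
    unfolding is_induced_subgraph_of_def induced_subgraph_iff[OF G] by blast
  then obtain h where h: "bij_betw h W (pverts H)" "\<And>u v. u \<in> W \<Longrightarrow> v \<in> W \<Longrightarrow> adj H (h u) (h v) \<longleftrightarrow> adj G u v"
    unfolding digraph_iso_iff[OF pair_graph_induce[OF G W(1)] H] by (auto simp: induce_def)
  let ?g = "inv_into W h"
  have g: "bij_betw ?g (pverts H) W" by (rule bij_betw_inv_into[OF h(1)])
  have "adj G (?g u) (?g v) \<longleftrightarrow> adj H u v" if "u \<in> pverts H" "v \<in> pverts H" for u v
    using h(2)[of "?g u" "?g v"] that g bij_betw_inv_into_right[OF h(1)] bij_betwE[OF g] by simp
  then show "embeds (pverts H) (adj H) (pverts G) (adj G)"
    using g W(1) unfolding embeds_def bij_betw_def by blast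
next
  assume "embeds (pverts H) (adj H) (pverts G) (adj G)"
  then obtain f where f: "inj_on f (pverts H)" "f ` pverts H \<subseteq> pverts G"
    "\<And>u v. u \<in> pverts H \<Longrightarrow> v \<in> pverts H \<Longrightarrow> adj G (f u) (f v) \<longleftrightarrow> adj H u v" unfolding embeds_def by blast
  let ?W = "f ` pverts H" and ?h = "inv_into (pverts H) f"
  have b: "bij_betw ?h ?W (pverts H)" using f(1) by (simp add: bij_betw_inv_into inj_on_imp_bij_betw)
  have "adj H (?h u) (?h v) \<longleftrightarrow> adj (induce G ?W) u v" if "u \<in> ?W" "v \<in> ?W" for u v
    using that f by (auto simp: induce_def)
  then have "digraph_iso (with_proj (induce G ?W)) (with_proj H)"
    unfolding digraph_iso_iff[OF pair_graph_induce[OF G f(2)] H] using b by (intro exI[of _ ?h]) (simp add: induce_def)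
  then show "is_induced_subgraph_of H G"
    unfolding is_induced_subgraph_of_def induced_subgraph_iff[OF G] using f(2) by blast
qed

lemma colorable_iff_lcol:
  assumes "pair_graph G"
  shows "colorable G L \<longleftrightarrow> lcol (adj G) (pverts G) L"
proof
  assume "colorable G L"
  then obtain c where "\<forall>v\<in>pverts G. c v \<in> L v" "\<forall>(u, v)\<in>parcs G. c u \<noteq> c v" unfolding colorable_def by blast
  then show "lcol (adj G) (pverts G) L" by (intro lcolI[of _ c]) auto
next
  assume "lcol (adj G) (pverts G) L"
  then obtain c where "\<And>v. v \<in> pverts G \<Longrightarrow> c v \<in> L v" "\<And>u v. u \<in> pverts G \<Longrightarrow> v \<in> pverts G \<Longrightarrow> adj G u v \<Longrightarrow> c u \<noteq> c v"
    by (erule lcolE)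
  then show "colorable G L" unfolding colorable_def using adj_verts[OF assms] by (intro exI[of _ c]) auto
qed

lemma lcol_induce: "lcol (adj (induce G W)) W L \<longleftrightarrow> lcol (adj G) W L"
  unfolding lcol_def by (auto simp: induce_def)

lemma minimal_list_obstruction_iff:
  assumes "pair_graph G"
  shows "minimal_list_obstruction G L \<longleftrightarrow> (\<forall>v\<in>pverts G. L v \<subseteq> {1,2,3}) \<and> \<not> lcol (adj G) (pverts G) L \<and>
    (\<forall>W. W \<subset> pverts G \<longrightarrow> lcol (adj G) W L)"
proof -
  have eq: "induce G W = G \<longleftrightarrow> W = pverts G" if "W \<subseteq> pverts G" for W
  proof
    assume "induce G W = G"
    then have "pverts (induce G W) = pverts G" by (rule arg_cong)
    then show "W = pverts G" unfolding induce_def by simp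
  next
    assume "W = pverts G"
    then show "induce G W = G"
      using adj_verts[OF assms] unfolding induce_def by (intro pair_pre_digraph.equality) auto
  qed
  have "(\<forall>A. induced_subgraph (with_proj A) (with_proj G) \<and> A \<noteq> G \<longrightarrow> colorable A L) \<longleftrightarrow>
    (\<forall>W. W \<subset> pverts G \<longrightarrow> colorable (induce G W) L)"
    unfolding induced_subgraph_iff[OF assms] using eq by (auto simp: psubset_eq)
  moreover have "colorable (induce G W) L \<longleftrightarrow> lcol (adj G) W L" if "W \<subset> pverts G" for W
    using colorable_iff_lcol[OF pair_graph_induce[OF assms]] that lcol_induce by (simp add: induce_def psubset_imp_subset)
  ultimately show ?thesis
    unfolding minimal_list_obstruction_def list_system_def using assms colorable_iff_lcol[OF assms] by auto
qed

text \<open>By minimality a non-colourable set of vertices is the whole vertex set, so the bounded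
  refutation bounds the obstruction itself.\<close>

lemma minimal_list_obstruction_card:
  assumes "minimal_list_obstruction G L" "small_obs (adj G) n (pverts G) L"
  shows "card (pverts G) \<le> n"
proof -
  have "pair_graph G" using assms(1) unfolding minimal_list_obstruction_def by blast
  from assms(1)[unfolded minimal_list_obstruction_iff[OF this]] assms(2) show ?thesis
    unfolding small_obs_def by blast
qed

text \<open>The relation is defined on all pre-digraphs. A class in the quotient contains every
  partner of an obstruction, and this lemma keeps these partners among the graphs.\<close>

lemma pair_graph_list_graph_iso:
  assumes G: "pair_graph G" and iso: "((G, L), (G', L')) \<in> list_graph_iso"
  shows "pair_graph G'"
proof -
  obtain f where f: "pre_digraph.digraph_isomorphism (with_proj G) f" and eq: "with_proj G' = app_iso f (with_proj G)"
    using iso unfolding list_graph_iso_def by blast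
  have V: "pverts G' = iso_verts f ` pverts G" and E: "parcs G' = iso_arcs f ` parcs G"
    and t: "iso_tail f = fst" "iso_head f = snd"
    using arg_cong[OF eq, of verts] arg_cong[OF eq, of arcs] arg_cong[OF eq, of tail] arg_cong[OF eq, of head] by simp_all
  have inj: "inj_on (iso_verts f) (pverts G)"
    and ends: "\<And>a. a \<in> parcs G \<Longrightarrow> iso_arcs f a = (iso_verts f (fst a), iso_verts f (snd a))"
    using f unfolding pre_digraph.digraph_isomorphism_def by (simp_all add: t prod_eq_iff)
  show ?thesis
  proof (rule pair_graphI)
    show "finite (pverts G')" unfolding V using finite_pverts[OF G] by simp
    fix u v assume "adj G' u v"
    then obtain x y where xy: "adj G x y" "u = iso_verts f x" "v = iso_verts f y" unfolding E by (auto simp: ends)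
    have "x \<noteq> y" using adj_irrefl[OF G] xy(1) by blast
    moreover have "adj G' v u" unfolding E xy(2,3) using adj_sym[OF G xy(1)] ends[of "(y, x)"] by (metis fst_conv image_eqI snd_conv)
    ultimately show "u \<in> pverts G' \<and> v \<in> pverts G' \<and> u \<noteq> v \<and> adj G' v u"
      using xy adj_verts[OF G xy(1)] inj unfolding V inj_on_def by blast
  qed
qed

lemma list_graph_iso_card:
  assumes G: "pair_graph G" and iso: "((G, L), (G', L')) \<in> list_graph_iso"
  shows "card (pverts G') = card (pverts G)"
proof -
  obtain h where "bij_betw h (pverts G) (pverts G')"
    using iso unfolding list_graph_iso_iff[OF G pair_graph_list_graph_iso[OF assms]] by blast
  then show ?thesis using bij_betw_same_card by metis
qed

section \<open>Isomorphism as an equivalence and normal forms\<close>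

lemma list_graph_iso_refl: "pair_graph G \<Longrightarrow> ((G, L), (G, L)) \<in> list_graph_iso"
  unfolding list_graph_iso_iff by (intro exI[of _ id]) auto

lemma list_graph_iso_sym:
  assumes G: "pair_graph G" and iso: "((G, L), (G', L')) \<in> list_graph_iso"
  shows "((G', L'), (G, L)) \<in> list_graph_iso"
proof -
  have G': "pair_graph G'" by (rule pair_graph_list_graph_iso[OF assms])
  obtain h where h: "bij_betw h (pverts G) (pverts G')"
    "\<And>u v. u \<in> pverts G \<Longrightarrow> v \<in> pverts G \<Longrightarrow> adj G' (h u) (h v) \<longleftrightarrow> adj G u v" "\<And>v. v \<in> pverts G \<Longrightarrow> L' (h v) = L v"
    using iso unfolding list_graph_iso_iff[OF G G'] by blast
  let ?g = "inv_into (pverts G) h"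
  have g: "bij_betw ?g (pverts G') (pverts G)" by (rule bij_betw_inv_into[OF h(1)])
  have hg: "h (?g v) = v" "?g v \<in> pverts G" if "v \<in> pverts G'" for v
    using bij_betw_inv_into_right[OF h(1) that] bij_betwE[OF g] that by auto
  show ?thesis unfolding list_graph_iso_iff[OF G' G]
    using g h(2)[of "?g _" "?g _"] h(3)[of "?g _"] hg by (intro exI[of _ ?g]) metis
qed

lemma list_graph_iso_trans:
  assumes G: "pair_graph G" and iso: "((G, L), (G', L')) \<in> list_graph_iso" "((G', L'), (G'', L'')) \<in> list_graph_iso"
  shows "((G, L), (G'', L'')) \<in> list_graph_iso"
proof -
  have G': "pair_graph G'" by (rule pair_graph_list_graph_iso[OF G iso(1)])
  have G'': "pair_graph G''" by (rule pair_graph_list_graph_iso[OF G' iso(2)])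
  obtain h where h: "bij_betw h (pverts G) (pverts G')"
    "\<And>u v. u \<in> pverts G \<Longrightarrow> v \<in> pverts G \<Longrightarrow> adj G' (h u) (h v) \<longleftrightarrow> adj G u v" "\<And>v. v \<in> pverts G \<Longrightarrow> L' (h v) = L v"
    using iso(1) unfolding list_graph_iso_iff[OF G G'] by blast
  obtain g where g: "bij_betw g (pverts G') (pverts G'')"
    "\<And>u v. u \<in> pverts G' \<Longrightarrow> v \<in> pverts G' \<Longrightarrow> adj G'' (g u) (g v) \<longleftrightarrow> adj G' u v" "\<And>v. v \<in> pverts G' \<Longrightarrow> L'' (g v) = L' v"
    using iso(2) unfolding list_graph_iso_iff[OF G' G''] by blast
  show ?thesis unfolding list_graph_iso_iff[OF G G'']
    using bij_betw_trans[OF h(1) g(1)] h(2,3) g(2,3) bij_betwE[OF h(1)]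
    by (intro exI[of _ "g \<circ> h"]) simp
qed

text \<open>Lists are fixed to be empty off the first \<open>n\<close> numbers; otherwise a single
  graph would carry infinitely many list functions that differ only away from its vertices.\<close>

definition normal_forms :: "nat \<Rightarrow> (nat pair_pre_digraph \<times> (nat \<Rightarrow> nat set)) set" where
  "normal_forms n = {(G, L). pverts G \<subseteq> {..<n} \<and> parcs G \<subseteq> {..<n} \<times> {..<n} \<and>
    (\<forall>v. L v \<subseteq> {1,2,3}) \<and> (\<forall>v\<ge>n. L v = {})}"

lemma list_graph_iso_normal_form:
  assumes G: "pair_graph G" and L: "\<forall>v\<in>pverts G. L v \<subseteq> {1,2,3}" and n: "card (pverts G) \<le> n"
  shows "\<exists>G' L'. ((G, L), (G', L')) \<in> list_graph_iso \<and> (G', L') \<in> normal_forms n"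
proof -
  obtain h where h: "bij_betw h (pverts G) {..<card (pverts G)}"
    using ex_bij_betw_finite_nat[OF finite_pverts[OF G]] atLeast0LessThan by metis
  let ?V = "{..<card (pverts G)}" and ?g = "inv_into (pverts G) h"
  define G' where "G' = \<lparr> pverts = ?V, parcs = {(i, j). i \<in> ?V \<and> j \<in> ?V \<and> adj G (?g i) (?g j)} \<rparr>"
  define L' where "L' i = (if i \<in> ?V then L (?g i) else {})" for i
  have gh: "?g (h v) = v" "h v \<in> ?V" if "v \<in> pverts G" for v
    using bij_betw_inv_into_left[OF h that] bij_betwE[OF h] that by auto
  have g: "?g i \<in> pverts G" if "i \<in> ?V" for i using bij_betwE[OF bij_betw_inv_into[OF h]] that by auto
  have G': "pair_graph G'"
    by (rule pair_graphI) (auto simp: G'_def dest: adj_sym[OF G] adj_irrefl[OF G, THEN notE])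
  have "((G, L), (G', L')) \<in> list_graph_iso"
    unfolding list_graph_iso_iff[OF G G'] using h gh
    by (intro exI[of _ h]) (simp add: G'_def L'_def)
  moreover have "pverts G' \<subseteq> {..<n}" "parcs G' \<subseteq> {..<n} \<times> {..<n}" using n by (auto simp: G'_def)
  moreover have "L' v \<subseteq> {1,2,3}" for v using L g[of v] unfolding L'_def by auto
  moreover have "L' v = {}" if "n \<le> v" for v using that n unfolding L'_def by simp
  ultimately show ?thesis unfolding normal_forms_def by blast
qed

lemma finite_normal_forms: "finite (normal_forms n)"
proof -
  let ?F = "{L :: nat \<Rightarrow> nat set. \<forall>v. (v \<in> {..<n} \<longrightarrow> L v \<in> Pow {1,2,3}) \<and> (v \<notin> {..<n} \<longrightarrow> L v = {})}"
  let ?T = "Pow {..<n} \<times> Pow ({..<n} \<times> {..<n}) \<times> ?F"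
  have "finite ?F" by (rule finite_set_of_finite_funs) simp_all
  then have "finite ?T" by simp
  moreover have "normal_forms n \<subseteq> (\<lambda>(V, E, L). (\<lparr> pverts = V, parcs = E \<rparr>, L)) ` ?T"
  unfolding normal_forms_def
  proof (clarify)
    fix G :: "nat pair_pre_digraph" and L :: "nat \<Rightarrow> nat set"
    assume a: "pverts G \<subseteq> {..<n}" "parcs G \<subseteq> {..<n} \<times> {..<n}" "\<forall>v. L v \<subseteq> {1,2,3}" "\<forall>v\<ge>n. L v = {}"
    have "(pverts G, parcs G, L) \<in> ?T" using a by (auto simp: not_less)
    moreover have "(G, L) = (\<lambda>(V, E, L). (\<lparr> pverts = V, parcs = E \<rparr>, L)) (pverts G, parcs G, L)" by simp
    ultimately show "(G, L) \<in> (\<lambda>(V, E, L). (\<lparr> pverts = V, parcs = E \<rparr>, L)) ` ?T" by (rule rev_image_eqI)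
  qed
  ultimately show ?thesis by (rule finite_surj)
qed

lemma free_minimal_list_obstructionsD:
  assumes "(G, L) \<in> free_minimal_list_obstructions H"
  shows "pair_graph G" "minimal_list_obstruction G L" "\<forall>v\<in>pverts G. L v \<subseteq> {1,2,3}" "\<not> lcol (adj G) (pverts G) L"
    "\<not> is_induced_subgraph_of H G"
proof -
  show m: "minimal_list_obstruction G L" and "\<not> is_induced_subgraph_of H G"
    using assms unfolding free_minimal_list_obstructions_def free_of_def by auto
  show g: "pair_graph G" using m unfolding minimal_list_obstruction_def by blast
  show "\<forall>v\<in>pverts G. L v \<subseteq> {1,2,3}" "\<not> lcol (adj G) (pverts G) L" using m unfolding minimal_list_obstruction_iff[OF g] by blast+
qed

text \<open>The number of vertices is constant on each class, so finitely many classes give a bound.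
  Conversely, a bound makes every class the class of one of finitely many normal forms.\<close>

theorem finite_obstructions_iff_bounded:
  "finite (free_minimal_list_obstructions H // list_graph_iso) \<longleftrightarrow>
    (\<exists>n. \<forall>(G, L) \<in> free_minimal_list_obstructions H. card (pverts G) \<le> n)" (is "finite (?F // ?R) \<longleftrightarrow> _")
proof
  assume fin: "finite (?F // ?R)"
  \<comment> \<open>The chosen member is an isomorphic copy of an obstruction in the class and has
    the same number of vertices.\<close>
  define size where "size X = card (pverts (fst (SOME z. z \<in> X)))" for X :: "(nat pair_pre_digraph \<times> (nat \<Rightarrow> nat set)) set"
  have "card (pverts G) \<le> Max (size ` (?F // ?R))" if GL: "(G, L) \<in> ?F" for G L
  proof -
    have G: "pair_graph G" by (rule free_minimal_list_obstructionsD[OF GL])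
    let ?X = "?R `` {(G, L)}"
    have "(SOME z. z \<in> ?X) \<in> ?X" by (rule someI[of _ "(G, L)"]) (simp add: list_graph_iso_refl[OF G])
    then obtain G' L' where z: "(SOME z. z \<in> ?X) = (G', L')" "((G, L), (G', L')) \<in> ?R" by (metis Image_singleton_iff surj_pair)
    have "size ?X = card (pverts G)" unfolding size_def z(1) using list_graph_iso_card[OF G z(2)] by simp
    moreover have "?X \<in> ?F // ?R" using GL by (rule quotientI)
    ultimately show ?thesis using fin by (metis Max_ge finite_imageI imageI)
  qed
  then show "\<exists>n. \<forall>(G, L) \<in> ?F. card (pverts G) \<le> n" by blast
next
  assume "\<exists>n. \<forall>(G, L) \<in> ?F. card (pverts G) \<le> n"
  then obtain n where n: "\<And>G L. (G, L) \<in> ?F \<Longrightarrow> card (pverts G) \<le> n" by blast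
  have "?F // ?R \<subseteq> (\<lambda>s. ?R `` {s}) ` normal_forms n"
  proof
    fix X assume "X \<in> ?F // ?R"
    then obtain G L where GL: "(G, L) \<in> ?F" "X = ?R `` {(G, L)}" by (auto elim!: quotientE)
    note G = free_minimal_list_obstructionsD[OF GL(1)]
    obtain G' L' where i: "((G, L), (G', L')) \<in> ?R" "(G', L') \<in> normal_forms n"
      using list_graph_iso_normal_form[OF G(1,3) n[OF GL(1)]] by blast
    have i': "((G', L'), (G, L)) \<in> ?R" by (rule list_graph_iso_sym[OF G(1) i(1)])
    have G': "pair_graph G'" by (rule pair_graph_list_graph_iso[OF G(1) i(1)])
    have "((G, L), z) \<in> ?R \<longleftrightarrow> ((G', L'), z) \<in> ?R" for z
      using list_graph_iso_trans[OF G(1) i(1)] list_graph_iso_trans[OF G' i'] by (cases z) blast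
    then have "X = ?R `` {(G', L')}" unfolding GL(2) by auto
    then show "X \<in> (\<lambda>s. ?R `` {s}) ` normal_forms n" using i(2) by blast
  qed
  then show "finite (?F // ?R)" by (rule finite_surj[OF finite_normal_forms])
qed

section \<open>The two directions of the equivalence\<close>

lemma path_graph_embeds:
  assumes "\<not> P6_free_on E V" and sym: "\<And>u v. E u v \<Longrightarrow> E v u" and irr: "\<And>v. \<not> E v v"
  shows "embeds (pverts (path_graph 6)) (adj (path_graph 6)) V E"
proof -
  obtain a b c d e f where V: "a \<in> V" "b \<in> V" "c \<in> V" "d \<in> V" "e \<in> V" "f \<in> V"
    and P: "E a b" "E b c" "E c d" "E d e" "E e f" and N: "\<not> E a c" "\<not> E a d" "\<not> E a e" "\<not> E a f" "\<not> E b d" "\<not> E b e" "\<not> E b f"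
      "\<not> E c e" "\<not> E c f" "\<not> E d f"
    using assms(1) unfolding P6_free_on_def by blast
  have P': "E b a" "E c b" "E d c" "E e d" "E f e" using P sym by blast+
  have N': "\<not> E c a" "\<not> E d a" "\<not> E e a" "\<not> E f a" "\<not> E d b" "\<not> E e b" "\<not> E f b" "\<not> E e c" "\<not> E f c" "\<not> E f d" using N sym by blast+
  define g where "g i = [a, b, c, d, e, f] ! i" for i :: nat
  have six: "{..<6} = {0, 1, 2, 3, 4, 5::nat}" by auto
  have "distinct [a, b, c, d, e, f]" using P P' N N' irr by auto
  then have "inj_on g {..<6}" unfolding g_def by (intro inj_onI) (simp add: nth_eq_iff_index_eq)
  moreover have "g ` {..<6} \<subseteq> V" unfolding six g_def using V by simp
  moreover have "\<forall>u\<in>{..<6}. \<forall>v\<in>{..<6}. E (g u) (g v) \<longleftrightarrow> adj (path_graph 6) u v"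
    unfolding six g_def path_graph_def using P P' N N' irr by simp
  ultimately show ?thesis unfolding embeds_def by (auto simp: path_graph_def)
qed

lemma P4kP1_embeds:
  assumes "\<not> P4kP1_free_on k E V" and sym: "\<And>u v. E u v \<Longrightarrow> E v u" and irr: "\<And>v. \<not> E v v"
  shows "embeds (pverts (disjoint_union (path_graph 4) (copies k (path_graph 1))))
    (adj (disjoint_union (path_graph 4) (copies k (path_graph 1)))) V E"
proof -
  obtain a b c d I where V: "a \<in> V" "b \<in> V" "c \<in> V" "d \<in> V" "I \<subseteq> V"
    and P: "E a b" "E b c" "E c d" and N: "\<not> E a c" "\<not> E a d" "\<not> E b d"
    and I0: "finite I" "card I = k" "\<forall>x\<in>I. \<not> E a x \<and> \<not> E b x \<and> \<not> E c x \<and> \<not> E d x" "\<forall>x\<in>I. \<forall>y\<in>I. \<not> E x y"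
    using assms(1)[unfolded P4kP1_free_on_def not_not] by (elim bexE exE conjE) (rule that)
  note I = I0(1,2) I0(3)[rule_format] I0(4)[rule_format]
  have P': "E b a" "E c b" "E d c" using P sym by blast+
  have N': "\<not> E c a" "\<not> E d a" "\<not> E d b" using N sym by blast+
  have I': "\<not> E x a \<and> \<not> E x b \<and> \<not> E x c \<and> \<not> E x d" if "x \<in> I" for x using I(3)[OF that] sym by blast
  have dI: "a \<notin> I" "b \<notin> I" "c \<notin> I" "d \<notin> I" using I' I(3) P by blast+
  obtain num where num: "bij_betw num {..<k} I"
    using ex_bij_betw_nat_finite[OF I(1)] I(2) atLeast0LessThan by metis
  have numI: "num t \<in> I" if "t < k" for t using bij_betwE[OF num] that by simp
  have numinj: "num s = num t \<longleftrightarrow> s = t" if "s < k" "t < k" for s t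
    using num that unfolding bij_betw_def by (metis inj_on_eq_iff lessThan_iff)
  define g :: "nat + nat \<times> nat \<Rightarrow> 'a" where "g z = (case z of Inl i \<Rightarrow> [a, b, c, d] ! i | Inr (t, _) \<Rightarrow> num t)" for z
  let ?U = "Inl ` {0, 1, 2, 3} \<union> Inr ` ({..<k} \<times> {0}) :: (nat + nat \<times> nat) set"
  have four: "{..<4} = {0, 1, 2, 3::nat}" by auto
  have U: "pverts (disjoint_union (path_graph 4) (copies k (path_graph 1))) = ?U"
    by (simp add: disjoint_union_def path_graph_def copies_def four lessThan_Suc)
  have D: "adj (disjoint_union (path_graph 4) (copies k (path_graph 1))) x y \<longleftrightarrow>
    (\<exists>i j. x = Inl i \<and> y = Inl j \<and> i < 4 \<and> j < 4 \<and> (j = Suc i \<or> i = Suc j))" for x y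
    by (auto simp: disjoint_union_def path_graph_def copies_def image_iff)
  have dist: "distinct [a, b, c, d]" using P P' N N' irr by auto
  have "inj_on g ?U"
  proof (rule inj_onI)
    fix x y assume xy: "x \<in> ?U" "y \<in> ?U" "g x = g y"
    show "x = y"
    proof (cases x; cases y)
      fix i j assume ij: "x = Inl i" "y = Inl j"
      then have "i < length [a, b, c, d]" "j < length [a, b, c, d]" using xy by auto
      then have "i = j" using xy(3) ij nth_eq_iff_index_eq[OF dist] unfolding g_def by simp
      then show ?thesis using ij by simp
    next
      fix i p assume ij: "x = Inl i" "y = Inr p"
      then obtain t where "p = (t, 0)" "t < k" using xy by auto
      then show ?thesis using xy ij numI[of t] dI unfolding g_def by auto
    next
      fix i p assume ij: "y = Inl i" "x = Inr p"
      then obtain t where "p = (t, 0)" "t < k" using xy by auto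
      then show ?thesis using xy ij numI[of t] dI unfolding g_def by auto
    next
      fix p q assume ij: "x = Inr p" "y = Inr q"
      then obtain s t where "p = (s, 0)" "s < k" "q = (t, 0)" "t < k" using xy by auto
      then show ?thesis using xy ij numinj unfolding g_def by simp
    qed
  qed
  moreover have "g ` ?U \<subseteq> V" using V numI unfolding g_def by auto
  moreover have "\<forall>u\<in>?U. \<forall>v\<in>?U. E (g u) (g v) \<longleftrightarrow> adj (disjoint_union (path_graph 4) (copies k (path_graph 1))) u v"
    unfolding D g_def using P P' N N' irr I' I(3,4) numI by auto
  ultimately show ?thesis unfolding embeds_def U by blast
qed

theorem finite_if_embeds:
  fixes H :: "'a pair_pre_digraph"
  assumes H: "pair_graph H"
    and emb: "is_induced_subgraph_of H (path_graph 6) \<or>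
      (\<exists>k. is_induced_subgraph_of H (disjoint_union (path_graph 4) (copies k (path_graph 1))))"
  shows "\<exists>n. \<forall>(G, L) \<in> free_minimal_list_obstructions H. card (pverts G) \<le> n"
  using emb
proof
  assume "is_induced_subgraph_of H (path_graph 6)"
  then have e: "embeds (pverts H) (adj H) (pverts (path_graph 6)) (adj (path_graph 6))"
    using is_induced_subgraph_of_iff[OF H pair_graph_path_graph] by blast
  show ?thesis
  proof (rule exI, clarify)
    fix G L assume GL: "(G, L) \<in> free_minimal_list_obstructions H"
    note G = free_minimal_list_obstructionsD[OF GL]
    have free: "P6_free_on (adj G) (pverts G)"
    proof (rule ccontr)
      assume "\<not> P6_free_on (adj G) (pverts G)"
      from path_graph_embeds[OF this adj_sym[OF G(1)] adj_irrefl[OF G(1)]]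
      have "embeds (pverts H) (adj H) (pverts G) (adj G)" using embeds_trans[OF e] by blast
      then show False using G(5) is_induced_subgraph_of_iff[OF H G(1)] by blast
    qed
    show "card (pverts G) \<le> p6_free.K6 ((4 * 25 + 7) * (3 * 25 + 1))"
      by (rule minimal_list_obstruction_card[OF G(2)], rule P6_free_small_obs[OF adj_sym[OF G(1)] adj_irrefl[OF G(1)] finite_pverts[OF G(1)] free _ G(4)])
        (use G(3) in blast)+
  qed
next
  assume "\<exists>k. is_induced_subgraph_of H (disjoint_union (path_graph 4) (copies k (path_graph 1)))"
  then obtain k where "is_induced_subgraph_of H (disjoint_union (path_graph 4) (copies k (path_graph 1)))" by blast
  then have e: "embeds (pverts H) (adj H) (pverts (disjoint_union (path_graph 4) (copies k (path_graph 1))))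
      (adj (disjoint_union (path_graph 4) (copies k (path_graph 1))))"
    using is_induced_subgraph_of_iff[OF H pair_graph_disjoint_union[OF pair_graph_path_graph pair_graph_copies[OF pair_graph_path_graph]]] by blast
  obtain n where n: "\<forall>E (V :: nat set) L. (\<forall>u v. E u v \<longrightarrow> E v u) \<longrightarrow> (\<forall>v. \<not> E v v) \<longrightarrow> finite V \<longrightarrow> P4kP1_free_on k E V \<longrightarrow>
    (\<forall>v\<in>V. L v \<subseteq> {1,2,3}) \<longrightarrow> \<not> lcol E V L \<longrightarrow> small_obs E n V L"
    using P4kP1_free_small_obs[where k=k and 'a=nat] by (elim exE) (rule that)
  show ?thesis
  proof (rule exI, clarify)
    fix G L assume GL: "(G, L) \<in> free_minimal_list_obstructions H"
    note G = free_minimal_list_obstructionsD[OF GL]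
    have free: "P4kP1_free_on k (adj G) (pverts G)"
    proof (rule ccontr)
      assume "\<not> P4kP1_free_on k (adj G) (pverts G)"
      from P4kP1_embeds[OF this adj_sym[OF G(1)] adj_irrefl[OF G(1)]]
      have "embeds (pverts H) (adj H) (pverts G) (adj G)" using embeds_trans[OF e] by blast
      then show False using G(5) is_induced_subgraph_of_iff[OF H G(1)] by blast
    qed
    have "small_obs (adj G) n (pverts G) L"
      using n[THEN spec, THEN spec, THEN spec, THEN mp, THEN mp, THEN mp, THEN mp, THEN mp, THEN mp,
          OF _ _ finite_pverts[OF G(1)] free G(3,4)] adj_sym[OF G(1)] adj_irrefl[OF G(1)] by blast
    then show "card (pverts G) \<le> n" by (rule minimal_list_obstruction_card[OF G(2)])
  qed
qed

text \<open>A twisted graph above the bound is a minimal obstruction when given its lists, so it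
  cannot be free of \<open>H\<close>.\<close>

lemma bounded_embeds_twisted:
  assumes H: "pair_graph H" and n: "\<forall>(G, L) \<in> free_minimal_list_obstructions H. card (pverts G) \<le> n" and E: "twisted E"
  shows "embeds (pverts H) (adj H) {..Suc n} E"
proof -
  \<comment> \<open>The graph has \<open>n + 2\<close> vertices, and its last index
    \<open>Suc n\<close> is at least 1, as \<open>twisted_not_lcol\<close> demands.\<close>
  define G where "G = \<lparr> pverts = {..Suc n}, parcs = {(x, y). x \<le> Suc n \<and> y \<le> Suc n \<and> E x y} \<rparr>"
  have G: "pair_graph G" by (rule pair_graphI) (use E in \<open>auto simp: G_def twisted_def\<close>)
  have lG: "lcol (adj G) W L \<longleftrightarrow> lcol E W L" if "W \<subseteq> {..Suc n}" for W L
    using that unfolding lcol_def by (auto simp: G_def subset_iff)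
  have m: "minimal_list_obstruction G (twist_lists (Suc n))"
    unfolding minimal_list_obstruction_iff[OF G]
  proof (intro conjI allI impI ballI)
    show "twist_lists (Suc n) v \<subseteq> {1,2,3}" for v
      using mod_3_cases[of v] mod_3_cases[of "v - 1"] mod_3_cases[of n] unfolding twist_lists_def by auto
    show "\<not> lcol (adj G) (pverts G) (twist_lists (Suc n))"
      using twisted_not_lcol[OF E, of "Suc n"] lG[of "{..Suc n}"] by (simp add: G_def)
    show "lcol (adj G) W (twist_lists (Suc n))" if "W \<subset> pverts G" for W
      using twisted_lcol_subset[OF E, of W "Suc n"] lG[of W] that by (simp add: G_def psubset_imp_subset)
  qed
  have "is_induced_subgraph_of H G"
  proof (rule ccontr)
    assume "\<not> is_induced_subgraph_of H G"
    then have "(G, twist_lists (Suc n)) \<in> free_minimal_list_obstructions H"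
      using m unfolding free_minimal_list_obstructions_def free_of_def by simp
    then have "card (pverts G) \<le> n" using n by blast
    then show False by (simp add: G_def)
  qed
  then have "embeds (pverts H) (adj H) (pverts G) (adj G)" using is_induced_subgraph_of_iff[OF H G] by blast
  then show ?thesis unfolding embeds_def by (simp add: G_def image_subset_iff) metis
qed

text \<open>The embedding into a path identifies \<open>H\<close> with a set \<open>?A\<close> of
  natural numbers. The inverse map turns the embeddings of \<open>H\<close> into the other two
  families into embeddings of \<open>?A\<close>, which keep 2P2 + P1 and 2P3 out of
  \<open>?A\<close>.\<close>

theorem embeds_if_finite:
  fixes H :: "'a pair_pre_digraph"
  assumes H: "pair_graph H" and n: "\<forall>(G, L) \<in> free_minimal_list_obstructions H. card (pverts G) \<le> n"
  shows "is_induced_subgraph_of H (path_graph 6) \<or>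
    (\<exists>k. is_induced_subgraph_of H (disjoint_union (path_graph 4) (copies k (path_graph 1))))"
proof -
  obtain f where f: "inj_on f (pverts H)" "f ` pverts H \<subseteq> {..Suc n}" "\<And>u v. u \<in> pverts H \<Longrightarrow> v \<in> pverts H \<Longrightarrow> path_adj (f u) (f v) \<longleftrightarrow> adj H u v"
    by (rule embedsE[OF bounded_embeds_twisted[OF H n twisted_path_adj]]) (rule that)
  let ?A = "f ` pverts H" and ?h = "inv_into (pverts H) f"
  have HA: "embeds (pverts H) (adj H) ?A path_adj" unfolding embeds_def using f(1,3) by blast
  have AH: "embeds ?A path_adj (pverts H) (adj H)"
    unfolding embeds_def
  proof (intro exI[of _ ?h] conjI ballI)
    show "inj_on ?h ?A" by (rule inj_on_inv_into) simp
    show "?h ` ?A \<subseteq> pverts H" by (simp add: f(1))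
    show "adj H (?h u) (?h v) \<longleftrightarrow> path_adj u v" if "u \<in> ?A" "v \<in> ?A" for u v
      using f(3)[OF inv_into_into[OF that(1)] inv_into_into[OF that(2)]] f_inv_into_f[OF that(1)] f_inv_into_f[OF that(2)] by simp
  qed
  obtain g where g: "inj_on g ?A" "g ` ?A \<subseteq> {..Suc n}" "\<And>u v. u \<in> ?A \<Longrightarrow> v \<in> ?A \<Longrightarrow> skew_adj (g u) (g v) \<longleftrightarrow> path_adj u v"
    by (rule embedsE[OF embeds_trans[OF AH bounded_embeds_twisted[OF H n twisted_skew_adj]]]) (rule that)
  obtain q where q: "inj_on q ?A" "q ` ?A \<subseteq> {..Suc n}" "\<And>u v. u \<in> ?A \<Longrightarrow> v \<in> ?A \<Longrightarrow> half_adj (q u) (q v) \<longleftrightarrow> path_adj u v"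
    by (rule embedsE[OF embeds_trans[OF AH bounded_embeds_twisted[OF H n twisted_half_adj]]]) (rule that)
  have geq: "g u = g v \<longleftrightarrow> u = v" if "u \<in> ?A" "v \<in> ?A" for u v using inj_on_eq_iff[OF g(1) that] .
  have qeq: "q u = q v \<longleftrightarrow> u = v" if "u \<in> ?A" "v \<in> ?A" for u v using inj_on_eq_iff[OF q(1) that] .
  have "embeds ?A path_adj {..<6} path_adj \<or> (\<exists>k. embeds ?A path_adj (Inl ` {..<4} \<union> Inr ` {..<k}) star_adj)"
  proof (rule path_subset_embeds)
    show "finite ?A" using finite_pverts[OF H] by simp
    show False if s: "{a, b, c, d, e} \<subseteq> ?A" and h: "path_adj a b" "path_adj c d" "\<not> path_adj a c" "\<not> path_adj a d" "\<not> path_adj a e"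
      "\<not> path_adj b c" "\<not> path_adj b d" "\<not> path_adj b e" "\<not> path_adj c e" "\<not> path_adj d e" "c \<notin> {a, b}" "d \<notin> {a, b}" "e \<notin> {a, b, c, d}"
      for a b c d e
    proof -
      have A: "a \<in> ?A" "b \<in> ?A" "c \<in> ?A" "d \<in> ?A" "e \<in> ?A" using s by blast+
      show False
        by (rule skew_adj_no_2P2_P1[of "g a" "g b" "g c" "g d" "g e"]) (use h in \<open>simp_all add: g(3) geq A\<close>)
    qed
    show False if s: "{a, b, c, d, e, p} \<subseteq> ?A" and h: "path_adj a b" "path_adj b c" "\<not> path_adj a c" "a \<noteq> c" "path_adj d e" "path_adj e p"
      "\<not> path_adj d p" "d \<noteq> p" and x: "\<forall>x\<in>{a, b, c}. \<forall>y\<in>{d, e, p}. \<not> path_adj x y" for a b c d e p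
    proof -
      have A: "a \<in> ?A" "b \<in> ?A" "c \<in> ?A" "d \<in> ?A" "e \<in> ?A" "p \<in> ?A" using s by blast+
      show False
      proof (rule half_adj_no_2P3[of "q a" "q b" "q c" "q d" "q e" "q p"])
        show "\<not> half_adj u v" if uv0: "u \<in> {q a, q b, q c}" "v \<in> {q d, q e, q p}" for u v
        proof -
          obtain u' v' where uv: "u' \<in> {a, b, c}" "v' \<in> {d, e, p}" "u = q u'" "v = q v'" using uv0 by blast
          have uvA: "u' \<in> ?A" "v' \<in> ?A" using uv(1,2) s by blast+
          show ?thesis unfolding uv(3,4) q(3)[OF uvA] by (rule x[rule_format, OF uv(1,2)])
        qed
      qed (use h in \<open>simp_all add: q(3) qeq A\<close>)
    qed
  qed
  then show ?thesis
  proof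
    assume "embeds ?A path_adj {..<6} path_adj"
    then have "embeds (pverts H) (adj H) {..<6} path_adj" by (rule embeds_trans[OF HA])
    then have "embeds (pverts H) (adj H) (pverts (path_graph 6)) (adj (path_graph 6))"
      unfolding embeds_def path_graph_def path_adj_def by (simp add: image_subset_iff) metis
    then show ?thesis using is_induced_subgraph_of_iff[OF H pair_graph_path_graph] by blast
  next
    assume "\<exists>k. embeds ?A path_adj (Inl ` {..<4} \<union> Inr ` {..<k}) star_adj"
    then obtain k where "embeds ?A path_adj (Inl ` {..<4} \<union> Inr ` {..<k}) star_adj" by blast
    then have e: "embeds (pverts H) (adj H) (Inl ` {..<4} \<union> Inr ` {..<k}) star_adj" by (rule embeds_trans[OF HA])
    let ?P = "disjoint_union (path_graph 4) (copies k (path_graph 1))"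
    have "embeds (Inl ` {..<4} \<union> Inr ` {..<k}) star_adj (pverts ?P) (adj ?P)"
      unfolding embeds_def
    proof (intro exI[of _ "map_sum id (\<lambda>t. (t, 0))"] conjI ballI)
      show "inj_on (map_sum id (\<lambda>t. (t, 0))) (Inl ` {..<4} \<union> Inr ` {..<k})" by (auto simp: inj_on_def)
      show "map_sum id (\<lambda>t. (t, 0)) ` (Inl ` {..<4} \<union> Inr ` {..<k}) \<subseteq> pverts ?P"
        by (auto simp: disjoint_union_def path_graph_def copies_def)
      show "adj ?P (map_sum id (\<lambda>t. (t, 0)) u) (map_sum id (\<lambda>t. (t, 0)) v) \<longleftrightarrow> star_adj u v"
        if "u \<in> Inl ` {..<4} \<union> Inr ` {..<k}" "v \<in> Inl ` {..<4} \<union> Inr ` {..<k}" for u v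
        using that by (auto simp: disjoint_union_def path_graph_def copies_def star_adj_def path_adj_def image_iff)
    qed
    from embeds_trans[OF e this] show ?thesis
      using is_induced_subgraph_of_iff[OF H pair_graph_disjoint_union[OF pair_graph_path_graph pair_graph_copies[OF pair_graph_path_graph]]] by blast
  qed
qed

theorem theorem3:
  fixes H :: "'a pair_pre_digraph"
  assumes "pair_graph H"
  shows "finite (free_minimal_list_obstructions H // list_graph_iso) \<longleftrightarrow>
    is_induced_subgraph_of H (path_graph 6) \<or>
    (\<exists>k. is_induced_subgraph_of H (disjoint_union (path_graph 4) (copies k (path_graph 1))))"
  unfolding finite_obstructions_iff_bounded
proof
  assume "\<exists>n. \<forall>(G, L) \<in> free_minimal_list_obstructions H. card (pverts G) \<le> n"
  then obtain n where n: "\<forall>(G, L) \<in> free_minimal_list_obstructions H. card (pverts G) \<le> n" by (rule exE)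
  show "is_induced_subgraph_of H (path_graph 6) \<or>
    (\<exists>k. is_induced_subgraph_of H (disjoint_union (path_graph 4) (copies k (path_graph 1))))"
    by (rule embeds_if_finite[OF assms n])
next
  assume "is_induced_subgraph_of H (path_graph 6) \<or>
    (\<exists>k. is_induced_subgraph_of H (disjoint_union (path_graph 4) (copies k (path_graph 1))))"
  then show "\<exists>n. \<forall>(G, L) \<in> free_minimal_list_obstructions H. card (pverts G) \<le> n"
    by (rule finite_if_embeds[OF assms])
qed

end
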